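(* Let $\mathfrak g_\infty$ be one of $\mathfrak{sl}_\infty,\mathfrak{so}_\infty,\mathfrak{sp}_\infty$ and let $J\subset\mathbf S^\cdot(\mathfrak g_\infty)$ be a non-zero radical Poisson ideal. Then $J=J^{\le r}$ for some $r\in\mathbb Z_{\ge0}$.
   Context: The base field $\mathbb F$ is algebraically closed of characteristic zero; ideals are proper. $\mathfrak{sl}_\infty,\mathfrak{so}_\infty,\mathfrak{sp}_\infty$ are the unions of the classical Lie algebras of the respective type under the standard left-upper-corner inclusions. An ideal of $\mathbf S^\cdot(\mathfrak g_\infty)$ is Poisson if it is stable under the adjoint action of $\mathfrak g_\infty$ (by derivations). Fix a chain $\mathfrak g_1\subset\mathfrak g_2\subset\cdots$ with $\bigcup_n\mathfrak g_n=\mathfrak g_\infty$ such that for $n\ge3$ all $\mathfrak g_n$ are simple, of the same type A, B, C or D, of rank $n$, with natural module $V_n$, and such that for $n\ge 3$ the restriction of $V_{n+1}$ to $\mathfrak g_n$ is isomorphic to $V_n$ plus a trivial module. For $r\in\mathbb Z_{\ge0}$ set $$\mathfrak g_n^{\le r}:=\{X\in\mathfrak g_n\mid \text{there is }\lambda\in\mathbb F\text{ with }\operatorname{rk}(X-\lambda\,\mathrm{Id}_{V_n})\le r\}.$$ Using compatible identifications $\mathfrak g_n\cong\mathfrak g_n^*$ (e.g. $X\mapsto(Y\mapsto\operatorname{tr}_{V_n}(XY))$), regard $\mathfrak g_n^{\le r}$ as a closed subset of $\mathfrak g_n^*$. Let $J_n^{\le r}\subset\mathbf S^\cdot(\mathfrak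 g_n)$ be the radical ideal of functions vanishing on $\mathfrak g_n^{\le r}$ and $J^{\le r}:=\bigcup_{n\ge3}J_n^{\le r}$, a radical Poisson ideal of $\mathbf S^\cdot(\mathfrak g_\infty)$. *)

theory Defs
  imports "HOL-Algebra.Ideal" "Jordan_Normal_Form.DL_Rank" "HOL-Library.Poly_Mapping"
begin

section \<open>Classical Lie algebras, finite and infinite\<close>

definition mat_trace :: "'a::comm_ring_1 mat \<Rightarrow> 'a" where
  "mat_trace A = (\<Sum>i<dim_row A. A $$ (i, i))"

definition mat_bracket :: "'a::comm_ring_1 mat \<Rightarrow> 'a mat \<Rightarrow> 'a mat" where
  "mat_bracket A B = A * B - B * A"

definition sl_mat :: "nat \<Rightarrow> 'a::comm_ring_1 mat set" where
  "sl_mat N = {A \<in> carrier_mat N N. mat_trace A = 0}"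

definition so_mat :: "nat \<Rightarrow> 'a::comm_ring_1 mat set" where
  "so_mat N = {A \<in> carrier_mat N N. transpose_mat A = - A}"

text \<open>The symplectic form is block diagonal with 2 by 2 blocks (0, 1; -1, 0), so that adding
  zero rows and columns at the bottom right maps sp(2n) into sp(2n+2).\<close>

definition symplectic_form :: "nat \<Rightarrow> 'a::comm_ring_1 mat" where
  "symplectic_form n = mat (2 * n) (2 * n)
     (\<lambda>(i, j). if even i \<and> j = i + 1 then 1 else if odd i \<and> i = j + 1 then - 1 else 0)"

definition sp_mat :: "nat \<Rightarrow> 'a::comm_ring_1 mat set" where
  "sp_mat n = {A \<in> carrier_mat (2 * n) (2 * n).
     transpose_mat A * symplectic_form n + symplectic_form n * A = 0\<^sub>m (2 * n) (2 * n)}"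

type_synonym 'a infmat = "nat \<Rightarrow> nat \<Rightarrow> 'a"

text \<open>The left-upper-corner inclusion of finite matrices into infinite ones.\<close>

definition corner :: "'a::comm_ring_1 mat \<Rightarrow> 'a infmat" where
  "corner A = (\<lambda>i j. if i < dim_row A \<and> j < dim_col A then A $$ (i, j) else 0)"

definition sl_inf :: "'a::comm_ring_1 infmat set" where
  "sl_inf = (\<Union>N. corner ` sl_mat N)"

definition so_inf :: "'a::comm_ring_1 infmat set" where
  "so_inf = (\<Union>N. corner ` so_mat N)"

definition sp_inf :: "'a::comm_ring_1 infmat set" where
  "sp_inf = (\<Union>n. corner ` sp_mat n)"

text \<open>Only applied to matrices with finitely many nonzero entries, so the sums are finite.\<close>

definition inf_bracket :: "'a::comm_ring_1 infmat \<Rightarrow> 'a infmat \<Rightarrow> 'a infmat" where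
  "inf_bracket X Y =
     (\<lambda>i j. Sum_any (\<lambda>k. X i k * Y k j) - Sum_any (\<lambda>k. Y i k * X k j))"

definition lie_subalgebra :: "'a::comm_ring_1 infmat set \<Rightarrow> bool" where
  "lie_subalgebra g \<longleftrightarrow>
     (\<lambda>i j. 0) \<in> g \<and>
     (\<forall>X\<in>g. \<forall>Y\<in>g. (\<lambda>i j. X i j + Y i j) \<in> g) \<and>
     (\<forall>c. \<forall>X\<in>g. (\<lambda>i j. c * X i j) \<in> g) \<and>
     (\<forall>X\<in>g. \<forall>Y\<in>g. inf_bracket X Y \<in> g)"


section \<open>Exhaustions by simple Lie algebras of one type\<close>

datatype cartan_type = Type_A | Type_B | Type_C | Type_D

fun natural_dim :: "cartan_type \<Rightarrow> nat \<Rightarrow> nat" where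
  "natural_dim Type_A n = n + 1"
| "natural_dim Type_B n = 2 * n + 1"
| "natural_dim Type_C n = 2 * n"
| "natural_dim Type_D n = 2 * n"

fun classical_mat :: "cartan_type \<Rightarrow> nat \<Rightarrow> 'a::comm_ring_1 mat set" where
  "classical_mat Type_A n = sl_mat (n + 1)"
| "classical_mat Type_B n = so_mat (2 * n + 1)"
| "classical_mat Type_C n = sp_mat n"
| "classical_mat Type_D n = so_mat (2 * n)"

text \<open>A natural module of a Lie algebra of the given type and rank is an isomorphism onto the
  matrix Lie algebra of that type and rank.\<close>

definition natural_module ::
  "cartan_type \<Rightarrow> nat \<Rightarrow> 'a::comm_ring_1 infmat set \<Rightarrow> ('a infmat \<Rightarrow> 'a mat) \<Rightarrow> bool" where
  "natural_module T n g \<rho> \<longleftrightarrow>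
     bij_betw \<rho> g (classical_mat T n) \<and>
     (\<forall>X\<in>g. \<forall>Y\<in>g. \<rho> (\<lambda>i j. X i j + Y i j) = \<rho> X + \<rho> Y) \<and>
     (\<forall>c. \<forall>X\<in>g. \<rho> (\<lambda>i j. c * X i j) = c \<cdot>\<^sub>m \<rho> X) \<and>
     (\<forall>X\<in>g. \<forall>Y\<in>g. \<rho> (inf_bracket X Y) = mat_bracket (\<rho> X) (\<rho> Y))"

text \<open>The last condition: the restriction to \<open>g n\<close> of the natural module of \<open>g (n + 1)\<close> is
  isomorphic to the natural module of \<open>g n\<close> plus a trivial module, the base change
  \<open>P\<close> (with inverse \<open>Q\<close>) being the same for all \<open>X\<close>.\<close>

definition classical_chain ::
  "cartan_type \<Rightarrow> 'a::comm_ring_1 infmat set \<Rightarrow> (nat \<Rightarrow> 'a infmat set) \<Rightarrow>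
   (nat \<Rightarrow> 'a infmat \<Rightarrow> 'a mat) \<Rightarrow> bool" where
  "classical_chain T ginf g \<rho> \<longleftrightarrow>
     (\<forall>n\<ge>1. lie_subalgebra (g n) \<and> g n \<subseteq> g (n + 1)) \<and>
     (\<Union>n\<in>{1..}. g n) = ginf \<and>
     (\<forall>n\<ge>3. natural_module T n (g n) (\<rho> n)) \<and>
     (\<forall>n\<ge>3. \<exists>P Q. \<forall>X\<in>g n.
        similar_mat_wit (\<rho> (n + 1) X)
          (let d = natural_dim T n; k = natural_dim T (n + 1) - d
           in four_block_mat (\<rho> n X) (0\<^sub>m d k) (0\<^sub>m k d) (0\<^sub>m k k))
          P Q)"


section \<open>Symmetric algebras and Poisson ideals\<close>

text \<open>The symmetric algebra of the space of all finitary matrices is the polynomial ring in the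
  matrix entries; the variable indexed by \<open>(i, j)\<close> is the matrix unit \<open>E\<^sub>i\<^sub>j\<close>. For a subspace
  \<open>g\<close>, the symmetric algebra of \<open>g\<close> is the subalgebra generated by \<open>g\<close>.\<close>

type_synonym 'a entry_poly = "(nat \<times> nat \<Rightarrow>\<^sub>0 nat) \<Rightarrow>\<^sub>0 'a"

definition const_poly :: "'a::comm_ring_1 \<Rightarrow> 'a entry_poly" where
  "const_poly c = Poly_Mapping.single 0 c"

definition lin_poly :: "'a::comm_ring_1 infmat \<Rightarrow> 'a entry_poly" where
  "lin_poly X =
     Sum_any (\<lambda>(i, j). Poly_Mapping.single (Poly_Mapping.single (i, j) 1) (X i j))"

inductive_set sym_alg :: "'a::comm_ring_1 infmat set \<Rightarrow> 'a entry_poly set"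
  for g :: "'a infmat set" where
  const: "const_poly c \<in> sym_alg g"
| lin: "X \<in> g \<Longrightarrow> lin_poly X \<in> sym_alg g"
| add: "p \<in> sym_alg g \<Longrightarrow> q \<in> sym_alg g \<Longrightarrow> p + q \<in> sym_alg g"
| mult: "p \<in> sym_alg g \<Longrightarrow> q \<in> sym_alg g \<Longrightarrow> p * q \<in> sym_alg g"

definition sym_ring :: "'a::comm_ring_1 infmat set \<Rightarrow> 'a entry_poly ring" where
  "sym_ring g = \<lparr>carrier = sym_alg g, mult = (*), one = 1, zero = 0, add = (+)\<rparr>"

text \<open>\<open>D\<close> is the adjoint action of \<open>X\<close> on the symmetric algebra of \<open>g\<close>: the derivation extending
  the bracket with \<open>X\<close>. For a Lie algebra \<open>g\<close> containing \<open>X\<close> it exists and is unique on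
  \<open>sym_alg g\<close>.\<close>

definition adjoint_action ::
  "'a::comm_ring_1 infmat set \<Rightarrow> 'a infmat \<Rightarrow> ('a entry_poly \<Rightarrow> 'a entry_poly) \<Rightarrow> bool" where
  "adjoint_action g X D \<longleftrightarrow>
     D ` sym_alg g \<subseteq> sym_alg g \<and>
     (\<forall>c. D (const_poly c) = 0) \<and>
     (\<forall>p\<in>sym_alg g. \<forall>q\<in>sym_alg g. D (p + q) = D p + D q \<and> D (p * q) = D p * q + p * D q) \<and>
     (\<forall>Y\<in>g. D (lin_poly Y) = lin_poly (inf_bracket X Y))"

definition poisson_ideal :: "'a::comm_ring_1 infmat set \<Rightarrow> 'a entry_poly set \<Rightarrow> bool" where
  "poisson_ideal g J \<longleftrightarrow>
     ideal J (sym_ring g) \<and> J \<noteq> sym_alg g \<and>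
     (\<forall>X\<in>g. \<exists>D. adjoint_action g X D \<and> D ` J \<subseteq> J)"

definition radical_ideal :: "'a::comm_ring_1 infmat set \<Rightarrow> 'a entry_poly set \<Rightarrow> bool" where
  "radical_ideal g J \<longleftrightarrow>
     ideal J (sym_ring g) \<and> (\<forall>p\<in>sym_alg g. \<forall>k::nat. p ^ k \<in> J \<longrightarrow> p \<in> J)"


section \<open>The ideals of functions vanishing on matrices of bounded rank\<close>

text \<open>\<open>e\<close> is evaluation of the elements of the symmetric algebra of \<open>g\<close>, regarded as polynomial
  functions on the dual of \<open>g\<close>, at the linear form \<open>\<phi>\<close>: the algebra homomorphism extending \<open>\<phi>\<close>.
  It exists and is unique on \<open>sym_alg g\<close> when \<open>g\<close> is a subspace and \<open>\<phi>\<close> is linear on \<open>g\<close>.\<close>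

definition evaluation_at ::
  "'a::comm_ring_1 infmat set \<Rightarrow> ('a infmat \<Rightarrow> 'a) \<Rightarrow> ('a entry_poly \<Rightarrow> 'a) \<Rightarrow> bool" where
  "evaluation_at g \<phi> e \<longleftrightarrow>
     (\<forall>c. e (const_poly c) = c) \<and>
     (\<forall>p\<in>sym_alg g. \<forall>q\<in>sym_alg g. e (p + q) = e p + e q \<and> e (p * q) = e p * e q) \<and>
     (\<forall>Y\<in>g. e (lin_poly Y) = \<phi> Y)"

definition vanishes_at ::
  "'a::comm_ring_1 infmat set \<Rightarrow> ('a infmat \<Rightarrow> 'a) \<Rightarrow> 'a entry_poly \<Rightarrow> bool" where
  "vanishes_at g \<phi> p \<longleftrightarrow> (\<exists>e. evaluation_at g \<phi> e \<and> e p = 0)"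

text \<open>In the next three definitions \<open>g\<close> has natural module \<open>\<rho>\<close> of dimension \<open>d\<close>, and \<open>g\<close> is
  identified with its dual by the trace form of \<open>\<rho>\<close>.\<close>

definition rank_le ::
  "'a::field infmat set \<Rightarrow> ('a infmat \<Rightarrow> 'a mat) \<Rightarrow> nat \<Rightarrow> nat \<Rightarrow> 'a infmat set" where
  "rank_le g \<rho> d r = {X \<in> g. \<exists>c. vec_space.rank d (\<rho> X - c \<cdot>\<^sub>m 1\<^sub>m d) \<le> r}"

definition trace_form ::
  "('a::field infmat \<Rightarrow> 'a mat) \<Rightarrow> 'a infmat \<Rightarrow> 'a infmat \<Rightarrow> 'a" where
  "trace_form \<rho> X Y = mat_trace (\<rho> X * \<rho> Y)"

definition J_fin ::
  "'a::field infmat set \<Rightarrow> ('a infmat \<Rightarrow> 'a mat) \<Rightarrow> nat \<Rightarrow> nat \<Rightarrow> 'a entry_poly set" where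
  "J_fin g \<rho> d r =
     {p \<in> sym_alg g. \<forall>X\<in>rank_le g \<rho> d r. vanishes_at g (trace_form \<rho> X) p}"

definition J_inf ::
  "cartan_type \<Rightarrow> (nat \<Rightarrow> 'a::field infmat set) \<Rightarrow> (nat \<Rightarrow> 'a infmat \<Rightarrow> 'a mat) \<Rightarrow>
   nat \<Rightarrow> 'a entry_poly set" where
  "J_inf T g \<rho> r = (\<Union>n\<in>{3..}. J_fin (g n) (\<rho> n) (natural_dim T n) r)"

end

theory Submission
  imports Defs "HOL-Computational_Algebra.Polynomial" "HOL-Library.Product_Lexorder"
    "HOL-Computational_Algebra.Polynomial_FPS"
begin

text \<open>Gluing the natural modules (after changing them by isometries of the standard form) identifies the
  chain with the standard one, so by the Nullstellensatz \<open>J\<close> is determined by its zero sets in the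
  matrix Lie algebras. As \<open>J\<close> is Poisson, these are stable under conjugation by a rational curve in
  the group for every \<open>a\<close> in the Lie algebra with \<open>a\<^sup>3 = k a\<close>.

  Write \<open>U\<close> for the first \<open>d n\<close> coordinates and \<open>V\<close> for the remaining ones up to \<open>d N\<close>. For the
  nilpotent \<open>a\<close> with blocks \<open>w : U \<rightarrow> V\<close> and \<open>- z : V \<rightarrow> U\<close>, \<open>z w = 0\<close>, the \<open>U\<close>-block of a zero \<open>X\<close> moves
  along a curve \<open>A + t P + t\<^sup>2 z X w\<close>. If the \<open>V\<close>-block of \<open>X\<close> has rank at least \<open>k\<close> modulo scalars,
  then \<open>z X w\<close> can be made any matrix \<open>R\<close> of rank at most \<open>k\<close>, and the leading coefficient in \<open>t\<close>
  shows by induction on the degree that \<open>J\<close> vanishes at \<open>R\<close>. Let \<open>r + 1\<close> be the least \<open>k\<close> such that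
  for some \<open>n\<close> and arbitrarily large \<open>N\<close> all \<open>V\<close>-blocks of zeros have rank below \<open>k\<close> modulo scalars; it
  exists because \<open>J\<close> is non-zero. Then \<open>J\<close> vanishes on the matrices of rank at most \<open>r\<close> modulo
  scalars, and exchanging \<open>U\<close> with a part of \<open>V\<close> shows that all zeros are of this kind.\<close>

section \<open>The Nullstellensatz for subalgebras of commutative rings\<close>

text \<open>Ranks are taken modulo scalars because a scalar in the \<open>V\<close>-block is
  invisible: as \<open>z w = 0\<close>, replacing \<open>X\<close> by \<open>X - \<mu>\<close> does
  not change \<open>z X w\<close>. The difficulty is to solve \<open>z w = 0\<close> and
  \<open>z X w = R\<close> together. In type A the blocks \<open>z\<close> and \<open>w\<close> are
  independent. In types B, C, D the nilpotent matrix must be skew, so \<open>z\<close> is the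
  adjoint of \<open>w\<close>: the columns of \<open>w\<close> have to be isotropic for the
  invariant form and have prescribed products for the form attached to \<open>X\<close>, which has
  the opposite symmetry. In each case a maximal partial solution exhausts the rank: equations that
  fail are repaired by adding vectors orthogonal to everything in sight, and the room for these
  explains bounds such as \<open>8 * m + 9\<close> and \<open>6 * m + 13\<close>. \<open>J\<close>
  is not assumed homogeneous. The descent on the degree works since a homogeneous component that
  vanishes on all matrices of rank at most \<open>r\<close> is already in \<open>J\<close>; so this
  inclusion has to precede the converse one. The curves are rational, so that the flow is a
  statement on formal power series which can be specialised after clearing denominators.\<close>

locale algebra_over =
  fixes \<iota> :: "'k::{alg_closed_field, field_char_0} \<Rightarrow> 'r::comm_ring_1"
  assumes \<iota>_add: "\<iota> (a + b) = \<iota> a + \<iota> b"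
    and \<iota>_mult: "\<iota> (a * b) = \<iota> a * \<iota> b"
    and \<iota>_1: "\<iota> 1 = 1"
begin

lemma \<iota>_0: "\<iota> 0 = 0"
  using \<iota>_add[of 0 0] by simp

lemma \<iota>_minus: "\<iota> (- a) = - \<iota> a"
  using \<iota>_add[of a "- a"] by (simp add: \<iota>_0 add_eq_0_iff)

definition subalg :: "'r set \<Rightarrow> bool" where
  "subalg A \<longleftrightarrow> range \<iota> \<subseteq> A \<and> (\<forall>a\<in>A. \<forall>b\<in>A. a + b \<in> A \<and> a * b \<in> A)"

definition ideal_on :: "'r set \<Rightarrow> 'r set \<Rightarrow> bool" where
  "ideal_on S I \<longleftrightarrow> I \<subseteq> S \<and> 0 \<in> I \<and> (\<forall>a\<in>I. \<forall>b\<in>I. a + b \<in> I) \<and> (\<forall>s\<in>S. \<forall>a\<in>I. s * a \<in> I)"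

definition prime_on :: "'r set \<Rightarrow> 'r set \<Rightarrow> bool" where
  "prime_on S P \<longleftrightarrow> ideal_on S P \<and> 1 \<notin> P \<and> (\<forall>a\<in>S. \<forall>b\<in>S. a * b \<in> P \<longrightarrow> a \<in> P \<or> b \<in> P)"

definition adjoin :: "'r set \<Rightarrow> 'r \<Rightarrow> 'r set" where
  "adjoin A x = {poly q x | q. \<forall>i. coeff q i \<in> A}"

text \<open>Only the part of \<open>P\<close> inside \<open>A\<close> is sent to 0: \<open>P\<close>
  stays an ideal of the large algebra, so that one prime serves all intermediate
  subalgebras.\<close>

definition char_on :: "'r set \<Rightarrow> 'r set \<Rightarrow> ('r \<Rightarrow> 'k) \<Rightarrow> bool" where
  "char_on A P \<chi> \<longleftrightarrow> (\<forall>c. \<chi> (\<iota> c) = c) \<and>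
     (\<forall>a\<in>A. \<forall>b\<in>A. \<chi> (a + b) = \<chi> a + \<chi> b \<and> \<chi> (a * b) = \<chi> a * \<chi> b) \<and>
     (\<forall>a\<in>A \<inter> P. \<chi> a = 0)"

context
  fixes A assumes A: "subalg A"
begin

lemma sub_\<iota>: "\<iota> c \<in> A" and sub_add: "a \<in> A \<Longrightarrow> b \<in> A \<Longrightarrow> a + b \<in> A"
  and sub_mult: "a \<in> A \<Longrightarrow> b \<in> A \<Longrightarrow> a * b \<in> A"
  using A by (auto simp: subalg_def)

lemma sub_0: "0 \<in> A" and sub_1: "1 \<in> A"
  using sub_\<iota>[of 0] sub_\<iota>[of 1] by (auto simp: \<iota>_0 \<iota>_1)

lemma sub_uminus: "a \<in> A \<Longrightarrow> - a \<in> A"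
  using sub_mult[OF sub_\<iota>[of "-1"], of a] by (simp add: \<iota>_minus \<iota>_1)

lemma sub_minus: "a \<in> A \<Longrightarrow> b \<in> A \<Longrightarrow> a - b \<in> A"
  using sub_add[OF _ sub_uminus] by fastforce

lemma sub_power: "a \<in> A \<Longrightarrow> a ^ n \<in> A"
  by (induction n) (auto simp: sub_1 sub_mult)

lemma sub_sum: "(\<And>i. i \<in> I \<Longrightarrow> f i \<in> A) \<Longrightarrow> sum f I \<in> A"
  by (induction I rule: infinite_finite_induct) (auto simp: sub_0 sub_add)

definition over :: "'r poly \<Rightarrow> bool" where "over q \<longleftrightarrow> (\<forall>i. coeff q i \<in> A)"

lemma over_add: "over p \<Longrightarrow> over q \<Longrightarrow> over (p + q)"
  and over_minus: "over p \<Longrightarrow> over q \<Longrightarrow> over (p - q)"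
  and over_smult: "a \<in> A \<Longrightarrow> over q \<Longrightarrow> over (Polynomial.smult a q)"
  and over_monom: "a \<in> A \<Longrightarrow> over (monom a n)"
  and over_mult: "over p \<Longrightarrow> over q \<Longrightarrow> over (p * q)"
  and over_0: "over 0"
  by (auto simp: over_def sub_add sub_minus sub_mult sub_0 coeff_mult Polynomial.coeff_smult coeff_monom intro!: sub_sum)

lemma over_const: "a \<in> A \<Longrightarrow> over [:a:]"
  using over_monom[of a 0] by (simp add: monom_0)

lemma poly_in_sub: "over q \<Longrightarrow> x \<in> A \<Longrightarrow> poly q x \<in> A"
  unfolding poly_altdef by (auto simp: over_def intro!: sub_sum sub_mult sub_power)

lemma adjoin_subalg: "subalg (adjoin A x)" and adjoin_base: "A \<subseteq> adjoin A x" and adjoin_gen: "x \<in> adjoin A x"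
proof -
  have adj: "adjoin A x = {poly q x | q. over q}" by (simp add: adjoin_def over_def)
  show base: "A \<subseteq> adjoin A x"
  proof
    fix a assume "a \<in> A"
    then show "a \<in> adjoin A x" unfolding adj using over_const by (intro CollectI exI[of _ "[:a:]"]) auto
  qed
  show "x \<in> adjoin A x"
    unfolding adj using over_monom[OF sub_1, of 1] by (intro CollectI exI[of _ "monom 1 1"]) (auto simp: poly_monom)
  show "subalg (adjoin A x)"
    unfolding subalg_def
  proof (intro conjI ballI)
    show "range \<iota> \<subseteq> adjoin A x" using base sub_\<iota> by auto
    fix a b assume "a \<in> adjoin A x" "b \<in> adjoin A x"
    then obtain p q where "a = poly p x" "b = poly q x" "over p" "over q" unfolding adj by auto
    then show "a + b \<in> adjoin A x" "a * b \<in> adjoin A x" unfolding adj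
      using over_add[of p q] over_mult[of p q] by (auto intro: exI[of _ "p + q"] exI[of _ "p * q"])
  qed
qed

text \<open>Euclidean division without inverting the leading coefficient: removing a top term costs
  one factor \<open>coeff g e\<close>. The bound on \<open>s\<close> in the last clause later makes
  the quotient of a minimal relation too short to be a nontrivial relation itself.\<close>

lemma pseudo_division:
  assumes g: "over g" "\<And>i. i > e \<Longrightarrow> coeff g i = 0"
  shows "over q \<Longrightarrow> (\<And>i. i \<ge> n \<Longrightarrow> coeff q i = 0) \<Longrightarrow>
    \<exists>m s t. over s \<and> over t \<and> Polynomial.smult (coeff g e ^ m) q = s * g + t \<and> (\<forall>i\<ge>e. coeff t i = 0) \<and>
      (\<forall>i. i + e \<ge> n \<longrightarrow> coeff s i = 0)"
proof (induction n arbitrary: q)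
  case 0
  then have "q = 0" by (simp add: poly_eq_iff)
  then show ?case using over_0 by (intro exI[of _ 0]) auto
next
  case (Suc n)
  show ?case
  proof (cases "n < e")
    case True
    then show ?thesis using Suc.prems over_0
      by (intro exI[of _ 0] exI[of _ q]) auto
  next
    case False
    define l where "l = coeff g e"
    define M where "M = monom (coeff q n) (n - e)"
    define q' where "q' = Polynomial.smult l q - M * g"
    have oM: "over M" unfolding M_def using Suc.prems(1) by (intro over_monom) (simp add: over_def)
    have l: "l \<in> A" using g by (auto simp: l_def over_def)
    have "over q'" unfolding q'_def using oM l g Suc.prems by (intro over_minus over_smult over_mult) auto
    moreover have "coeff q' i = 0" if "i \<ge> n" for i
    proof (cases "i = n")
      case True
      then show ?thesis using False by (simp add: q'_def M_def coeff_monom_mult l_def)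
    next
      case F2: False
      then have "i - (n - e) > e" "i > n" using that False by auto
      then show ?thesis using Suc.prems(2)[of i] g(2)[of "i - (n - e)"]
        by (simp add: q'_def M_def coeff_monom_mult)
    qed
    ultimately obtain m s t where *: "over s" "over t" "Polynomial.smult (l ^ m) q' = s * g + t" "\<forall>i\<ge>e. coeff t i = 0"
      "\<forall>i. i + e \<ge> n \<longrightarrow> coeff s i = 0"
      using Suc.IH[of q'] unfolding l_def by blast
    have "Polynomial.smult (l ^ Suc m) q = Polynomial.smult (l ^ m) (q' + M * g)" by (simp add: q'_def mult.commute)
    also have "\<dots> = (s + Polynomial.smult (l ^ m) M) * g + t"
      using *(3) by (simp add: smult_add_right algebra_simps)
    finally have "Polynomial.smult (l ^ Suc m) q = (s + Polynomial.smult (l ^ m) M) * g + t" .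
    moreover have "over (s + Polynomial.smult (l ^ m) M)" using * oM l by (intro over_add over_smult sub_power)
    moreover have "coeff (s + Polynomial.smult (l ^ m) M) i = 0" if "i + e \<ge> Suc n" for i
      using *(5) that False by (auto simp: M_def coeff_monom)
    ultimately show ?thesis using *(2,4) unfolding l_def by blast
  qed
qed

end

section \<open>Extension of characters from A to A[x]\<close>

lemma char_on_map_poly:
  assumes A: "subalg A" and \<chi>: "char_on A P \<chi>"
  shows "\<chi> 0 = 0" and "over A p \<Longrightarrow> over A q \<Longrightarrow> map_poly \<chi> (p + q) = map_poly \<chi> p + map_poly \<chi> q"
    and "over A p \<Longrightarrow> over A q \<Longrightarrow> map_poly \<chi> (p * q) = map_poly \<chi> p * map_poly \<chi> q"
    and "a \<in> A \<Longrightarrow> over A q \<Longrightarrow> map_poly \<chi> (Polynomial.smult a q) = Polynomial.smult (\<chi> a) (map_poly \<chi> q)"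
proof -
  have \<chi>a: "\<chi> (a + b) = \<chi> a + \<chi> b" "\<chi> (a * b) = \<chi> a * \<chi> b" if "a \<in> A" "b \<in> A" for a b
    using \<chi> that by (auto simp: char_on_def)
  show 0: "\<chi> 0 = 0" using \<chi> \<iota>_0 unfolding char_on_def by metis
  have s: "finite I \<Longrightarrow> \<chi> (sum f I) = (\<Sum>i\<in>I. \<chi> (f i))" if "\<And>i. f i \<in> A" for f and I :: "nat set"
    by (induction I rule: finite_induct) (auto simp: 0 \<chi>a sub_sum[OF A] that)
  note oc = over_def[OF A]
  show "over A p \<Longrightarrow> over A q \<Longrightarrow> map_poly \<chi> (p + q) = map_poly \<chi> p + map_poly \<chi> q"
    by (rule poly_eqI) (auto simp: coeff_map_poly 0 \<chi>a oc)
  show "over A p \<Longrightarrow> over A q \<Longrightarrow> map_poly \<chi> (p * q) = map_poly \<chi> p * map_poly \<chi> q"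
  proof (rule poly_eqI)
    fix n assume "over A p" "over A q"
    then have "\<chi> (\<Sum>i\<le>n. coeff p i * coeff q (n - i)) = (\<Sum>i\<le>n. \<chi> (coeff p i * coeff q (n - i)))"
      by (intro s) (auto simp: oc sub_mult[OF A])
    also have "\<dots> = (\<Sum>i\<le>n. \<chi> (coeff p i) * \<chi> (coeff q (n - i)))"
      using \<open>over A p\<close> \<open>over A q\<close> by (intro sum.cong) (auto simp: \<chi>a oc)
    finally show "coeff (map_poly \<chi> (p * q)) n = coeff (map_poly \<chi> p * map_poly \<chi> q) n"
      by (simp add: coeff_map_poly 0 coeff_mult)
  qed
  show "a \<in> A \<Longrightarrow> over A q \<Longrightarrow> map_poly \<chi> (Polynomial.smult a q) = Polynomial.smult (\<chi> a) (map_poly \<chi> q)"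
    by (rule poly_eqI) (auto simp: coeff_map_poly 0 \<chi>a oc)
qed

text \<open>Substituting \<xi> for \<open>x\<close> is well defined on A[x], because two polynomials
  with the same value at \<open>x\<close> differ by one whose value is 0, an element of
  \<open>P\<close>.\<close>

lemma extend_char:
  assumes A: "subalg A" and \<chi>: "char_on A P \<chi>"
    and P: "\<And>q. over A q \<Longrightarrow> poly q x \<in> P \<Longrightarrow> poly (map_poly \<chi> q) \<xi> = 0" and P0: "0 \<in> P"
  shows "\<exists>\<chi>'. char_on (adjoin A x) P \<chi>' \<and> (\<forall>q. over A q \<longrightarrow> \<chi>' (poly q x) = poly (map_poly \<chi> q) \<xi>)"
proof -
  define \<chi>' where "\<chi>' y = poly (map_poly \<chi> (SOME q. over A q \<and> poly q x = y)) \<xi>" for y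
  note hom = char_on_map_poly[OF A \<chi>]
  have *: "\<chi>' (poly q x) = poly (map_poly \<chi> q) \<xi>" if q: "over A q" for q
  proof -
    let ?r = "SOME r. over A r \<and> poly r x = poly q x"
    have r: "over A ?r \<and> poly ?r x = poly q x" by (rule someI[of _ q]) (use q in auto)
    have d: "over A (?r - q)" using r q over_minus[OF A] by blast
    have "poly (map_poly \<chi> (?r - q)) \<xi> = 0" using r P0 by (intro P d) auto
    moreover have "map_poly \<chi> ?r = map_poly \<chi> (?r - q) + map_poly \<chi> q"
      using hom(2)[OF d q] by simp
    ultimately show ?thesis by (simp add: \<chi>'_def)
  qed
  have adj: "\<exists>q. over A q \<and> y = poly q x" if "y \<in> adjoin A x" for y
    using that by (auto simp: adjoin_def over_def[OF A])
  have "char_on (adjoin A x) P \<chi>'"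
    unfolding char_on_def
  proof (intro conjI ballI allI)
    fix c
    have "\<chi>' (poly [:\<iota> c:] x) = poly (map_poly \<chi> [:\<iota> c:]) \<xi>" by (intro * over_const[OF A] sub_\<iota>[OF A])
    then show "\<chi>' (\<iota> c) = c" using \<chi> by (simp add: map_poly_pCons char_on_def hom(1) split: if_splits)
  next
    fix a b assume "a \<in> adjoin A x" "b \<in> adjoin A x"
    then obtain p q where pq: "over A p" "a = poly p x" "over A q" "b = poly q x" using adj by metis
    show "\<chi>' (a + b) = \<chi>' a + \<chi>' b" 
      using *[OF over_add[OF A pq(1,3)]] *[OF pq(1)] *[OF pq(3)] hom(2)[OF pq(1,3)] pq by simp
    show "\<chi>' (a * b) = \<chi>' a * \<chi>' b" 
      using *[OF over_mult[OF A pq(1,3)]] *[OF pq(1)] *[OF pq(3)] hom(3)[OF pq(1,3)] pq by simp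
  next
    fix a assume "a \<in> adjoin A x \<inter> P"
    then show "\<chi>' a = 0" using adj * P by (metis IntE)
  qed
  then show ?thesis using * by blast
qed

text \<open>The element \<open>a\<close> is a generic denominator. If \<open>x\<close> is
  transcendental modulo \<open>P\<close>, it is a coefficient of a polynomial representing
  \<open>b\<close>. If \<open>x\<close> is algebraic, it is the product of the leading coefficient
  \<open>l\<close> of a minimal relation and of an element \<open>k\<close> of \<open>A\<close>
  outside \<open>P\<close> that is a multiple of \<open>b\<close> modulo \<open>P\<close>.\<close>

lemma char_extension:
  assumes S: "subalg S" and P: "prime_on S P" and A: "subalg A" "A \<subseteq> S" and x: "x \<in> S"
    and b: "b \<in> adjoin A x" "b \<notin> P"
  shows "\<exists>a\<in>A - P. \<forall>\<chi>. char_on A P \<chi> \<longrightarrow> \<chi> a \<noteq> 0 \<longrightarrow> (\<exists>\<chi>'. char_on (adjoin A x) P \<chi>' \<and> \<chi>' b \<noteq> 0)"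
proof -
  have Pi: "P \<subseteq> S" "0 \<in> P" "\<And>a b. a \<in> P \<Longrightarrow> b \<in> P \<Longrightarrow> a + b \<in> P" "\<And>s a. s \<in> S \<Longrightarrow> a \<in> P \<Longrightarrow> s * a \<in> P"
    and P1: "1 \<notin> P" and Pp: "\<And>a b. a \<in> S \<Longrightarrow> b \<in> S \<Longrightarrow> a * b \<in> P \<Longrightarrow> a \<in> P \<or> b \<in> P"
    using P by (auto simp: prime_on_def ideal_on_def)
  have Pneg: "- a \<in> P" if "a \<in> P" for a
    using Pi(4)[OF sub_uminus[OF S sub_1[OF S]] that] by simp
  have Pmin: "a - b \<in> P" if "a \<in> P" "b \<in> P" for a b
    using Pi(3)[OF that(1) Pneg[OF that(2)]] by simp
  have Ppow: "a ^ n \<notin> P" if "a \<in> S" "a \<notin> P" for a n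
    by (induction n) (use that P1 Pp sub_power[OF S] in auto)
  let ?o = "over A"
  note oc = over_def[OF A(1)]
  have inS: "poly q x \<in> S" if "?o q" for q
    by (rule poly_in_sub[OF S]) (use that x A in \<open>auto simp: oc over_def[OF S]\<close>)
  have allP: "poly q x \<in> P" if "\<forall>i. coeff q i \<in> P" for q
    unfolding poly_altdef
  proof -
    have "finite I \<Longrightarrow> (\<Sum>i\<in>I. coeff q i * x ^ i) \<in> P" for I
      by (induction I rule: finite_induct)
        (use that Pi sub_power[OF S x] in \<open>auto simp: mult.commute[of "coeff q _"]\<close>)
    then show "(\<Sum>i\<le>degree q. coeff q i * x ^ i) \<in> P" by simp
  qed
  obtain qb where qb: "?o qb" "b = poly qb x" using b by (auto simp: adjoin_def oc)
  show ?thesis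
  proof (cases "\<forall>q. ?o q \<longrightarrow> poly q x \<in> P \<longrightarrow> (\<forall>i. coeff q i \<in> P)")
    case True
    obtain i where i: "coeff qb i \<notin> P" using allP b qb by blast
    show ?thesis
    proof (rule bexI[of _ "coeff qb i"], intro allI impI)
      show "coeff qb i \<in> A - P" using i qb by (auto simp: oc)
      fix \<chi> assume \<chi>: "char_on A P \<chi>" "\<chi> (coeff qb i) \<noteq> 0"
      note hom = char_on_map_poly[OF A(1) \<chi>(1)]
      have "map_poly \<chi> qb \<noteq> 0" using \<chi>(2) by (metis coeff_0 coeff_map_poly hom(1))
      \<comment> \<open>A nonzero polynomial over an infinite field has a non-root. Every \<xi> is
        admissible here, since all relations of \<open>x\<close> have their coefficients in
        \<open>P\<close>.\<close>
      then obtain \<xi> where \<xi>: "poly (map_poly \<chi> qb) \<xi> \<noteq> 0"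
        using poly_roots_finite infinite_UNIV_char_0 by (metis (mono_tags, lifting) UNIV_eq_I mem_Collect_eq)
      have "poly (map_poly \<chi> q) \<xi> = 0" if "?o q" "poly q x \<in> P" for q
      proof -
        have "\<chi> (coeff q i) = 0" for i using that True \<chi>(1) by (auto simp: char_on_def oc)
        then have "map_poly \<chi> q = 0" by (intro poly_eqI) (simp add: coeff_map_poly hom(1))
        then show ?thesis by simp
      qed
      then obtain \<chi>' where "char_on (adjoin A x) P \<chi>'" "\<forall>q. ?o q \<longrightarrow> \<chi>' (poly q x) = poly (map_poly \<chi> q) \<xi>"
        using extend_char[OF A(1) \<chi>(1)] Pi(2) by blast
      then show "\<exists>\<chi>'. char_on (adjoin A x) P \<chi>' \<and> \<chi>' b \<noteq> 0" using \<xi> qb by auto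
    qed
  next
    case False
    \<comment> \<open>Relations of \<open>x\<close> modulo \<open>P\<close> whose coefficients are
      not all in \<open>P\<close>. One of least degree, \<open>g\<close>, plays the role of a
      minimal polynomial over the fraction field of \<open>A\<close> modulo
      \<open>P\<close>.\<close>
    define good where "good q \<longleftrightarrow> ?o q \<and> poly q x \<in> P \<and> (\<exists>i. coeff q i \<notin> P)" for q
    have "\<exists>q. good q" using False by (auto simp: good_def)
    then obtain g where g: "good g" and gmin: "\<And>q. good q \<Longrightarrow> degree g \<le> degree q"
      using arg_min_natI[of good _ degree] arg_min_nat_le[of good _ degree] by metis
    define e where "e = degree g"
    define l where "l = coeff g e"
    have og: "?o g" and gP: "poly g x \<in> P" using g by (auto simp: good_def)
    have lA: "l \<in> A" using og by (auto simp: l_def oc)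
    have trunc: "\<exists>q'. ?o q' \<and> poly q x - poly q' x \<in> P \<and> (\<forall>i\<ge>degree q. coeff q' i = 0) \<and>
        (\<forall>i. coeff q i \<in> P \<or> coeff q' i = coeff q i)"
      if "?o q" "coeff q (degree q) \<in> P" for q
    proof (intro exI[of _ "q - monom (lead_coeff q) (degree q)"] conjI allI impI)
      show "?o (q - monom (lead_coeff q) (degree q))"
        by (intro over_minus[OF A(1)] over_monom[OF A(1)]) (use that in \<open>auto simp: oc\<close>)
      have "poly q x - poly (q - monom (lead_coeff q) (degree q)) x = x ^ degree q * lead_coeff q"
        by (simp add: poly_monom mult.commute)
      also have "\<dots> \<in> P" using that Pi(4) sub_power[OF S x] by blast
      finally show "poly q x - poly (q - monom (lead_coeff q) (degree q)) x \<in> P" .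
    next
      fix i assume "i \<ge> degree q"
      then show "coeff (q - monom (lead_coeff q) (degree q)) i = 0"
        by (cases "i = degree q") (auto simp: coeff_monom coeff_eq_0)
    next
      fix i show "coeff q i \<in> P \<or> coeff (q - monom (lead_coeff q) (degree q)) i = coeff q i"
        using that by (cases "i = degree q") (auto simp: coeff_monom)
    qed
    have lP: "l \<notin> P"
    proof
      assume "l \<in> P"
      then obtain q' where q': "?o q'" "poly g x - poly q' x \<in> P" "\<forall>i\<ge>degree g. coeff q' i = 0"
        "\<forall>i. coeff g i \<in> P \<or> coeff q' i = coeff g i"
        using trunc[OF og] by (auto simp: l_def e_def)
      have "poly q' x \<in> P" using Pmin[OF gP q'(2)] by simp
      moreover have nz: "\<exists>i. coeff q' i \<notin> P" using g q'(4) by (metis good_def)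
      ultimately have "good q'" using q' by (auto simp: good_def)
      then have "degree g \<le> degree q'" by (rule gmin)
      then have "lead_coeff q' = 0" using q'(3) by auto
      then have "q' = 0" by simp
      then show False using nz Pi by auto
    qed
    have e1: "e > 0"
    proof (rule ccontr)
      assume "\<not> e > 0"
      then have "g = [:l:]" by (simp add: e_def l_def degree_0_id)
      then show False using gP lP by simp
    qed
    have small: "coeff q i \<in> P" if "?o q" "poly q x \<in> P" "\<forall>i\<ge>e. coeff q i = 0" for q i
    proof (rule ccontr)
      assume "coeff q i \<notin> P"
      then have "good q" using that by (auto simp: good_def)
      then have "e \<le> degree q" unfolding e_def by (rule gmin)
      then have "lead_coeff q = 0" using that by auto
      then show False using \<open>coeff q i \<notin> P\<close> Pi by simp
    qed
    \<comment> \<open>Elements of A[x] outside \<open>P\<close> that are multiples of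
      \<open>b\<close> modulo \<open>P\<close>. One of least degree turns out to be constant, which
      replaces inverting \<open>b\<close> in a finite extension of the fraction field.\<close>
    define cand where "cand q \<longleftrightarrow> ?o q \<and> poly q x \<notin> P \<and> (\<exists>s. ?o s \<and> poly q x - poly s x * b \<in> P)" for q
    have "cand qb" using qb b Pi over_const[OF A(1) sub_1[OF A(1)]] by (auto simp: cand_def intro!: exI[of _ 1] simp: one_pCons)
    then obtain h where h: "cand h" and hmin: "\<And>q. cand q \<Longrightarrow> degree h \<le> degree q"
      using arg_min_natI[of cand _ degree] arg_min_nat_le[of cand _ degree] by metis
    have oh: "?o h" and hP: "poly h x \<notin> P" using h by (auto simp: cand_def)
    obtain sh where sh: "?o sh" "poly h x - poly sh x * b \<in> P" using h by (auto simp: cand_def)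
    define k where "k = coeff h (degree h)"
    have kA: "k \<in> A" using oh by (auto simp: k_def oc)
    have bS: "b \<in> S" using inS qb by auto
    have cand_rem: "poly t x \<in> P" if "?o t" "?o s" "poly t x - poly s x * poly h x \<in> P" "\<forall>i\<ge>degree h. coeff t i = 0" for s t
    proof (rule ccontr)
      assume n: "poly t x \<notin> P"
      have "poly t x - poly (s * sh) x * b = (poly t x - poly s x * poly h x) + poly s x * (poly h x - poly sh x * b)"
        by (simp add: algebra_simps)
      also have "\<dots> \<in> P" using that sh inS by (intro Pi) auto
      finally have "cand t" using n that sh over_mult[OF A(1)] unfolding cand_def by blast
      then have "lead_coeff t = 0" using hmin that(4) by blast
      then show False using n Pi by simp
    qed
    have kP: "k \<notin> P"
    proof
      assume "k \<in> P"
      then obtain q' where q': "?o q'" "poly h x - poly q' x \<in> P" "\<forall>i\<ge>degree h. coeff q' i = 0"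
        using trunc[OF oh] by (auto simp: k_def)
      have "poly q' x - poly 1 x * poly h x \<in> P" using Pneg[OF q'(2)] by simp
      then have "poly q' x \<in> P" 
        using cand_rem[OF q'(1) over_const[OF A(1) sub_1[OF A(1)], folded one_pCons] _ q'(3)] by simp
      then have "poly h x \<in> P" using Pi(3)[OF q'(2), of "poly q' x"] by simp
      then show False using hP by simp
    qed
    have h0: "degree h = 0"
    proof (rule ccontr)
      assume h1: "degree h \<noteq> 0"
      have he: "degree h < e"
      proof (rule ccontr)
        assume "\<not> degree h < e"
        obtain m s t where *: "?o s" "?o t" "Polynomial.smult (l ^ m) h = s * g + t" "\<forall>i\<ge>e. coeff t i = 0"
          using pseudo_division[OF A(1) og, of e h "Suc (degree h)"] oh coeff_eq_0[of g] coeff_eq_0[of h]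
          unfolding l_def e_def by (metis Suc_le_lessD)
        have "l ^ m * poly h x = poly s x * poly g x + poly t x"
          using arg_cong[OF *(3), of "\<lambda>p. poly p x"] by simp
        then have eq: "poly t x - l ^ m * poly h x = - (poly s x * poly g x)" by simp
        also have "\<dots> \<in> P" using Pneg Pi(4)[OF inS gP] * by blast
        finally have "poly t x - poly [:l ^ m:] x * poly h x \<in> P" by simp
        then have "poly t x \<in> P"
          using cand_rem[OF *(2) over_const[OF A(1) sub_power[OF A(1) lA]]] *(4) \<open>\<not> degree h < e\<close> by auto
        then have "poly t x + poly s x * poly g x \<in> P" using Pi(3) Pi(4)[OF inS gP] * by blast
        moreover have "poly t x + poly s x * poly g x = l ^ m * poly h x" using eq by (simp add: algebra_simps)
        ultimately have "l ^ m * poly h x \<in> P" by simp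
        then show False using Pp[OF _ inS[OF oh]] Ppow lP lA A hP sub_power[OF S] by blast
      qed
      \<comment> \<open>Now \<open>g\<close> is divided by \<open>h\<close>. The remainder has value
        in \<open>P\<close>, hence so has \<open>s * h\<close>; as \<open>P\<close> is prime and
        \<open>s\<close> is shorter than the minimal relation, all coefficients of \<open>s\<close>
        are in \<open>P\<close>. Then so is the coefficient of index \<open>e\<close>, which is
        \<open>k ^ m * l\<close>.\<close>
      obtain m s t where *: "?o s" "?o t" "Polynomial.smult (k ^ m) g = s * h + t" "\<forall>i\<ge>degree h. coeff t i = 0"
          "\<forall>i. i + degree h \<ge> Suc e \<longrightarrow> coeff s i = 0"
        using pseudo_division[OF A(1) oh, of "degree h" g "Suc e"] og coeff_eq_0[of g] coeff_eq_0[of h]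
        unfolding k_def e_def by (metis Suc_le_lessD)
      have eq: "k ^ m * poly g x = poly s x * poly h x + poly t x"
        using arg_cong[OF *(3), of "\<lambda>p. poly p x"] by simp
      have kg: "k ^ m * poly g x \<in> P" using Pi(4)[OF _ gP] kA A sub_power[OF S] by blast
      have "poly t x - poly (- s) x * poly h x \<in> P" using kg eq by (simp add: algebra_simps)
      then have tP: "poly t x \<in> P" using cand_rem[OF *(2) _ _ *(4), of "- s"] over_minus[OF A(1) over_0[OF A(1)] *(1)] by simp
      then have "poly s x * poly h x \<in> P" using Pmin[OF kg tP] eq by simp
      then have "poly s x \<in> P" using Pp[OF inS inS] * oh hP by blast
      then have sP: "coeff s i \<in> P" for i
        by (intro small[OF *(1)]) (use *(5) h1 in auto)
      have "coeff (s * h) e \<in> P"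
      proof -
        have "finite I \<Longrightarrow> (\<Sum>i\<in>I. coeff s i * coeff h (e - i)) \<in> P" for I
        proof (induction I rule: finite_induct)
          case (insert i I)
          have "coeff h (e - i) \<in> S" using oh A(2) by (auto simp: oc)
          then have "coeff h (e - i) * coeff s i \<in> P" using Pi(4) sP by blast
          then show ?case using Pi(3) insert by (simp add: mult.commute)
        qed (simp add: Pi)
        then show ?thesis by (simp add: coeff_mult)
      qed
      moreover have "k ^ m * l = coeff (s * h) e"
        using arg_cong[OF *(3), of "\<lambda>p. coeff p e"] *(4) he by (simp add: l_def)
      ultimately have "k ^ m * l \<in> P" by simp
      then show False using Pp lP Ppow kP lA kA A sub_power[OF S] by blast
    qed
    have hk: "h = [:k:]" using h0 by (simp add: k_def degree_0_id)
    show ?thesis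
    proof (rule bexI[of _ "k * l"], intro allI impI)
      show "k * l \<in> A - P" using sub_mult[OF A(1) kA lA] Pp kP lP kA lA A by blast
      fix \<chi> assume \<chi>: "char_on A P \<chi>" "\<chi> (k * l) \<noteq> 0"
      note hom = char_on_map_poly[OF A(1) \<chi>(1)]
      have \<chi>m: "\<chi> (a * b) = \<chi> a * \<chi> b" if "a \<in> A" "b \<in> A" for a b using \<chi>(1) that by (auto simp: char_on_def)
      have \<chi>p: "\<chi> (a ^ n) = \<chi> a ^ n" if "a \<in> A" for a n
        by (induction n) (use \<chi>m that sub_power[OF A(1) that] \<chi>(1) \<iota>_1 in \<open>auto simp: char_on_def\<close>, metis)
      have nz: "\<chi> k \<noteq> 0" "\<chi> l \<noteq> 0" using \<chi>(2) \<chi>m[OF kA lA] by auto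
      have "coeff (map_poly \<chi> g) e \<noteq> 0" using nz by (simp add: coeff_map_poly hom(1) l_def)
      then have "degree (map_poly \<chi> g) > 0" using e1 le_degree by (metis gr_zeroI le_zero_eq)
      \<comment> \<open>As \<chi> does not kill \<open>l\<close>, the image of \<open>g\<close>
        keeps its positive degree, and algebraic closedness supplies the value of
        \<open>x\<close>.\<close>
      then obtain \<xi> where \<xi>: "poly (map_poly \<chi> g) \<xi> = 0" using alg_closed_imp_poly_has_root by blast
      have vanish: "poly (map_poly \<chi> q) \<xi> = 0" if q: "?o q" "poly q x \<in> P" for q
      proof -
        obtain m s t where *: "?o s" "?o t" "Polynomial.smult (l ^ m) q = s * g + t" "\<forall>i\<ge>e. coeff t i = 0"
          using pseudo_division[OF A(1) og, of e q "Suc (degree q)"] q coeff_eq_0[of g] coeff_eq_0[of q]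
          unfolding l_def e_def by (metis Suc_le_lessD)
        have eq: "l ^ m * poly q x = poly s x * poly g x + poly t x"
          using arg_cong[OF *(3), of "\<lambda>p. poly p x"] by simp
        have "poly t x = l ^ m * poly q x - poly s x * poly g x" using eq by simp
        also have "\<dots> \<in> P" using Pmin Pi(4) q gP inS[OF *(1)] sub_power[OF S] lA A by (meson subsetD)
        finally have "\<chi> (coeff t i) = 0" for i
          using small[OF *(2) _ *(4)] \<chi>(1) *(2) by (auto simp: char_on_def oc)
        then have "map_poly \<chi> t = 0" by (intro poly_eqI) (simp add: coeff_map_poly hom(1))
        then have "map_poly \<chi> (Polynomial.smult (l ^ m) q) = map_poly \<chi> s * map_poly \<chi> g"
          unfolding *(3) by (simp add: hom over_mult[OF A(1)] * og)
        then have "Polynomial.smult (\<chi> l ^ m) (map_poly \<chi> q) = map_poly \<chi> s * map_poly \<chi> g"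
          by (simp add: hom(4) sub_power[OF A(1)] lA q \<chi>p)
        from arg_cong[OF this, of "\<lambda>p. poly p \<xi>"] show ?thesis using nz \<xi> by simp
      qed
      obtain \<chi>' where \<chi>': "char_on (adjoin A x) P \<chi>'" "\<forall>q. ?o q \<longrightarrow> \<chi>' (poly q x) = poly (map_poly \<chi> q) \<xi>"
        using extend_char[OF A(1) \<chi>(1)] vanish Pi(2) by blast
      have o2: "?o ([:k:] - sh * qb)" "?o (sh * qb)" "?o [:k:]"
        using over_minus[OF A(1)] over_mult[OF A(1)] over_const[OF A(1)] kA sh qb by auto
      \<comment> \<open>\<open>k\<close> equals \<open>sh\<close> times \<open>b\<close> modulo
        \<open>P\<close>, so \<chi> \<open>k\<close> is a multiple of the new value at
        \<open>b\<close>; being nonzero, it forces that value to be nonzero.\<close>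
      have "poly (map_poly \<chi> ([:k:] - sh * qb)) \<xi> = 0"
        using o2 sh(2) hk qb by (intro vanish) auto
      moreover have "map_poly \<chi> [:k:] = map_poly \<chi> ([:k:] - sh * qb) + map_poly \<chi> sh * map_poly \<chi> qb"
        using hom(2)[OF o2(1,2)] hom(3)[OF sh(1) qb(1)] by simp
      ultimately have "poly (map_poly \<chi> [:k:]) \<xi> = poly (map_poly \<chi> sh) \<xi> * poly (map_poly \<chi> qb) \<xi>"
        by simp
      then have "poly (map_poly \<chi> qb) \<xi> \<noteq> 0" using nz by (auto simp: map_poly_pCons hom(1))
      then show "\<exists>\<chi>'. char_on (adjoin A x) P \<chi>' \<and> \<chi>' b \<noteq> 0" using \<chi>' qb by auto
    qed
  qed
qed

section \<open>Finitely generated subalgebras and existence of points\<close>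

fun fin_gen :: "'r list \<Rightarrow> 'r set" where
  "fin_gen [] = range \<iota>"
| "fin_gen (x # xs) = adjoin (fin_gen xs) x"

lemma fin_gen_subalg: "subalg (fin_gen xs)"
proof (induction xs)
  case Nil
  show ?case by (auto simp: subalg_def \<iota>_add[symmetric] \<iota>_mult[symmetric])
qed (auto intro: adjoin_subalg)

lemma fin_gen_superset: "set xs \<subseteq> fin_gen xs"
proof (induction xs)
  case (Cons x xs)
  then show ?case using adjoin_gen[OF fin_gen_subalg] adjoin_base[OF fin_gen_subalg] by fastforce
qed simp

lemma fin_gen_least: "subalg S \<Longrightarrow> set xs \<subseteq> S \<Longrightarrow> fin_gen xs \<subseteq> S"
proof (induction xs)
  case Nil
  then show ?case by (auto simp: subalg_def)
next
  case (Cons x xs)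
  then have "fin_gen xs \<subseteq> S" "x \<in> S" by auto
  then show ?case using poly_in_sub[OF Cons.prems(1)] over_def[OF Cons.prems(1)]
    by (auto simp: adjoin_def) (meson subsetD)
qed

text \<open>The generators are removed one at a time, the element that must not vanish being
  replaced by the denominator from \<open>char_extension\<close>. Over the base field this ends well
  because a prime contains no nonzero constant.\<close>

lemma char_exists:
  assumes S: "subalg S" and P: "prime_on S P"
  shows "set xs \<subseteq> S \<Longrightarrow> b \<in> fin_gen xs \<Longrightarrow> b \<notin> P \<Longrightarrow> \<exists>\<chi>. char_on (fin_gen xs) P \<chi> \<and> \<chi> b \<noteq> 0"
proof (induction xs arbitrary: b)
  case Nil
  have Pi: "0 \<in> P" "\<And>s a. s \<in> S \<Longrightarrow> a \<in> P \<Longrightarrow> s * a \<in> P" and P1: "1 \<notin> P"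
    using P by (auto simp: prime_on_def ideal_on_def)
  have z: "c = 0" if "\<iota> c \<in> P" for c
  proof (rule ccontr)
    assume "c \<noteq> 0"
    then have "1 = \<iota> (inverse c) * \<iota> c" by (simp add: \<iota>_mult[symmetric] \<iota>_1)
    then show False using Pi(2)[OF sub_\<iota>[OF S] that] P1 by metis
  qed
  have inj: "c = d" if "\<iota> c = \<iota> d" for c d
  proof -
    have "\<iota> (c + - d) = 0" using that by (simp only: \<iota>_add \<iota>_minus) simp
    then show ?thesis using z[of "c + - d"] Pi by simp
  qed
  define \<chi> where "\<chi> y = (THE c. y = \<iota> c)" for y
  have \<chi>: "\<chi> (\<iota> c) = c" for c unfolding \<chi>_def by (rule the_equality) (auto dest: inj)
  have "char_on (fin_gen []) P \<chi>"
    by (auto simp: char_on_def \<chi> \<iota>_add[symmetric] \<iota>_mult[symmetric] z)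
  moreover obtain c where "b = \<iota> c" using Nil by auto
  ultimately show ?case using \<chi> Nil Pi \<iota>_0 by metis
next
  case (Cons x xs)
  have "fin_gen xs \<subseteq> S" using Cons.prems fin_gen_least[OF S] by auto
  then obtain a where a: "a \<in> fin_gen xs - P" "\<forall>\<chi>. char_on (fin_gen xs) P \<chi> \<longrightarrow> \<chi> a \<noteq> 0 \<longrightarrow> (\<exists>\<chi>'. char_on (fin_gen (x # xs)) P \<chi>' \<and> \<chi>' b \<noteq> 0)"
    using char_extension[OF S P fin_gen_subalg, of xs x b] Cons.prems by auto
  then show ?case using Cons.IH[of a] Cons.prems by auto
qed

text \<open>An ideal maximal among those that contain \<open>I\<close> and no power of
  \<open>p\<close> is prime: enlarging it by either of two elements produces a power of
  \<open>p\<close>, and the product of two such powers would lie in it if the product of the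
  elements did.\<close>

lemma prime_avoiding:
  assumes S: "subalg S" and I: "ideal_on S I" and p: "p \<in> S" "\<And>k::nat. p ^ k \<notin> I"
  shows "\<exists>P. prime_on S P \<and> I \<subseteq> P \<and> p \<notin> P"
proof -
  let ?C = "{K. ideal_on S K \<and> I \<subseteq> K \<and> (\<forall>k::nat. p ^ k \<notin> K)}"
  have "\<exists>M\<in>?C. \<forall>X\<in>?C. M \<subseteq> X \<longrightarrow> X = M"
  proof (rule subset_Zorn_nonempty)
    show "?C \<noteq> {}" using I p by auto
    fix C assume C: "C \<noteq> {}" "subset.chain ?C C"
    have el: "ideal_on S K" "I \<subseteq> K" "p ^ k \<notin> K" if "K \<in> C" for K k
      using C(2) that by (auto simp: subset_chain_def)
    have "ideal_on S (\<Union>C)"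
      unfolding ideal_on_def
    proof (intro conjI ballI)
      show "\<Union>C \<subseteq> S" using el(1) by (force simp: ideal_on_def)
      show "0 \<in> \<Union>C" using el(1) C(1) by (auto simp: ideal_on_def)
      fix a b assume "a \<in> \<Union>C" "b \<in> \<Union>C"
      then obtain K L where KL: "K \<in> C" "L \<in> C" "a \<in> K" "b \<in> L" by auto
      then have "K \<subseteq> L \<or> L \<subseteq> K" using C(2) by (auto simp: subset_chain_def)
      then show "a + b \<in> \<Union>C" using KL el(1) unfolding ideal_on_def by (metis UnionI subsetD)
    next
      fix s a assume "s \<in> S" "a \<in> \<Union>C"
      then show "s * a \<in> \<Union>C" using el(1) by (fastforce simp: ideal_on_def)
    qed
    moreover have "I \<subseteq> \<Union>C" using el(2) C(1) by blast
    ultimately show "\<Union>C \<in> ?C" using el(3) by auto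
  qed
  then obtain M where M: "ideal_on S M" "I \<subseteq> M" "\<And>k::nat. p ^ k \<notin> M"
    and max: "\<And>K. ideal_on S K \<Longrightarrow> I \<subseteq> K \<Longrightarrow> M \<subseteq> K \<Longrightarrow> (\<forall>k::nat. p ^ k \<notin> K) \<Longrightarrow> K = M" by auto
  have Mi: "M \<subseteq> S" "0 \<in> M" "\<And>a b. a \<in> M \<Longrightarrow> b \<in> M \<Longrightarrow> a + b \<in> M" "\<And>s a. s \<in> S \<Longrightarrow> a \<in> M \<Longrightarrow> s * a \<in> M"
    using M(1) by (auto simp: ideal_on_def)
  have ext: "\<exists>k::nat. \<exists>m\<in>M. \<exists>s\<in>S. p ^ k = m + s * a" if "a \<in> S" "a \<notin> M" for a
  proof -
    let ?K = "{m + s * a | m s. m \<in> M \<and> s \<in> S}"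
    have "ideal_on S ?K"
      unfolding ideal_on_def
    proof (intro conjI ballI)
      show "?K \<subseteq> S" using Mi that sub_add[OF S] sub_mult[OF S] by auto
      show "0 \<in> ?K" using Mi sub_0[OF S] by force
      fix u v assume "u \<in> ?K" "v \<in> ?K"
      then obtain m s m' s' where "u = m + s * a" "v = m' + s' * a" "m \<in> M" "s \<in> S" "m' \<in> M" "s' \<in> S" by auto
      then show "u + v \<in> ?K" using Mi(3) sub_add[OF S]
        by (intro CollectI exI[of _ "m + m'"] exI[of _ "s + s'"]) (auto simp: algebra_simps)
    next
      fix t u assume "t \<in> S" "u \<in> ?K"
      then obtain m s where "u = m + s * a" "m \<in> M" "s \<in> S" by auto
      then show "t * u \<in> ?K" using Mi(4)[OF \<open>t \<in> S\<close>] sub_mult[OF S \<open>t \<in> S\<close>]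
        by (intro CollectI exI[of _ "t * m"] exI[of _ "t * s"]) (simp add: distrib_left mult.assoc)
    qed
    moreover have sub: "M \<subseteq> ?K"
    proof
      fix m assume "m \<in> M"
      then show "m \<in> ?K" using sub_0[OF S] by (intro CollectI exI[of _ m] exI[of _ 0]) auto
    qed
    moreover have "a \<in> ?K" using Mi sub_1[OF S] by force
    ultimately have "\<exists>k. p ^ k \<in> ?K" using max[of ?K] M(2) that(2) by blast
    then show ?thesis by blast
  qed
  have "prime_on S M"
    unfolding prime_on_def
  proof (intro conjI M(1) ballI impI)
    show "1 \<notin> M" using M(3)[of 0] by simp
    fix a b assume ab: "a \<in> S" "b \<in> S" "a * b \<in> M"
    show "a \<in> M \<or> b \<in> M"
    proof (rule ccontr)
      assume "\<not> (a \<in> M \<or> b \<in> M)"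
      then obtain k m s k' m' s' where *: "m \<in> M" "s \<in> S" "p ^ k = m + s * a" "m' \<in> M" "s' \<in> S" "p ^ k' = m' + s' * b"
        using ext ab by metis
      have "p ^ (k + k') = (m' + s' * b) * m + ((s * a) * m' + (s * s') * (a * b))"
        unfolding power_add *(3,6) by (simp add: algebra_simps)
      also have "\<dots> \<in> M" using * ab Mi sub_mult[OF S] sub_add[OF S] by (meson subsetD)
      finally show False using M(3) by blast
    qed
  qed
  then show ?thesis using M(2) M(3)[of 1] by auto
qed

theorem nullstellensatz:
  assumes I: "ideal_on (fin_gen xs) I" and rad: "\<And>q k. q \<in> fin_gen xs \<Longrightarrow> q ^ k \<in> I \<Longrightarrow> q \<in> I"
    and p: "p \<in> fin_gen xs" "p \<notin> I"
  shows "\<exists>\<chi>. char_on (fin_gen xs) I \<chi> \<and> \<chi> p \<noteq> 0"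
proof -
  obtain P where P: "prime_on (fin_gen xs) P" "I \<subseteq> P" "p \<notin> P"
    using prime_avoiding[OF fin_gen_subalg I p(1)] rad p by blast
  then obtain \<chi> where "char_on (fin_gen xs) P \<chi>" "\<chi> p \<noteq> 0"
    using char_exists[OF fin_gen_subalg P(1) fin_gen_superset p(1)] by blast
  then show ?thesis using P(2) by (intro exI[of _ \<chi>]) (auto simp: char_on_def)
qed

end

section \<open>Linear algebra in coordinates\<close>

text \<open>Elimination of one unknown per equation. The solution is extended by 0 outside
  \<open>I\<close> so that it can be paired with vectors on a larger index set.\<close>

lemma homogeneous_system:
  fixes A :: "nat \<Rightarrow> 'i \<Rightarrow> 'a::field"
  assumes "finite I" "n < card I"
  shows "\<exists>x. (\<exists>i\<in>I. x i \<noteq> 0) \<and> (\<forall>i. i \<notin> I \<longrightarrow> x i = 0) \<and> (\<forall>k<n. (\<Sum>i\<in>I. A k i * x i) = 0)"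
  using assms
proof (induction n arbitrary: I A)
  case 0
  then obtain j where "j \<in> I" by fastforce
  then show ?case by (intro exI[of _ "\<lambda>i. if i = j then 1 else 0"]) auto
next
  case (Suc n)
  show ?case
  proof (cases "\<forall>i\<in>I. A n i = 0")
    case True
    obtain x where x: "\<exists>i\<in>I. x i \<noteq> 0" "\<forall>i. i \<notin> I \<longrightarrow> x i = 0" "\<forall>k<n. (\<Sum>i\<in>I. A k i * x i) = 0"
      using Suc.IH[of I A] Suc.prems by auto
    then show ?thesis using True by (intro exI[of _ x]) (auto simp: less_Suc_eq)
  next
    case False
    then obtain j where j: "j \<in> I" "A n j \<noteq> 0" by auto
    let ?I = "I - {j}"
    have "n < card ?I" using Suc.prems j by simp
    then obtain x where x: "\<exists>i\<in>?I. x i \<noteq> 0" "\<forall>i. i \<notin> ?I \<longrightarrow> x i = 0"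
      "\<forall>k<n. (\<Sum>i\<in>?I. (A k i - A k j * A n i / A n j) * x i) = 0"
      using Suc.IH[of ?I "\<lambda>k i. A k i - A k j * A n i / A n j"] Suc.prems by auto
    define S where "S = (\<Sum>i\<in>?I. A n i * x i)"
    define y where "y = x(j := - S / A n j)"
    have y: "(\<Sum>i\<in>I. A k i * y i) = A k j * (- S / A n j) + (\<Sum>i\<in>?I. A k i * x i)" for k
      using Suc.prems(1) j by (simp add: sum.remove[of I j] y_def)
    have "(\<Sum>i\<in>I. A k i * y i) = 0" if "k < Suc n" for k
    proof (cases "k = n")
      case True
      then show ?thesis using j y[of n] by (simp add: S_def)
    next
      case False
      then have "(\<Sum>i\<in>?I. A k i * x i - A k j / A n j * (A n i * x i)) = 0"
        using x(3) that by (simp add: algebra_simps)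
      then have "(\<Sum>i\<in>?I. A k i * x i) = A k j / A n j * S"
        by (simp add: sum_subtractf S_def sum_distrib_left)
      then show ?thesis using y[of k] by simp
    qed
    then show ?thesis using x j by (intro exI[of _ y]) (auto simp: y_def)
  qed
qed

definition dot :: "nat set \<Rightarrow> (nat \<Rightarrow> 'a::field) \<Rightarrow> (nat \<Rightarrow> 'a) \<Rightarrow> 'a" where
  "dot T u v = (\<Sum>i\<in>T. u i * v i)"

lemma dot_commute: "dot T u v = dot T v u"
  by (simp add: dot_def mult.commute)

text \<open>\<open>I\<close> is a largest index set supporting no nonzero vector annihilated by
  \<open>ys\<close>, in other words a set of pivot columns. One more index \<open>j\<close> creates
  such a vector, and its entry at \<open>j\<close> can be normalised.\<close>

lemma pivots:
  fixes ys :: "(nat \<Rightarrow> 'a::field) list"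
  assumes T: "finite T"
  shows "\<exists>I\<subseteq>T. card I \<le> length ys \<and>
    (\<forall>j\<in>T - I. \<exists>u. u j = 1 \<and> (\<forall>i. i \<notin> insert j I \<longrightarrow> u i = 0) \<and> (\<forall>y\<in>set ys. dot T y u = 0))"
proof -
  define ind where "ind I \<longleftrightarrow> I \<subseteq> T \<and> (\<forall>x. (\<forall>i. i \<notin> I \<longrightarrow> x i = 0) \<longrightarrow> (\<forall>y\<in>set ys. dot T y x = 0) \<longrightarrow> (\<forall>i. x i = 0))" for I
  have "ind {}" by (auto simp: ind_def)
  moreover have "card J < Suc (card T)" if "ind J" for J
    using that T card_mono by (auto simp: ind_def less_Suc_eq_le)
  ultimately obtain I where I: "ind I" and max: "\<And>J. ind J \<Longrightarrow> card J \<le> card I"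
    using ex_has_greatest_nat[of ind "{}" card "Suc (card T)"] by blast
  have fI: "finite I" using I T finite_subset by (auto simp: ind_def)
  have "card I \<le> length ys"
  proof (rule ccontr)
    assume "\<not> card I \<le> length ys"
    then obtain x where x: "\<exists>i\<in>I. x i \<noteq> 0" "\<forall>i. i \<notin> I \<longrightarrow> x i = 0" "\<forall>k<length ys. (\<Sum>i\<in>I. (ys ! k) i * x i) = 0"
      using homogeneous_system[OF fI, of "length ys" "\<lambda>k i. (ys ! k) i"] by auto
    have "dot T y x = 0" if "y \<in> set ys" for y
    proof -
      have "dot T y x = (\<Sum>i\<in>I. y i * x i)"
        unfolding dot_def using I x(2) T by (intro sum.mono_neutral_right) (auto simp: ind_def)
      then show ?thesis using x(3) that by (metis in_set_conv_nth)
    qed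
    then show False using I x by (auto simp: ind_def)
  qed
  moreover have "\<exists>u. u j = 1 \<and> (\<forall>i. i \<notin> insert j I \<longrightarrow> u i = 0) \<and> (\<forall>y\<in>set ys. dot T y u = 0)" if j: "j \<in> T - I" for j
  proof -
    have "\<not> ind (insert j I)"
    proof
      assume "ind (insert j I)"
      then show False using max[of "insert j I"] j fI by simp
    qed
    then obtain x where x: "\<forall>i. i \<notin> insert j I \<longrightarrow> x i = 0" "\<forall>y\<in>set ys. dot T y x = 0" "\<exists>i. x i \<noteq> 0"
      using I j unfolding ind_def by auto
    have xj: "x j \<noteq> 0"
    proof
      assume "x j = 0"
      then have "\<forall>i. i \<notin> I \<longrightarrow> x i = 0" using x(1) by auto
      then show False using I x by (auto simp: ind_def)
    qed
    have "dot T y (\<lambda>i. x i / x j) = 0" if "y \<in> set ys" for y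
    proof -
      have "dot T y (\<lambda>i. x i / x j) = dot T y x / x j" by (simp add: dot_def sum_divide_distrib)
      then show ?thesis using x that by simp
    qed
    then show ?thesis using x xj by (intro exI[of _ "\<lambda>i. x i / x j"]) auto
  qed
  ultimately show ?thesis using I by (auto simp: ind_def)
qed

text \<open>\<open>p\<close> is supported off the pivots of \<open>ys\<close>, where there is room
  enough to annihilate \<open>hs\<close>. A kernel vector of \<open>ys\<close> belonging to an index
  \<open>j\<close> with \<open>p j \<noteq> 0\<close> meets \<open>p\<close> only at
  \<open>j\<close>, so it can be scaled to have product 1 with \<open>p\<close>.\<close>

lemma dual_pair:
  fixes ys hs :: "(nat \<Rightarrow> 'a::field) list"
  assumes T: "finite T" "length ys + length hs < card T"
  shows "\<exists>p q. (\<forall>h\<in>set hs. dot T h p = 0) \<and> (\<forall>y\<in>set ys. dot T q y = 0) \<and> dot T q p = 1"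
proof -
  from pivots[OF T(1), of ys] obtain I where I: "I \<subseteq> T" "card I \<le> length ys"
    "\<forall>j\<in>T - I. \<exists>u. u j = 1 \<and> (\<forall>i. i \<notin> insert j I \<longrightarrow> u i = 0) \<and> (\<forall>y\<in>set ys. dot T y u = 0)"
    by (elim exE conjE)
  have fI: "finite (T - I)" using T by simp
  have "length hs < card (T - I)"
    using T I card_Diff_subset[of I T] finite_subset[OF I(1) T(1)] by linarith
  from homogeneous_system[OF fI this, of "\<lambda>k i. (hs ! k) i"]
  obtain p where p: "\<exists>i\<in>T - I. p i \<noteq> 0" "\<forall>i. i \<notin> T - I \<longrightarrow> p i = 0"
    "\<forall>k<length hs. (\<Sum>i\<in>T - I. (hs ! k) i * p i) = 0"
    by blast
  have d: "dot T h p = (\<Sum>i\<in>T - I. h i * p i)" for h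
    unfolding dot_def using p(2) T by (intro sum.mono_neutral_right) auto
  obtain j where j: "j \<in> T - I" "p j \<noteq> 0" using p by auto
  obtain u where u: "u j = 1" "\<forall>i. i \<notin> insert j I \<longrightarrow> u i = 0" "\<forall>y\<in>set ys. dot T y u = 0"
    using bspec[OF I(3) j(1)] by (elim exE conjE)
  define q where "q i = u i / p j" for i
  have "dot T q y = 0" if "y \<in> set ys" for y
  proof -
    have "dot T q y = dot T y u / p j" by (simp add: dot_def q_def sum_divide_distrib mult.commute)
    then show ?thesis using u that by simp
  qed
  moreover have "dot T q p = 1"
  proof -
    have "dot T q p = (\<Sum>i\<in>{j}. q i * p i)"
      unfolding d using j u(2) T by (intro sum.mono_neutral_right) (auto simp: q_def)
    then show ?thesis using j u(1) by (simp add: q_def)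
  qed
  moreover have "dot T h p = 0" if "h \<in> set hs" for h
    using p(3) that unfolding d by (metis in_set_conv_nth)
  ultimately show ?thesis by blast
qed

text \<open>The vectors already found join the conditions on the next pair, one on each side; this
  is the summand \<open>2 * M\<close>.\<close>

lemma dual_pairs:
  fixes ys hs :: "(nat \<Rightarrow> 'a::field) list"
  assumes T: "finite T"
  shows "length ys + length hs + 2 * M \<le> card T \<Longrightarrow> \<exists>p q. (\<forall>a<M. \<forall>h\<in>set hs. dot T h (p a) = 0) \<and>
    (\<forall>a<M. \<forall>y\<in>set ys. dot T (q a) y = 0) \<and> (\<forall>a<M. \<forall>b<M. dot T (q a) (p b) = (if a = b then 1 else 0))"
proof (induction M)
  case (Suc M)
  then obtain p q where pq: "\<forall>a<M. \<forall>h\<in>set hs. dot T h (p a) = 0" "\<forall>a<M. \<forall>y\<in>set ys. dot T (q a) y = 0"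
    "\<forall>a<M. \<forall>b<M. dot T (q a) (p b) = (if a = b then 1 else 0)" by auto
  obtain x y where x: "\<forall>h\<in>set (hs @ map q [0..<M]). dot T h x = 0"
    and y: "\<forall>z\<in>set (ys @ map p [0..<M]). dot T y z = 0" and 1: "dot T y x = 1"
    using dual_pair[OF T, of "ys @ map p [0..<M]" "hs @ map q [0..<M]"] Suc.prems by auto
  have "dot T h x = 0" if "h \<in> set hs" for h using x that by simp
  moreover have "dot T (q a) x = 0" if "a < M" for a using x that by simp
  moreover have "dot T y h = 0" if "h \<in> set ys" for h using y that by simp
  moreover have "dot T y (p a) = 0" if "a < M" for a using y that by simp
  ultimately show ?case using pq 1
    by (intro exI[of _ "p(M := x)"] exI[of _ "q(M := y)"]) (simp add: less_Suc_eq)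
qed auto

lemma dot_lin:
  "dot T (\<lambda>i. u i + v i) w = dot T u w + dot T v w" "dot T w (\<lambda>i. u i + v i) = dot T w u + dot T w v"
  "dot T (\<lambda>i. u i - v i) w = dot T u w - dot T v w" "dot T w (\<lambda>i. u i - v i) = dot T w u - dot T w v"
  "dot T (\<lambda>i. c * u i) w = c * dot T u w" "dot T w (\<lambda>i. c * u i) = c * dot T w u"
  "dot T (\<lambda>i. \<Sum>j\<in>J. f j i) w = (\<Sum>j\<in>J. dot T (f j) w)" "dot T w (\<lambda>i. \<Sum>j\<in>J. f j i) = (\<Sum>j\<in>J. dot T w (f j))"
proof -
  show "dot T (\<lambda>i. \<Sum>j\<in>J. f j i) w = (\<Sum>j\<in>J. dot T (f j) w)"
    unfolding dot_def sum_distrib_right by (rule sum.swap)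
  then show "dot T w (\<lambda>i. \<Sum>j\<in>J. f j i) = (\<Sum>j\<in>J. dot T w (f j))"
    by (simp add: dot_commute[of T w])
qed (auto simp: dot_def distrib_left distrib_right left_diff_distrib right_diff_distrib sum.distrib sum_subtractf
  sum_distrib_left mult_ac)

lemma sum_delta_if: "(\<Sum>j<m. (if i = j then (f j :: 'a::field) else 0)) = (if i < m then f i else 0)"
  "(\<Sum>j<m. (if j = i then (f j :: 'a::field) else 0)) = (if i < m then f i else 0)" for m i :: nat
  by (auto simp: sum.delta sum.delta')

section \<open>Null systems and rank modulo scalars\<close>

definition factor_rank :: "nat set \<Rightarrow> nat \<Rightarrow> (nat \<Rightarrow> nat \<Rightarrow> 'a::field) \<Rightarrow> bool" where
  "factor_rank I k X \<longleftrightarrow> (\<exists>a b. \<forall>i\<in>I. \<forall>j\<in>I. X i j = (\<Sum>l<k. a i l * b l j))"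

definition mapply :: "nat set \<Rightarrow> (nat \<Rightarrow> nat \<Rightarrow> 'a::field) \<Rightarrow> (nat \<Rightarrow> 'a) \<Rightarrow> nat \<Rightarrow> 'a" where
  "mapply T X v i = (\<Sum>j\<in>T. X i j * v j)"

text \<open>The rows \<open>z i\<close> and columns \<open>w j\<close> from which, in type A, the
  blocks of the nilpotent matrix are built: the first relation gives a product 0, the second makes
  \<open>z X w\<close> an arbitrary matrix of rank at most \<open>m\<close>.\<close>

definition null_system :: "nat set \<Rightarrow> (nat \<Rightarrow> nat \<Rightarrow> 'a::field) \<Rightarrow> nat \<Rightarrow> (nat \<Rightarrow> nat \<Rightarrow> 'a) \<Rightarrow> (nat \<Rightarrow> nat \<Rightarrow> 'a) \<Rightarrow> bool" where
  "null_system T X m z w \<longleftrightarrow> (\<forall>i<m. \<forall>j<m. dot T (z i) (w j) = 0 \<and>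
     dot T (z i) (mapply T X (w j)) = (if i = j then 1 else 0))"

lemma null_system_extend:
  assumes s: "null_system T X m z w"
    and "\<forall>i<m. dot T (z i) v = 0 \<and> dot T \<phi> (w i) = 0 \<and> dot T (z i) (mapply T X v) = 0 \<and> dot T \<phi> (mapply T X (w i)) = 0"
    and "dot T \<phi> v = 0" "dot T \<phi> (mapply T X v) \<noteq> 0"
  shows "\<exists>z w. null_system T X (Suc m) z w"
proof -
  let ?c = "dot T \<phi> (mapply T X v)"
  have "null_system T X (Suc m) (z(m := (\<lambda>i. inverse ?c * \<phi> i))) (w(m := v))"
    using assms by (auto simp: null_system_def less_Suc_eq dot_lin)
  then show ?thesis by blast
qed

text \<open>If the system cannot grow, \<open>X\<close> acts as a scalar \<mu> between the vectors
  and covectors orthogonal to the system in both senses. \<open>B\<close> is the form of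
  \<open>X - \<mu>\<close>, and the system turns out to span it. The auxiliary vectors need
  \<open>4 * m + 9\<close> coordinates for the single pair in \<open>scal\<close> and
  \<open>8 * m + 6\<close> for the pairs in \<open>B0\<close>; the bound covers both.\<close>

lemma null_system_or_low_rank:
  fixes X :: "nat \<Rightarrow> nat \<Rightarrow> 'a::field"
  assumes T: "finite T" "8 * m + 9 \<le> card T" and s: "null_system T X m z w"
    and max: "\<not> (\<exists>z w. null_system T X (Suc m) z w)"
  shows "\<exists>\<mu>. factor_rank T m (\<lambda>i j. X i j - (if i = j then \<mu> else 0))"
proof -
  let ?A = "mapply T X" and ?d = "dot T"
  let ?At = "mapply T (\<lambda>i j. X j i)"
  have adj: "?d \<phi> (?A v) = ?d (?At \<phi>) v" for \<phi> v
    unfolding dot_def mapply_def sum_distrib_left sum_distrib_right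
    by (subst sum.swap) (simp add: mult_ac)
  have Alin: "?A (\<lambda>i. u i + v i) = (\<lambda>i. ?A u i + ?A v i)" "?A (\<lambda>i. u i - v i) = (\<lambda>i. ?A u i - ?A v i)"
    "?A (\<lambda>i. c * u i) = (\<lambda>i. c * ?A u i)" "?A (\<lambda>i. \<Sum>j\<in>J. f j i) = (\<lambda>i. \<Sum>j\<in>J. ?A (f j) i)" for u v c f and J :: "nat set"
  proof -
    show "?A (\<lambda>i. \<Sum>j\<in>J. f j i) = (\<lambda>i. \<Sum>j\<in>J. ?A (f j) i)"
      unfolding mapply_def sum_distrib_left by (subst sum.swap) (rule refl)
  qed (auto simp: mapply_def distrib_left right_diff_distrib sum.distrib sum_subtractf sum_distrib_left mult.left_commute)
  define V1 where "V1 v \<longleftrightarrow> (\<forall>i<m. ?d (z i) v = 0 \<and> ?d (z i) (?A v) = 0)" for v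
  define F1 where "F1 \<phi> \<longleftrightarrow> (\<forall>i<m. ?d \<phi> (w i) = 0 \<and> ?d \<phi> (?A (w i)) = 0)" for \<phi>
  have key: "?d \<phi> (?A v) = 0" if "V1 v" "F1 \<phi>" "?d \<phi> v = 0" for v \<phi>
  proof (rule ccontr)
    assume "?d \<phi> (?A v) \<noteq> 0"
    with that have "\<exists>z w. null_system T X (Suc m) z w"
      by (intro null_system_extend[OF s, of v \<phi>]) (simp_all add: V1_def F1_def)
    with max show False by (rule notE)
  qed
  define hs where "hs = map z [0..<m] @ map (\<lambda>i. ?At (z i)) [0..<m]"
  define ys where "ys = map w [0..<m] @ map (\<lambda>i. ?A (w i)) [0..<m]"
  have V1h: "V1 v" if "\<forall>h\<in>set hs. ?d h v = 0" for v using that by (auto simp: V1_def hs_def adj)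
  have F1y: "F1 v" if "\<forall>y\<in>set ys. ?d v y = 0" for v using that by (auto simp: F1_def ys_def)
  have len: "length hs = 2 * m" "length ys = 2 * m" by (auto simp: hs_def ys_def)
  obtain p q where pq: "V1 p" "F1 q" "?d q p = 1"
    using dual_pair[OF T(1), of ys hs] V1h F1y T len by auto
  define \<mu> where "\<mu> = ?d q (?A p)"
  have scal: "?d \<phi> (?A v) = \<mu> * ?d \<phi> v" if v: "V1 v" and \<phi>: "F1 \<phi>" for v \<phi>
  proof -
    \<comment> \<open>A pair orthogonal to both (\<phi>, v) and (q, p), also through
      \<open>X\<close>. Comparing each of the two with it shows that they share one scalar, whether
      or not \<phi> and \<open>v\<close> are orthogonal.\<close>
    obtain p' q' where h: "\<forall>h\<in>set (hs @ [\<phi>, ?At \<phi>, q, ?At q]). ?d h p' = 0"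
      and y: "\<forall>y\<in>set (ys @ [v, ?A v, p, ?A p]). ?d q' y = 0" and 1: "?d q' p' = 1"
      using dual_pair[OF T(1), of "ys @ [v, ?A v, p, ?A p]" "hs @ [\<phi>, ?At \<phi>, q, ?At q]"] T len by auto
    have p': "V1 p'" "?d \<phi> p' = 0" "?d \<phi> (?A p') = 0" "?d q p' = 0" "?d q (?A p') = 0"
      using h V1h by (auto simp: adj)
    have q': "F1 q'" "?d q' v = 0" "?d q' (?A v) = 0" "?d q' p = 0" "?d q' (?A p) = 0"
      using y F1y by auto
    have gen: "?d \<psi> (?A u) = ?d \<psi> u * ?d q' (?A p')" if "V1 u" "F1 \<psi>" "?d \<psi> p' = 0" "?d \<psi> (?A p') = 0" "?d q' u = 0" "?d q' (?A u) = 0" for \<psi> u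
    proof -
      have "?d (\<lambda>i. \<psi> i + q' i) (?A (\<lambda>i. u i - ?d \<psi> u * p' i)) = 0"
        by (rule key) (use that p' q' 1 in \<open>auto simp: V1_def F1_def Alin dot_lin\<close>)
      then show ?thesis using that by (simp add: Alin dot_lin)
    qed
    have "?d q (?A p) = ?d q' (?A p')" using gen[OF pq(1,2)] p' q' pq(3) by simp
    moreover have "?d \<phi> (?A v) = ?d \<phi> v * ?d q' (?A p')" using gen[OF v \<phi>] p' q' by simp
    ultimately show ?thesis by (simp add: \<mu>_def)
  qed
  define B where "B \<phi> v = ?d \<phi> (?A v) - \<mu> * ?d \<phi> v" for \<phi> v
  have Blin: "B (\<lambda>i. u i + v i) x = B u x + B v x" "B x (\<lambda>i. u i + v i) = B x u + B x v"
    "B (\<lambda>i. u i - v i) x = B u x - B v x" "B x (\<lambda>i. u i - v i) = B x u - B x v"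
    "B (\<lambda>i. c * u i) x = c * B u x" "B x (\<lambda>i. c * u i) = c * B x u" 
    "B (\<lambda>i. \<Sum>j\<in>J. f j i) x = (\<Sum>j\<in>J. B (f j) x)" "B x (\<lambda>i. \<Sum>j\<in>J. f j i) = (\<Sum>j\<in>J. B x (f j))"
    for u v x c f and J :: "nat set"
    by (auto simp: B_def Alin dot_lin algebra_simps sum_subtractf sum_distrib_left)
  have Bs: "?d (z i) (w j) = 0" "B (z i) (w j) = (if i = j then 1 else 0)" if "i < m" "j < m" for i j
    using s that by (auto simp: null_system_def B_def)
  have B0: "B \<phi> v = 0" if vV: "\<forall>i<m. B (z i) v = 0" and pF: "\<forall>i<m. B \<phi> (w i) = 0" for v \<phi>
  proof (rule ccontr)
    assume nz: "B \<phi> v \<noteq> 0"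
    \<comment> \<open>The first \<open>m\<close> pairs repair the products of \<open>v\<close> with
      the \<open>z i\<close>, the next \<open>m\<close> those of \<phi> with the \<open>w i\<close>,
      and the last one the product of \<phi> and \<open>v\<close>. Since \<open>X - \<mu>\<close>
      vanishes between the auxiliary vectors, the repairs leave \<open>B\<close> unchanged, and the
      repaired data would extend the repaired system.\<close>
    let ?M = "2 * m + 1"
    obtain p q where h: "\<forall>a<?M. \<forall>h\<in>set (hs @ [\<phi>, ?At \<phi>]). ?d h (p a) = 0"
      and y: "\<forall>a<?M. \<forall>y\<in>set (ys @ [v, ?A v]). ?d (q a) y = 0"
      and du: "\<forall>a<?M. \<forall>b<?M. ?d (q a) (p b) = (if a = b then 1 else 0)"
      using dual_pairs[OF T(1), of "ys @ [v, ?A v]" "hs @ [\<phi>, ?At \<phi>]" ?M] T len by auto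
    have p: "V1 (p a)" "?d \<phi> (p a) = 0" "B \<phi> (p a) = 0" if "a < ?M" for a
      using h V1h that by (auto simp: adj B_def)
    have q: "F1 (q a)" "?d (q a) v = 0" "B (q a) v = 0" if "a < ?M" for a
      using y F1y that by (auto simp: B_def)
    have zp: "?d (z i) (p a) = 0" "B (z i) (p a) = 0" "?d (q a) (w i) = 0" "B (q a) (w i) = 0" if "i < m" "a < ?M" for i a
      using p(1)[of a] q(1)[of a] that by (auto simp: V1_def F1_def B_def)
    have qp: "B (q a) (p b) = 0" if "a < ?M" "b < ?M" for a b
      using scal[OF p(1) q(1)] that by (simp add: B_def)
    define z' where "z' i k = z i k + q i k" for i k
    define w' where "w' i k = w i k + p (m + i) k" for i k
    define v' where "v' k = (v k - (\<Sum>j<m. ?d (z j) v * p j k)) - ?d \<phi> v * p (2 * m) k" for k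
    define f' where "f' k = (\<phi> k - (\<Sum>j<m. ?d \<phi> (w j) * q (m + j) k)) + q (2 * m) k" for k
    have unf: "z' i = (\<lambda>k. z i k + q i k)" "w' i = (\<lambda>k. w i k + p (m + i) k)"
      "v' = (\<lambda>k. (v k - (\<Sum>j<m. ?d (z j) v * p j k)) - ?d \<phi> v * p (2 * m) k)"
      "f' = (\<lambda>k. (\<phi> k - (\<Sum>j<m. ?d \<phi> (w j) * q (m + j) k)) + q (2 * m) k)" for i
      by (auto simp: z'_def w'_def v'_def f'_def)
    note R = unf dot_lin Blin
    have zw: "?d (z' i) (w' j) = 0" "B (z' i) (w' j) = (if i = j then 1 else 0)" if "i < m" "j < m" for i j
      using that by (simp_all add: R Bs zp qp du)
    have zv: "?d (z' i) v' = 0" "B (z' i) v' = 0" if "i < m" for i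
      using that by (simp_all add: R Bs zp qp du vV q if_distrib[of "(*) _"] sum_delta_if cong: if_cong)
    have fw: "?d f' (w' i) = 0" "B f' (w' i) = 0" if "i < m" for i
      using that by (simp_all add: R Bs zp qp du pF p if_distrib[of "(*) _"] sum_delta_if cong: if_cong)
    have fv: "?d f' v' = 0" "B f' v' = B \<phi> v"
      by (simp_all add: R zp qp du p q if_distrib[of "(*) _"] sum_delta_if cong: if_cong)
    have s': "null_system T X m z' w'"
      using zw by (auto simp: null_system_def B_def)
    show False
      using null_system_extend[OF s', of v' f'] max zv fw fv nz by (auto simp: B_def)
  qed
  \<comment> \<open>Subtracting what the system sees of \<phi> and \<open>x\<close> leaves arguments
    covered by \<open>B0\<close>. Thus \<open>B\<close> is a sum of \<open>m\<close> products, which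
    is a factorisation of \<open>X - \<mu>\<close>.\<close>
  have expand: "B \<phi> x = (\<Sum>l<m. B \<phi> (w l) * B (z l) x)" for \<phi> x
  proof -
    define x' where "x' = (\<lambda>k. x k - (\<Sum>l<m. B (z l) x * w l k))"
    define f' where "f' = (\<lambda>k. \<phi> k - (\<Sum>l<m. B \<phi> (w l) * z l k))"
    have x0: "\<forall>i<m. B (z i) x' = 0"
      by (simp add: x'_def Blin Bs if_distrib[of "(*) _"] sum_delta_if cong: if_cong)
    have "\<forall>i<m. B f' (w i) = 0"
      by (simp add: f'_def Blin Bs if_distrib[of "(*) _"] sum_delta_if cong: if_cong)
    with x0 have "B f' x' = 0" by (rule B0)
    then have "B \<phi> x' = 0" using x0 by (simp add: f'_def Blin)
    then have "B \<phi> x = (\<Sum>l<m. B (z l) x * B \<phi> (w l))" by (simp add: x'_def Blin)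
    then show ?thesis by (simp add: mult.commute)
  qed
  define e where "e a i = (if i = a then 1 else 0 :: 'a)" for a i :: nat
  have "X i j - (if i = j then \<mu> else 0) = (\<Sum>l<m. B (e i) (w l) * B (z l) (e j))" if "i \<in> T" "j \<in> T" for i j
  proof -
    have d: "?d (e a) u = u a" if "a \<in> T" for a u
      using that T(1) by (simp add: dot_def e_def if_distrib[of "\<lambda>x. x * _"] cong: if_cong)
    have A: "?A (e b) = (\<lambda>i. X i b)" if "b \<in> T" for b
      using that T(1) by (simp add: fun_eq_iff mapply_def e_def if_distrib[of "(*) _"] cong: if_cong)
    have "B (e i) (e j) = X i j - (if i = j then \<mu> else 0)"
      using that by (simp add: B_def d A) (simp add: e_def)
    then show ?thesis using expand[of "e i" "e j"] by simp
  qed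
  then have "\<forall>i\<in>T. \<forall>j\<in>T. X i j - (if i = j then \<mu> else 0) = (\<Sum>l<m. B (e i) (w l) * B (z l) (e j))"
    by blast
  then have "factor_rank T m (\<lambda>i j. X i j - (if i = j then \<mu> else 0))"
    unfolding factor_rank_def by (intro exI[of _ "\<lambda>i l. B (e i) (w l)"] exI[of _ "\<lambda>l j. B (z l) (e j)"])
  then show ?thesis by (rule exI)
qed

lemma null_system_exists:
  fixes X :: "nat \<Rightarrow> nat \<Rightarrow> 'a::field"
  assumes T: "finite T" "8 * k + 9 \<le> card T"
    and r: "\<And>m. m < k \<Longrightarrow> \<not> (\<exists>\<mu>. factor_rank T m (\<lambda>i j. X i j - (if i = j then \<mu> else 0)))"
  shows "m \<le> k \<Longrightarrow> \<exists>z w. null_system T X m z w"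
proof (induction m)
  case 0
  then show ?case by (auto simp: null_system_def)
next
  case (Suc m)
  then obtain z w where s: "null_system T X m z w" by auto
  have "8 * m + 9 \<le> card T" using T(2) Suc.prems by linarith
  show ?case
  proof (rule ccontr)
    assume "\<not> (\<exists>z w. null_system T X (Suc m) z w)"
    then have ex: "\<exists>\<mu>. factor_rank T m (\<lambda>i j. X i j - (if i = j then \<mu> else 0))"
      by (rule null_system_or_low_rank[OF T(1) \<open>8 * m + 9 \<le> card T\<close> s])
    have "m < k" using Suc.prems by simp
    from r[OF this]  ex show False by (rule notE)
  qed
qed

section \<open>Pairs of bilinear forms of opposite symmetry\<close>

text \<open>The flag \<open>sy\<close> selects between the dot product and the standard symplectic form with 2 by 2
  blocks: the only basis vector not orthogonal to the \<open>i\<close>-th one is the one with index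
  \<open>dual_index sy i\<close>, and the value of the form on the two is \<open>dual_sign sy i\<close>.\<close>

definition dual_index :: "bool \<Rightarrow> nat \<Rightarrow> nat" where
  "dual_index sy i = (if sy then (if even i then i + 1 else i - 1) else i)"

definition dual_sign :: "bool \<Rightarrow> nat \<Rightarrow> 'a::comm_ring_1" where
  "dual_sign sy i = (if sy \<and> odd i then - 1 else 1)"

definition form_sign :: "bool \<Rightarrow> 'a::comm_ring_1" where
  "form_sign sy = (if sy then - 1 else 1)"

lemma dual_index_dual_index [simp]: "dual_index sy (dual_index sy i) = i"
  by (auto simp: dual_index_def)

lemma dual_sign_dual_index: "dual_sign sy (dual_index sy i) = form_sign sy * dual_sign sy i"
  by (auto simp: dual_index_def dual_sign_def form_sign_def)

lemma dual_sign_dual_sign [simp]: "dual_sign sy i * dual_sign sy i = 1" "dual_sign sy i * (dual_sign sy i * x) = x"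
  by (auto simp: dual_sign_def)

lemma form_sign_form_sign [simp]: "form_sign sy * form_sign sy = 1" "form_sign sy * (form_sign sy * x) = x"
  by (auto simp: form_sign_def)

lemma form_sign_not: "form_sign (\<not> sy) = - form_sign sy"
  by (auto simp: form_sign_def)

lemma dual_index_less: "(sy \<Longrightarrow> even n) \<Longrightarrow> dual_index sy i < n \<longleftrightarrow> i < n"
  by (auto simp: dual_index_def) presburger+

lemma sqrt_exists:
  fixes c :: "'a::alg_closed_field" shows "\<exists>r. r * r = c"
  using nth_root_exists[of 2 c] by (auto simp: power2_eq_square)

section \<open>A single symmetric or skew form and its standard systems\<close>

locale eps_form =
  fixes b :: "(nat \<Rightarrow> 'a::{alg_closed_field, field_char_0}) \<Rightarrow> (nat \<Rightarrow> 'a) \<Rightarrow> 'a" and sy :: bool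
  assumes add_l: "b (\<lambda>k. u k + v k) w = b u w + b v w"
    and scale_l: "b (\<lambda>k. c * u k) w = c * b u w"
    and sym: "b v u = form_sign sy * b u v"
begin

lemma add_r: "b w (\<lambda>k. u k + v k) = b w u + b w v"
proof -
  have "b w (\<lambda>k. u k + v k) = form_sign sy * (b u w + b v w)" using sym[of w "\<lambda>k. u k + v k"] by (simp add: add_l)
  then show ?thesis using sym[of w u] sym[of w v] by (simp add: distrib_left)
qed

lemma scale_r: "b w (\<lambda>k. c * u k) = c * b w u"
proof -
  have "b w (\<lambda>k. c * u k) = form_sign sy * (c * b u w)" using sym[of w "\<lambda>k. c * u k"] by (simp add: scale_l)
  then show ?thesis using sym[of w u] by simp
qed

lemma minus_l: "b (\<lambda>k. u k - v k) w = b u w - b v w"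
  using add_l[of "\<lambda>k. u k - v k" v w] by simp

lemma minus_r: "b w (\<lambda>k. u k - v k) = b w u - b w v"
  using add_r[of w "\<lambda>k. u k - v k" v] by simp

lemma zero_l: "b (\<lambda>k. 0) w = 0"
  using scale_l[of 0 "\<lambda>k. 0" w] by simp

lemma zero_r: "b w (\<lambda>k. 0) = 0"
  using scale_r[of w 0 "\<lambda>k. 0"] by simp

lemma sum_l: "b (\<lambda>k. \<Sum>j\<in>J. f j k) w = (\<Sum>j\<in>J. b (f j) w)"
proof (induction J rule: infinite_finite_induct)
  case (insert j J)
  have "b (\<lambda>k. f j k + (\<Sum>j\<in>J. f j k)) w = b (f j) w + b (\<lambda>k. \<Sum>j\<in>J. f j k) w" by (rule add_l)
  with insert show ?case by simp
qed (auto simp: zero_l)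

lemma sum_r: "b w (\<lambda>k. \<Sum>j\<in>J. f j k) = (\<Sum>j\<in>J. b w (f j))"
proof (induction J rule: infinite_finite_induct)
  case (insert j J)
  have "b w (\<lambda>k. f j k + (\<Sum>j\<in>J. f j k)) = b w (f j) + b w (\<lambda>k. \<Sum>j\<in>J. f j k)" by (rule add_r)
  with insert show ?case by simp
qed (auto simp: zero_r)

lemmas bilin = add_l add_r scale_l scale_r minus_l minus_r sum_l sum_r

lemma zero_sym: "b u v = 0 \<Longrightarrow> b v u = 0"
  by (simp add: sym[of v u])

lemma skew_self: "sy \<Longrightarrow> b u u = 0"
  using sym[of u u] by (simp add: form_sign_def)

text \<open>Polarisation: if \<open>u\<close>, \<open>v\<close> and \<open>u + v\<close> were
  isotropic, twice the product of \<open>u\<close> and \<open>v\<close> would be 0.\<close>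

lemma nonisotropic:
  assumes "\<not> sy" "b u v \<noteq> 0"
  shows "\<exists>c d. b (\<lambda>k. c * u k + d * v k) (\<lambda>k. c * u k + d * v k) \<noteq> 0"
proof (rule ccontr)
  assume "\<not> ?thesis"
  then have z: "\<forall>c d. b (\<lambda>k. c * u k + d * v k) (\<lambda>k. c * u k + d * v k) = 0" by simp
  have "b v u = b u v" using assms sym[of v u] by (simp add: form_sign_def)
  then show False using assms(2) z[rule_format, of 1 1] z[rule_format, of 1 0] z[rule_format, of 0 1]
    by (simp add: bilin)
qed

text \<open>The Gram matrix is the identity for a symmetric form and a sum of hyperbolic planes for
  a skew one.\<close>

definition stdsys :: "nat \<Rightarrow> (nat \<Rightarrow> nat \<Rightarrow> 'a) \<Rightarrow> bool" where
  "stdsys m w \<longleftrightarrow> (sy \<longrightarrow> even m) \<and>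
     (\<forall>i<m. \<forall>j<m. b (w i) (w j) = (if j = dual_index sy i then dual_sign sy i else 0))"

lemma stdsysD: "stdsys m w \<Longrightarrow> sy \<Longrightarrow> even m"
  "stdsys m w \<Longrightarrow> i < m \<Longrightarrow> j < m \<Longrightarrow> b (w i) (w j) = (if j = dual_index sy i then dual_sign sy i else 0)"
  "stdsys m w \<Longrightarrow> dual_index sy i < m \<longleftrightarrow> i < m"
proof -
  show *: "stdsys m w \<Longrightarrow> sy \<Longrightarrow> even m" unfolding stdsys_def by blast
  show "stdsys m w \<Longrightarrow> i < m \<Longrightarrow> j < m \<Longrightarrow> b (w i) (w j) = (if j = dual_index sy i then dual_sign sy i else 0)"
    unfolding stdsys_def by blast
  show "stdsys m w \<Longrightarrow> dual_index sy i < m \<longleftrightarrow> i < m" by (rule dual_index_less) (rule *)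
qed

text \<open>Coefficients of the orthogonal projection to the span of the system: up to sign, the
  vector dual to \<open>w a\<close> is \<open>w (dual_index sy a)\<close>.\<close>

definition coef :: "(nat \<Rightarrow> nat \<Rightarrow> 'a) \<Rightarrow> (nat \<Rightarrow> 'a) \<Rightarrow> nat \<Rightarrow> 'a" where
  "coef w x a = dual_sign sy a * b x (w (dual_index sy a))"

lemma residual:
  assumes w: "stdsys m w" and j: "j < m"
  shows "b (\<lambda>k. x k - (\<Sum>a<m. coef w x a * w a k)) (w j) = 0"
proof -
  note l = stdsysD(3)[OF w]
  have "(\<Sum>a<m. coef w x a * b (w a) (w j)) = (\<Sum>a<m. if a = dual_index sy j then coef w x a * dual_sign sy a else 0)"
    using j by (intro sum.cong) (auto simp: stdsysD(2)[OF w])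
  also have "\<dots> = coef w x (dual_index sy j) * dual_sign sy (dual_index sy j)" using j l by simp
  also have "\<dots> = b x (w j)" by (simp add: coef_def mult_ac)
  finally show ?thesis by (simp add: bilin)
qed

text \<open>Subtracting the projections moves both arguments into the orthogonal complement of the
  system, where the form is assumed to vanish; only the projections contribute.\<close>

lemma expand:
  assumes w: "stdsys m w"
    and z: "\<And>x y. \<forall>j<m. b x (w j) = 0 \<Longrightarrow> \<forall>j<m. b y (w j) = 0 \<Longrightarrow> b x y = 0"
  shows "b x y = (\<Sum>a<m. coef w x a * b (w a) y)" "b x y = (\<Sum>a<m. dual_sign sy a * coef w x a * coef w y (dual_index sy a))"
proof -
  define x' where "x' = (\<lambda>k. x k - (\<Sum>a<m. coef w x a * w a k))"
  define y' where "y' = (\<lambda>k. y k - (\<Sum>a<m. coef w y a * w a k))"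
  have x0: "\<forall>j<m. b x' (w j) = 0" and y0: "\<forall>j<m. b y' (w j) = 0"
    using residual[OF w] by (auto simp: x'_def y'_def)
  have "b x' y' = 0" using x0 y0 by (rule z)
  then have "b x' y = 0" using x0 by (simp add: y'_def bilin)
  then show 1: "b x y = (\<Sum>a<m. coef w x a * b (w a) y)" by (simp add: x'_def bilin)
  have "dual_sign sy a * coef w y (dual_index sy a) = (dual_sign sy a * dual_sign sy a) * (form_sign sy * b y (w a))" for a
    by (simp add: coef_def dual_sign_dual_index)
  then have "b (w a) y = dual_sign sy a * coef w y (dual_index sy a)" for a
    using sym[of "w a" y] by simp
  then show "b x y = (\<Sum>a<m. dual_sign sy a * coef w x a * coef w y (dual_index sy a))"
    unfolding 1 by (simp add: mult_ac)
qed

lemma stdsys_extend_sym: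
  assumes w: "stdsys m w" and v: "\<not> sy" "b v v \<noteq> 0" "\<forall>j<m. b v (w j) = 0"
  shows "\<exists>c. stdsys (Suc m) (w(m := (\<lambda>k. c * v k)))"
proof -
  obtain c where c: "c * c = inverse (b v v)" using sqrt_exists by blast
  have "b (w j) v = 0" if "j < m" for j using v(3) that zero_sym by blast
  moreover have "c * (c * b v v) = 1" using c v(2) by (simp add: mult.assoc[symmetric])
  ultimately have "stdsys (Suc m) (w(m := (\<lambda>k. c * v k)))"
    using stdsysD(2)[OF w] v unfolding stdsys_def by (simp add: less_Suc_eq bilin dual_index_def dual_sign_def)
  then show ?thesis by (rule exI[of _ c])
qed

lemma stdsys_extend_skew:
  assumes w: "stdsys m w" and v: "sy" "b u v \<noteq> 0" "\<forall>j<m. b u (w j) = 0" "\<forall>j<m. b v (w j) = 0"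
  shows "\<exists>c. stdsys (Suc (Suc m)) (w(m := u, Suc m := (\<lambda>k. c * v k)))"
proof -
  have u0: "b (w j) u = 0" "b (w j) v = 0" if "j < m" for j using v(3,4) that zero_sym by blast+
  have s: "b u u = 0" "b v v = 0" "b v u = - b u v" using skew_self[OF v(1)] sym[of v u] v(1) by (auto simp: form_sign_def)
  have ev: "even m" using stdsysD(1)[OF w v(1)] .
  have bm: "dual_index sy m = Suc m" "dual_index sy (Suc m) = m" using ev v(1) by (auto simp: dual_index_def)
  have bl: "dual_index sy j < m" if "j < m" for j using that dual_index_less[of sy m j] ev by auto
  have bne: "m \<noteq> dual_index sy j" "Suc m \<noteq> dual_index sy j" if "j < m" for j using bl[OF that] by auto
  have bne2: "j \<noteq> dual_index sy m" "j \<noteq> dual_index sy (Suc m)" if "j < m" for j using that by (auto simp: bm)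
  have sgm: "dual_sign sy m = 1" "dual_sign sy (Suc m) = (-1 :: 'a)" using ev v(1) by (auto simp: dual_sign_def)
  have "stdsys (Suc (Suc m)) (w(m := u, Suc m := (\<lambda>k. inverse (b u v) * v k)))"
    unfolding stdsys_def
  proof (intro conjI allI impI)
    fix i j assume "i < Suc (Suc m)" "j < Suc (Suc m)"
    then have "i < m \<or> i = m \<or> i = Suc m" "j < m \<or> j = m \<or> j = Suc m" by auto
    then show "b ((w(m := u, Suc m := (\<lambda>k. inverse (b u v) * v k))) i) ((w(m := u, Suc m := (\<lambda>k. inverse (b u v) * v k))) j)
      = (if j = dual_index sy i then dual_sign sy i else 0)"
      by (elim disjE) (simp_all add: bilin stdsysD(2)[OF w] v(2) v(3,4)[rule_format] u0 s bm bne bne2 sgm)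
  qed (use ev in auto)
  then show ?thesis by (rule exI[of _ "inverse (b u v)"])
qed

text \<open>If \<open>m\<close> exceeded \<open>k\<close>, some nontrivial combination of the
  \<open>w i\<close> would be killed by all \<beta> and so be orthogonal to the whole system,
  although its Gram matrix is invertible.\<close>

lemma stdsys_bounded:
  assumes w: "stdsys m w" and f: "\<And>x y. b x y = (\<Sum>l<k. \<alpha> l x * \<beta> l y)"
  shows "m \<le> k"
proof (rule ccontr)
  assume "\<not> m \<le> k"
  then have "k < card {..<m}" by simp
  from homogeneous_system[OF finite_lessThan this, of "\<lambda>l i. \<beta> l (w i)"]
  obtain c where c: "\<exists>i\<in>{..<m}. c i \<noteq> 0" "\<forall>l<k. (\<Sum>i<m. \<beta> l (w i) * c i) = 0"
    by (elim exE conjE)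
  note l = stdsysD(3)[OF w]
  have "c i = 0" if i: "i < m" for i
  proof -
    have "(\<Sum>j<m. c j * b (w (dual_index sy i)) (w j)) = (\<Sum>j<m. if j = i then c j * dual_sign sy (dual_index sy i) else 0)"
      using i l by (intro sum.cong) (auto simp: stdsysD(2)[OF w])
    also have "\<dots> = c i * dual_sign sy (dual_index sy i)" using i by simp
    finally have "c i * dual_sign sy (dual_index sy i) = (\<Sum>j<m. \<Sum>l<k. \<alpha> l (w (dual_index sy i)) * (\<beta> l (w j) * c j))"
      by (simp add: f sum_distrib_left mult_ac)
    also have "\<dots> = (\<Sum>l<k. \<alpha> l (w (dual_index sy i)) * (\<Sum>j<m. \<beta> l (w j) * c j))"
      by (subst sum.swap) (simp add: sum_distrib_left)
    also have "\<dots> = 0" using c by simp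
    finally show ?thesis by (auto simp: dual_sign_def split: if_splits)
  qed
  then show False using c by auto
qed

text \<open>The classification of forms of finite rank over an algebraically closed field, in the
  coordinates \<gamma>. On the complement of a standard system of greatest size the form vanishes,
  since otherwise the system could be enlarged by a nonisotropic vector or by a hyperbolic
  plane.\<close>

lemma std_decomp:
  assumes f: "\<And>x y. b x y = (\<Sum>l<k. \<alpha> l x * \<beta> l y)"
  shows "\<exists>m\<le>k. (sy \<longrightarrow> even m) \<and> (\<exists>\<gamma>. \<forall>x y. b x y = (\<Sum>a<m. dual_sign sy a * \<gamma> a x * \<gamma> (dual_index sy a) y))"
proof -
  define P where "P m \<longleftrightarrow> (\<exists>w. stdsys m w)" for m
  have "P 0" by (auto simp: P_def stdsys_def)
  moreover have "m \<le> k" if "P m" for m using that stdsys_bounded[OF _ f] unfolding P_def by (elim exE)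
  ultimately obtain m where m: "P m" and max: "\<And>m'. P m' \<Longrightarrow> m' \<le> m" and mk: "m \<le> k"
    using ex_has_greatest_nat[of P 0 "\<lambda>x. x" "Suc k"] by (metis less_Suc_eq_le)
  then obtain w where w: "stdsys m w" by (auto simp: P_def)
  have "b x y = 0" if x: "\<forall>j<m. b x (w j) = 0" and y: "\<forall>j<m. b y (w j) = 0" for x y
  proof (rule ccontr)
    assume nz: "b x y \<noteq> 0"
    show False
    proof (cases sy)
      case True
      from stdsys_extend_skew[OF w True nz x y]
      obtain c where "stdsys (Suc (Suc m)) (w(m := x, Suc m := (\<lambda>k. c * y k)))" by (elim exE)
      then have "P (Suc (Suc m))" unfolding P_def by (rule exI[of "stdsys (Suc (Suc m))"])
      then show False using max by fastforce
    next
      case False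
      from nonisotropic[OF False nz] obtain c d where cd: "b (\<lambda>k. c * x k + d * y k) (\<lambda>k. c * x k + d * y k) \<noteq> 0" by (elim exE)
      have "\<forall>j<m. b (\<lambda>k. c * x k + d * y k) (w j) = 0" using x y by (simp add: bilin)
      from stdsys_extend_sym[OF w False cd this]
      obtain e where "stdsys (Suc m) (w(m := (\<lambda>k. e * (c * x k + d * y k))))" by (elim exE)
      then have "P (Suc m)" unfolding P_def by (rule exI[of "stdsys (Suc m)"])
      then show False using max by fastforce
    qed
  qed
  then have "\<forall>x y. b x y = (\<Sum>a<m. dual_sign sy a * coef w x a * coef w y (dual_index sy a))"
    using expand(2)[OF w] by simp
  then show ?thesis using mk stdsysD(1)[OF w] by (intro exI[of _ m] conjI exI[of _ "\<lambda>a x. coef w x a"]) simp_all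
qed

end

text \<open>\<open>b0\<close> is the invariant form and \<open>b1\<close> the form of opposite symmetry attached to an element \<open>A\<close> of its
  Lie algebra. The systems sought are isotropic for \<open>b0\<close> and standard for \<open>b1\<close>.\<close>

locale form_pair = b0: eps_form b0 \<sigma> + b1: eps_form b1 "\<not> \<sigma>"
  for b0 b1 :: "(nat \<Rightarrow> 'a::{alg_closed_field, field_char_0}) \<Rightarrow> (nat \<Rightarrow> 'a) \<Rightarrow> 'a" and \<sigma> :: bool +
  fixes A :: "(nat \<Rightarrow> 'a) \<Rightarrow> nat \<Rightarrow> 'a" and N :: nat
  assumes b1_b0: "b1 u v = b0 (A u) v"
    and dual: "length ys \<le> N \<Longrightarrow> \<exists>p q. (\<forall>y\<in>set ys. b0 y p = 0 \<and> b0 y q = 0) \<and> b0 p q = 1"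
begin

lemma norm_vector:
  assumes "\<not> \<sigma>" "length ys \<le> N"
  shows "\<exists>e. (\<forall>y\<in>set ys. b0 y e = 0) \<and> b0 e e = c"
proof -
  from dual[OF assms(2)] obtain p q where y: "\<forall>y\<in>set ys. b0 y p = 0 \<and> b0 y q = 0" and 1: "b0 p q = 1" by (elim exE conjE)
  then have "b0 p q \<noteq> 0" by simp
  from b0.nonisotropic[OF assms(1) this] obtain s t where nz: "b0 (\<lambda>k. s * p k + t * q k) (\<lambda>k. s * p k + t * q k) \<noteq> 0"
    by (elim exE)
  define f where "f = (\<lambda>k. s * p k + t * q k)"
  obtain r where r: "r * r = c / b0 f f" using sqrt_exists by blast
  have "r * (r * b0 f f) = c" using r nz by (simp add: f_def mult.assoc[symmetric])
  then have "b0 (\<lambda>k. r * f k) (\<lambda>k. r * f k) = c" by (simp add: b0.bilin)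
  moreover have "\<forall>y\<in>set ys. b0 y (\<lambda>k. r * f k) = 0" using y by (simp add: b0.bilin f_def)
  ultimately show ?thesis by (intro exI[of _ "\<lambda>k. r * f k"] conjI)
qed

text \<open>For a symmetric form, two orthogonal vectors of norms 1 and -1 span a hyperbolic plane.
  Choosing the second orthogonal to the first is the one additional condition.\<close>

lemma hyperbolic_pair:
  assumes "length ys + 1 \<le> N"
  shows "\<exists>p q. (\<forall>y\<in>set ys. b0 y p = 0 \<and> b0 y q = 0) \<and> b0 p q = 1 \<and> b0 p p = 0 \<and> b0 q q = 0"
proof (cases \<sigma>)
  case True
  have "length ys \<le> N" using assms by simp
  from dual[OF this] obtain p q where "\<forall>y\<in>set ys. b0 y p = 0 \<and> b0 y q = 0" "b0 p q = 1" by (elim exE conjE)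
  then show ?thesis using b0.skew_self[OF True] by (intro exI[of _ p] exI[of _ q]) simp
next
  case False
  from norm_vector[OF False, of ys 1] assms obtain e where e: "\<forall>y\<in>set ys. b0 y e = 0" "b0 e e = 1" by (auto elim!: exE)
  from norm_vector[OF False, of "e # ys" "- 1"] assms obtain f where f: "\<forall>y\<in>set (e # ys). b0 y f = 0" "b0 f f = - 1" by (auto elim!: exE)
  have ef: "b0 e f = 0" "b0 f e = 0" using f b0.zero_sym[of e f] by auto
  define p where "p = (\<lambda>k. e k + f k)"
  obtain h where h: "h + h = (1::'a)" by (rule that[of "1 / 2"]) simp
  define q where "q = (\<lambda>k. h * (e k - f k))"
  have "b0 p p = 0" "b0 q q = 0" "b0 p q = 1"
    using ef e f h by (simp_all add: p_def q_def b0.add_l b0.add_r b0.scale_l b0.scale_r b0.minus_l b0.minus_r)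
  moreover have "\<forall>y\<in>set ys. b0 y p = 0 \<and> b0 y q = 0"
    using e f by (auto simp: p_def q_def b0.add_r b0.scale_r b0.minus_r)
  ultimately show ?thesis by (intro exI[of _ p] exI[of _ q]) simp
qed

text \<open>Nothing is asked of \<open>b1 (p a) (q a)\<close>: orthogonality for \<open>b1\<close>
  is imposed through images under \<open>A\<close>, hence only against vectors chosen
  before.\<close>

definition hpairs :: "(nat \<Rightarrow> 'a) list \<Rightarrow> nat \<Rightarrow> (nat \<Rightarrow> nat \<Rightarrow> 'a) \<Rightarrow> (nat \<Rightarrow> nat \<Rightarrow> 'a) \<Rightarrow> bool" where
  "hpairs ys M p q \<longleftrightarrow> (\<forall>a<M. (\<forall>y\<in>set ys. b0 y (p a) = 0 \<and> b0 y (q a) = 0)) \<and>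
     (\<forall>a<M. \<forall>c<M. b0 (p a) (p c) = 0 \<and> b0 (q a) (q c) = 0 \<and>
        b0 (p a) (q c) = (if a = c then 1 else 0) \<and> b0 (q a) (p c) = (if a = c then form_sign \<sigma> else 0)) \<and>
     (\<forall>a<M. \<forall>c<M. a \<noteq> c \<longrightarrow> b1 (p a) (p c) = 0 \<and> b1 (q a) (q c) = 0 \<and> b1 (p a) (q c) = 0)"

text \<open>Each earlier pair contributes four conditions: its two vectors and their images under
  \<open>A\<close>, the latter giving orthogonality for \<open>b1\<close>.\<close>

lemma hyperbolic_pairs: "length ys + 4 * M + 1 \<le> N \<Longrightarrow> \<exists>p q. hpairs ys M p q"
proof (induction M)
  case 0
  then show ?case by (auto simp: hpairs_def)
next
  case (Suc M)
  then obtain p q where pq: "hpairs ys M p q" by auto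
  define L where "L = ys @ map p [0..<M] @ map q [0..<M] @ map (\<lambda>i. A (p i)) [0..<M] @ map (\<lambda>i. A (q i)) [0..<M]"
  have "length L + 1 \<le> N" using Suc.prems by (simp add: L_def)
  from hyperbolic_pair[OF this] obtain x y where xy: "\<forall>z\<in>set L. b0 z x = 0 \<and> b0 z y = 0" "b0 x y = 1" "b0 x x = 0" "b0 y y = 0"
    by (elim exE conjE)
  have o: "b0 (p a) x = 0" "b0 (p a) y = 0" "b0 (q a) x = 0" "b0 (q a) y = 0" 
    "b1 (p a) x = 0" "b1 (p a) y = 0" "b1 (q a) x = 0" "b1 (q a) y = 0" if "a < M" for a
    using xy(1) that by (auto simp: L_def b1_b0)
  have o': "b0 x (p a) = 0" "b0 y (p a) = 0" "b0 x (q a) = 0" "b0 y (q a) = 0" 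
    "b1 x (p a) = 0" "b1 y (p a) = 0" "b1 x (q a) = 0" "b1 y (q a) = 0" if "a < M" for a
    using o[OF that] b0.zero_sym b1.zero_sym by auto
  have yx: "b0 y x = form_sign \<sigma>" using b0.sym[of y x] xy by simp
  have z: "b0 z x = 0" "b0 z y = 0" if "z \<in> set ys" for z using xy(1) that by (auto simp: L_def)
  have "hpairs ys (Suc M) (p(M := x)) (q(M := y))"
    using pq xy(2-) o o' yx z unfolding hpairs_def by (simp add: less_Suc_eq all_conj_distrib)
  then show ?case by (intro exI)
qed

section \<open>Isotropic standard systems of greatest size\<close>

definition isosys :: "nat \<Rightarrow> (nat \<Rightarrow> nat \<Rightarrow> 'a) \<Rightarrow> bool" where
  "isosys m w \<longleftrightarrow> b1.stdsys m w \<and> (\<forall>i<m. \<forall>j<m. b0 (w i) (w j) = 0)"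

text \<open>If \<sigma> holds, \<open>b0\<close> is skew and \<open>b1\<close> symmetric: every
  vector is isotropic for \<open>b0\<close>, and systems grow by one vector. In the opposite case
  \<open>b1\<close> is skew, so two vectors are added at once and their isotropy has to be
  arranged.\<close>

lemma isosys_extend_sp:
  assumes w: "isosys m w" and v: "\<sigma>" "b1 v v \<noteq> 0" "\<forall>j<m. b1 v (w j) = 0" "\<forall>j<m. b0 v (w j) = 0"
  shows "\<exists>m'>m. \<exists>w. isosys m' w"
proof -
  have "b1.stdsys m w" using w unfolding isosys_def by (rule conjunct1)
  moreover have "\<not> \<not> \<sigma>" using v by simp
  ultimately have "\<exists>c. b1.stdsys (Suc m) (w(m := (\<lambda>k. c * v k)))" by (rule b1.stdsys_extend_sym[OF _ _ v(2,3)])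
  then obtain c where c: "b1.stdsys (Suc m) (w(m := (\<lambda>k. c * v k)))" by (elim exE)
  have "b0 v v = 0" "\<forall>j<m. b0 (w j) v = 0" using v b0.skew_self b0.zero_sym by auto
  then have "isosys (Suc m) (w(m := (\<lambda>k. c * v k)))"
    using c w v(4) unfolding isosys_def by (simp add: less_Suc_eq b0.scale_l b0.scale_r)
  then show ?thesis by (intro exI[of _ "Suc m"] conjI exI) simp
qed

lemma isosys_extend_so:
  assumes w: "isosys m w" and v: "\<not> \<sigma>" "b1 u v \<noteq> 0" "\<forall>j<m. b1 u (w j) = 0" "\<forall>j<m. b1 v (w j) = 0"
    "\<forall>j<m. b0 u (w j) = 0" "\<forall>j<m. b0 v (w j) = 0" "b0 u u = 0" "b0 v v = 0" "b0 u v = 0"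
  shows "\<exists>m'>m. \<exists>w. isosys m' w"
proof -
  have "b1.stdsys m w" using w unfolding isosys_def by (rule conjunct1)
  from b1.stdsys_extend_skew[OF this v(1-4)]
  obtain c where c: "b1.stdsys (Suc (Suc m)) (w(m := u, Suc m := (\<lambda>k. c * v k)))" by (elim exE)
  have z: "b0 v u = 0" "\<forall>j<m. b0 (w j) v = 0" "\<forall>j<m. b0 (w j) u = 0" using v b0.zero_sym by auto
  have "isosys (Suc (Suc m)) (w(m := u, Suc m := (\<lambda>k. c * v k)))"
    unfolding isosys_def
  proof (intro conjI c allI impI)
    fix i j assume "i < Suc (Suc m)" "j < Suc (Suc m)"
    then have "i < m \<or> i = m \<or> i = Suc m" "j < m \<or> j = m \<or> j = Suc m" by auto
    then show "b0 ((w(m := u, Suc m := (\<lambda>k. c * v k))) i) ((w(m := u, Suc m := (\<lambda>k. c * v k))) j) = 0"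
      using w z v unfolding isosys_def by (elim disjE) (simp_all add: b0.scale_l b0.scale_r)
  qed
  then show ?thesis by (intro exI[of _ "Suc (Suc m)"] conjI exI) simp
qed

context
  fixes m w assumes w: "isosys m w" and max: "\<not> (\<exists>m'>m. \<exists>w. isosys m' w)"
    and N: "6 * m + 13 \<le> N"
begin

definition perp :: "(nat \<Rightarrow> 'a) \<Rightarrow> bool" where
  "perp x \<longleftrightarrow> (\<forall>i<m. b0 (w i) x = 0 \<and> b1 (w i) x = 0)"

definition base :: "(nat \<Rightarrow> 'a) list" where
  "base = map w [0..<m] @ map (\<lambda>i. A (w i)) [0..<m]"

lemma perp_base: "\<forall>y\<in>set base. b0 y x = 0 \<Longrightarrow> perp x"
  by (auto simp: perp_def base_def b1_b0)

lemma length_base: "length base = 2 * m"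
  by (simp add: base_def)

lemma perp_flip: "perp x \<Longrightarrow> i < m \<Longrightarrow> b0 x (w i) = 0 \<and> b1 x (w i) = 0"
  using b0.zero_sym b1.zero_sym by (auto simp: perp_def)

text \<open>Maximality gives this for arguments that are isotropic and orthogonal for
  \<open>b0\<close>. Auxiliary hyperbolic planes absorb the norms of the arguments
  (\<open>orth\<close>), and one more absorbs their product. If \<open>b0\<close> is skew,
  polarising \<open>b1\<close> is enough.\<close>

lemma perp_zero:
  assumes x: "perp x" and y: "perp y"
  shows "b1 x y = 0"
proof (cases \<sigma>)
  case True
  have sq: "b1 u u = 0" if "perp u" for u
  proof (rule ccontr)
    assume "b1 u u \<noteq> 0"
    then have "\<exists>m'>m. \<exists>w. isosys m' w"
      by (rule isosys_extend_sp[OF w True]) (use perp_flip[OF that] in auto)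
    with max show False by (rule notE)
  qed
  have "perp (\<lambda>k. x k + y k)" using x y by (simp add: perp_def b0.add_r b1.add_r)
  then have "b1 (\<lambda>k. x k + y k) (\<lambda>k. x k + y k) = 0" by (rule sq)
  then have "b1 x y + b1 y x = 0" using sq[OF x] sq[OF y] by (simp add: b1.add_l b1.add_r add.commute)
  moreover have "b1 y x = b1 x y" using b1.sym[of y x] True by (simp add: form_sign_def)
  ultimately show ?thesis by simp
next
  case False
  have iso: "b1 u v = 0" if "perp u" "perp v" "b0 u u = 0" "b0 v v = 0" "b0 u v = 0" for u v
  proof (rule ccontr)
    assume "b1 u v \<noteq> 0"
    then have "\<exists>m'>m. \<exists>w. isosys m' w"
      by (rule isosys_extend_so[OF w False]) (use perp_flip that in auto)
    with max show False by (rule notE)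
  qed
  have e: "form_sign \<sigma> = (1::'a)" using False by (simp add: form_sign_def)
  have orth: "b1 u v = 0" if uv: "perp u" "perp v" "b0 u v = 0" for u v
  proof -
    have "length (base @ [u, v, A u, A v]) + 4 * 2 + 1 \<le> N" using N length_base by simp
    from hyperbolic_pairs[OF this] obtain p q where pq: "hpairs (base @ [u, v, A u, A v]) 2 p q" by (elim exE)
    have pp: "perp (p a)" "perp (q a)" "b0 u (p a) = 0" "b0 u (q a) = 0" "b0 v (p a) = 0" "b0 v (q a) = 0"
      "b1 u (p a) = 0" "b1 u (q a) = 0" "b1 v (p a) = 0" "b1 v (q a) = 0" if "a < 2" for a
      using pq that by (auto simp: hpairs_def b1_b0 intro!: perp_base)
    have pp': "b0 (p a) u = 0" "b0 (q a) u = 0" "b0 (p a) v = 0" "b0 (q a) v = 0"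
      "b1 (p a) u = 0" "b1 (q a) u = 0" "b1 (p a) v = 0" "b1 (q a) v = 0" if "a < 2" for a
      using pp(3-)[OF that] b0.zero_sym b1.zero_sym by auto
    have dd: "b0 (p a) (p c) = 0" "b0 (q a) (q c) = 0" "b0 (p a) (q c) = (if a = c then 1 else 0)" 
      "b0 (q a) (p c) = (if a = c then 1 else 0)" if "a < 2" "c < 2" for a c
      using pq that e by (auto simp: hpairs_def)
    have d1: "b1 (p 0) (p 1) = 0" "b1 (q 0) (q 1) = 0" "b1 (p 0) (q 1) = 0" "b1 (p 1) (q 0) = 0"
      using pq by (auto simp: hpairs_def)
    have d2: "b1 (q 0) (p 1) = 0" using d1(4) b1.zero_sym by blast
    obtain cu where cu: "b0 u u = cu + cu" by (rule that[of "b0 u u / 2"]) simp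
    obtain cv where cv: "b0 v v = cv + cv" by (rule that[of "b0 v v / 2"]) simp
    \<comment> \<open>The vector \<open>p 0 - cu * q 0\<close> has norm \<open>- b0 u u\<close>,
      since \<open>p 0\<close> and \<open>q 0\<close> are isotropic with product 1; so
      \<open>u'\<close> is isotropic.\<close>
    define u' where "u' = (\<lambda>k. u k + (p 0 k - cu * q 0 k))"
    define v' where "v' = (\<lambda>k. v k + (p 1 k - cv * q 1 k))"
    note B = b0.add_l b0.add_r b0.minus_l b0.minus_r b0.scale_l b0.scale_r b1.add_l b1.add_r b1.minus_l b1.minus_r b1.scale_l b1.scale_r
    have "b1 u' v' = 0"
    proof (rule iso)
      show "perp u'" "perp v'" using uv(1,2) pp(1,2)[of 0] pp(1,2)[of 1] by (simp_all add: perp_def u'_def v'_def B)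
      show "b0 u' u' = 0" "b0 v' v' = 0" "b0 u' v' = 0"
        using pp[of 0] pp[of 1] pp'[of 0] pp'[of 1] dd uv(3) cu cv by (simp_all add: u'_def v'_def B)
    qed
    then show ?thesis using pp[of 0] pp[of 1] pp'[of 0] pp'[of 1] d1 d2 by (simp add: u'_def v'_def B)
  qed
  have "length (base @ [x, y, A x, A y]) + 1 \<le> N" using N length_base by simp
  from hyperbolic_pair[OF this] obtain p q where pq: "\<forall>z\<in>set (base @ [x, y, A x, A y]). b0 z p = 0 \<and> b0 z q = 0"
    "b0 p q = 1" "b0 p p = 0" "b0 q q = 0" by (elim exE conjE)
  have pp: "perp p" "perp q" "b0 x p = 0" "b0 x q = 0" "b0 y p = 0" "b0 y q = 0" 
    "b1 x p = 0" "b1 x q = 0" "b1 y p = 0" "b1 y q = 0"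
    using pq(1) by (auto simp: b1_b0 intro!: perp_base)
  have pp': "b0 p x = 0" "b0 q x = 0" "b0 p y = 0" "b0 q y = 0" "b1 p x = 0" "b1 q x = 0" "b1 p y = 0" "b1 q y = 0"
    using pp b0.zero_sym b1.zero_sym by auto
  have qp: "b0 q p = 1" "b1 q p = - b1 p q" using b0.sym[of q p] b1.sym[of q p] pq(2) e False by (auto simp: form_sign_def)
  note B = b0.add_l b0.add_r b0.minus_l b0.minus_r b0.scale_l b0.scale_r b1.add_l b1.add_r b1.minus_l b1.minus_r b1.scale_l b1.scale_r
  \<comment> \<open>\<open>p + q\<close> and \<open>p - q\<close> are orthogonal for
    \<open>b0\<close> although \<open>p\<close> and \<open>q\<close> are not. The resulting
    \<open>b1 p q = 0\<close> removes the term that the final correction of \<open>x\<close> and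
    \<open>y\<close> introduces.\<close>
  have "b1 (\<lambda>k. p k + q k) (\<lambda>k. p k - q k) = 0"
    by (rule orth) (use pp pq qp in \<open>auto simp: perp_def B\<close>)
  then have "b1 p q = 0" using b1.skew_self[of p] b1.skew_self[of q] False qp by (simp add: B)
  moreover have "b1 (\<lambda>k. x k + p k) (\<lambda>k. y k - b0 x y * q k) = 0"
    by (rule orth) (use pp pp' pq x y in \<open>auto simp: perp_def B\<close>)
  ultimately show ?thesis using pp pp' by (simp add: B)
qed

text \<open>Here \<open>x\<close> and \<open>y\<close> are orthogonal to the system for
  \<open>b1\<close> only. The system is moved by vectors \<open>p\<close>, and \<open>x\<close>,
  \<open>y\<close> by combinations of the \<open>q\<close>, so that the products for
  \<open>b0\<close> cancel; \<open>b1\<close> vanishes between these vectors by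
  \<open>perp_zero\<close> and keeps its values. Maximality is then applied to the moved system.
  Besides the \<open>m\<close> pairs for this, two more make \<open>x\<close> and \<open>y\<close>
  isotropic and orthogonal. Together with \<open>2 * m + 4\<close> conditions from the system,
  \<open>x\<close>, \<open>y\<close> and the images under \<open>A\<close>, this is the bound
  \<open>6 * m + 13\<close>.\<close>

lemma isosys_zero:
  assumes x: "\<forall>j<m. b1 x (w j) = 0" and y: "\<forall>j<m. b1 y (w j) = 0"
  shows "b1 x y = 0"
proof (rule ccontr)
  assume nz: "b1 x y \<noteq> 0"
  note B = b0.add_l b0.add_r b0.minus_l b0.minus_r b0.scale_l b0.scale_r b0.sum_l b0.sum_r
    b1.add_l b1.add_r b1.minus_l b1.minus_r b1.scale_l b1.scale_r b1.sum_l b1.sum_r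
  have ww: "b0 (w i) (w j) = 0" "b1 (w i) (w j) = (if j = dual_index (\<not> \<sigma>) i then dual_sign (\<not> \<sigma>) i else 0)" if "i < m" "j < m" for i j
    using w that unfolding isosys_def b1.stdsys_def by simp_all
  have wst: "\<not> \<sigma> \<longrightarrow> even m" using w unfolding isosys_def b1.stdsys_def by blast
  define M where "M = m + 2"
  have "length (base @ [x, y, A x, A y]) + 4 * M + 1 \<le> N" using N length_base by (simp add: M_def)
  from hyperbolic_pairs[OF this] obtain p q where pq: "hpairs (base @ [x, y, A x, A y]) M p q" by (elim exE)
  have pp: "perp (p a)" "perp (q a)" "b0 x (p a) = 0" "b0 x (q a) = 0" "b0 y (p a) = 0" "b0 y (q a) = 0"
    "b1 x (p a) = 0" "b1 x (q a) = 0" "b1 y (p a) = 0" "b1 y (q a) = 0" if "a < M" for a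
    using pq that by (auto simp: hpairs_def b1_b0 intro!: perp_base)
  have pp': "b0 (p a) x = 0" "b0 (q a) x = 0" "b0 (p a) y = 0" "b0 (q a) y = 0"
    "b1 (p a) x = 0" "b1 (q a) x = 0" "b1 (p a) y = 0" "b1 (q a) y = 0" if "a < M" for a
    using pp(3-)[OF that] b0.zero_sym b1.zero_sym by auto
  have pw: "b0 (p a) (w i) = 0" "b1 (p a) (w i) = 0" "b0 (q a) (w i) = 0" "b1 (q a) (w i) = 0"
    "b0 (w i) (p a) = 0" "b1 (w i) (p a) = 0" "b0 (w i) (q a) = 0" "b1 (w i) (q a) = 0" if "a < M" "i < m" for a i
    using perp_flip[OF pp(1)] perp_flip[OF pp(2)] pp(1)[of a] pp(2)[of a] that by (auto simp: perp_def)
  have dd: "b0 (p a) (p c) = 0" "b0 (q a) (q c) = 0" "b0 (p a) (q c) = (if a = c then 1 else 0)" 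
    "b0 (q a) (p c) = (if a = c then form_sign \<sigma> else 0)" if "a < M" "c < M" for a c
    using pq that by (auto simp: hpairs_def)
  have d1: "b1 (p a) (p c) = 0" "b1 (q a) (q c) = 0" "b1 (p a) (q c) = 0" "b1 (q a) (p c) = 0" if "a < M" "c < M" for a c
    using perp_zero pp(1,2) that by auto
  have wx: "b1 (w i) x = 0" "b1 (w i) y = 0" if "i < m" for i using x y that b1.zero_sym by auto
  define w' where "w' i = (\<lambda>k. w i k + p i k)" for i
  define coord where "coord j u = - b0 (w j) u" for j u
  define \<eta> where "\<eta> u = (\<lambda>k. \<Sum>j<m. coord j u * q j k)" for u
  have mM: "i < M" if "i < m" for i using that by (simp add: M_def)
  have M2: "m < M" "Suc m < M" by (auto simp: M_def)
  note ifs = if_distrib[of "(*) _"] sum_delta_if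
  have eta: "b0 (w i) (\<eta> u) = 0" "b0 (p i) (\<eta> u) = coord i u" "b1 (w i) (\<eta> u) = 0" "b1 (p i) (\<eta> u) = 0" if "i < m" for i u
    using that by (simp_all add: \<eta>_def B pw dd d1 mM ifs cong: if_cong)
  have eta2: "b0 (\<eta> u) (\<eta> v) = 0" "b1 (\<eta> u) (\<eta> v) = 0" "b0 x (\<eta> u) = 0" "b0 y (\<eta> u) = 0" "b1 x (\<eta> u) = 0" "b1 y (\<eta> u) = 0" for u v
    by (simp_all add: \<eta>_def B dd d1 mM pp)
  have eta3: "b0 (\<eta> u) x = 0" "b0 (\<eta> u) y = 0" "b1 (\<eta> u) x = 0" "b1 (\<eta> u) y = 0" for u
    using eta2 b0.zero_sym b1.zero_sym by auto
  have eta4: "b0 (p a) (\<eta> u) = 0" "b0 (q a) (\<eta> u) = 0" "b0 (\<eta> u) (p a) = 0" "b0 (\<eta> u) (q a) = 0" 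
    "b1 (p a) (\<eta> u) = 0" "b1 (q a) (\<eta> u) = 0" "b1 (\<eta> u) (p a) = 0" "b1 (\<eta> u) (q a) = 0" if "a = m \<or> a = Suc m" for a u
    using that by (auto simp add: \<eta>_def B dd d1 mM M2)
  have w': "isosys m w'"
    unfolding isosys_def b1.stdsys_def
    using wst by (simp add: w'_def B ww pw dd d1 mM)
  show False
  proof (cases \<sigma>)
    case True
    then have "\<not> \<not> \<sigma>" by simp
    from b1.nonisotropic[OF this nz] obtain c d where nz': "b1 (\<lambda>k. c * x k + d * y k) (\<lambda>k. c * x k + d * y k) \<noteq> 0" by (elim exE)
    define v where "v = (\<lambda>k. c * x k + d * y k)"
    define v' where "v' = (\<lambda>k. v k + \<eta> v k)"
    have v0: "b1 (w i) v = 0" "b0 (p i) v = 0" "b1 (p i) v = 0" if "i < m" for i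
      using that wx pp' mM by (simp_all add: v_def B)
    have ve: "b1 v (\<eta> v) = 0" "b1 (\<eta> v) v = 0" using eta2 eta3 by (simp_all add: v_def B)
    have "\<exists>m'>m. \<exists>w. isosys m' w"
    proof (rule isosys_extend_sp[OF w' True])
      show "b1 v' v' \<noteq> 0" using nz' ve eta2 by (simp add: v'_def B v_def[symmetric])
      have "b1 (w' j) v' = 0" "b0 (w' j) v' = 0" if "j < m" for j
        using that by (simp_all add: w'_def v'_def B v0 eta coord_def)
      then show "\<forall>j<m. b1 v' (w' j) = 0" "\<forall>j<m. b0 v' (w' j) = 0"
        using b0.zero_sym b1.zero_sym by auto
    qed
    with max show False by (rule notE)
  next
    case False
    have e: "form_sign \<sigma> = (1::'a)" using False by (simp add: form_sign_def)
    have byx: "b0 y x = b0 x y" using b0.sym[of y x] e by simp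
    obtain cu where cu: "b0 x x = cu + cu" by (rule that[of "b0 x x / 2"]) simp
    obtain cv where cv: "b0 y y = cv + cv" by (rule that[of "b0 y y / 2"]) simp
    define x' where "x' = (\<lambda>k. (x k + \<eta> x k) + (p m k - cu * q m k))"
    \<comment> \<open>The multiple of \<open>q m\<close> meets \<open>p m\<close> in
      \<open>x'\<close> and cancels the product \<open>b0 x y\<close>.\<close>
    define y' where "y' = (\<lambda>k. (y k + \<eta> y k) + ((p (Suc m) k - cv * q (Suc m) k) - b0 x y * q m k))"
    note P = pp(3-)[OF M2(1)] pp(3-)[OF M2(2)] pp'[OF M2(1)] pp'[OF M2(2)]
    have "\<exists>m'>m. \<exists>w. isosys m' w"
    proof (rule isosys_extend_so[OF w' False])
      show "b1 x' y' \<noteq> 0" using nz by (simp add: x'_def y'_def B P eta2 eta3 eta4 d1 M2)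
      have "b1 (w' j) x' = 0" "b0 (w' j) x' = 0" "b1 (w' j) y' = 0" "b0 (w' j) y' = 0" if "j < m" for j
        using that by (simp_all add: w'_def x'_def y'_def B pw wx pp' mM M2 eta dd d1 coord_def)
      then show "\<forall>j<m. b1 x' (w' j) = 0" "\<forall>j<m. b1 y' (w' j) = 0" "\<forall>j<m. b0 x' (w' j) = 0" "\<forall>j<m. b0 y' (w' j) = 0"
        using b0.zero_sym b1.zero_sym by auto
      show "b0 x' x' = 0" "b0 y' y' = 0" "b0 x' y' = 0"
        by (simp_all add: x'_def y'_def B P eta2 eta3 eta4 dd M2 e byx cu cv)
    qed
    with max show False by (rule notE)
  qed
qed

end

text \<open>By \<open>isosys_zero\<close>, a system of greatest size \<open>m\<close> expands
  \<open>b1\<close> into \<open>m\<close> products, so \<open>m\<close> cannot be below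
  \<open>k\<close>.\<close>

lemma isosys_exists:
  assumes N: "6 * k + 13 \<le> N"
    and r: "\<And>m \<alpha> \<beta>. m < k \<Longrightarrow> \<not> (\<forall>x y. b1 x y = (\<Sum>l<m. \<alpha> l x * \<beta> l y))"
  shows "\<exists>m\<ge>k. \<exists>w. isosys m w"
proof (rule ccontr)
  assume n: "\<not> ?thesis"
  define P where "P m \<longleftrightarrow> (\<exists>w. isosys m w)" for m
  have "P 0" by (auto simp: P_def isosys_def b1.stdsys_def)
  moreover have lt: "m < k" if "P m" for m using n that by (auto simp: P_def not_le[symmetric])
  ultimately obtain m where m: "P m" and mx: "\<And>m'. P m' \<Longrightarrow> m' \<le> m"
    using ex_has_greatest_nat[of P 0 "\<lambda>x. x" k] by blast
  then obtain w where w: "isosys m w" by (auto simp: P_def)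
  have max: "\<not> (\<exists>m'>m. \<exists>w. isosys m' w)" using mx by (auto simp: P_def not_le[symmetric])
  have N': "6 * m + 13 \<le> N" using N lt[OF m] by simp
  have st: "b1.stdsys m w" using w unfolding isosys_def by (rule conjunct1)
  have "\<forall>x y. b1 x y = (\<Sum>l<m. b1.coef w x l * b1 (w l) y)"
    by (intro allI, rule b1.expand(1)[OF st], rule isosys_zero[OF w max N'])
  with r[OF lt[OF m], of "\<lambda>l x. b1.coef w x l" "\<lambda>l y. b1 (w l) y"] show False by (rule notE)
qed

end

section \<open>Evaluation homomorphisms and derivations on symmetric algebras\<close>

locale coeff_hom =
  fixes \<kappa> :: "'a::field \<Rightarrow> 'k::comm_ring_1"
  assumes k_add: "\<kappa> (a + b) = \<kappa> a + \<kappa> b" and k_mult: "\<kappa> (a * b) = \<kappa> a * \<kappa> b" and k_1: "\<kappa> 1 = 1"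
begin

lemma k_0: "\<kappa> 0 = 0"
  using k_add[of 0 0] by simp

lemma k_sum: "\<kappa> (sum f I) = (\<Sum>i\<in>I. \<kappa> (f i))"
  by (induction I rule: infinite_finite_induct) (auto simp: k_0 k_add)

definition mev :: "('x \<Rightarrow> 'k) \<Rightarrow> ('x \<Rightarrow>\<^sub>0 nat) \<Rightarrow> 'k" where
  "mev v m = (\<Prod>x\<in>Poly_Mapping.keys m. v x ^ Poly_Mapping.lookup m x)"

definition ev :: "('x \<Rightarrow> 'k) \<Rightarrow> (('x \<Rightarrow>\<^sub>0 nat) \<Rightarrow>\<^sub>0 'a) \<Rightarrow> 'k" where
  "ev v p = (\<Sum>m\<in>Poly_Mapping.keys p. \<kappa> (Poly_Mapping.lookup p m) * mev v m)"

lemma mev_superset: "finite K \<Longrightarrow> Poly_Mapping.keys m \<subseteq> K \<Longrightarrow> mev v m = (\<Prod>x\<in>K. v x ^ Poly_Mapping.lookup m x)"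
  unfolding mev_def by (intro prod.mono_neutral_left) (auto simp: in_keys_iff)

lemma mev_add: "mev v (m + n) = mev v m * mev v n"
proof -
  let ?K = "Poly_Mapping.keys m \<union> Poly_Mapping.keys n"
  have "Poly_Mapping.keys (m + n) \<subseteq> ?K" by (rule keys_add)
  then show ?thesis
    by (simp add: mev_superset[of ?K] lookup_add power_add prod.distrib)
qed

lemma ev_superset: "finite K \<Longrightarrow> Poly_Mapping.keys p \<subseteq> K \<Longrightarrow> ev v p = (\<Sum>m\<in>K. \<kappa> (Poly_Mapping.lookup p m) * mev v m)"
  unfolding ev_def by (intro sum.mono_neutral_left) (auto simp: in_keys_iff k_0)

lemma ev_add: "ev v (p + q) = ev v p + ev v q"
proof -
  let ?K = "Poly_Mapping.keys p \<union> Poly_Mapping.keys q"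
  have "Poly_Mapping.keys (p + q) \<subseteq> ?K" by (rule keys_add)
  then show ?thesis
    by (simp add: ev_superset[of ?K] lookup_add k_add distrib_right sum.distrib)
qed

lemma ev_0: "ev v 0 = 0"
  by (simp add: ev_def)

lemma ev_sum: "ev v (sum f I) = (\<Sum>i\<in>I. ev v (f i))"
  by (induction I rule: infinite_finite_induct) (auto simp: ev_0 ev_add)

lemma ev_single: "ev v (Poly_Mapping.single m c) = \<kappa> c * mev v m"
  by (subst ev_superset[of "{m}"]) (auto simp: keys_def lookup_single when_def)

lemma sum_singles: "p = (\<Sum>m\<in>Poly_Mapping.keys p. Poly_Mapping.single m (Poly_Mapping.lookup p m))"
proof (rule poly_mapping_eqI)
  fix k
  show "Poly_Mapping.lookup p k = Poly_Mapping.lookup (\<Sum>m\<in>Poly_Mapping.keys p. Poly_Mapping.single m (Poly_Mapping.lookup p m)) k"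
    by (simp add: lookup_sum lookup_single when_def in_keys_iff)
qed

lemma ev_mult: "ev v (p * q) = ev v p * ev v q"
proof -
  have "p * q = (\<Sum>m\<in>Poly_Mapping.keys p. \<Sum>n\<in>Poly_Mapping.keys q. Poly_Mapping.single (m + n) (Poly_Mapping.lookup p m * Poly_Mapping.lookup q n))"
    by (subst (1) sum_singles[of p], subst (1) sum_singles[of q]) (simp add: sum_product mult_single)
  then have "ev v (p * q) = (\<Sum>m\<in>Poly_Mapping.keys p. \<Sum>n\<in>Poly_Mapping.keys q. \<kappa> (Poly_Mapping.lookup p m * Poly_Mapping.lookup q n) * mev v (m + n))"
    by (simp add: ev_sum ev_single)
  also have "\<dots> = ev v p * ev v q"
    unfolding ev_def sum_product by (simp add: k_mult mev_add mult_ac)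
  finally show ?thesis .
qed

lemma ev_const: "ev v (Poly_Mapping.single 0 c) = \<kappa> c"
  by (simp add: ev_single mev_def)

lemma ev_var: "ev v (Poly_Mapping.single (Poly_Mapping.single x 1) c) = \<kappa> c * v x"
  by (simp add: ev_single mev_def)

end

section \<open>Linear polynomials, linear functionals and the grading\<close>

definition supp :: "'a::zero infmat \<Rightarrow> (nat \<times> nat) set" where
  "supp X = {(i, j). X i j \<noteq> 0}"

lemma lin_poly_superset:
  assumes "finite K" "supp X \<subseteq> K"
  shows "lin_poly X = (\<Sum>(i, j)\<in>K. Poly_Mapping.single (Poly_Mapping.single (i, j) 1) (X i j))"
  unfolding lin_poly_def
  by (rule Sum_any.expand_superset) (use assms in \<open>auto simp: supp_def\<close>)

lemma lin_poly_add:
  fixes X Y :: "'a::field infmat"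
  assumes "finite (supp X)" "finite (supp Y)"
  shows "lin_poly (\<lambda>i j. X i j + Y i j) = lin_poly X + lin_poly Y"
proof -
  let ?K = "supp X \<union> supp Y"
  have f: "finite ?K" using assms by simp
  have s: "supp (\<lambda>i j. X i j + Y i j) \<subseteq> ?K" "supp X \<subseteq> ?K" "supp Y \<subseteq> ?K" by (auto simp: supp_def)
  show ?thesis
    unfolding lin_poly_superset[OF f s(1)] lin_poly_superset[OF f s(2)] lin_poly_superset[OF f s(3)] sum.distrib[symmetric]
    by (intro sum.cong) (auto simp: single_add)
qed

lemma lin_poly_scale:
  fixes X :: "'a::field infmat"
  assumes "finite (supp X)"
  shows "lin_poly (\<lambda>i j. c * X i j) = const_poly c * lin_poly X"
proof -
  have s: "supp (\<lambda>i j. c * X i j) \<subseteq> supp X" by (auto simp: supp_def)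
  show ?thesis
    unfolding lin_poly_superset[OF assms s] lin_poly_superset[OF assms subset_refl] const_poly_def sum_distrib_left
    by (intro sum.cong) (auto simp: mult_single)
qed

lemma lin_poly_inj:
  fixes X Y :: "'a::field infmat"
  assumes "finite (supp X)" "finite (supp Y)" "lin_poly X = lin_poly Y"
  shows "X = Y"
proof -
  have "Poly_Mapping.lookup (lin_poly zeros) (Poly_Mapping.single (i, j) 1) = zeros i j" if "finite (supp zeros)" for zeros :: "'a infmat" and i j
  proof -
    have inj: "Poly_Mapping.single x (Suc 0) = Poly_Mapping.single y (Suc 0) \<longleftrightarrow> x = y" for x y :: "nat \<times> nat"
    proof
      assume "Poly_Mapping.single x (Suc 0) = Poly_Mapping.single y (Suc 0)"
      then have "Poly_Mapping.keys (Poly_Mapping.single x (1::nat)) = Poly_Mapping.keys (Poly_Mapping.single y (1::nat))" by simp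
      then show "x = y" by simp
    qed simp
    have "Poly_Mapping.lookup (lin_poly zeros) (Poly_Mapping.single (i, j) 1) = (\<Sum>x\<in>supp zeros. if x = (i, j) then zeros (fst x) (snd x) else 0)"
      using that unfolding lin_poly_superset[OF that subset_refl] lookup_sum
      by (intro sum.cong) (auto simp: lookup_single when_def inj case_prod_beta)
    also have "\<dots> = zeros i j" using that by (auto simp: supp_def)
    finally show ?thesis .
  qed
  note * = this
  show ?thesis
  proof (intro ext)
    fix i j show "X i j = Y i j" using *[OF assms(1), of i j] *[OF assms(2), of i j] assms(3) by simp
  qed
qed

lemma const_poly_add: "const_poly (a + b) = const_poly a + (const_poly b :: 'a::field entry_poly)"
  and const_poly_mult: "const_poly (a * b) = const_poly a * (const_poly b :: 'a::field entry_poly)"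
  and const_poly_1: "const_poly 1 = (1 :: 'a::field entry_poly)"
  and const_poly_0: "const_poly 0 = (0 :: 'a::field entry_poly)"
  by (auto simp: const_poly_def single_add mult_single)

text \<open>Polynomials are written in the matrix entries, while the functional is known only on the
  subspace \<open>G\<close>. Transported to linear polynomials and extended along a basis, it
  assigns a value to every single variable; evaluation thereby becomes substitution.\<close>

lemma linear_extension:
  fixes G :: "'a::field infmat set" and \<phi> :: "'a infmat \<Rightarrow> 'a"
  assumes G: "(\<lambda>i j. 0) \<in> G" "\<And>X Y. X \<in> G \<Longrightarrow> Y \<in> G \<Longrightarrow> (\<lambda>i j. X i j + Y i j) \<in> G"
      "\<And>c X. X \<in> G \<Longrightarrow> (\<lambda>i j. c * X i j) \<in> G"
    and fin: "\<And>X. X \<in> G \<Longrightarrow> finite (supp X)"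
    and \<phi>: "\<And>X Y. X \<in> G \<Longrightarrow> Y \<in> G \<Longrightarrow> \<phi> (\<lambda>i j. X i j + Y i j) = \<phi> X + \<phi> Y"
      "\<And>c X. X \<in> G \<Longrightarrow> \<phi> (\<lambda>i j. c * X i j) = c * \<phi> X"
  shows "\<exists>v. \<forall>X\<in>G. \<phi> X = (\<Sum>(i, j)\<in>supp X. X i j * v (i, j))"
proof -
  define s where "s c p = const_poly c * p" for c :: 'a and p :: "'a entry_poly"
  interpret V: vector_space s
    by unfold_locales (auto simp: s_def const_poly_add const_poly_mult const_poly_1 algebra_simps)
  interpret F: vector_space "(*) :: 'a \<Rightarrow> 'a \<Rightarrow> 'a"
    by unfold_locales (auto simp: algebra_simps)
  interpret VF: vector_space_pair s "(*) :: 'a \<Rightarrow> 'a \<Rightarrow> 'a" ..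
  define L where "L = lin_poly ` G"
  have "V.subspace L"
  proof (rule V.subspaceI)
    have "lin_poly (\<lambda>i j. 0 :: 'a) = 0" by (simp add: lin_poly_superset[of "{}"] supp_def)
    then show "0 \<in> L" unfolding L_def by (rule image_eqI[OF sym G(1)])
    show "x + y \<in> L" if "x \<in> L" "y \<in> L" for x y
    proof -
      obtain X Y where XY: "X \<in> G" "Y \<in> G" "x = lin_poly X" "y = lin_poly Y" using \<open>x \<in> L\<close> \<open>y \<in> L\<close> unfolding L_def by (elim imageE)
      have "x + y = lin_poly (\<lambda>i j. X i j + Y i j)" unfolding XY(3,4) by (rule lin_poly_add[OF fin fin, OF XY(1,2), symmetric])
      then show ?thesis unfolding L_def by (rule image_eqI[OF _ G(2)[OF XY(1,2)]])
    qed
    show "s c x \<in> L" if "x \<in> L" for c x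
    proof -
      obtain X where X: "X \<in> G" "x = lin_poly X" using \<open>x \<in> L\<close> unfolding L_def by (elim imageE)
      have "s c x = lin_poly (\<lambda>i j. c * X i j)" unfolding X(2) s_def by (rule lin_poly_scale[OF fin[OF X(1)], symmetric])
      then show ?thesis unfolding L_def by (rule image_eqI[OF _ G(3)[OF X(1)]])
    qed
  qed
  then have spL: "V.span L = L" by simp
  obtain B where B: "B \<subseteq> L" "V.independent B" "L \<subseteq> V.span B"
    using V.maximal_independent_subset by blast
  define \<phi>' where "\<phi>' p = \<phi> (the_inv_into G lin_poly p)" for p
  have inj: "inj_on lin_poly G" using fin by (intro inj_onI lin_poly_inj) auto
  have \<phi>': "\<phi>' (lin_poly X) = \<phi> X" if "X \<in> G" for X
    using the_inv_into_f_f[OF inj that] by (simp add: \<phi>'_def)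
  from VF.linear_independent_extend[OF B(2), of \<phi>']
  obtain h where h: "Vector_Spaces.linear s (*) h" "\<forall>x\<in>B. h x = \<phi>' x"
    by (elim exE conjE)
  have hp: "h (x + y) = h x + h y" "h (s c x) = c * h x" for x y c
    using h(1) by (auto simp: Vector_Spaces.linear_iff)
  have z0: "\<phi> (\<lambda>i j. 0) = 0" using \<phi>(2)[OF G(1), of 0] by simp
  have ext: "x \<in> L \<and> h x = \<phi>' x" if "x \<in> V.span B" for x
    using that
  proof (induction rule: V.span_induct_alt)
    case base
    have "lin_poly (\<lambda>i j. 0 :: 'a) = 0" by (simp add: lin_poly_superset[of "{}"] supp_def)
    then have "\<phi>' 0 = 0" "0 \<in> L" using \<phi>'[OF G(1)] z0 imageI[OF G(1), of lin_poly] unfolding L_def by simp_all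
    moreover have "h 0 = 0" using hp(2)[of 0 0] by (simp add: s_def)
    ultimately show ?case by simp
  next
    case (step c x y)
    then have "x \<in> L" "y \<in> L" using B(1) by auto
    then obtain X Y where XY: "X \<in> G" "x = lin_poly X" "Y \<in> G" "y = lin_poly Y" unfolding L_def by (elim imageE)
    have cX: "(\<lambda>i j. c * X i j) \<in> G" using G(3) XY by blast
    have eq: "s c x + y = lin_poly (\<lambda>i j. c * X i j + Y i j)"
      using XY fin cX by (simp add: lin_poly_add lin_poly_scale s_def)
    have in_G: "(\<lambda>i j. c * X i j + Y i j) \<in> G" using G(2)[OF cX] XY by simp
    have "\<phi>' (s c x + y) = c * \<phi> X + \<phi> Y" unfolding eq \<phi>'[OF in_G] using \<phi>(1)[OF cX] \<phi>(2) XY by simp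
    moreover have "h (s c x + y) = c * \<phi> X + \<phi> Y" using hp step h(2) \<phi>' XY by simp
    moreover have "s c x + y \<in> L" unfolding L_def eq by (rule imageI[OF in_G])
    ultimately show ?case by simp
  qed
  define v where "v x = h (Poly_Mapping.single (Poly_Mapping.single x 1) 1)" for x
  have h0: "h 0 = 0" using hp(2)[of 0 0] by (simp add: s_def)
  have hsum: "h (sum f I) = (\<Sum>i\<in>I. h (f i))" if "finite I" for f and I :: "(nat \<times> nat) set"
    using that by (induction I rule: finite_induct) (auto simp: h0 hp)
  have "\<phi> X = (\<Sum>(i, j)\<in>supp X. X i j * v (i, j))" if X: "X \<in> G" for X
  proof -
    have "lin_poly X \<in> V.span B" using X B(3) unfolding L_def by blast
    then have "\<phi> X = h (lin_poly X)" using ext \<phi>'[OF X] by simp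
    also have "\<dots> = (\<Sum>x\<in>supp X. h (Poly_Mapping.single (Poly_Mapping.single x 1) (X (fst x) (snd x))))"
      using fin[OF X] by (simp add: lin_poly_superset[of "supp X"] hsum case_prod_beta)
    also have "\<dots> = (\<Sum>x\<in>supp X. X (fst x) (snd x) * v x)"
    proof (rule sum.cong[OF refl])
      fix x
      have "Poly_Mapping.single (Poly_Mapping.single x 1) (X (fst x) (snd x)) = s (X (fst x) (snd x)) (Poly_Mapping.single (Poly_Mapping.single x (1::nat)) 1)"
        by (simp add: s_def const_poly_def mult_single)
      then show "h (Poly_Mapping.single (Poly_Mapping.single x 1) (X (fst x) (snd x))) = X (fst x) (snd x) * v x"
        by (simp add: hp v_def)
    qed
    finally show ?thesis by (simp add: case_prod_beta)
  qed
  then show ?thesis by (intro exI[of _ v] ballI)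
qed

lemma sym_alg_uminus: "p \<in> sym_alg g \<Longrightarrow> - p \<in> sym_alg (g :: 'a::field infmat set)"
proof -
  assume "p \<in> sym_alg g"
  then have "const_poly (- 1) * p \<in> sym_alg g" by (intro sym_alg.mult sym_alg.const)
  moreover have "const_poly (- 1) * p = - p"
    by (simp add: const_poly_def single_uminus)
  ultimately show ?thesis by simp
qed

lemma sym_alg_0: "0 \<in> sym_alg (g :: 'a::field infmat set)" and sym_alg_1: "1 \<in> sym_alg g"
  using sym_alg.const[of 0 g] sym_alg.const[of 1 g] by (auto simp: const_poly_0 const_poly_1)

lemma sym_alg_sum: "(\<And>i. i \<in> I \<Longrightarrow> f i \<in> sym_alg g) \<Longrightarrow> sum f I \<in> sym_alg (g :: 'a::field infmat set)"
  by (induction I rule: infinite_finite_induct) (auto simp: sym_alg_0 intro: sym_alg.add)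

lemma sym_alg_mono: "p \<in> sym_alg g \<Longrightarrow> g \<subseteq> h \<Longrightarrow> p \<in> sym_alg h"
  by (induction rule: sym_alg.induct) (auto intro: sym_alg.intros)

lemma sym_ring_ideal:
  assumes "ideal J (sym_ring (g :: 'a::field infmat set))"
  shows "J \<subseteq> sym_alg g" "0 \<in> J" "p \<in> J \<Longrightarrow> q \<in> J \<Longrightarrow> p + q \<in> J" "s \<in> sym_alg g \<Longrightarrow> p \<in> J \<Longrightarrow> s * p \<in> J"
    "p \<in> J \<Longrightarrow> - p \<in> J"
proof -
  interpret ideal J "sym_ring g" by fact
  show "J \<subseteq> sym_alg g" using a_subset by (simp add: sym_ring_def)
  show "0 \<in> J" using additive_subgroup.zero_closed[OF is_additive_subgroup] by (simp add: sym_ring_def)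
  show "p \<in> J \<Longrightarrow> q \<in> J \<Longrightarrow> p + q \<in> J" using additive_subgroup.a_closed[OF is_additive_subgroup, of p q] by (simp add: sym_ring_def)
  show *: "s \<in> sym_alg g \<Longrightarrow> p \<in> J \<Longrightarrow> s * p \<in> J" for s p using I_l_closed[of p s] by (simp add: sym_ring_def)
  assume "p \<in> J"
  then show "- p \<in> J" using *[OF sym_alg_uminus[OF sym_alg_1]] by simp
qed

text \<open>Homogeneity is recorded by construction from elements of \<open>g\<close>, so that
  statements on leading terms can be proved by induction along the generators.\<close>

inductive homog :: "'a::field infmat set \<Rightarrow> nat \<Rightarrow> 'a entry_poly \<Rightarrow> bool" for g where
  homog_const: "homog g 0 (const_poly c)"
| homog_lin: "X \<in> g \<Longrightarrow> homog g 1 (lin_poly X)"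
| homog_add: "homog g k p \<Longrightarrow> homog g k q \<Longrightarrow> homog g k (p + q)"
| homog_mult: "homog g k p \<Longrightarrow> homog g l q \<Longrightarrow> homog g (k + l) (p * q)"

lemma homog_sym_alg: "homog g k p \<Longrightarrow> p \<in> sym_alg g"
  by (induction rule: homog.induct) (auto intro: sym_alg.intros)

lemma homog_zero: "g \<noteq> {} \<Longrightarrow> homog g k 0"
proof (induction k)
  case 0
  then show ?case using homog_const[of g 0] by (simp add: const_poly_0)
next
  case (Suc k)
  then obtain X where "X \<in> g" by blast
  from homog_mult[OF homog_lin[OF this] Suc.IH[OF Suc.prems]] show ?case by simp
qed

lemma homog_decomp:
  assumes g: "g \<noteq> {}"
  shows "p \<in> sym_alg g \<Longrightarrow> \<exists>K h. (\<forall>k. homog g k (h k)) \<and> p = (\<Sum>k<K. h k)"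
proof (induction rule: sym_alg.induct)
  case (const c)
  then show ?case using homog_zero[OF g] homog_const
    by (intro exI[of _ 1] exI[of _ "\<lambda>k. if k = 0 then const_poly c else 0"]) auto
next
  case (lin X)
  then show ?case using homog_zero[OF g] homog_lin
    by (intro exI[of _ 2] exI[of _ "\<lambda>k. if k = 1 then lin_poly X else 0"]) (auto simp: numeral_2_eq_2)
next
  case (add p q)
  then obtain K h L f where *: "\<forall>k. homog g k (h k)" "p = (\<Sum>k<K. h k)" "\<forall>k. homog g k (f k)" "q = (\<Sum>k<L. f k)" by blast
  define h' where "h' k = (if k < K then h k else 0) + (if k < L then f k else 0)" for k
  have "\<forall>k. homog g k (h' k)" using * homog_zero[OF g] by (auto simp: h'_def intro!: homog_add)
  moreover have "p + q = (\<Sum>k<K + L. h' k)"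
    unfolding *(2,4) h'_def sum.distrib
    by (auto simp: sum.If_cases Int_absorb1 lessThan_def[symmetric] intro!: arg_cong2[where f = "(+)"] sum.cong)
  ultimately show ?case by blast
next
  case (mult p q)
  then obtain K h L f where *: "\<forall>k. homog g k (h k)" "p = (\<Sum>k<K. h k)" "\<forall>k. homog g k (f k)" "q = (\<Sum>k<L. f k)" by blast
  define h' where "h' k = (\<Sum>i\<in>{i. i < K \<and> i \<le> k \<and> k - i < L}. h i * f (k - i))" for k
  have "homog g k (h' k)" for k
  proof -
    have s: "homog g k (sum F I)" if "finite I" "\<And>i. i \<in> I \<Longrightarrow> homog g k (F i)" for I :: "nat set" and F
      using that by (induction I rule: finite_induct) (auto simp: homog_zero[OF g] intro: homog_add)
    have m: "homog g k (h i * f (k - i))" if "i \<le> k" for i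
      using homog_mult[OF *(1)[rule_format, of i] *(3)[rule_format, of "k - i"]] that by simp
    show ?thesis unfolding h'_def by (rule s, simp, rule m, simp)
  qed
  moreover have "p * q = (\<Sum>k<K + L. h' k)"
  proof -
    have "p * q = (\<Sum>(i, j)\<in>{..<K} \<times> {..<L}. h i * f j)"
      unfolding *(2,4) by (simp add: sum_product sum.cartesian_product)
    also have "\<dots> = (\<Sum>(k, i)\<in>(SIGMA k:{..<K + L}. {i. i < K \<and> i \<le> k \<and> k - i < L}). h i * f (k - i))"
      by (rule sum.reindex_bij_witness[of _ "\<lambda>(k, i). (i, k - i)" "\<lambda>(i, j). (i + j, i)"]) auto
    finally show ?thesis by (simp add: sum.Sigma h'_def)
  qed
  ultimately show ?case by blast
qed

section \<open>Infinite matrices of the classical types\<close>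

abbreviation sgn_T :: "cartan_type \<Rightarrow> nat \<Rightarrow> 'a::comm_ring_1" where
  "sgn_T T \<equiv> dual_sign (T = Type_C)"

abbreviation bar_T :: "cartan_type \<Rightarrow> nat \<Rightarrow> nat" where
  "bar_T T \<equiv> dual_index (T = Type_C)"

definition sup_in :: "nat \<Rightarrow> 'a::zero infmat \<Rightarrow> bool" where
  "sup_in D M \<longleftrightarrow> (\<forall>i j. M i j \<noteq> 0 \<longrightarrow> i < D \<and> j < D)"

text \<open>The adjoint with respect to the invariant form; it has no meaning in type A.\<close>

definition star :: "cartan_type \<Rightarrow> 'a::comm_ring_1 infmat \<Rightarrow> 'a infmat" where
  "star T M i j = sgn_T T i * sgn_T T j * M (bar_T T j) (bar_T T i)"

text \<open>In type A the trace condition is dropped, since translating by scalars does not change the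
  linear form defined by a matrix.\<close>

definition std_gl :: "cartan_type \<Rightarrow> nat \<Rightarrow> 'a::comm_ring_1 infmat set" where
  "std_gl T D = {M. sup_in D M \<and> (T \<noteq> Type_A \<longrightarrow> (\<forall>i j. star T M i j = - M i j))}"

definition std_lie :: "cartan_type \<Rightarrow> nat \<Rightarrow> 'a::comm_ring_1 infmat set" where
  "std_lie T D = {M \<in> std_gl T D. T = Type_A \<longrightarrow> (\<Sum>i<D. M i i) = 0}"

definition mprod :: "nat \<Rightarrow> (nat \<Rightarrow> nat \<Rightarrow> 'k::comm_ring_1) \<Rightarrow> (nat \<Rightarrow> nat \<Rightarrow> 'k) \<Rightarrow> nat \<Rightarrow> nat \<Rightarrow> 'k" where
  "mprod D A B i j = (\<Sum>k<D. A i k * B k j)"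

definition trace_prod :: "nat \<Rightarrow> (nat \<Rightarrow> nat \<Rightarrow> 'k::comm_ring_1) \<Rightarrow> (nat \<Rightarrow> nat \<Rightarrow> 'k) \<Rightarrow> 'k" where
  "trace_prod D A B = (\<Sum>i<D. \<Sum>j<D. A i j * B j i)"

text \<open>The orthogonal projection of all matrices of size \<open>D\<close> to the Lie algebra
  with respect to the trace form. This is why the linear form of a matrix on the Lie algebra does
  not change under it.\<close>

definition proj_T :: "cartan_type \<Rightarrow> nat \<Rightarrow> 'a::field_char_0 infmat \<Rightarrow> 'a infmat" where
  "proj_T T D M i j = (if i < D \<and> j < D then
     (if T = Type_A then M i j - (if i = j then (\<Sum>k<D. M k k) / of_nat D else 0)
      else (M i j - star T M i j) / 2) else 0)"

lemma mprod_assoc: "mprod D A (mprod D B C) i j = mprod D (mprod D A B) C i j"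
  unfolding mprod_def sum_distrib_left sum_distrib_right by (subst sum.swap) (simp add: mult_ac)

lemma trace_prod_mprod: "trace_prod D (mprod D A B) C = trace_prod D A (mprod D B C)"
proof -
  have "trace_prod D (mprod D A B) C = (\<Sum>i<D. \<Sum>j<D. \<Sum>k<D. A i k * B k j * C j i)"
    by (simp add: trace_prod_def mprod_def sum_distrib_right)
  also have "\<dots> = (\<Sum>i<D. \<Sum>k<D. \<Sum>j<D. A i k * B k j * C j i)"
    by (intro sum.cong refl sum.swap)
  finally show ?thesis by (simp add: trace_prod_def mprod_def sum_distrib_left mult.assoc)
qed

lemma trace_prod_commute: "trace_prod D A B = trace_prod D B A"
  unfolding trace_prod_def by (subst sum.swap) (simp add: mult.commute)

lemma bar_less: "(T = Type_C \<Longrightarrow> even D) \<Longrightarrow> bar_T T i < D \<longleftrightarrow> i < D"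
  by (rule dual_index_less)

lemma star_star: "star T (star T M) i j = (M i j :: 'a::comm_ring_1)"
proof -
  have "(sgn_T T i * sgn_T T (bar_T T i)) * ((sgn_T T j * sgn_T T (bar_T T j)) * M i j) = M i j"
    by (simp add: dual_sign_dual_index mult_ac)
  then show ?thesis by (simp add: star_def mult_ac)
qed

lemma sum_bar:
  assumes "T = Type_C \<Longrightarrow> even D"
  shows "(\<Sum>k<D. f (bar_T T k)) = (\<Sum>k<D. f k)"
  by (rule sum.reindex_bij_witness[of _ "bar_T T" "bar_T T"]) (use bar_less[OF assms] in auto)

lemma star_mprod:
  assumes D: "T = Type_C \<Longrightarrow> even D"
  shows "star T (mprod D A B) i j = mprod D (star T B) (star T A) i j"
proof -
  have "mprod D (star T B) (star T A) i j = (\<Sum>k<D. sgn_T T i * sgn_T T j * (A (bar_T T j) (bar_T T k) * B (bar_T T k) (bar_T T i)))"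
    unfolding mprod_def star_def
  proof (rule sum.cong[OF refl])
    fix k
    have "sgn_T T k * sgn_T T k = (1::'a)" by simp
    then show "sgn_T T i * sgn_T T k * B (bar_T T k) (bar_T T i) * (sgn_T T k * sgn_T T j * A (bar_T T j) (bar_T T k)) =
      sgn_T T i * sgn_T T j * (A (bar_T T j) (bar_T T k) * B (bar_T T k) (bar_T T i))" by (simp add: mult_ac)
  qed
  also have "\<dots> = (\<Sum>k<D. sgn_T T i * sgn_T T j * (A (bar_T T j) k * B k (bar_T T i)))"
    by (rule sum_bar[OF D])
  finally show ?thesis by (simp add: star_def mprod_def sum_distrib_left mult_ac)
qed

lemma proj_T_std_lie:
  assumes D: "T = Type_C \<Longrightarrow> even D" "D > 0"
  shows "proj_T T D M \<in> std_lie T D"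
proof -
  have "star T (proj_T T D M) i j = - proj_T T D M i j" if "T \<noteq> Type_A" for i j
    using that star_star[of T M i j] bar_less[of T D i] bar_less[of T D j] D(1)
    by (auto simp: star_def[of _ "proj_T T D M"] proj_T_def) (simp_all add: star_def field_simps)
  moreover have "(\<Sum>i<D. proj_T T D M i i) = 0" if "T = Type_A"
    using that D(2) by (simp add: proj_T_def sum_subtractf)
  ultimately show ?thesis by (auto simp: std_lie_def std_gl_def sup_in_def proj_T_def)
qed

lemma proj_T_id:
  assumes "M \<in> std_lie T D"
  shows "proj_T T D M = M"
proof (intro ext)
  fix i j
  show "proj_T T D M i j = M i j"
    using assms by (auto simp: std_lie_def std_gl_def sup_in_def proj_T_def)
qed

lemma trace_prod_proj:
  fixes A :: "'a::field_char_0 infmat"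
  assumes D: "T = Type_C \<Longrightarrow> even D" and M: "M \<in> std_lie T D"
  shows "trace_prod D (proj_T T D A) M = trace_prod D A M"
proof (cases "T = Type_A")
  case True
  have "trace_prod D (proj_T T D A) M = trace_prod D A M - (\<Sum>i<D. \<Sum>j<D. (if i = j then (\<Sum>k<D. A k k) / of_nat D else 0) * M j i)"
    using True unfolding trace_prod_def by (simp add: proj_T_def left_diff_distrib sum_subtractf)
  also have "(\<Sum>i<D. \<Sum>j<D. (if i = j then (\<Sum>k<D. A k k) / of_nat D else 0) * M j i) = (\<Sum>k<D. A k k) / of_nat D * (\<Sum>i<D. M i i)"
    by (simp add: if_distrib[of "\<lambda>x. x * _"] sum_distrib_left cong: if_cong)
  finally show ?thesis using M True by (simp add: std_lie_def)
next
  case False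
  have M': "star T M i j = - M i j" for i j using M False by (auto simp: std_lie_def std_gl_def)
  have "trace_prod D (star T A) M = (\<Sum>i<D. \<Sum>j<D. A (bar_T T j) (bar_T T i) * - M (bar_T T i) (bar_T T j))"
    unfolding trace_prod_def
  proof (intro sum.cong refl)
    fix i j
    have "star T A i j * M j i = A (bar_T T j) (bar_T T i) * (sgn_T T i * sgn_T T j * M j i)"
      by (simp add: star_def mult_ac)
    also have "sgn_T T i * sgn_T T j * M j i = - M (bar_T T i) (bar_T T j)"
    proof -
      have "sgn_T T i * sgn_T T j * star T M j i = M (bar_T T i) (bar_T T j)"
        by (simp add: star_def mult_ac)
      then show ?thesis unfolding M' by (simp add: minus_equation_iff[of _ "M (bar_T T i) (bar_T T j)"] eq_commute)
    qed
    finally show "star T A i j * M j i = A (bar_T T j) (bar_T T i) * - M (bar_T T i) (bar_T T j)" .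
  qed
  also have "\<dots> = (\<Sum>i<D. \<Sum>j<D. A (bar_T T j) i * - M i (bar_T T j))"
    by (rule sum_bar[OF D, where f = "\<lambda>i. \<Sum>j<D. A (bar_T T j) i * - M i (bar_T T j)"])
  also have "\<dots> = (\<Sum>i<D. \<Sum>j<D. A j i * - M i j)"
    by (intro sum.cong refl sum_bar[OF D, where f = "\<lambda>j. A j i * - M i j" for i])
  also have "\<dots> = - trace_prod D A M"
    unfolding trace_prod_def by (subst sum.swap) (simp add: sum_negf)
  finally have s: "trace_prod D (star T A) M = - trace_prod D A M" .
  have "trace_prod D (proj_T T D A) M = (trace_prod D A M - trace_prod D (star T A) M) / 2"
    using False unfolding trace_prod_def by (simp add: proj_T_def left_diff_distrib sum_subtractf diff_divide_distrib sum_divide_distrib)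
  then show ?thesis by (simp add: s)
qed

lemma std_lie_add: "A \<in> std_lie T D \<Longrightarrow> B \<in> std_lie T D \<Longrightarrow> (\<lambda>i j. A i j + B i j) \<in> std_lie T D"
  and std_lie_scale: "A \<in> std_lie T D \<Longrightarrow> (\<lambda>i j. c * A i j) \<in> std_lie T D"
  and std_lie_0: "(\<lambda>i j. 0) \<in> std_lie T D" for A B :: "'a::comm_ring_1 infmat"
proof -
  have z: "sup_in D M \<longleftrightarrow> (\<forall>i j. D \<le> i \<or> D \<le> j \<longrightarrow> M i j = 0)" for M :: "'a infmat"
    unfolding sup_in_def by (meson not_le)
  have s: "star T (\<lambda>i j. A i j + B i j) i j = star T A i j + star T B i j"
    "star T (\<lambda>i j. c * A i j) i j = c * star T A i j" for i j
    by (auto simp: star_def algebra_simps)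
  show "A \<in> std_lie T D \<Longrightarrow> B \<in> std_lie T D \<Longrightarrow> (\<lambda>i j. A i j + B i j) \<in> std_lie T D"
    by (simp add: std_lie_def std_gl_def z s sum.distrib)
  show "A \<in> std_lie T D \<Longrightarrow> (\<lambda>i j. c * A i j) \<in> std_lie T D"
    by (simp add: std_lie_def std_gl_def z s sum_distrib_left[symmetric])
  show "(\<lambda>i j. 0) \<in> std_lie T D" by (auto simp: std_lie_def std_gl_def sup_in_def star_def)
qed

lemma std_lie_sum: "(\<And>i. i \<in> I \<Longrightarrow> F i \<in> std_lie T D) \<Longrightarrow> (\<lambda>i j. \<Sum>k\<in>I. F k i j) \<in> std_lie T D"
proof (induction I rule: infinite_finite_induct)
  case (insert x I)
  then show ?case using std_lie_add[of "F x" T D "\<lambda>i j. \<Sum>k\<in>I. F k i j"] by simp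
qed (auto simp: std_lie_0)

text \<open>The projected matrix units span the Lie algebra. Working with this spanning set gives
  one finite list of generators for all types.\<close>

lemma proj_expand:
  fixes M :: "'a::field_char_0 infmat"
  assumes M: "M \<in> std_lie T D"
  shows "M i j = (\<Sum>x\<in>{..<D} \<times> {..<D}. M (fst x) (snd x) * proj_T T D (\<lambda>k l. if (k, l) = x then 1 else 0) i j)"
proof -
  let ?E = "\<lambda>x k l. if (k, l) = x then 1 else (0::'a)"
  have sup: "sup_in D M" using M by (auto simp: std_lie_def std_gl_def)
  have M': "M k l = (\<Sum>x\<in>{..<D} \<times> {..<D}. M (fst x) (snd x) * ?E x k l)" for k l
  proof -
    have "(\<Sum>x\<in>{..<D} \<times> {..<D}. M (fst x) (snd x) * ?E x k l) = (\<Sum>x\<in>{..<D} \<times> {..<D}. if x = (k, l) then M k l else 0)"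
      by (intro sum.cong) auto
    then show ?thesis using sup by (auto simp: sup_in_def)
  qed
  have "proj_T T D M i j = (\<Sum>x\<in>{..<D} \<times> {..<D}. M (fst x) (snd x) * proj_T T D (?E x) i j)" (is "_ = ?R")
  proof (cases "i < D \<and> j < D")
    case True
    show ?thesis
    proof (cases "T = Type_A")
      case A: True
      have "(\<Sum>k<D. M k k) = (\<Sum>x\<in>{..<D} \<times> {..<D}. M (fst x) (snd x) * (\<Sum>k<D. ?E x k k))"
        unfolding sum_distrib_left by (subst sum.swap) (intro sum.cong refl M')
      then show ?thesis using True A M'[of i j]
        by (auto simp: proj_T_def right_diff_distrib sum_subtractf sum_divide_distrib[symmetric])
    next
      case A: False
      have "star T M i j = (\<Sum>x\<in>{..<D} \<times> {..<D}. M (fst x) (snd x) * star T (?E x) i j)"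
        unfolding star_def by (subst M') (simp add: sum_distrib_left mult_ac)
      then show ?thesis using True A M'[of i j]
        by (simp add: proj_T_def right_diff_distrib sum_subtractf diff_divide_distrib sum_divide_distrib[symmetric])
    qed
  qed (auto simp: proj_T_def)
  then show ?thesis by (simp add: proj_T_id[OF M])
qed

section \<open>Evaluation at matrices\<close>

text \<open>A single \<psi> serves all levels: the chain is identified with the standard one under
  corner inclusions, so restricting a linear form to \<open>g n\<close> means reading off the first
  \<open>d n\<close> coordinates of its matrix.\<close>

locale chain_model =
  fixes T :: cartan_type and g :: "nat \<Rightarrow> 'a::{alg_closed_field, field_char_0} infmat set" and \<psi> :: "'a infmat \<Rightarrow> 'a infmat"
  assumes lie: "3 \<le> n \<Longrightarrow> lie_subalgebra (g n)"
    and g_Suc: "3 \<le> n \<Longrightarrow> g n \<subseteq> g (Suc n)"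
    and fin: "3 \<le> n \<Longrightarrow> X \<in> g n \<Longrightarrow> finite (supp X)"
    and bij: "3 \<le> n \<Longrightarrow> bij_betw \<psi> (g n) (std_lie T (natural_dim T n))"
    and \<psi>_add: "3 \<le> n \<Longrightarrow> X \<in> g n \<Longrightarrow> Y \<in> g n \<Longrightarrow> \<psi> (\<lambda>i j. X i j + Y i j) = (\<lambda>i j. \<psi> X i j + \<psi> Y i j)"
    and \<psi>_scale: "3 \<le> n \<Longrightarrow> X \<in> g n \<Longrightarrow> \<psi> (\<lambda>i j. c * X i j) = (\<lambda>i j. c * \<psi> X i j)"
    and \<psi>_bracket: "3 \<le> n \<Longrightarrow> X \<in> g n \<Longrightarrow> Y \<in> g n \<Longrightarrow>
      \<psi> (inf_bracket X Y) = (\<lambda>i j. mprod (natural_dim T n) (\<psi> X) (\<psi> Y) i j - mprod (natural_dim T n) (\<psi> Y) (\<psi> X) i j)"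
begin

abbreviation d :: "nat \<Rightarrow> nat" where "d \<equiv> natural_dim T"

lemma d_mono: "m \<le> n \<Longrightarrow> d m \<le> d n" and d_ge: "n \<le> d n"
  by (cases T; simp)+

lemma d_even: "T = Type_C \<Longrightarrow> even (d n)"
  by simp

lemma g_mono: "3 \<le> m \<Longrightarrow> m \<le> n \<Longrightarrow> g m \<subseteq> g n"
proof (induction n)
  case (Suc n)
  then show ?case using g_Suc[of n] by (cases "m = Suc n") auto
qed simp

definition G :: "'a infmat set" where "G = (\<Union>n\<in>{3..}. g n)"

lemma g_G: "3 \<le> n \<Longrightarrow> g n \<subseteq> G"
  by (auto simp: G_def)

lemma G_common:
  assumes "X \<in> G" "Y \<in> G"
  obtains n where "3 \<le> n" "X \<in> g n" "Y \<in> g n"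
proof -
  obtain m n where "3 \<le> m" "3 \<le> n" "X \<in> g m" "Y \<in> g n" using assms by (auto simp: G_def)
  then show ?thesis using g_mono[of m "max m n"] g_mono[of n "max m n"] that[of "max m n"]
    by (auto simp: le_max_iff_disj)
qed

lemma sym_alg_G: "p \<in> sym_alg G \<Longrightarrow> \<exists>n\<ge>N. 3 \<le> n \<and> p \<in> sym_alg (g n)"
proof (induction rule: sym_alg.induct)
  case (const c)
  then show ?case by (intro exI[of _ "max 3 N"]) (auto intro: sym_alg.const)
next
  case (lin X)
  then obtain n where n: "3 \<le> n" "X \<in> g n" by (auto simp: G_def)
  then have "X \<in> g (max n N)" using g_mono[of n "max n N"] by auto
  then show ?case using n by (intro exI[of _ "max n N"]) (auto intro: sym_alg.lin)
next
  case (add p q)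
  then obtain m n where "m \<ge> N" "3 \<le> m" "p \<in> sym_alg (g m)" "3 \<le> n" "q \<in> sym_alg (g n)" by auto
  then show ?case using sym_alg_mono[of p "g m" "g (max m n)"] sym_alg_mono[of q "g n" "g (max m n)"] g_mono[of m "max m n"] g_mono[of n "max m n"]
    by (intro exI[of _ "max m n"]) (auto intro: sym_alg.add)
next
  case (mult p q)
  then obtain m n where "m \<ge> N" "3 \<le> m" "p \<in> sym_alg (g m)" "3 \<le> n" "q \<in> sym_alg (g n)" by auto
  then show ?case using sym_alg_mono[of p "g m" "g (max m n)"] sym_alg_mono[of q "g n" "g (max m n)"] g_mono[of m "max m n"] g_mono[of n "max m n"]
    by (intro exI[of _ "max m n"]) (auto intro: sym_alg.mult)
qed

lemma coordinates_exist: "\<exists>c. \<forall>i j. \<forall>X\<in>G. \<psi> X i j = (\<Sum>(k, l)\<in>supp X. X k l * c i j (k, l))"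
proof -
  have "\<exists>v. \<forall>X\<in>G. \<psi> X i j = (\<Sum>(k, l)\<in>supp X. X k l * v (k, l))" for i j
  proof (rule linear_extension)
    show "(\<lambda>i j. 0) \<in> G" using lie[of 3] g_G[of 3] by (auto simp: lie_subalgebra_def)
    fix X assume X: "X \<in> G"
    then obtain n where n: "3 \<le> n" "X \<in> g n" by (auto simp: G_def)
    show "finite (supp X)" by (rule fin[OF n])
    show "\<psi> (\<lambda>i j. c * X i j) i j = c * \<psi> X i j" for c using \<psi>_scale[OF n] by simp
    show "(\<lambda>i j. c * X i j) \<in> G" for c using lie[OF n(1)] n g_G[OF n(1)] by (auto simp: lie_subalgebra_def)
    fix Y assume Y: "Y \<in> G"
    obtain m where m: "3 \<le> m" "X \<in> g m" "Y \<in> g m" using G_common[OF X Y] .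
    show "(\<lambda>i j. X i j + Y i j) \<in> G" using lie[OF m(1)] m g_G[OF m(1)] by (auto simp: lie_subalgebra_def)
    show "\<psi> (\<lambda>i j. X i j + Y i j) i j = \<psi> X i j + \<psi> Y i j" using \<psi>_add[OF m] by simp
  qed
  then have "\<forall>i. \<forall>j. \<exists>v. \<forall>X\<in>G. \<psi> X i j = (\<Sum>(k, l)\<in>supp X. X k l * v (k, l))" by blast
  then show ?thesis by (simp only: choice_iff)
qed

definition coord :: "nat \<Rightarrow> nat \<Rightarrow> nat \<times> nat \<Rightarrow> 'a" where
  "coord = (SOME c. \<forall>i j. \<forall>X\<in>G. \<psi> X i j = (\<Sum>(k, l)\<in>supp X. X k l * c i j (k, l)))"

lemma coord: "X \<in> G \<Longrightarrow> \<psi> X i j = (\<Sum>x\<in>supp X. X (fst x) (snd x) * coord i j x)"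
  using someI_ex[OF coordinates_exist] unfolding coord_def[symmetric] by (simp add: case_prod_beta)

text \<open>Evaluation at the linear form sending \<open>X\<close> to the trace of \<open>M\<close>
  times \<open>\<psi> X\<close>. The ring of values is general because \<open>M\<close> will also be
  a matrix of polynomials or of power series in the parameter of a curve.\<close>

definition ring_eval :: "('a \<Rightarrow> 'k::comm_ring_1) \<Rightarrow> nat \<Rightarrow> (nat \<Rightarrow> nat \<Rightarrow> 'k) \<Rightarrow> 'a entry_poly \<Rightarrow> 'k" where
  "ring_eval \<kappa> D M = coeff_hom.ev \<kappa> (\<lambda>x. \<Sum>i<D. \<Sum>j<D. M i j * \<kappa> (coord j i x))"

context
  fixes \<kappa> :: "'a \<Rightarrow> 'k::comm_ring_1" assumes \<kappa>: "coeff_hom \<kappa>"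
begin

interpretation coeff_hom \<kappa> by (rule \<kappa>)

lemma ring_eval_add: "ring_eval \<kappa> D M (p + q) = ring_eval \<kappa> D M p + ring_eval \<kappa> D M q"
  and ring_eval_mult: "ring_eval \<kappa> D M (p * q) = ring_eval \<kappa> D M p * ring_eval \<kappa> D M q"
  and ring_eval_const: "ring_eval \<kappa> D M (const_poly c) = \<kappa> c"
  by (auto simp: ring_eval_def ev_add ev_mult const_poly_def ev_const)

lemma ring_eval_lin:
  assumes X: "X \<in> G"
  shows "ring_eval \<kappa> D M (lin_poly X) = trace_prod D M (\<lambda>i j. \<kappa> (\<psi> X i j))"
proof -
  have f: "finite (supp X)" using X fin by (auto simp: G_def)
  let ?c = "\<lambda>x i j. \<kappa> (X (fst x) (snd x)) * (M i j * \<kappa> (coord j i x))"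
  have "ring_eval \<kappa> D M (lin_poly X) = (\<Sum>x\<in>supp X. \<kappa> (X (fst x) (snd x)) * (\<Sum>i<D. \<Sum>j<D. M i j * \<kappa> (coord j i x)))"
    unfolding ring_eval_def lin_poly_superset[OF f subset_refl] ev_sum case_prod_beta prod.collapse ev_var ..
  also have "\<dots> = (\<Sum>x\<in>supp X. \<Sum>i<D. \<Sum>j<D. ?c x i j)"
    by (simp add: sum_distrib_left)
  also have "\<dots> = (\<Sum>i<D. \<Sum>x\<in>supp X. \<Sum>j<D. ?c x i j)"
    by (rule sum.swap)
  also have "\<dots> = (\<Sum>i<D. \<Sum>j<D. \<Sum>x\<in>supp X. ?c x i j)"
    by (intro sum.cong refl sum.swap)
  also have "\<dots> = trace_prod D M (\<lambda>i j. \<kappa> (\<psi> X i j))"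
    unfolding trace_prod_def coord[OF X] k_sum k_mult sum_distrib_left by (simp add: mult_ac)
  finally show ?thesis .
qed

end

lemma hom_unique:
  fixes e f :: "'a entry_poly \<Rightarrow> 'k::comm_ring_1"
  assumes "\<And>c. e (const_poly c) = f (const_poly c)" "\<And>X. X \<in> h \<Longrightarrow> e (lin_poly X) = f (lin_poly X)"
    and "\<And>p q. p \<in> sym_alg h \<Longrightarrow> q \<in> sym_alg h \<Longrightarrow> e (p + q) = e p + e q \<and> e (p * q) = e p * e q"
    and "\<And>p q. p \<in> sym_alg h \<Longrightarrow> q \<in> sym_alg h \<Longrightarrow> f (p + q) = f p + f q \<and> f (p * q) = f p * f q"
    and "p \<in> sym_alg h"
  shows "e p = f p"
  using assms(5) by (induction rule: sym_alg.induct) (simp_all add: assms(1-4))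

definition eval_at :: "nat \<Rightarrow> 'a infmat \<Rightarrow> 'a entry_poly \<Rightarrow> 'a" where
  "eval_at = ring_eval (\<lambda>x. x)"

lemma coeff_hom_id: "coeff_hom (\<lambda>x. x :: 'a)"
  by unfold_locales auto

lemmas eval_at_simps = ring_eval_add[OF coeff_hom_id, folded eval_at_def] ring_eval_mult[OF coeff_hom_id, folded eval_at_def]
  ring_eval_const[OF coeff_hom_id, folded eval_at_def] 

lemma eval_at_lin: "X \<in> G \<Longrightarrow> eval_at D M (lin_poly X) = trace_prod D M (\<psi> X)"
  using ring_eval_lin[OF coeff_hom_id, of X D M] by (simp add: eval_at_def)

lemma eval_at_eqI:
  assumes "3 \<le> n" "p \<in> sym_alg (g n)" "\<And>Y. Y \<in> g n \<Longrightarrow> trace_prod D M (\<psi> Y) = trace_prod E N (\<psi> Y)"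
  shows "eval_at D M p = eval_at E N p"
  by (rule hom_unique[OF _ _ _ _ assms(2)]) (use assms(3) subsetD[OF g_G[OF assms(1)]] in \<open>auto simp: eval_at_simps eval_at_lin\<close>)

lemma \<psi>_std_lie: "3 \<le> n \<Longrightarrow> X \<in> g n \<Longrightarrow> \<psi> X \<in> std_lie T (d n)"
  using bij by (auto simp: bij_betw_def)

lemma trace_prod_restrict:
  assumes "sup_in E B" "E \<le> D"
  shows "trace_prod D A B = trace_prod E A B"
proof -
  have z: "B i j = 0" if "E \<le> i \<or> E \<le> j" for i j using assms(1) that unfolding sup_in_def by (meson not_le)
  have "trace_prod D A B = (\<Sum>i<E. \<Sum>j<D. A i j * B j i)"
    unfolding trace_prod_def using assms(2) z by (intro sum.mono_neutral_right) auto
  also have "\<dots> = trace_prod E A B"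
    unfolding trace_prod_def using assms(2) z by (intro sum.cong refl sum.mono_neutral_right) auto
  finally show ?thesis .
qed

definition lift_mat :: "nat \<Rightarrow> 'a infmat \<Rightarrow> 'a infmat" where
  "lift_mat n M = inv_into (g n) \<psi> M"

lemma lift_mat: "3 \<le> n \<Longrightarrow> M \<in> std_lie T (d n) \<Longrightarrow> lift_mat n M \<in> g n \<and> \<psi> (lift_mat n M) = M"
  using bij[of n] unfolding lift_mat_def bij_betw_def by (metis f_inv_into_f inv_into_into)

lemma lift_mat_\<psi>: "3 \<le> n \<Longrightarrow> X \<in> g n \<Longrightarrow> lift_mat n (\<psi> X) = X"
  using bij[of n] unfolding lift_mat_def bij_betw_def by simp

lemma lift_mat_add: "3 \<le> n \<Longrightarrow> M \<in> std_lie T (d n) \<Longrightarrow> M' \<in> std_lie T (d n) \<Longrightarrow>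
  lin_poly (lift_mat n (\<lambda>i j. M i j + M' i j)) = lin_poly (lift_mat n M) + lin_poly (lift_mat n M')"
proof -
  assume n: "3 \<le> n" and M: "M \<in> std_lie T (d n)" "M' \<in> std_lie T (d n)"
  note y = lift_mat[OF n M(1)] lift_mat[OF n M(2)]
  have in_g: "(\<lambda>i j. lift_mat n M i j + lift_mat n M' i j) \<in> g n" using lie[OF n] y by (auto simp: lie_subalgebra_def)
  have "\<psi> (\<lambda>i j. lift_mat n M i j + lift_mat n M' i j) = (\<lambda>i j. M i j + M' i j)" using \<psi>_add[OF n] y by auto
  then have "lift_mat n (\<lambda>i j. M i j + M' i j) = (\<lambda>i j. lift_mat n M i j + lift_mat n M' i j)" using lift_mat_\<psi>[OF n in_g] by simp
  then show ?thesis using lin_poly_add fin[OF n] y by auto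
qed

lemma lift_mat_scale: "3 \<le> n \<Longrightarrow> M \<in> std_lie T (d n) \<Longrightarrow> lin_poly (lift_mat n (\<lambda>i j. c * M i j)) = const_poly c * lin_poly (lift_mat n M)"
proof -
  assume n: "3 \<le> n" and M: "M \<in> std_lie T (d n)"
  note y = lift_mat[OF n M(1)]
  have in_g: "(\<lambda>i j. c * lift_mat n M i j) \<in> g n" using lie[OF n] y by (auto simp: lie_subalgebra_def)
  have "\<psi> (\<lambda>i j. c * lift_mat n M i j) = (\<lambda>i j. c * M i j)" using \<psi>_scale[OF n] y by auto
  then have "lift_mat n (\<lambda>i j. c * M i j) = (\<lambda>i j. c * lift_mat n M i j)" using lift_mat_\<psi>[OF n in_g] by simp
  then show ?thesis using lin_poly_scale fin[OF n] y by auto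
qed

lemma lift_mat_sum:
  assumes n: "3 \<le> n"
  shows "finite I \<Longrightarrow> (\<And>k. k \<in> I \<Longrightarrow> F k \<in> std_lie T (d n)) \<Longrightarrow>
    lin_poly (lift_mat n (\<lambda>i j. \<Sum>k\<in>I. F k i j)) = (\<Sum>k\<in>I. lin_poly (lift_mat n (F k)))"
proof (induction I rule: finite_induct)
  case empty
  show ?case using lift_mat_scale[OF n std_lie_0, of 0] by (simp add: const_poly_0)
next
  case (insert x I)
  have "F x \<in> std_lie T (d n)" "(\<lambda>i j. \<Sum>k\<in>I. F k i j) \<in> std_lie T (d n)" using insert by (auto intro!: std_lie_sum)
  from lift_mat_add[OF n this] insert show ?case by simp
qed

sublocale A: algebra_over const_poly
  by unfold_locales (auto simp: const_poly_add const_poly_mult const_poly_1)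

definition gens :: "nat \<Rightarrow> 'a entry_poly list" where
  "gens n = (SOME xs. set xs = (\<lambda>x. lin_poly (lift_mat n (proj_T T (d n) (\<lambda>k l. if (k, l) = x then 1 else 0)))) ` ({..<d n} \<times> {..<d n}))"

lemma set_gens: "set (gens n) = (\<lambda>x. lin_poly (lift_mat n (proj_T T (d n) (\<lambda>k l. if (k, l) = x then 1 else 0)))) ` ({..<d n} \<times> {..<d n})"
  unfolding gens_def by (rule someI_ex, rule finite_list) auto

lemma lin_poly_expand:
  assumes n: "3 \<le> n" and M: "M \<in> std_lie T (d n)"
  shows "lin_poly (lift_mat n M) = (\<Sum>x\<in>{..<d n} \<times> {..<d n}. const_poly (M (fst x) (snd x)) *
    lin_poly (lift_mat n (proj_T T (d n) (\<lambda>k l. if (k, l) = x then 1 else 0))))"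
proof -
  let ?P = "\<lambda>x. proj_T T (d n) (\<lambda>k l. if (k, l) = x then 1 else (0::'a))"
  have P: "?P x \<in> std_lie T (d n)" for x using n d_ge[of n] by (intro proj_T_std_lie d_even) auto
  have "M = (\<lambda>i j. \<Sum>x\<in>{..<d n} \<times> {..<d n}. M (fst x) (snd x) * ?P x i j)"
    by (intro ext proj_expand[OF M])
  then have "lin_poly (lift_mat n M) = lin_poly (lift_mat n (\<lambda>i j. \<Sum>x\<in>{..<d n} \<times> {..<d n}. M (fst x) (snd x) * ?P x i j))" by simp
  also have "\<dots> = (\<Sum>x\<in>{..<d n} \<times> {..<d n}. lin_poly (lift_mat n (\<lambda>i j. M (fst x) (snd x) * ?P x i j)))"
    by (rule lift_mat_sum[OF n]) (auto intro: std_lie_scale[OF P])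
  finally show ?thesis by (simp add: lift_mat_scale[OF n P])
qed

lemma subalg_sym_alg: "A.subalg (sym_alg h)"
  by (auto simp: A.subalg_def intro: sym_alg.intros)

lemma sym_alg_fin_gen:
  assumes n: "3 \<le> n"
  shows "sym_alg (g n) = A.fin_gen (gens n)"
proof
  let ?P = "\<lambda>x. proj_T T (d n) (\<lambda>k l. if (k, l) = x then 1 else (0::'a))"
  have P: "?P x \<in> std_lie T (d n)" for x using n d_ge[of n] by (intro proj_T_std_lie d_even) auto
  show "A.fin_gen (gens n) \<subseteq> sym_alg (g n)"
    by (rule A.fin_gen_least[OF subalg_sym_alg]) (use lift_mat[OF n P] in \<open>auto simp: set_gens intro: sym_alg.lin\<close>)
  note F = A.fin_gen_subalg[of "gens n"]
  have lin: "lin_poly X \<in> A.fin_gen (gens n)" if X: "X \<in> g n" for X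
  proof -
    have "lin_poly (lift_mat n (\<psi> X)) \<in> A.fin_gen (gens n)"
      unfolding lin_poly_expand[OF n \<psi>_std_lie[OF n X]]
      by (intro A.sub_sum[OF F] A.sub_mult[OF F] A.sub_\<iota>[OF F] subsetD[OF A.fin_gen_superset]) (auto simp: set_gens)
    then show ?thesis by (simp add: lift_mat_\<psi>[OF n X])
  qed
  show "sym_alg (g n) \<subseteq> A.fin_gen (gens n)"
  proof
    fix p assume "p \<in> sym_alg (g n)"
    then show "p \<in> A.fin_gen (gens n)"
      by (induction rule: sym_alg.induct) (auto intro: A.sub_\<iota>[OF F] lin A.sub_add[OF F] A.sub_mult[OF F])
  qed
qed

text \<open>A character of the finitely generated algebra restricts to a linear form on
  \<open>g n\<close>. Its values on the projected matrix units are the entries of a matrix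
  representing it, and projecting this matrix puts it into the Lie algebra.\<close>

lemma point_exists:
  assumes n: "3 \<le> n" and I: "A.ideal_on (sym_alg (g n)) I"
    and rad: "\<And>q k. q \<in> sym_alg (g n) \<Longrightarrow> q ^ k \<in> I \<Longrightarrow> q \<in> I"
    and p: "p \<in> sym_alg (g n)" "p \<notin> I"
  shows "\<exists>X\<in>std_lie T (d n). (\<forall>f\<in>I. eval_at (d n) X f = 0) \<and> eval_at (d n) X p \<noteq> 0"
proof -
  obtain \<chi> where \<chi>: "A.char_on (sym_alg (g n)) I \<chi>" "\<chi> p \<noteq> 0"
    using A.nullstellensatz[of "gens n" I p] I rad p unfolding sym_alg_fin_gen[OF n] by blast
  have \<chi>h: "\<chi> (const_poly c) = c" "q \<in> sym_alg (g n) \<Longrightarrow> r \<in> sym_alg (g n) \<Longrightarrow> \<chi> (q + r) = \<chi> q + \<chi> r"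
    "q \<in> sym_alg (g n) \<Longrightarrow> r \<in> sym_alg (g n) \<Longrightarrow> \<chi> (q * r) = \<chi> q * \<chi> r" for c q r
    using \<chi>(1) by (auto simp: A.char_on_def)
  let ?P = "\<lambda>x. proj_T T (d n) (\<lambda>k l. if (k, l) = x then 1 else (0::'a))"
  have D0: "0 < d n" using n d_ge[of n] by linarith
  have P: "?P x \<in> std_lie T (d n)" for x using D0 by (intro proj_T_std_lie d_even)
  \<comment> \<open>The index pair is transposed because the trace form pairs the entry (i, j) of
    one factor with the entry (j, i) of the other.\<close>
  define X0 where "X0 i j = \<chi> (lin_poly (lift_mat n (?P (j, i))))" for i j
  define X where "X = proj_T T (d n) X0"
  have X: "X \<in> std_lie T (d n)" unfolding X_def using D0 by (intro proj_T_std_lie d_even)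
  have \<chi>s: "finite I \<Longrightarrow> (\<And>k. k \<in> I \<Longrightarrow> f k \<in> sym_alg (g n)) \<Longrightarrow> \<chi> (sum f I) = (\<Sum>k\<in>I. \<chi> (f k))" for f and I :: "(nat \<times> nat) set"
  proof (induction I rule: finite_induct)
    case empty
    show ?case using \<chi>h(1)[of 0] by (simp add: const_poly_0)
  next
    case (insert x F)
    then show ?case using \<chi>h(2)[of "f x" "sum f F"] sym_alg_sum[of F f "g n"] by simp
  qed
  have gen: "eval_at (d n) X (lin_poly Y) = \<chi> (lin_poly Y)" if Y: "Y \<in> g n" for Y
  proof -
    note M = \<psi>_std_lie[OF n Y]
    have "\<chi> (lin_poly Y) = \<chi> (lin_poly (lift_mat n (\<psi> Y)))" by (simp add: lift_mat_\<psi>[OF n Y])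
    also have "\<dots> = (\<Sum>x\<in>{..<d n} \<times> {..<d n}. \<psi> Y (fst x) (snd x) * X0 (snd x) (fst x))"
      unfolding lin_poly_expand[OF n M] X0_def prod.collapse using lift_mat[OF n P]
      by (subst \<chi>s) (auto simp: \<chi>h sym_alg.const sym_alg.lin intro!: sym_alg.mult sum.cong)
    also have "\<dots> = (\<Sum>i<d n. \<Sum>j<d n. \<psi> Y i j * X0 j i)"
      by (simp add: sum.cartesian_product case_prod_beta)
    also have "\<dots> = trace_prod (d n) X0 (\<psi> Y)" unfolding trace_prod_commute[of _ X0] by (simp add: trace_prod_def)
    also have "\<dots> = trace_prod (d n) X (\<psi> Y)" unfolding X_def by (rule trace_prod_proj[OF d_even M, symmetric])
    finally show ?thesis using eval_at_lin[of Y] g_G[OF n] Y by auto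
  qed
  have eq: "eval_at (d n) X q = \<chi> q" if "q \<in> sym_alg (g n)" for q
    by (rule hom_unique[OF _ _ _ _ that]) (auto simp: \<chi>h eval_at_simps gen)
  have "eval_at (d n) X f = 0" if "f \<in> I" for f
    using that eq[of f] I \<chi>(1) by (auto simp: A.ideal_on_def A.char_on_def)
  then show ?thesis using X eq[OF p(1)] \<chi>(2) by (intro bexI[of _ X]) auto
qed

end

section \<open>Flows on the zero sets of a Poisson ideal\<close>

locale poisson_model = chain_model T g \<psi>
  for T :: cartan_type and g :: "nat \<Rightarrow> 'a::{alg_closed_field, field_char_0} infmat set" and \<psi> :: "'a infmat \<Rightarrow> 'a infmat" +
  fixes J :: "'a entry_poly set"
  assumes pois: "poisson_ideal G J" and rad: "radical_ideal G J"
begin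

lemma J_ideal: "ideal J (sym_ring G)"
  using pois by (simp add: poisson_ideal_def)

lemmas J_props = sym_ring_ideal[OF J_ideal]

lemma J_minus: "p \<in> J \<Longrightarrow> q \<in> J \<Longrightarrow> p - q \<in> J"
  using J_props(3)[of p "- q"] J_props(5)[of q] by simp

lemma one_notin_J: "1 \<notin> J"
proof
  assume "1 \<in> J"
  then have "s \<in> J" if "s \<in> sym_alg G" for s using J_props(4)[OF that] by force
  then show False using J_props(1) pois by (auto simp: poisson_ideal_def)
qed

definition zeros :: "nat \<Rightarrow> 'a infmat set" where
  "zeros N = {X \<in> std_gl T (d N). \<forall>f\<in>J \<inter> sym_alg (g N). eval_at (d N) X f = 0}"

lemma sym_alg_gG: "3 \<le> n \<Longrightarrow> p \<in> sym_alg (g n) \<Longrightarrow> p \<in> sym_alg G"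
  using sym_alg_mono g_G by blast

lemma J_ideal_on: "3 \<le> n \<Longrightarrow> A.ideal_on (sym_alg (g n)) (J \<inter> sym_alg (g n))"
  using J_props sym_alg_gG by (auto simp: A.ideal_on_def sym_alg_0 intro: sym_alg.intros)

text \<open>The Nullstellensatz for the part of \<open>J\<close> at level \<open>n\<close>, which is
  again a radical ideal, now in a finitely generated algebra.\<close>

lemma zeros_separates:
  assumes n: "3 \<le> n" and p: "p \<in> sym_alg (g n)" "p \<notin> J"
  shows "\<exists>X\<in>zeros n. X \<in> std_lie T (d n) \<and> eval_at (d n) X p \<noteq> 0"
proof -
  have r: "q \<in> J \<inter> sym_alg (g n)" if "q \<in> sym_alg (g n)" "q ^ k \<in> J \<inter> sym_alg (g n)" for q k
    using that rad sym_alg_gG[OF n] unfolding radical_ideal_def by blast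
  have "p \<notin> J \<inter> sym_alg (g n)" using p by simp
  have "\<exists>X\<in>std_lie T (d n). (\<forall>f\<in>J \<inter> sym_alg (g n). eval_at (d n) X f = 0) \<and> eval_at (d n) X p \<noteq> 0"
    by (rule point_exists[OF n J_ideal_on[OF n] _ p(1) \<open>p \<notin> J \<inter> sym_alg (g n)\<close>]) (rule r)
  then obtain X where "X \<in> std_lie T (d n)" "\<forall>f\<in>J \<inter> sym_alg (g n). eval_at (d n) X f = 0" "eval_at (d n) X p \<noteq> 0" by blast
  then show ?thesis by (intro bexI[of _ X]) (auto simp: zeros_def std_lie_def)
qed

lemma zeros_nonempty: "3 \<le> n \<Longrightarrow> zeros n \<noteq> {}"
  using zeros_separates[of n 1] one_notin_J sym_alg_1 by auto

lemma zeros_vanish: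
  assumes n: "3 \<le> n" and p: "p \<in> sym_alg (g n)" "\<And>X. X \<in> zeros n \<Longrightarrow> eval_at (d n) X p = 0"
  shows "p \<in> J"
  using zeros_separates[OF n p(1)] p(2) by auto

lemma derivation_exists:
  assumes n: "3 \<le> n" and a: "a \<in> g n"
  shows "\<exists>\<delta>. (\<forall>c. \<delta> (const_poly c) = 0) \<and> (\<forall>Y\<in>g n. \<delta> (lin_poly Y) = lin_poly (inf_bracket a Y)) \<and>
    (\<forall>p\<in>sym_alg (g n). \<forall>q\<in>sym_alg (g n). \<delta> (p + q) = \<delta> p + \<delta> q \<and> \<delta> (p * q) = \<delta> p * q + p * \<delta> q) \<and>
    (\<forall>p\<in>sym_alg (g n). \<delta> p \<in> sym_alg (g n)) \<and> (\<forall>p\<in>J \<inter> sym_alg (g n). \<delta> p \<in> J \<inter> sym_alg (g n))"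
proof -
  have "a \<in> G" using a g_G[OF n] by auto
  then obtain \<delta> where ad: "adjoint_action G a \<delta>" "\<delta> ` J \<subseteq> J" using pois unfolding poisson_ideal_def by blast
  have ad': "\<delta> (const_poly c) = 0" "Y \<in> g n \<Longrightarrow> \<delta> (lin_poly Y) = lin_poly (inf_bracket a Y)"
    "p \<in> sym_alg (g n) \<Longrightarrow> q \<in> sym_alg (g n) \<Longrightarrow> \<delta> (p + q) = \<delta> p + \<delta> q \<and> \<delta> (p * q) = \<delta> p * q + p * \<delta> q" for c Y p q
    using ad(1) g_G[OF n] sym_alg_gG[OF n] by (auto simp: adjoint_action_def)
  have br: "inf_bracket a Y \<in> g n" if "Y \<in> g n" for Y using lie[OF n] a that by (auto simp: lie_subalgebra_def)
  have "\<delta> p \<in> sym_alg (g n)" if "p \<in> sym_alg (g n)" for p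
    using that by (induction rule: sym_alg.induct) (auto simp: ad' sym_alg_0 br intro: sym_alg.intros)
  then show ?thesis using ad' ad(2) by (intro exI[of _ \<delta>]) auto
qed

context
  fixes N :: nat and a :: "'a infmat" and k :: 'a and X :: "'a infmat"
  assumes N: "3 \<le> N" and a: "a \<in> std_lie T (d N)"
    and a3: "\<And>i j. i < d N \<Longrightarrow> j < d N \<Longrightarrow> mprod (d N) a (mprod (d N) a a) i j = k * a i j"
    and X: "X \<in> zeros N"
begin

text \<open>The matrix \<open>fM / fden\<^sup>2\<close> is the conjugate \<open>X\<^sub>t\<close> of \<open>X\<close> by the Cayley-like curve \<open>fN\<close>. It satisfies
  \<open>X\<^sub>t' = (2 / fden) [a, X\<^sub>t]\<close>, so the power series \<open>f\<theta> f\<close> of the values of \<open>f\<close> along the curve satisfies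
  a linear differential equation involving \<open>{a, f} \<in> J\<close>; hence all its coefficients vanish.\<close>

definition "fD = d N"
definition "fA i j = [:a i j:]"
definition "fA2 = mprod fD fA fA"
definition "fx = [:0, 1 :: 'a:]"
definition "fden = 1 - [:k:] * fx\<^sup>2"
definition "fN S i j = fden * (if i = j then 1 else 0) + 2 * S * fx * fA i j + 2 * fx\<^sup>2 * fA2 i j"
definition "fM i j = (\<Sum>p<fD. \<Sum>q<fD. fN 1 i p * [:X p q:] * fN (- 1) q j)"
definition "fW = inverse (fps_of_poly fden)"
definition "fZ i j = fW\<^sup>2 * fps_of_poly (fM i j)"
definition "f\<theta> = ring_eval fps_const fD fZ"

lemma const_sum: "[:sum f I:] = (\<Sum>i\<in>I. [:f i:])"
proof (induction I rule: infinite_finite_induct)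
  case (insert x F)
  have "[:f x + sum f F:] = [:f x:] + [:sum f F:]" by simp
  then show ?case using insert by simp
qed simp_all

lemma fA2: "fA2 i j = [:mprod fD a a i j:]"
  by (simp add: fA2_def fA_def mprod_def const_sum mult.commute)

lemma fA3: "i < fD \<Longrightarrow> j < fD \<Longrightarrow> mprod fD fA fA2 i j = [:k:] * fA i j"
  using a3[of i j] by (simp add: mprod_def fA2[unfolded mprod_def] fA_def const_sum[symmetric] fD_def mult.commute)

lemma fA3': "i < fD \<Longrightarrow> j < fD \<Longrightarrow> mprod fD fA2 fA i j = [:k:] * fA i j"
  using fA3[of i j] by (simp add: fA2_def mprod_assoc)

lemma sum_if_mult: 
  fixes f :: "nat \<Rightarrow> 'k::comm_ring_1"
  assumes "j < D" shows "(\<Sum>p<D. f p * (if p = j then 1 else 0)) = f j" "(\<Sum>p<D. (if j = p then 1 else 0) * f p) = f j"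
    "(\<Sum>p<D. f p * (if j = p then 1 else 0)) = f j" "(\<Sum>p<D. (if p = j then 1 else 0) * f p) = f j"
  using assms by (auto simp: if_distrib[of "\<lambda>x. x * _"] if_distrib[of "(*) _"] cong: if_cong)

lemma fAN:
  assumes "i < fD" "j < fD"
  shows "mprod fD fA (fN S) i j = fden * fA i j + 2 * S * fx * fA2 i j + 2 * fx\<^sup>2 * ([:k:] * fA i j)"
    "mprod fD (fN S) fA i j = fden * fA i j + 2 * S * fx * fA2 i j + 2 * fx\<^sup>2 * ([:k:] * fA i j)"
proof -
  have "mprod fD fA (fN S) i j = (\<Sum>p<fD. fden * (fA i p * (if p = j then 1 else 0)) + 2 * S * fx * (fA i p * fA p j) + 2 * fx\<^sup>2 * (fA i p * fA2 p j))"
    unfolding mprod_def fN_def by (intro sum.cong refl) (simp add: algebra_simps)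
  then show "mprod fD fA (fN S) i j = fden * fA i j + 2 * S * fx * fA2 i j + 2 * fx\<^sup>2 * ([:k:] * fA i j)"
    using fA3[OF assms] assms by (simp only: sum.distrib sum_distrib_left[symmetric] sum_if_mult) (simp add: fA2_def mprod_def)
  have "mprod fD (fN S) fA i j = (\<Sum>p<fD. fden * ((if i = p then 1 else 0) * fA p j) + 2 * S * fx * (fA i p * fA p j) + 2 * fx\<^sup>2 * (fA2 i p * fA p j))"
    unfolding mprod_def fN_def by (intro sum.cong refl) (simp add: algebra_simps)
  then show "mprod fD (fN S) fA i j = fden * fA i j + 2 * S * fx * fA2 i j + 2 * fx\<^sup>2 * ([:k:] * fA i j)"
    using fA3'[OF assms] assms by (simp only: sum.distrib sum_distrib_left[symmetric] sum_if_mult) (simp add: fA2_def mprod_def)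
qed

text \<open>\<open>fN S\<close> divided by \<open>fden\<close> is the Cayley transform (1 + S x a) /
  (1 - S x a), simplified by a^3 = k a. Its logarithmic derivative 2 S a / (1 - x^2 a^2) equals 2 S
  a divided by \<open>fden\<close>, by the same relation.\<close>

lemma fN_deriv:
  assumes "i < fD" "j < fD" and S: "S = 1 \<or> S = - 1"
  shows "fden * pderiv (fN S i j) = pderiv fden * fN S i j + 2 * S * mprod fD fA (fN S) i j"
    "mprod fD fA (fN S) i j = mprod fD (fN S) fA i j"
proof -
  have x: "pderiv fx = 1" by (simp add: fx_def pderiv_pCons)
  have c: "pderiv (fA i j) = 0" "pderiv (fA2 i j) = 0" "pderiv (if i = j then 1 else (0 :: 'a poly)) = 0" "pderiv S = 0" "pderiv [:k:] = 0" "pderiv (2 :: 'a poly) = 0"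
    using S pderiv_of_nat[of 2] by (auto simp: fA_def fA2 pderiv_pCons pderiv_minus)
  have dd: "pderiv fden = - (2 * [:k:] * fx)"
    unfolding fden_def by (simp only: pderiv_diff pderiv_1 pderiv_mult power2_eq_square x c) (simp add: algebra_simps)
  have dN: "pderiv (fN S i j) = pderiv fden * (if i = j then 1 else 0) + 2 * S * fA i j + 4 * fx * fA2 i j"
    unfolding fN_def by (simp only: pderiv_add pderiv_mult power2_eq_square x c) (simp add: algebra_simps)
  have SS: "S * S = 1" using S by auto
  have S2: "2 * S * (fden * fA i j + 2 * S * fx * fA2 i j + 2 * fx\<^sup>2 * ([:k:] * fA i j)) =
     2 * S * fden * fA i j + 4 * (S * S) * fx * fA2 i j + 4 * S * fx\<^sup>2 * [:k:] * fA i j"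
    by (simp add: algebra_simps)
  show "fden * pderiv (fN S i j) = pderiv fden * fN S i j + 2 * S * mprod fD fA (fN S) i j"
    unfolding fAN(1)[OF assms(1,2)] dN dd S2 SS unfolding fN_def fden_def
    by (simp add: algebra_simps power2_eq_square del: mult_pCons_left mult_pCons_right)
  show "mprod fD fA (fN S) i j = mprod fD (fN S) fA i j" using fAN[OF assms(1,2)] by simp
qed

lemma fM_deriv:
  assumes ij: "i < fD" "j < fD"
  shows "fden * pderiv (fM i j) = 2 * pderiv fden * fM i j + 2 * (mprod fD fA fM i j - mprod fD fM fA i j)"
proof -
  have dM: "fden * pderiv (fM i j) = (\<Sum>p<fD. \<Sum>q<fD. (fden * pderiv (fN 1 i p)) * [:X p q:] * fN (- 1) q j +
      fN 1 i p * [:X p q:] * (fden * pderiv (fN (- 1) q j)))"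
  proof -
    have "pderiv (sum f I) = (\<Sum>p\<in>I. pderiv (f p))" for f :: "nat \<Rightarrow> 'a poly" and I
      by (induction I rule: infinite_finite_induct) (auto simp: pderiv_add)
    moreover have "pderiv (fN 1 i p * [:X p q:] * fN (- 1) q j) = pderiv (fN 1 i p) * [:X p q:] * fN (- 1) q j +
      fN 1 i p * [:X p q:] * pderiv (fN (- 1) q j)" for p q
      using pderiv_pCons[of "X p q" 0] by (simp only: pderiv_mult) (simp add: algebra_simps)
    ultimately show ?thesis unfolding fM_def sum_distrib_left
      by (simp only: sum_distrib_left) (intro sum.cong refl, simp add: distrib_left mult_ac)
  qed
  also have "\<dots> = (\<Sum>p<fD. \<Sum>q<fD. 2 * pderiv fden * (fN 1 i p * [:X p q:] * fN (- 1) q j) +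
      (2 * (mprod fD fA (fN 1) i p * [:X p q:] * fN (- 1) q j) - 2 * (fN 1 i p * [:X p q:] * mprod fD (fN (- 1)) fA q j)))"
  proof (intro sum.cong refl)
    fix p q assume "p \<in> {..<fD}" "q \<in> {..<fD}"
    then have "p < fD" "q < fD" by auto
    note e = fN_deriv(1)[OF ij(1) this(1) disjI1[OF refl]] fN_deriv[OF this(2) ij(2) disjI2[OF refl]]
    show "(fden * pderiv (fN 1 i p)) * [:X p q:] * fN (- 1) q j + fN 1 i p * [:X p q:] * (fden * pderiv (fN (- 1) q j)) =
       2 * pderiv fden * (fN 1 i p * [:X p q:] * fN (- 1) q j) +
      (2 * (mprod fD fA (fN 1) i p * [:X p q:] * fN (- 1) q j) - 2 * (fN 1 i p * [:X p q:] * mprod fD (fN (- 1)) fA q j))"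
      unfolding e by (simp add: algebra_simps del: mult_pCons_left mult_pCons_right)
  qed
  also have "\<dots> = 2 * pderiv fden * fM i j + (2 * (\<Sum>p<fD. \<Sum>q<fD. mprod fD fA (fN 1) i p * [:X p q:] * fN (- 1) q j)
     - 2 * (\<Sum>p<fD. \<Sum>q<fD. fN 1 i p * [:X p q:] * mprod fD (fN (- 1)) fA q j))"
    by (simp only: sum.distrib sum_subtractf sum_distrib_left[symmetric] fM_def)
  also have "(\<Sum>p<fD. \<Sum>q<fD. mprod fD fA (fN 1) i p * [:X p q:] * fN (- 1) q j) = mprod fD fA fM i j"
  proof -
    have "mprod fD fA fM i j = (\<Sum>r<fD. \<Sum>p<fD. \<Sum>q<fD. fA i r * fN 1 r p * [:X p q:] * fN (- 1) q j)"
      by (simp only: mprod_def fM_def sum_distrib_left mult.assoc)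
    also have "\<dots> = (\<Sum>p<fD. \<Sum>r<fD. \<Sum>q<fD. fA i r * fN 1 r p * [:X p q:] * fN (- 1) q j)" by (rule sum.swap)
    also have "\<dots> = (\<Sum>p<fD. \<Sum>q<fD. \<Sum>r<fD. fA i r * fN 1 r p * [:X p q:] * fN (- 1) q j)" by (intro sum.cong refl sum.swap)
    finally show ?thesis by (simp only: mprod_def sum_distrib_right)
  qed
  also have "(\<Sum>p<fD. \<Sum>q<fD. fN 1 i p * [:X p q:] * mprod fD (fN (- 1)) fA q j) = mprod fD fM fA i j"
  proof -
    have "mprod fD fM fA i j = (\<Sum>r<fD. \<Sum>p<fD. \<Sum>q<fD. fN 1 i p * [:X p q:] * (fN (- 1) q r * fA r j))"
      by (simp only: mprod_def fM_def sum_distrib_right mult.assoc)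
    also have "\<dots> = (\<Sum>p<fD. \<Sum>r<fD. \<Sum>q<fD. fN 1 i p * [:X p q:] * (fN (- 1) q r * fA r j))" by (rule sum.swap)
    also have "\<dots> = (\<Sum>p<fD. \<Sum>q<fD. \<Sum>r<fD. fN 1 i p * [:X p q:] * (fN (- 1) q r * fA r j))" by (intro sum.cong refl sum.swap)
    finally show ?thesis by (simp only: mprod_def sum_distrib_left)
  qed
  finally show ?thesis by (simp only: right_diff_distrib)
qed

lemma fden_0: "fps_nth (fps_of_poly fden) 0 = 1"
  by (simp add: fden_def fx_def power2_eq_square poly_0_coeff_0[symmetric])

lemma fW: "fW * fps_of_poly fden = 1"
  unfolding fW_def by (rule inverse_mult_eq_1) (simp only: fden_0 one_neq_zero not_False_eq_True)

lemma fW_0: "fps_nth fW 0 = 1"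
  unfolding fW_def fps_inverse_nth_0 fden_0 by simp

lemma fZ_deriv:
  assumes ij: "i < fD" "j < fD"
  shows "fps_deriv (fZ i j) = 2 * fW * (mprod fD (\<lambda>i j. fps_const (a i j)) fZ i j - mprod fD fZ (\<lambda>i j. fps_const (a i j)) i j)"
proof -
  let ?d = "fps_of_poly fden" and ?M = "fps_of_poly (fM i j)"
  let ?B = "fps_of_poly (mprod fD fA fM i j - mprod fD fM fA i j)"
  have 1: "?d * fps_deriv ?M = 2 * fps_deriv ?d * ?M + 2 * ?B"
    using arg_cong[OF fM_deriv[OF ij], of fps_of_poly]
    by (simp add: fps_of_poly_mult fps_of_poly_add fps_of_poly_diff fps_of_poly_pderiv)
  have dW: "fps_deriv fW = - fps_deriv ?d * fW\<^sup>2"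
    unfolding fW_def by (rule fps_inverse_deriv) (simp only: fden_0 one_neq_zero not_False_eq_True)
  have "fps_deriv (fZ i j) = 2 * fW * fps_deriv fW * ?M + fW\<^sup>2 * fps_deriv ?M"
    by (simp add: fZ_def power2_eq_square algebra_simps)
  also have "\<dots> = fW ^ 3 * ((fW * ?d) * 0 - 2 * fps_deriv ?d * ?M) + fW\<^sup>2 * (fW * ?d) * fps_deriv ?M"
    unfolding dW fW by (simp add: power2_eq_square power3_eq_cube algebra_simps)
  also have "\<dots> = fW ^ 3 * (?d * fps_deriv ?M - 2 * fps_deriv ?d * ?M)"
    by (simp add: power2_eq_square power3_eq_cube algebra_simps)
  also have "\<dots> = 2 * fW * (fW\<^sup>2 * ?B)"
    unfolding 1 by (simp add: power2_eq_square power3_eq_cube algebra_simps)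
  also have "fW\<^sup>2 * ?B = mprod fD (\<lambda>i j. fps_const (a i j)) fZ i j - mprod fD fZ (\<lambda>i j. fps_const (a i j)) i j"
    unfolding mprod_def fZ_def fA_def
    by (simp add: fps_of_poly_diff fps_of_poly_sum fps_of_poly_mult fps_of_poly_const fps_of_poly_smult right_diff_distrib sum_distrib_left mult_ac)
  finally show ?thesis .
qed

lemma coeff_hom_fps: "coeff_hom (fps_const :: 'a \<Rightarrow> 'a fps)"
  by unfold_locales auto

lemmas f\<theta>_simps = ring_eval_add[OF coeff_hom_fps, of fD fZ, folded f\<theta>_def] ring_eval_mult[OF coeff_hom_fps, of fD fZ, folded f\<theta>_def]
  ring_eval_const[OF coeff_hom_fps, of fD fZ, folded f\<theta>_def] ring_eval_lin[OF coeff_hom_fps, of _ fD fZ, folded f\<theta>_def]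

text \<open>Invariance of the trace form moves the bracket with \<open>a\<close> from the curve to
  \<open>Y\<close>, which accounts for the sign.\<close>

lemma f\<theta>_lin_deriv:
  assumes Y: "Y \<in> g N"
  shows "fps_deriv (f\<theta> (lin_poly Y)) = - 2 * fW * f\<theta> (lin_poly (inf_bracket (lift_mat N a) Y))"
proof -
  let ?a = "\<lambda>i j. fps_const (a i j)" and ?Y = "\<lambda>i j. fps_const (\<psi> Y i j)"
  note ya = lift_mat[OF N a]
  have YG: "Y \<in> G" and bG: "inf_bracket (lift_mat N a) Y \<in> G"
    using Y g_G[OF N] lie[OF N] ya by (auto simp: lie_subalgebra_def)
  have b: "(\<lambda>i j. fps_const (\<psi> (inf_bracket (lift_mat N a) Y) i j)) = (\<lambda>i j. mprod fD ?a ?Y i j - mprod fD ?Y ?a i j)"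
  proof -
    have s: "fps_const (sum f I) = (\<Sum>i\<in>I. fps_const (f i))" for f :: "nat \<Rightarrow> 'a" and I
      by (induction I rule: infinite_finite_induct) (auto simp: fps_const_add[symmetric] simp del: fps_const_add)
    show ?thesis using \<psi>_bracket[OF N, of "lift_mat N a" Y] ya Y
      by (simp add: fD_def mprod_def fps_const_sub[symmetric] s fps_const_mult[symmetric] del: fps_const_sub fps_const_mult)
  qed
  have ds: "fps_deriv (sum f I) = (\<Sum>i\<in>I. fps_deriv (f i))" for f :: "nat \<Rightarrow> 'a fps" and I
    by (induction I rule: infinite_finite_induct) auto
  have "fps_deriv (f\<theta> (lin_poly Y)) = (\<Sum>i<fD. \<Sum>j<fD. fps_deriv (fZ i j) * ?Y j i)"
    unfolding f\<theta>_simps(4)[OF YG] trace_prod_def by (simp add: ds)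
  also have "\<dots> = (\<Sum>i<fD. \<Sum>j<fD. 2 * fW * ((mprod fD ?a fZ i j - mprod fD fZ ?a i j) * ?Y j i))"
    by (intro sum.cong refl) (simp add: fZ_deriv mult.assoc)
  also have "\<dots> = 2 * fW * (trace_prod fD (mprod fD ?a fZ) ?Y - trace_prod fD (mprod fD fZ ?a) ?Y)"
    unfolding trace_prod_def by (simp only: sum_distrib_left[symmetric] left_diff_distrib sum_subtractf)
  also have "trace_prod fD (mprod fD ?a fZ) ?Y = trace_prod fD fZ (mprod fD ?Y ?a)"
    unfolding trace_prod_mprod[of fD ?a] trace_prod_commute[of fD ?a] by (rule trace_prod_mprod)
  also have "trace_prod fD (mprod fD fZ ?a) ?Y = trace_prod fD fZ (mprod fD ?a ?Y)" by (rule trace_prod_mprod)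
  also have "trace_prod fD fZ (mprod fD ?Y ?a) - trace_prod fD fZ (mprod fD ?a ?Y) = - trace_prod fD fZ (\<lambda>i j. mprod fD ?a ?Y i j - mprod fD ?Y ?a i j)"
    unfolding trace_prod_def by (simp add: right_diff_distrib sum_subtractf)
  finally show ?thesis unfolding f\<theta>_simps(4)[OF bG] b by simp
qed

lemma f\<theta>_zero:
  assumes f: "f \<in> J \<inter> sym_alg (g N)"
  shows "f\<theta> f = 0"
proof -
  obtain \<delta> where \<delta>: "\<forall>c. \<delta> (const_poly c) = 0" "\<forall>Y\<in>g N. \<delta> (lin_poly Y) = lin_poly (inf_bracket (lift_mat N a) Y)"
    "\<forall>p\<in>sym_alg (g N). \<forall>q\<in>sym_alg (g N). \<delta> (p + q) = \<delta> p + \<delta> q \<and> \<delta> (p * q) = \<delta> p * q + p * \<delta> q"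
    "\<forall>p\<in>sym_alg (g N). \<delta> p \<in> sym_alg (g N)" "\<forall>p\<in>J \<inter> sym_alg (g N). \<delta> p \<in> J \<inter> sym_alg (g N)"
    using derivation_exists[OF N, of "lift_mat N a"] lift_mat[OF N a] by auto
  have deriv: "fps_deriv (f\<theta> p) = - 2 * fW * f\<theta> (\<delta> p)" if "p \<in> sym_alg (g N)" for p
    using that
  proof (induction rule: sym_alg.induct)
    case (const c)
    have "f\<theta> 0 = 0" using f\<theta>_simps(3)[of 0] by (simp add: const_poly_0)
    then show ?case using \<delta>(1) by (simp add: f\<theta>_simps)
  next
    case (lin X)
    then show ?case using \<delta>(2) f\<theta>_lin_deriv by simp
  next
    case (add p q)
    then show ?case using \<delta>(3) by (simp add: f\<theta>_simps distrib_left)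
  next
    case (mult p q)
    then show ?case using \<delta>(3) by (simp add: f\<theta>_simps algebra_simps)
  qed
  have at0: "fps_nth (f\<theta> p) 0 = eval_at fD X p" if "p \<in> sym_alg (g N)" for p
  proof (rule hom_unique[OF _ _ _ _ that])
    fix Y assume "Y \<in> g N"
    then have YG: "Y \<in> G" using g_G[OF N] by auto
    have n0: "fps_nth (fps_of_poly (fN S i j)) 0 = (if i = j then 1 else 0)" for S i j
      by (simp add: fN_def fden_def fx_def power2_eq_square mult.assoc coeff_mult)
    have "fps_nth (fZ i j) 0 = X i j" if "i < fD" "j < fD" for i j
    proof -
      have "fps_nth (fps_of_poly (fM i j)) 0 = (\<Sum>p<fD. \<Sum>q<fD. (if i = p then 1 else 0) * (X p q * (if q = j then 1 else 0)))"
        unfolding fM_def using n0 by (simp add: coeff_sum coeff_mult mult_ac)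
      also have "\<dots> = X i j" using that by (simp only: sum_distrib_left[symmetric] sum_if_mult)
      finally show ?thesis by (simp add: fZ_def fW_0 power2_eq_square)
    qed
    then show "fps_nth (f\<theta> (lin_poly Y)) 0 = eval_at fD X (lin_poly Y)"
      unfolding f\<theta>_simps(4)[OF YG] eval_at_lin[OF YG] trace_prod_def by (simp add: fps_sum_nth)
  qed (auto simp: f\<theta>_simps eval_at_simps)
  have "\<forall>f\<in>J \<inter> sym_alg (g N). fps_nth (f\<theta> f) m = 0" for m
  proof (induction m rule: less_induct)
    case (less m)
    show ?case
    proof
      fix f assume f: "f \<in> J \<inter> sym_alg (g N)"
      show "fps_nth (f\<theta> f) m = 0"
      proof (cases m)
        case 0
        then show ?thesis using f at0[of f] X by (auto simp: zeros_def fD_def)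
      next
        case (Suc l)
        \<comment> \<open>The coefficient of index \<open>l + 1\<close> is determined by lower
          coefficients of the series of \<open>\<delta> f\<close>, which is in \<open>J\<close>
          again. Characteristic zero permits the division by \<open>l + 1\<close>.\<close>
        have "of_nat (Suc l) * fps_nth (f\<theta> f) (Suc l) = fps_nth (fps_deriv (f\<theta> f)) l" by simp
        also have "\<dots> = (\<Sum>i\<le>l. fps_nth (- 2 * fW) i * fps_nth (f\<theta> (\<delta> f)) (l - i))"
          using deriv[of f] f by (simp only: fps_mult_nth Int_iff atLeast0AtMost)
        also have "\<dots> = 0"
        proof (rule sum.neutral, rule ballI)
          fix i assume "i \<in> {..l}"
          then have "l - i < m" using Suc by auto
          then show "fps_nth (- 2 * fW) i * fps_nth (f\<theta> (\<delta> f)) (l - i) = 0" using less \<delta>(5) f by simp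
        qed
        finally show ?thesis using Suc by (simp del: of_nat_Suc)
      qed
    qed
  qed
  then show ?thesis using f by (intro fps_ext) simp
qed

text \<open>Along the curve every value is a rational function whose denominator is a power of
  \<open>fden\<close>. Its numerator \<open>P\<close> is a polynomial whose power series is already
  known to vanish, so \<open>P\<close> itself is 0 and may be evaluated at \<tau>.\<close>

lemma flow_vanish:
  assumes \<tau>: "poly fden \<tau> \<noteq> 0" and f: "f \<in> J \<inter> sym_alg (g N)"
  shows "eval_at fD (\<lambda>i j. poly (fM i j) \<tau> / (poly fden \<tau>)\<^sup>2) f = 0"
proof -
  let ?X = "\<lambda>i j. poly (fM i j) \<tau> / (poly fden \<tau>)\<^sup>2"
  have *: "\<exists>m P. fps_of_poly P = fps_of_poly (fden ^ m) * f\<theta> p \<and> poly P \<tau> = poly fden \<tau> ^ m * eval_at fD ?X p" if "p \<in> sym_alg (g N)" for p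
    using that
  proof (induction rule: sym_alg.induct)
    case (const c)
    then show ?case by (intro exI[of _ 0] exI[of _ "[:c:]"]) (simp add: f\<theta>_simps eval_at_simps fps_of_poly_const)
  next
    case (lin Y)
    then have YG: "Y \<in> G" using g_G[OF N] by auto
    let ?P = "\<Sum>i<fD. \<Sum>j<fD. fM i j * [:\<psi> Y j i:]"
    have WW: "fps_of_poly fden * (fps_of_poly fden * (fW * (fW * x))) = x" for x
    proof -
      have "fps_of_poly fden * (fps_of_poly fden * (fW * (fW * x))) = (fW * fps_of_poly fden) * ((fW * fps_of_poly fden) * x)"
        by (simp only: mult_ac)
      then show ?thesis by (simp add: fW)
    qed
    have "fps_of_poly (fden ^ 2) * f\<theta> (lin_poly Y) = fps_of_poly ?P"
      unfolding f\<theta>_simps(4)[OF YG] trace_prod_def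
      by (simp add: fps_of_poly_sum fps_of_poly_mult fps_of_poly_const sum_distrib_left fZ_def power2_eq_square mult.assoc WW fps_of_poly_smult)
        (simp add: mult.commute)
    moreover have "poly ?P \<tau> = poly fden \<tau> ^ 2 * eval_at fD ?X (lin_poly Y)"
      unfolding eval_at_lin[OF YG] trace_prod_def using \<tau> by (simp add: poly_sum sum_distrib_left mult.commute)
    ultimately show ?case by (intro exI[of _ 2] exI[of _ ?P]) simp
  next
    case (add p q)
    then obtain m P l Q where *: "fps_of_poly P = fps_of_poly (fden ^ m) * f\<theta> p" "poly P \<tau> = poly fden \<tau> ^ m * eval_at fD ?X p"
      "fps_of_poly Q = fps_of_poly (fden ^ l) * f\<theta> q" "poly Q \<tau> = poly fden \<tau> ^ l * eval_at fD ?X q" by blast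
    show ?case
      by (intro exI[of _ "m + l"] exI[of _ "fden ^ l * P + fden ^ m * Q"])
        (simp add: fps_of_poly_add fps_of_poly_mult * power_add f\<theta>_simps eval_at_simps algebra_simps)
  next
    case (mult p q)
    then obtain m P l Q where *: "fps_of_poly P = fps_of_poly (fden ^ m) * f\<theta> p" "poly P \<tau> = poly fden \<tau> ^ m * eval_at fD ?X p"
      "fps_of_poly Q = fps_of_poly (fden ^ l) * f\<theta> q" "poly Q \<tau> = poly fden \<tau> ^ l * eval_at fD ?X q" by blast
    show ?case
      by (intro exI[of _ "m + l"] exI[of _ "P * Q"])
        (simp add: fps_of_poly_mult * power_add f\<theta>_simps eval_at_simps algebra_simps)
  qed
  have "f \<in> sym_alg (g N)" using f by simp
  from *[OF this] obtain m P where P: "fps_of_poly P = fps_of_poly (fden ^ m) * f\<theta> f" "poly P \<tau> = poly fden \<tau> ^ m * eval_at fD ?X f"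
    by blast
  then have "P = 0" using f\<theta>_zero[OF f] by (simp add: fps_of_poly_eq_iff[of P 0, simplified])
  then show ?thesis using P(2) \<tau> by simp
qed

end

end

lemma coeff_mult_bounds:
  fixes p q :: "'a::comm_ring_1 poly"
  assumes "degree p \<le> m" "degree q \<le> n"
  shows "coeff (p * q) (m + n) = coeff p m * coeff q n"
proof -
  have "(\<Sum>i\<le>m + n. coeff p i * coeff q (m + n - i)) = (\<Sum>i\<in>{m}. coeff p i * coeff q (m + n - i))"
  proof (rule sum.mono_neutral_right)
    show "\<forall>i\<in>{..m + n} - {m}. coeff p i * coeff q (m + n - i) = 0"
    proof
      fix i assume "i \<in> {..m + n} - {m}"
      then have "i > m \<or> m + n - i > n" by auto
      then show "coeff p i * coeff q (m + n - i) = 0" using assms by (auto simp: coeff_eq_0)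
    qed
  qed auto
  then show ?thesis by (simp add: coeff_mult)
qed

section \<open>Two special flows: exchange of coordinates and quadratic paths\<close>

context poisson_model
begin

definition flow_num :: "nat \<Rightarrow> 'a infmat \<Rightarrow> 'a \<Rightarrow> 'a \<Rightarrow> 'a \<Rightarrow> 'a infmat" where
  "flow_num D a k \<tau> s i j = (if i = j then 1 - k * \<tau>\<^sup>2 else 0) + 2 * s * \<tau> * a i j + 2 * \<tau>\<^sup>2 * mprod D a a i j"

lemma flow_zeros:
  assumes N: "3 \<le> N" and a: "a \<in> std_lie T (d N)"
    and a3: "\<And>i j. i < d N \<Longrightarrow> j < d N \<Longrightarrow> mprod (d N) a (mprod (d N) a a) i j = k * a i j"
    and X: "X \<in> zeros N" and \<tau>: "1 - k * \<tau>\<^sup>2 \<noteq> 0"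
  shows "(\<lambda>i j. mprod (d N) (mprod (d N) (flow_num (d N) a k \<tau> 1) X) (flow_num (d N) a k \<tau> (- 1)) i j / (1 - k * \<tau>\<^sup>2)\<^sup>2) \<in> zeros N"
    (is "?Y \<in> _")
proof -
  let ?D = "d N"
  have fDN: "fD N = d N" by (rule fD_def[OF N a _ X]) (rule a3)
  note fdefs = fden_def[OF N a a3 X] fx_def[OF N a a3 X] fN_def[OF N a a3 X] fA2[OF N a a3 X] fA_def[OF N a a3 X]
    fDN fM_def[OF N a a3 X]
  have den: "poly (fden k) \<tau> = 1 - k * \<tau>\<^sup>2" by (simp add: fdefs power2_eq_square)
  have gmN: "poly (fN N a k S i j) \<tau> = flow_num ?D a k \<tau> (poly S \<tau>) i j" for S i j
    unfolding fdefs(3) poly_add poly_mult den by (simp add: flow_num_def fdefs power2_eq_square mult_ac)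
  have Y: "?Y i j = poly (fM N a k X i j) \<tau> / (poly (fden k) \<tau>)\<^sup>2" for i j
  proof -
    have "poly (fM N a k X i j) \<tau> = (\<Sum>p<?D. \<Sum>q<?D. flow_num ?D a k \<tau> 1 i p * X p q * flow_num ?D a k \<tau> (- 1) q j)"
      by (simp add: fdefs(7) poly_sum gmN fdefs(6) mult_ac)
    also have "\<dots> = (\<Sum>q<?D. \<Sum>p<?D. flow_num ?D a k \<tau> 1 i p * X p q * flow_num ?D a k \<tau> (- 1) q j)" by (rule sum.swap)
    finally show ?thesis by (simp add: den mprod_def sum_distrib_right)
  qed
  have v: "eval_at ?D ?Y f = 0" if "f \<in> J \<inter> sym_alg (g N)" for f
  proof -
    have "eval_at (fD N) (\<lambda>i j. poly (fM N a k X i j) \<tau> / (poly (fden k) \<tau>)\<^sup>2) f = 0"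
      by (rule flow_vanish[OF N a a3 X]) (use that \<tau> den in auto)
    then show ?thesis by (simp add: Y fdefs(6))
  qed
  have sa: "sup_in ?D a" "sup_in ?D X" using a X by (auto simp: std_lie_def std_gl_def zeros_def)
  then have a0: "a i j = 0" if "?D \<le> i \<or> ?D \<le> j" for i j using that unfolding sup_in_def by (meson not_le)
  have g0: "flow_num ?D a k \<tau> s i j = 0" if "i \<noteq> j" "?D \<le> i \<or> ?D \<le> j" for s i j
    using that a0 by (auto simp: flow_num_def mprod_def)
  have "sup_in ?D ?Y"
    unfolding sup_in_def
  proof (intro allI impI, rule ccontr)
    fix i j assume nz: "?Y i j \<noteq> 0" and "\<not> (i < ?D \<and> j < ?D)"
    then have "?D \<le> i \<or> ?D \<le> j" by auto
    then have "mprod ?D (mprod ?D (flow_num ?D a k \<tau> 1) X) (flow_num ?D a k \<tau> (- 1)) i j = 0"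
    proof
      assume "?D \<le> i"
      then have "flow_num ?D a k \<tau> 1 i p = 0" if "p < ?D" for p using g0[of i p 1] that by auto
      then show ?thesis by (simp add: mprod_def)
    next
      assume "?D \<le> j"
      then have "flow_num ?D a k \<tau> (-1) p j = 0" if "p < ?D" for p using g0[of p j "-1"] that by auto
      then show ?thesis by (simp add: mprod_def)
    qed
    then show False using nz by simp
  qed
  moreover have "star T ?Y i j = - ?Y i j" if TA: "T \<noteq> Type_A" for i j
  proof -
    have sX: "star T X = (\<lambda>i j. - X i j)" and sa: "star T a = (\<lambda>i j. - a i j)"
      using X a TA by (intro ext, auto simp: zeros_def std_gl_def std_lie_def)+
    have e: "star T (mprod ?D A B) = mprod ?D (star T B) (star T A)" for A B :: "'a infmat" by (intro ext star_mprod d_even)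
    \<comment> \<open>\<open>a\<close> is skew and its square self-adjoint, so taking adjoints
      reverses the curve; conjugation along the curve therefore preserves skewness.\<close>
    have dual_sign: "star T (flow_num ?D a k \<tau> s) = flow_num ?D a k \<tau> (- s)" for s
    proof (intro ext)
      fix i j
      have "star T (mprod ?D a a) i j = mprod ?D a a i j" unfolding e sa by (simp add: mprod_def)
      moreover have "star T (flow_num ?D a k \<tau> s) i j = sgn_T T i * sgn_T T j * (if i = j then 1 - k * \<tau>\<^sup>2 else 0) + 2 * s * \<tau> * star T a i j + 2 * \<tau>\<^sup>2 * star T (mprod ?D a a) i j"
        by (auto simp: star_def flow_num_def algebra_simps dest: arg_cong[of _ _ "bar_T T"])
      ultimately show "star T (flow_num ?D a k \<tau> s) i j = flow_num ?D a k \<tau> (- s) i j" unfolding sa by (auto simp: flow_num_def)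
    qed
    have neg: "mprod ?D A (\<lambda>i j. - B i j) i j = - mprod ?D A B i j" "mprod ?D (\<lambda>i j. - A i j) B i j = - mprod ?D A B i j" for A B :: "'a infmat" and i j
      by (simp_all add: mprod_def sum_negf)
    have "star T (mprod ?D (mprod ?D (flow_num ?D a k \<tau> 1) X) (flow_num ?D a k \<tau> (- 1))) i j = mprod ?D (flow_num ?D a k \<tau> 1) (mprod ?D (\<lambda>i j. - X i j) (flow_num ?D a k \<tau> (- 1))) i j"
      unfolding e sX dual_sign by simp
    also have "\<dots> = - mprod ?D (mprod ?D (flow_num ?D a k \<tau> 1) X) (flow_num ?D a k \<tau> (- 1)) i j"
      unfolding mprod_assoc by (simp add: mprod_def[of _ "mprod _ _ _"]) (simp add: neg sum_negf)
    finally show ?thesis by (simp add: star_def)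
  qed
  ultimately show ?thesis using v by (auto simp: zeros_def std_gl_def)
qed

text \<open>The matrix \<open>a\<close> exchanges the first and the last \<open>d m\<close>
  coordinates up to sign and satisfies a^3 = - a. For k = -1 and \<tau> = 1 the numerator is 2 (1 +
  a + a^2), which is twice a signed exchange of the two blocks; the square of the denominator 2
  cancels the factors.\<close>

lemma swap_zeros:
  assumes N: "3 \<le> N" and X: "X \<in> zeros N" and E: "2 * d m \<le> d N"
  shows "\<exists>Y\<in>zeros N. \<forall>i<d m. \<forall>j<d m. Y (i + (d N - d m)) (j + (d N - d m)) = X i j"
proof -
  define E where "E = d m"
  define D where "D = d N"
  define h where "h = D - E"
  have ED: "E \<le> h" "h + E = D" using E by (auto simp: E_def D_def h_def)
  \<comment> \<open>In type C the shift by \<open>h\<close> must respect the pairing of an even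
    index with its successor, otherwise \<open>a\<close> would not be in the Lie algebra.\<close>
  have hev: "T = Type_C \<Longrightarrow> even h" using d_even[of N] d_even[of m] ED by (auto simp: h_def E_def D_def)
  define a :: "'a infmat" where "a i j = (if i < E \<and> j = i + h then - 1 else if j < E \<and> i = j + h then 1 else 0)" for i j
  have bE: "bar_T T i < E \<longleftrightarrow> i < E" for i unfolding E_def by (rule bar_less) simp
  have bh: "bar_T T (i + h) = bar_T T i + h" for i using hev by (auto simp: dual_index_def elim!: oddE)
  have bi: "bar_T T i = bar_T T j \<longleftrightarrow> i = j" for i j using dual_index_dual_index by metis
  have sh: "sgn_T T (i + h) = (sgn_T T i :: 'a)" for i using hev by (auto simp: dual_sign_def)
  have "a \<in> std_lie T D"
  proof -
    have "star T a i j = - a i j" for i j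
    proof -
      have "star T a i j = sgn_T T i * sgn_T T j * (if j < E \<and> i = j + h then - 1 else if i < E \<and> j = i + h then 1 else 0)"
        unfolding star_def a_def bE bh[symmetric] bi ..
      also have "\<dots> = - a i j" using ED by (auto simp: a_def sh)
      finally show ?thesis .
    qed
    moreover have "(\<Sum>i<D. a i i) = 0" using ED by (intro sum.neutral) (auto simp: a_def)
    moreover have "sup_in D a" using ED by (auto simp: sup_in_def a_def split: if_splits)
    ultimately show ?thesis by (auto simp: std_lie_def std_gl_def)
  qed
  have row: "(\<Sum>k<D. a i k * f k) = (if i < E then - f (i + h) else if h \<le> i \<and> i < D then f (i - h) else 0)" for i and f :: "nat \<Rightarrow> 'a"
  proof -
    have "(\<Sum>k<D. a i k * f k) = (\<Sum>k<D. if k = (if i < E then i + h else i - h) then a i k * f k else 0)"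
      using ED by (intro sum.cong refl) (auto simp: a_def)
    then show ?thesis using ED by (auto simp: a_def)
  qed
  have a2: "mprod D a a i j = (if i = j \<and> (i < E \<or> (h \<le> i \<and> i < D)) then - 1 else 0)" for i j
    unfolding mprod_def row using ED by (auto simp: a_def)
  have a3: "mprod D a (mprod D a a) i j = - 1 * a i j" for i j
    unfolding mprod_def[of D a "mprod D a a"] row a2 using ED by (auto simp: a_def)
  have two: "(1::'a) - (- 1) * 1\<^sup>2 = 2" by simp
  let ?Y = "\<lambda>i j. mprod D (mprod D (flow_num D a (- 1) 1 1) X) (flow_num D a (- 1) 1 (- 1)) i j / (1 - (- 1) * 1\<^sup>2)\<^sup>2"
  have YZ: "?Y \<in> zeros N"
    unfolding D_def by (rule flow_zeros[OF N _ _ X]) (use \<open>a \<in> std_lie T D\<close> a3 in \<open>auto simp: D_def\<close>)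
  have "?Y (i + h) (j + h) = X i j" if ij: "i < E" "j < E" for i j
  proof -
    have r: "flow_num D a (- 1) 1 1 (i + h) k = (if k = i then 2 else 0)" for k
      using ij ED by (auto simp: flow_num_def a2 a_def)
    have c: "flow_num D a (- 1) 1 (- 1) k (j + h) = (if k = j then 2 else 0)" for k
      using ij ED by (auto simp: flow_num_def a2 a_def)
    have "mprod D (mprod D (flow_num D a (- 1) 1 1) X) (flow_num D a (- 1) 1 (- 1)) (i + h) (j + h) = 2 * X i j * 2"
      using ij ED by (simp add: mprod_def r c if_distrib[of "\<lambda>x. x * _"] if_distrib[of "(*) _"] cong: if_cong)
    then show ?thesis by simp
  qed
  then show ?thesis using YZ by (intro bexI[of _ ?Y]) (auto simp: h_def E_def D_def)
qed

definition nil_mat :: "nat \<Rightarrow> nat \<Rightarrow> (nat \<Rightarrow> nat \<Rightarrow> 'a) \<Rightarrow> (nat \<Rightarrow> nat \<Rightarrow> 'a) \<Rightarrow> 'a infmat" where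
  "nil_mat e D z w i j = (if e \<le> i \<and> i < D \<and> j < e then w i j else if i < e \<and> e \<le> j \<and> j < D then - z i j else 0)"

text \<open>\<open>z w = 0\<close> makes the rows and columns of a^2 that belong to U vanish and
  gives a^3 = 0. Hence the curve has denominator 1, and the U-block of the conjugate is quadratic in
  the parameter.\<close>

lemma path_zeros:
  assumes n: "3 \<le> n" "n \<le> N" and X: "X \<in> zeros N"
    and a: "nil_mat (d n) (d N) z w \<in> std_lie T (d N)"
    and zw: "\<And>i j. i < d n \<Longrightarrow> j < d n \<Longrightarrow> (\<Sum>k=d n..<d N. z i k * w k j) = 0"
  shows "\<exists>A P. \<forall>t. \<exists>Y\<in>zeros N. \<forall>i<d n. \<forall>j<d n. Y i j = A i j + t * P i j +
    t\<^sup>2 * (\<Sum>k=d n..<d N. \<Sum>l=d n..<d N. z i k * X k l * w l j)"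
proof -
  define e where "e = d n"
  define D where "D = d N"
  define a where "a = nil_mat e D z w"
  have eD: "e \<le> D" using d_mono[OF n(2)] by (simp add: e_def D_def)
  have split: "(\<Sum>k<D. f k) = (\<Sum>k<e. f k) + (\<Sum>k=e..<D. f k)" for f :: "nat \<Rightarrow> 'a"
    using sum.atLeastLessThan_concat[of 0 e D f] eD by (simp add: atLeast0LessThan)
  have aU: "a i j = 0" "a i k = - z i k" "a k j = w k j" "a k l = 0" if "i < e" "j < e" "k \<in> {e..<D}" "l \<in> {e..<D}" for i j k l
    using that by (auto simp: a_def nil_mat_def)
  have rU: "(\<Sum>k<D. a i k * f k) = - (\<Sum>k=e..<D. z i k * f k)" if "i < e" for i f
    unfolding split using that by (simp add: a_def nil_mat_def sum_negf)
  have rT: "(\<Sum>k<D. a i k * f k) = (\<Sum>k<e. w i k * f k)" if "e \<le> i" "i < D" for i f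
    unfolding split using that by (simp add: a_def nil_mat_def)
  have cU: "(\<Sum>k<D. f k * a k j) = (\<Sum>k=e..<D. f k * w k j)" if "j < e" for j f
    unfolding split using that by (simp add: a_def nil_mat_def)
  have zw': "(\<Sum>k=e..<D. z i k * w k j) = 0" if "i < e" "j < e" for i j using zw that by (simp add: e_def D_def)
  have a2U: "mprod D a a i j = 0" if "i < e" "j < D" for i j
  proof (cases "j < e")
    case True
    then show ?thesis unfolding mprod_def rU[OF that(1)] using zw'[OF that(1) True] True by (simp add: a_def nil_mat_def)
  next
    case False
    then show ?thesis unfolding mprod_def rU[OF that(1)] using that by (auto simp: a_def nil_mat_def)
  qed
  have a2U': "mprod D a a i j = 0" if "j < e" "i < D" for i j
  proof (cases "i < e")
    case True
    then show ?thesis using a2U that eD by simp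
  next
    case False
    then have "mprod D a a i j = (\<Sum>k<e. w i k * a k j)" unfolding mprod_def using rT[of i] that by simp
    then show ?thesis using that by (simp add: a_def nil_mat_def)
  qed
  have a2T: "mprod D a a k j = - (\<Sum>l<e. w k l * z l j)" if "e \<le> k" "k < D" "e \<le> j" "j < D" for k j
  proof -
    have "mprod D a a k j = (\<Sum>l<e. w k l * a l j)" unfolding mprod_def using rT[of k] that by simp
    then show ?thesis using that by (simp add: a_def nil_mat_def sum_negf)
  qed
  have a3: "mprod D a (mprod D a a) i j = 0 * a i j" if ij: "i < D" "j < D" for i j
  proof (cases "i < e")
    case True
    show ?thesis
    proof (cases "j < e")
      case j: True
      show ?thesis unfolding mprod_def[of D a "mprod D a a"] rU[OF True] using a2U'[OF j] by simp
    next
      case j: False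
      have "(\<Sum>k=e..<D. z i k * mprod D a a k j) = - (\<Sum>k=e..<D. \<Sum>l<e. z i k * w k l * z l j)"
        using j ij by (simp add: a2T sum_negf sum_distrib_left mult.assoc)
      also have "(\<Sum>k=e..<D. \<Sum>l<e. z i k * w k l * z l j) = (\<Sum>l<e. (\<Sum>k=e..<D. z i k * w k l) * z l j)"
        unfolding sum_distrib_right by (rule sum.swap)
      also have "\<dots> = 0" using zw'[OF True] by simp
      finally show ?thesis unfolding mprod_def[of D a "mprod D a a"] rU[OF True] by simp
    qed
  next
    case False
    then show ?thesis unfolding mprod_def[of D a "mprod D a a"] using rT[of i] ij a2U eD by simp
  qed
  define A where "A = X"
  define P where "P i j = - (\<Sum>k=e..<D. z i k * X k j) - (\<Sum>l=e..<D. X i l * w l j)" for i j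
  have "\<exists>Y\<in>zeros N. \<forall>i<e. \<forall>j<e. Y i j = A i j + t * P i j + t\<^sup>2 * (\<Sum>k=e..<D. \<Sum>l=e..<D. z i k * X k l * w l j)" for t
  proof -
    \<comment> \<open>The numerator of the curve begins with 1 + 2 \<tau> a, hence the
      halving.\<close>
    obtain \<tau> where \<tau>: "t = 2 * \<tau>" by (rule that[of "t / 2"]) simp
    let ?Y = "\<lambda>i j. mprod D (mprod D (flow_num D a 0 \<tau> 1) X) (flow_num D a 0 \<tau> (- 1)) i j / (1 - 0 * \<tau>\<^sup>2)\<^sup>2"
    have "?Y \<in> zeros N"
      unfolding D_def by (rule flow_zeros[OF n(1)[THEN order_trans, OF n(2)] _ _ X]) (use a a3 in \<open>auto simp: a_def D_def e_def\<close>)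
    moreover have "?Y i j = A i j + t * P i j + t\<^sup>2 * (\<Sum>k=e..<D. \<Sum>l=e..<D. z i k * X k l * w l j)" if ij: "i < e" "j < e" for i j
    proof -
      have iD: "i < D" "j < D" using ij eD by auto
      have L: "mprod D (flow_num D a 0 \<tau> 1) X i q = X i q - t * (\<Sum>k=e..<D. z i k * X k q)" for q
      proof -
        have "mprod D (flow_num D a 0 \<tau> 1) X i q = (\<Sum>k<D. (if k = i then X k q else 0) + t * (a i k * X k q))"
          unfolding mprod_def[of D "flow_num D a 0 \<tau> 1"] using a2U[OF ij(1)] by (intro sum.cong refl) (auto simp: flow_num_def \<tau> algebra_simps)
        also have "\<dots> = X i q + t * (\<Sum>k<D. a i k * X k q)"
          using iD by (simp add: sum.distrib sum_distrib_left)
        finally show ?thesis unfolding rU[OF ij(1)] by simp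
      qed
      have "mprod D F (flow_num D a 0 \<tau> (- 1)) i j = F i j - t * (\<Sum>l=e..<D. F i l * w l j)" for F
      proof -
        have "mprod D F (flow_num D a 0 \<tau> (- 1)) i j = (\<Sum>k<D. (if k = j then F i k else 0) - t * (F i k * a k j))"
          unfolding mprod_def[of D F] using a2U'[OF ij(2)] by (intro sum.cong refl) (auto simp: flow_num_def \<tau> algebra_simps)
        also have "\<dots> = F i j - t * (\<Sum>k<D. F i k * a k j)"
          using iD by (simp add: sum_subtractf sum_distrib_left)
        finally show ?thesis unfolding cU[OF ij(2)] by simp
      qed
      then have "?Y i j = (X i j - t * (\<Sum>k=e..<D. z i k * X k j)) - t * (\<Sum>l=e..<D. (X i l - t * (\<Sum>k=e..<D. z i k * X k l)) * w l j)"
        by (simp add: L)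
      also have "(\<Sum>l=e..<D. (X i l - t * (\<Sum>k=e..<D. z i k * X k l)) * w l j) = (\<Sum>l=e..<D. X i l * w l j) - t * (\<Sum>l=e..<D. \<Sum>k=e..<D. z i k * X k l * w l j)"
        by (simp add: left_diff_distrib sum_subtractf sum_distrib_left sum_distrib_right mult.assoc)
      also have "(\<Sum>l=e..<D. \<Sum>k=e..<D. z i k * X k l * w l j) = (\<Sum>k=e..<D. \<Sum>l=e..<D. z i k * X k l * w l j)"
        by (rule sum.swap)
      finally show ?thesis by (simp add: A_def P_def power2_eq_square algebra_simps)
    qed
    ultimately show ?thesis by (intro bexI[of _ ?Y]) auto
  qed
  then show ?thesis unfolding e_def D_def by (intro exI[of _ A] exI[of _ P] allI)
qed

section \<open>Leading coefficients along quadratic paths\<close>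

lemma coeff_hom_poly: "coeff_hom (\<lambda>c :: 'a. [:c:])"
  by unfold_locales (auto simp: one_pCons)

lemma homog_top:
  fixes A P R :: "nat \<Rightarrow> nat \<Rightarrow> 'a"
  assumes n: "3 \<le> n"
  defines "M \<equiv> \<lambda>i j. [:A i j, P i j, R i j:]"
  shows "homog (g n) k p \<Longrightarrow> degree (ring_eval (\<lambda>c. [:c:]) (d n) M p) \<le> 2 * k \<and>
    coeff (ring_eval (\<lambda>c. [:c:]) (d n) M p) (2 * k) = eval_at (d n) R p"
proof (induction rule: homog.induct)
  case (homog_const c)
  then show ?case by (simp add: ring_eval_const[OF coeff_hom_poly] eval_at_simps)
next
  case (homog_lin X)
  then have XG: "X \<in> G" using g_G[OF n] by auto
  have "degree (M i j * [:c:]) \<le> 2" for i j c by (rule order.trans[OF degree_mult_le]) (simp add: M_def)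
  then have "degree (trace_prod (d n) M (\<lambda>i j. [:\<psi> X i j:])) \<le> 2" unfolding trace_prod_def by (intro degree_sum_le) auto
  then show ?case by (simp add: ring_eval_lin[OF coeff_hom_poly XG] eval_at_lin[OF XG] trace_prod_def coeff_sum) (simp add: M_def numeral_2_eq_2 mult.commute)
next
  case (homog_add k p q)
  then show ?case by (simp add: ring_eval_add[OF coeff_hom_poly] eval_at_simps degree_add_le)
next
  case (homog_mult k p l q)
  then show ?case 
    using coeff_mult_bounds[of "ring_eval (\<lambda>c. [:c:]) (d n) M p" "2 * k" "ring_eval (\<lambda>c. [:c:]) (d n) M q" "2 * l"]
      order.trans[OF degree_mult_le, of "ring_eval (\<lambda>c. [:c:]) (d n) M p" "ring_eval (\<lambda>c. [:c:]) (d n) M q" "2 * k + 2 * l"]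
    by (simp add: ring_eval_mult[OF coeff_hom_poly] eval_at_simps)
qed

lemma poly_ring_eval:
  assumes n: "3 \<le> n" and p: "p \<in> sym_alg (g n)"
  shows "poly (ring_eval (\<lambda>c. [:c:]) (d n) M p) t = eval_at (d n) (\<lambda>i j. poly (M i j) t) p"
proof (rule hom_unique[OF _ _ _ _ p])
  fix X assume "X \<in> g n"
  then have XG: "X \<in> G" using g_G[OF n] by auto
  show "poly (ring_eval (\<lambda>c. [:c:]) (d n) M (lin_poly X)) t = eval_at (d n) (\<lambda>i j. poly (M i j) t) (lin_poly X)"
    by (simp add: ring_eval_lin[OF coeff_hom_poly XG] eval_at_lin[OF XG] trace_prod_def poly_sum mult.commute)
qed (auto simp: ring_eval_const[OF coeff_hom_poly] ring_eval_add[OF coeff_hom_poly] ring_eval_mult[OF coeff_hom_poly] eval_at_simps)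

text \<open>The component of highest degree vanishes at \<open>R\<close>, being the leading
  coefficient in \<open>t\<close>. By \<open>inJ\<close> it then lies in \<open>J\<close>, so it can
  be subtracted, and the next component becomes the highest. The level \<open>N\<close> of the path
  may depend on \<open>R\<close>.\<close>

lemma vanishing_on_cone:
  assumes n: "3 \<le> n"
    and path: "\<And>R. R \<in> \<Xi> \<Longrightarrow> \<exists>N\<ge>n. \<exists>A P. \<forall>t. \<exists>Y\<in>zeros N. \<forall>i<d n. \<forall>j<d n. Y i j = A i j + t * P i j + t\<^sup>2 * R i j"
    and inJ: "\<And>h. h \<in> sym_alg (g n) \<Longrightarrow> (\<forall>R\<in>\<Xi>. eval_at (d n) R h = 0) \<Longrightarrow> h \<in> J"
    and f: "f \<in> J \<inter> sym_alg (g n)" and R: "R \<in> \<Xi>"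
  shows "eval_at (d n) R f = 0"
proof -
  have ne: "g n \<noteq> {}" using lie[OF n] by (auto simp: lie_subalgebra_def)
  have ptsum: "eval_at D M (sum h I) = (\<Sum>k\<in>I. eval_at D M (h k))" for D M h and I :: "nat set"
    using eval_at_simps(3)[of D M 0] by (induction I rule: infinite_finite_induct) (auto simp: eval_at_simps const_poly_0)
  have *: "\<forall>R\<in>\<Xi>. eval_at (d n) R (\<Sum>k<K. h k) = 0" if hh: "\<forall>k. homog (g n) k (h k)" and hJ: "(\<Sum>k<K. h k) \<in> J" for K h
    using hJ
  proof (induction K)
    case 0
    then show ?case using ptsum[of _ _ h "{}"] by simp
  next
    case (Suc K)
    let ?f = "\<Sum>k<Suc K. h k"
    have hs: "h k \<in> sym_alg (g n)" for k using hh homog_sym_alg by blast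
    have fs: "?f \<in> sym_alg (g n)" using hs by (intro sym_alg_sum)
    have top: "eval_at (d n) R (h K) = 0" if R: "R \<in> \<Xi>" for R
    proof -
      obtain N A P where N: "N \<ge> n" and Y: "\<forall>t. \<exists>Y\<in>zeros N. \<forall>i<d n. \<forall>j<d n. Y i j = A i j + t * P i j + t\<^sup>2 * R i j"
        using path[OF R] by blast
      define M where "M = (\<lambda>i j. [:A i j, P i j, R i j:])"
      define e where "e = ring_eval (\<lambda>c. [:c:]) (d n) M"
      have N3: "3 \<le> N" using n N by simp
      have fN: "?f \<in> J \<inter> sym_alg (g N)" using Suc.prems sym_alg_mono[OF fs g_mono[OF n N]] by simp
      have "poly (e ?f) t = 0" for t
      proof -
        obtain Y where Y: "Y \<in> zeros N" "\<forall>i<d n. \<forall>j<d n. Y i j = A i j + t * P i j + t\<^sup>2 * R i j" using Y by blast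
        have "eval_at (d N) Y ?f = 0" using Y(1) fN by (auto simp: zeros_def)
        \<comment> \<open>The function comes from \<open>g n\<close>, so only the corner block of
          size \<open>d n\<close> of \<open>Y\<close> enters.\<close>
        also have "eval_at (d N) Y ?f = eval_at (d n) (\<lambda>i j. poly (M i j) t) ?f"
        proof (rule eval_at_eqI[OF n fs])
          fix V assume "V \<in> g n"
          then have "sup_in (d n) (\<psi> V)" using \<psi>_std_lie[OF n] by (auto simp: std_lie_def std_gl_def)
          then have "trace_prod (d N) Y (\<psi> V) = trace_prod (d n) Y (\<psi> V)" by (rule trace_prod_restrict[OF _ d_mono[OF N]])
          also have "\<dots> = trace_prod (d n) (\<lambda>i j. poly (M i j) t) (\<psi> V)"
            unfolding trace_prod_def using Y(2) by (intro sum.cong refl) (simp add: M_def algebra_simps power2_eq_square)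
          finally show "trace_prod (d N) Y (\<psi> V) = trace_prod (d n) (\<lambda>i j. poly (M i j) t) (\<psi> V)" .
        qed
        finally show ?thesis unfolding e_def poly_ring_eval[OF n fs] .
      qed
      then have "e ?f = 0" using poly_all_0_iff_0 by blast
      have esum: "e (sum h I) = (\<Sum>k\<in>I. e (h k))" if "finite I" for I
        using that ring_eval_const[OF coeff_hom_poly, of "d n" M 0]
        by (induction I rule: finite_induct) (auto simp: e_def ring_eval_add[OF coeff_hom_poly] const_poly_0)
      have ht: "degree (e (h k)) \<le> 2 * k" "coeff (e (h k)) (2 * k) = eval_at (d n) R (h k)" for k
        using homog_top[OF n hh[rule_format, of k], where A = A and P = P and R = R] by (auto simp: e_def M_def)
      have "0 = coeff (e ?f) (2 * K)" using \<open>e ?f = 0\<close> by simp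
      also have "\<dots> = (\<Sum>k<K. coeff (e (h k)) (2 * K)) + eval_at (d n) R (h K)"
        unfolding esum[OF finite_lessThan] by (simp add: coeff_sum ht)
      also have "(\<Sum>k<K. coeff (e (h k)) (2 * K)) = 0"
      proof (rule sum.neutral, rule ballI)
        fix k assume "k \<in> {..<K}"
        then have "degree (e (h k)) < 2 * K" using ht(1)[of k] by auto
        then show "coeff (e (h k)) (2 * K) = 0" by (rule coeff_eq_0)
      qed
      finally show ?thesis by simp
    qed
    then have "h K \<in> J" using inJ[OF hs] by blast
    then have "(\<Sum>k<K. h k) \<in> J" using J_minus[OF Suc.prems, of "h K"] by simp
    then show ?case using Suc.IH top by (simp add: eval_at_simps)
  qed
  obtain K h where "\<forall>k. homog (g n) k (h k)" "f = (\<Sum>k<K. h k)" using homog_decomp[OF ne] f by blast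
  then show ?thesis using * f R by blast
qed

end

section \<open>The zero sets are determinantal\<close>

text \<open>The standard invariant form restricted to the coordinates in \<open>I\<close>. It is
  used for sets \<open>I\<close> stable under \<open>bar_T T\<close>, on which it is
  nondegenerate.\<close>

definition coord_form :: "cartan_type \<Rightarrow> nat set \<Rightarrow> (nat \<Rightarrow> 'a::field) \<Rightarrow> (nat \<Rightarrow> 'a) \<Rightarrow> 'a" where
  "coord_form T I u v = (\<Sum>k\<in>I. u k * sgn_T T k * v (bar_T T k))"

lemma sum_bar_set:
  assumes "\<And>i. bar_T T i \<in> I \<longleftrightarrow> i \<in> I"
  shows "(\<Sum>k\<in>I. f (bar_T T k)) = (\<Sum>k\<in>I. f k)"
  by (rule sum.reindex_bij_witness[of _ "bar_T T" "bar_T T"]) (use assms in auto)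

lemma coord_form_form:
  fixes T I
  assumes I: "\<And>i. bar_T T i \<in> I \<longleftrightarrow> i \<in> I"
  shows "eps_form (coord_form T I :: (nat \<Rightarrow> 'a::{alg_closed_field, field_char_0}) \<Rightarrow> _) (T = Type_C)"
proof
  fix u v w :: "nat \<Rightarrow> 'a" and c :: 'a
  show "coord_form T I (\<lambda>k. u k + v k) w = coord_form T I u w + coord_form T I v w" by (simp add: coord_form_def distrib_right sum.distrib)
  show "coord_form T I (\<lambda>k. c * u k) w = c * coord_form T I u w" by (simp add: coord_form_def sum_distrib_left mult.assoc)
  have "coord_form T I v u = (\<Sum>k\<in>I. v (bar_T T k) * sgn_T T (bar_T T k) * u k)"
    unfolding coord_form_def by (subst sum_bar_set[OF I, symmetric]) simp
  then show "coord_form T I v u = form_sign (T = Type_C) * coord_form T I u v"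
    by (simp add: coord_form_def dual_sign_dual_index sum_distrib_left mult_ac)
qed

text \<open>Moving a skew \<open>X\<close> to the other argument of the invariant form costs a sign,
  which reverses the symmetry. A block of \<open>X\<close> suffices, because \<open>I\<close> is
  stable under \<open>bar_T T\<close>.\<close>

lemma coord_form_mat_form:
  fixes X :: "'a::{alg_closed_field, field_char_0} infmat"
  assumes I: "\<And>i. bar_T T i \<in> I \<longleftrightarrow> i \<in> I" and X: "\<And>i j. star T X i j = - X i j"
  shows "eps_form (\<lambda>u v. coord_form T I (mapply I X u) v) (\<not> (T = Type_C))"
proof
  fix u v w :: "nat \<Rightarrow> 'a" and c :: 'a
  show "coord_form T I (mapply I X (\<lambda>k. u k + v k)) w = coord_form T I (mapply I X u) w + coord_form T I (mapply I X v) w"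
    by (simp add: coord_form_def mapply_def distrib_left distrib_right sum.distrib)
  show "coord_form T I (mapply I X (\<lambda>k. c * u k)) w = c * coord_form T I (mapply I X u) w"
    by (simp add: coord_form_def mapply_def sum_distrib_left sum_distrib_right mult_ac)
  have Xb: "X (bar_T T k) (bar_T T j) = - (sgn_T T j * sgn_T T k * X j k)" for j k
  proof -
    have "sgn_T T j * sgn_T T k * star T X j k = X (bar_T T k) (bar_T T j)" by (simp add: star_def mult_ac)
    then show ?thesis unfolding X by simp
  qed
  have "coord_form T I (mapply I X v) u = (\<Sum>k\<in>I. \<Sum>j\<in>I. X k j * v j * sgn_T T k * u (bar_T T k))"
    by (simp add: coord_form_def mapply_def sum_distrib_right)
  also have "\<dots> = (\<Sum>k\<in>I. \<Sum>j\<in>I. X (bar_T T k) j * v j * sgn_T T (bar_T T k) * u k)"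
    using sum_bar_set[OF I, where f = "\<lambda>k. \<Sum>j\<in>I. X k j * v j * sgn_T T k * u (bar_T T k)"] by simp
  also have "\<dots> = (\<Sum>k\<in>I. \<Sum>j\<in>I. X (bar_T T k) (bar_T T j) * v (bar_T T j) * sgn_T T (bar_T T k) * u k)"
  proof (rule sum.cong[OF refl])
    fix k
    show "(\<Sum>j\<in>I. X (bar_T T k) j * v j * sgn_T T (bar_T T k) * u k) = (\<Sum>j\<in>I. X (bar_T T k) (bar_T T j) * v (bar_T T j) * sgn_T T (bar_T T k) * u k)"
      by (rule sum_bar_set[OF I, where f = "\<lambda>j. X (bar_T T k) j * v j * sgn_T T (bar_T T k) * u k", symmetric])
  qed
  also have "\<dots> = (\<Sum>k\<in>I. \<Sum>j\<in>I. - form_sign (T = Type_C) * (X j k * u k * sgn_T T j * v (bar_T T j)))"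
  proof (intro sum.cong refl)
    fix k j
    have "sgn_T T k * (sgn_T T k * (form_sign (T = Type_C) * y)) = form_sign (T = Type_C) * y" for y :: 'a by simp
    then show "X (bar_T T k) (bar_T T j) * v (bar_T T j) * sgn_T T (bar_T T k) * u k = - form_sign (T = Type_C) * (X j k * u k * sgn_T T j * v (bar_T T j))"
      unfolding Xb dual_sign_dual_index by (simp add: mult_ac)
  qed
  also have "\<dots> = - form_sign (T = Type_C) * (\<Sum>k\<in>I. \<Sum>j\<in>I. X j k * u k * sgn_T T j * v (bar_T T j))"
    by (simp add: sum_distrib_left)
  also have "(\<Sum>k\<in>I. \<Sum>j\<in>I. X j k * u k * sgn_T T j * v (bar_T T j)) = (\<Sum>j\<in>I. \<Sum>k\<in>I. X j k * u k * sgn_T T j * v (bar_T T j))"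
    by (rule sum.swap)
  also have "\<dots> = coord_form T I (mapply I X u) v"
    by (simp add: coord_form_def mapply_def sum_distrib_right)
  finally show "coord_form T I (mapply I X v) u = form_sign (\<not> (T = Type_C)) * coord_form T I (mapply I X u) v" by (simp only: form_sign_not)
qed

text \<open>\<open>F\<close> translates the form into the dot product. Every vector of
  \<open>ys\<close> then imposes one condition on \<open>p\<close> and one on \<open>q\<close>,
  hence the factor 2.\<close>

lemma coord_form_dual:
  fixes ys :: "(nat \<Rightarrow> 'a::{alg_closed_field, field_char_0}) list"
  assumes I: "\<And>i. bar_T T i \<in> I \<longleftrightarrow> i \<in> I" "finite I" and l: "2 * length ys < card I"
  shows "\<exists>p q. (\<forall>y\<in>set ys. coord_form T I y p = 0 \<and> coord_form T I y q = 0) \<and> coord_form T I p q = 1"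
proof -
  define F where "F y = (\<lambda>k. sgn_T T (bar_T T k) * y (bar_T T k))" for y :: "nat \<Rightarrow> 'a"
  have fp: "coord_form T I y p = dot I (F y) p" for y p
    unfolding coord_form_def dot_def F_def by (subst sum_bar_set[OF I(1), symmetric]) (simp add: mult_ac)
  have fq: "coord_form T I y (F q) = dot I y q" for y q
    unfolding coord_form_def dot_def F_def by (simp add: mult.assoc)
  have "length ys + length (map F ys) < card I" using l by simp
  from dual_pair[OF I(2) this] obtain p q where pq: "\<forall>h\<in>set (map F ys). dot I h p = 0" "\<forall>y\<in>set ys. dot I q y = 0" "dot I q p = 1"
    by (elim exE conjE)
  then show ?thesis by (intro exI[of _ p] exI[of _ "F q"]) (simp add: fp[of _ p] fq dot_commute[of I _ q])
qed

lemma factor_rank_mono: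
  assumes "factor_rank I m X" "m \<le> k"
  shows "factor_rank I k X"
proof -
  obtain a b where ab: "\<forall>i\<in>I. \<forall>j\<in>I. X i j = (\<Sum>l<m. a i l * b l j)" using assms(1) by (auto simp: factor_rank_def)
  have "(\<Sum>l<m. a i l * b l j) = (\<Sum>l<k. a i l * (if l < m then b l j else 0))" for i j
    using assms(2) by (intro sum.mono_neutral_cong_left) auto
  then show ?thesis using ab unfolding factor_rank_def by (intro exI[of _ a] exI[of _ "\<lambda>l j. if l < m then b l j else 0"]) auto
qed

context poisson_model
begin

text \<open>Outside type A nonzero scalars are not skew, so \<mu> is fixed to 0. The comparison with
  \<open>rank_le\<close>, which admits every scalar, is made later by
  \<open>scalar_eq_0\<close>.\<close>

definition scalar_rank :: "nat \<Rightarrow> nat set \<Rightarrow> 'a infmat \<Rightarrow> bool" where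
  "scalar_rank k I X \<longleftrightarrow> (\<exists>\<mu>. (T \<noteq> Type_A \<longrightarrow> \<mu> = 0) \<and> factor_rank I k (\<lambda>i j. X i j - (if i = j then \<mu> else 0)))"

text \<open>A factorisation of \<open>R\<close> into columns \<open>a\<close> and rows
  \<open>b\<close> is spread over a null system: \<open>z\<close> combines the \<open>z l\<close>
  with coefficients \<open>a\<close>, and \<open>w\<close> the \<open>w l\<close> with coefficients
  \<open>b\<close>. The two relations of the system become the two required identities.\<close>

lemma null_matrices_A:
  assumes T: "T = Type_A" and eD: "e \<le> D" "8 * k + 9 \<le> D - e"
    and X: "\<And>m \<mu>. m < k \<Longrightarrow> \<not> factor_rank {e..<D} m (\<lambda>i j. X i j - (if i = j then \<mu> else 0))"
    and R: "factor_rank {..<e} k R"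
  shows "\<exists>z w. nil_mat e D z w \<in> std_lie T D \<and> (\<forall>i<e. \<forall>j<e. (\<Sum>p=e..<D. z i p * w p j) = 0 \<and>
    (\<Sum>p=e..<D. \<Sum>q=e..<D. z i p * X p q * w q j) = R i j)"
proof -
  let ?I = "{e..<D}"
  have c: "8 * k + 9 \<le> card ?I" using eD by simp
  have "\<not> (\<exists>\<mu>. factor_rank ?I m (\<lambda>i j. X i j - (if i = j then \<mu> else 0)))" if "m < k" for m using X[OF that] by simp
  from null_system_exists[OF _ c this order.refl] obtain z w where zw: "null_system ?I X k z w" by auto
  obtain a b where ab: "\<forall>i\<in>{..<e}. \<forall>j\<in>{..<e}. R i j = (\<Sum>l<k. a i l * b l j)" using R by (auto simp: factor_rank_def)
  define z' where "z' i p = (\<Sum>l<k. a i l * z l p)" for i p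
  define w' where "w' p j = (\<Sum>l<k. w l p * b l j)" for p j
  have "nil_mat e D z' w' \<in> std_lie T D"
    using T by (auto simp: std_lie_def std_gl_def sup_in_def nil_mat_def split: if_splits intro!: sum.neutral)
  moreover have "(\<Sum>p=e..<D. z' i p * w' p j) = 0" for i j
  proof -
    have "(\<Sum>p=e..<D. z' i p * w' p j) = (\<Sum>p=e..<D. \<Sum>l<k. \<Sum>l'<k. a i l * b l' j * (z l p * w l' p))"
      unfolding z'_def w'_def sum_product by (simp add: mult_ac)
    also have "\<dots> = (\<Sum>l<k. \<Sum>p=e..<D. \<Sum>l'<k. a i l * b l' j * (z l p * w l' p))" by (rule sum.swap)
    also have "\<dots> = (\<Sum>l<k. \<Sum>l'<k. \<Sum>p=e..<D. a i l * b l' j * (z l p * w l' p))" by (intro sum.cong refl sum.swap)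
    also have "\<dots> = (\<Sum>l<k. \<Sum>l'<k. a i l * b l' j * dot ?I (z l) (w l'))" by (simp add: dot_def sum_distrib_left)
    also have "\<dots> = 0" using zw by (simp add: null_system_def)
    finally show ?thesis .
  qed
  moreover have "(\<Sum>p=e..<D. \<Sum>q=e..<D. z' i p * X p q * w' q j) = R i j" if "i < e" "j < e" for i j
  proof -
    have "(\<Sum>q=e..<D. X p q * w' q j) = (\<Sum>l'<k. mapply ?I X (w l') p * b l' j)" for p
      unfolding w'_def sum_distrib_left mapply_def sum_distrib_right by (subst sum.swap) (simp add: mult_ac)
    then have "(\<Sum>p=e..<D. \<Sum>q=e..<D. z' i p * X p q * w' q j) = (\<Sum>p=e..<D. z' i p * (\<Sum>l'<k. mapply ?I X (w l') p * b l' j))"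
      by (simp add: mult.assoc sum_distrib_left[symmetric])
    also have "\<dots> = (\<Sum>p=e..<D. \<Sum>l<k. \<Sum>l'<k. a i l * b l' j * (z l p * mapply ?I X (w l') p))"
      unfolding z'_def sum_product by (simp add: mult_ac)
    also have "\<dots> = (\<Sum>l<k. \<Sum>p=e..<D. \<Sum>l'<k. a i l * b l' j * (z l p * mapply ?I X (w l') p))" by (rule sum.swap)
    also have "\<dots> = (\<Sum>l<k. \<Sum>l'<k. \<Sum>p=e..<D. a i l * b l' j * (z l p * mapply ?I X (w l') p))" by (intro sum.cong refl sum.swap)
    also have "\<dots> = (\<Sum>l<k. \<Sum>l'<k. a i l * b l' j * dot ?I (z l) (mapply ?I X (w l')))" by (simp add: dot_def sum_distrib_left)
    also have "\<dots> = (\<Sum>l<k. \<Sum>l'<k. if l = l' then a i l * b l' j else 0)" using zw by (intro sum.cong refl) (simp add: null_system_def)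
    also have "\<dots> = R i j" using ab that by simp
    finally show ?thesis .
  qed
  ultimately show ?thesis by blast
qed

text \<open>\<open>R\<close> is read as a form on U and put into standard form with at most
  \<open>k\<close> coordinates \<gamma>. These are pulled back to an isotropic system
  \<open>W\<close>, on which the form of \<open>X\<close> has the same standard Gram matrix. The
  bound provides for \<open>6 * k + 13\<close> conditions, doubled by
  \<open>coord_form_dual\<close>.\<close>

lemma null_matrices_BCD:
  assumes T: "T \<noteq> Type_A" and eD: "e \<le> D" "12 * k + 30 \<le> D - e" and ev: "T = Type_C \<Longrightarrow> even e \<and> even D"
    and Xs: "\<And>i j. star T X i j = - X i j" and Rs: "\<And>i j. star T R i j = - R i j"
    and X: "\<And>m. m < k \<Longrightarrow> \<not> factor_rank {e..<D} m X"
    and R: "factor_rank {..<e} k R"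
  shows "\<exists>z w. nil_mat e D z w \<in> std_lie T D \<and> (\<forall>i<e. \<forall>j<e. (\<Sum>p=e..<D. z i p * w p j) = 0 \<and>
    (\<Sum>p=e..<D. \<Sum>q=e..<D. z i p * X p q * w q j) = R i j)"
proof -
  let ?I = "{e..<D}" and ?U = "{..<e}" and ?s = "sgn_T T :: nat \<Rightarrow> 'a" and ?b = "bar_T T"
  have bU: "?b i < e \<longleftrightarrow> i < e" and bD: "?b i < D \<longleftrightarrow> i < D" for i using ev by (auto intro!: bar_less)
  have bI: "?b i \<in> ?I \<longleftrightarrow> i \<in> ?I" and bU': "?b i \<in> ?U \<longleftrightarrow> i \<in> ?U" for i using bU[of i] bD[of i] by auto
  define b0 where "b0 = (coord_form T ?I :: (nat \<Rightarrow> 'a) \<Rightarrow> _)"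
  define b1 where "b1 u v = coord_form T ?I (mapply ?I X u) v" for u v
  define bR where "bR u v = coord_form T ?U (mapply ?U R u) v" for u v
  have e0: "eps_form b0 (T = Type_C)" unfolding b0_def by (rule coord_form_form[OF bI])
  have e1: "eps_form b1 (\<not> (T = Type_C))" unfolding b1_def by (rule coord_form_mat_form[OF bI Xs])
  have eR: "eps_form bR (\<not> (T = Type_C))" unfolding bR_def by (rule coord_form_mat_form[OF bU' Rs])
  define N where "N = 6 * k + 13"
  have fp: "form_pair b0 b1 (T = Type_C) (mapply ?I X) N"
  proof (intro form_pair.intro form_pair_axioms.intro e0 e1)
    show "b1 u v = b0 (mapply ?I X u) v" for u v by (simp add: b0_def b1_def)
    show "\<exists>p q. (\<forall>y\<in>set ys. b0 y p = 0 \<and> b0 y q = 0) \<and> b0 p q = 1" if "length ys \<le> N" for ys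
      unfolding b0_def by (rule coord_form_dual[OF bI]) (use that eD in \<open>auto simp: N_def\<close>)
  qed
  interpret F: form_pair b0 b1 "T = Type_C" "mapply ?I X" N by (rule fp)
  interpret R: eps_form bR "\<not> (T = Type_C)" by (rule eR)
  define u where "u j i = (if i = j then 1 else 0 :: 'a)" for j i :: nat
  have entry: "coord_form T S (mapply S M (u j)) (u (?b i)) = ?s i * M i j" if "finite S" "i \<in> S" "j \<in> S" for S M i j
  proof -
    have "mapply S M (u j) k = M k j" for k
      using that by (simp add: mapply_def u_def if_distrib[of "(*) _"] cong: if_cong)
    moreover have "?b k = ?b i \<longleftrightarrow> k = i" for k using dual_index_dual_index by metis
    ultimately have "coord_form T S (mapply S M (u j)) (u (?b i)) = (\<Sum>k\<in>S. if k = i then M k j * ?s k else 0)"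
      unfolding coord_form_def u_def by (intro sum.cong refl) auto
    then show ?thesis using that by (simp add: mult.commute)
  qed
  have nf: "\<not> (\<forall>x y. b1 x y = (\<Sum>l<m. \<alpha> l x * \<beta> l y))" if "m < k" for m \<alpha> \<beta>
  proof
    assume f: "\<forall>x y. b1 x y = (\<Sum>l<m. \<alpha> l x * \<beta> l y)"
    have "X i j = (\<Sum>l<m. (?s i * \<beta> l (u (?b i))) * \<alpha> l (u j))" if "i \<in> ?I" "j \<in> ?I" for i j
    proof -
      have "X i j = ?s i * b1 (u j) (u (?b i))" unfolding b1_def entry[OF finite_atLeastLessThan that] by simp
      then show ?thesis using f by (simp add: sum_distrib_left mult_ac)
    qed
    then have "factor_rank ?I m X" unfolding factor_rank_def
      by (intro exI[of _ "\<lambda>i l. ?s i * \<beta> l (u (?b i))"] exI[of _ "\<lambda>l j. \<alpha> l (u j)"] ballI)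
    then show False using X[OF that] by simp
  qed
  have "6 * k + 13 \<le> N" by (simp add: N_def)
  have "\<exists>m\<ge>k. \<exists>w. F.isosys m w"
  proof (rule F.isosys_exists[OF \<open>6 * k + 13 \<le> N\<close>])
    fix m \<alpha> \<beta> assume "m < k"
    then show "\<not> (\<forall>x y. b1 x y = (\<Sum>l<m. \<alpha> l x * \<beta> l y))" by (rule nf)
  qed
  then obtain m W where mk: "k \<le> m" and W: "F.isosys m W" by (elim exE conjE)
  obtain a b where ab: "\<forall>i\<in>?U. \<forall>j\<in>?U. R i j = (\<Sum>l<k. a i l * b l j)" using R by (auto simp: factor_rank_def)
  have bRk: "bR x y = (\<Sum>l<k. (\<Sum>j<e. b l j * x j) * (\<Sum>i<e. a i l * ?s i * y (?b i)))" for x y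
  proof -
    have "bR x y = (\<Sum>i<e. \<Sum>j<e. \<Sum>l<k. a i l * b l j * x j * ?s i * y (?b i))"
      unfolding bR_def coord_form_def mapply_def sum_distrib_right using ab by (intro sum.cong refl) (simp add: sum_distrib_right)
    also have "\<dots> = (\<Sum>i<e. \<Sum>l<k. \<Sum>j<e. a i l * b l j * x j * ?s i * y (?b i))" by (intro sum.cong refl sum.swap)
    also have "\<dots> = (\<Sum>l<k. \<Sum>i<e. \<Sum>j<e. a i l * b l j * x j * ?s i * y (?b i))" by (rule sum.swap)
    also have "\<dots> = (\<Sum>l<k. \<Sum>j<e. \<Sum>i<e. a i l * b l j * x j * ?s i * y (?b i))" by (intro sum.cong refl sum.swap)
    finally show ?thesis by (simp add: sum_product mult_ac)
  qed
  from R.std_decomp[where k = k and \<alpha> = "\<lambda>l x. \<Sum>j<e. b l j * x j" and \<beta> = "\<lambda>l y. \<Sum>i<e. a i l * ?s i * y (?b i)", OF bRk]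
  obtain m' \<gamma> where m': "m' \<le> k" "\<not> (T = Type_C) \<longrightarrow> even m'"
    and \<gamma>: "\<forall>x y. bR x y = (\<Sum>c<m'. dual_sign (\<not> (T = Type_C)) c * \<gamma> c x * \<gamma> (dual_index (\<not> (T = Type_C)) c) y)"
    by (elim exE conjE)
  define w where "w p l = (\<Sum>c<m'. \<gamma> c (u l) * W c p)" for p l
  have wf: "(\<lambda>p. w p l) = (\<lambda>p. \<Sum>c<m'. \<gamma> c (u l) * W c p)" for l by (simp add: w_def)
  have m'm: "c < m" if "c < m'" for c using that m' mk by simp
  have WW: "b0 (W c) (W c') = 0" "b1 (W c) (W c') = (if c' = dual_index (\<not> (T = Type_C)) c then dual_sign (\<not> (T = Type_C)) c else 0)" if "c < m'" "c' < m'" for c c'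
    using W m'm[OF that(1)] m'm[OF that(2)] unfolding F.isosys_def F.b1.stdsys_def by blast+
  have bm': "dual_index (\<not> (T = Type_C)) c < m' \<longleftrightarrow> c < m'" for c using m' by (intro dual_index_less) auto
  have w0: "b0 (\<lambda>p. w p l) (\<lambda>p. w p i) = 0" for l i
    unfolding wf by (simp add: F.b0.bilin WW)
  have w1: "b1 (\<lambda>p. w p l) (\<lambda>p. w p i) = bR (u l) (u i)" for l i
  proof -
    have "b1 (\<lambda>p. w p l) (\<lambda>p. w p i) = (\<Sum>c<m'. \<Sum>c'<m'. \<gamma> c (u l) * (\<gamma> c' (u i) * b1 (W c) (W c')))"
      unfolding wf by (simp add: F.b1.bilin sum_distrib_left)
    also have "\<dots> = (\<Sum>c<m'. \<Sum>c'<m'. if c' = dual_index (\<not> (T = Type_C)) c then \<gamma> c (u l) * (\<gamma> c' (u i) * dual_sign (\<not> (T = Type_C)) c) else 0)"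
      by (intro sum.cong refl) (auto simp: WW)
    also have "\<dots> = (\<Sum>c<m'. \<gamma> c (u l) * (\<gamma> (dual_index (\<not> (T = Type_C)) c) (u i) * dual_sign (\<not> (T = Type_C)) c))"
      using bm' by (intro sum.cong refl) simp
    finally show ?thesis using \<gamma> by (simp add: mult_ac)
  qed
  \<comment> \<open>The adjoint of \<open>w\<close>; this choice makes \<open>nil_mat\<close> skew
    and leaves \<open>w\<close> as the only unknown.\<close>
  define z where "z i p = ?s i * ?s p * w (?b p) (?b i)" for i p
  have zw: "(\<Sum>p=e..<D. z i p * f p) = ?s i * coord_form T ?I f (\<lambda>p. w p (?b i))" for i f
    by (simp add: z_def coord_form_def sum_distrib_left mult_ac)
  have n0: "(\<Sum>p=e..<D. z i p * w p j) = 0" for i j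
    unfolding zw using w0[of j "?b i"] by (simp add: b0_def)
  have nR: "(\<Sum>p=e..<D. \<Sum>q=e..<D. z i p * X p q * w q j) = R i j" if "i < e" "j < e" for i j
  proof -
    have "(\<Sum>p=e..<D. \<Sum>q=e..<D. z i p * X p q * w q j) = (\<Sum>p=e..<D. z i p * mapply ?I X (\<lambda>p. w p j) p)"
      by (simp add: mapply_def sum_distrib_left mult.assoc)
    also have "\<dots> = ?s i * b1 (\<lambda>p. w p j) (\<lambda>p. w p (?b i))" unfolding zw b1_def ..
    also have "\<dots> = ?s i * bR (u j) (u (?b i))" unfolding w1 ..
    also have "\<dots> = R i j" unfolding bR_def using entry[of ?U i j R] that by simp
    finally show ?thesis .
  qed
  have "star T (nil_mat e D z w) i j = - nil_mat e D z w i j" for i j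
  proof -
    have s4: "?s i * (?s j * (?s (?b i) * (?s (?b j) * x))) = x" for x
    proof -
      have "?s i * (?s j * (?s (?b i) * (?s (?b j) * x))) = (?s i * ?s i) * ((?s j * ?s j) * ((form_sign (T = Type_C) * form_sign (T = Type_C)) * x))"
        unfolding dual_sign_dual_index by (simp only: mult_ac)
      then show ?thesis by simp
    qed
    consider "e \<le> i" "i < D" "j < e" | "i < e" "e \<le> j" "j < D" | "\<not> (e \<le> i \<and> i < D \<and> j < e)" "\<not> (i < e \<and> e \<le> j \<and> j < D)"
      by blast
    then show ?thesis
    proof cases
      case 1
      then have "e \<le> ?b i" "?b i < D" "?b j < e" using bU bD not_le by metis+
      then show ?thesis using 1 s4[of "w i j"] by (simp add: star_def nil_mat_def z_def mult_ac)
    next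
      case 2
      then have "e \<le> ?b j" "?b j < D" "?b i < e" using bU bD not_le by metis+
      then show ?thesis using 2 by (simp add: star_def nil_mat_def z_def mult_ac)
    next
      case 3
      have "\<not> (e \<le> ?b j \<and> ?b j < D \<and> ?b i < e)" "\<not> (?b j < e \<and> e \<le> ?b i \<and> ?b i < D)" using 3 bU bD not_le by metis+
      then have "nil_mat e D z w (?b j) (?b i) = 0" "nil_mat e D z w i j = 0" using 3 by (auto simp: nil_mat_def)
      then show ?thesis by (simp add: star_def)
    qed
  qed
  moreover have "sup_in D (nil_mat e D z w)" using eD by (auto simp: sup_in_def nil_mat_def split: if_splits)
  ultimately have "nil_mat e D z w \<in> std_lie T D" using T by (auto simp: std_lie_def std_gl_def)
  then show ?thesis using n0 nR by (intro exI[of _ z] exI[of _ w]) auto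
qed

text \<open>The matrices have small rank themselves and are scalar translates of elements of the Lie
  algebra: in type A, subtracting \<mu> destroys trace 0 but not the linear form.\<close>

definition cone :: "nat \<Rightarrow> nat \<Rightarrow> 'a infmat set" where
  "cone n k = {R. factor_rank {..<d n} k R \<and> (\<exists>Q\<in>std_lie T (d n). \<exists>\<mu>. (T \<noteq> Type_A \<longrightarrow> \<mu> = 0) \<and> R = (\<lambda>i j. Q i j - (if i = j then \<mu> else 0)))}"

lemma path_exists:
  assumes n: "3 \<le> n" "n \<le> N" and big: "12 * k + 30 \<le> d N - d n" and X: "X \<in> zeros N"
    and r: "\<And>m. m < k \<Longrightarrow> \<not> scalar_rank m {d n..<d N} X" and R: "R \<in> cone n k"
  shows "\<exists>A P. \<forall>t. \<exists>Y\<in>zeros N. \<forall>i<d n. \<forall>j<d n. Y i j = A i j + t * P i j + t\<^sup>2 * R i j"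
proof -
  have eD: "d n \<le> d N" by (rule d_mono[OF n(2)])
  obtain Q \<mu> where Q: "Q \<in> std_lie T (d n)" "T \<noteq> Type_A \<longrightarrow> \<mu> = 0" "R = (\<lambda>i j. Q i j - (if i = j then \<mu> else 0))" and fR: "factor_rank {..<d n} k R"
    using R by (auto simp: cone_def)
  have "\<exists>z w. nil_mat (d n) (d N) z w \<in> std_lie T (d N) \<and> (\<forall>i<d n. \<forall>j<d n. (\<Sum>p=d n..<d N. z i p * w p j) = 0 \<and>
    (\<Sum>p=d n..<d N. \<Sum>q=d n..<d N. z i p * X p q * w q j) = R i j)"
  proof (cases "T = Type_A")
    case True
    show ?thesis
    proof (rule null_matrices_A[OF True eD _ _ fR])
      show "8 * k + 9 \<le> d N - d n" using big by linarith
      show "\<not> factor_rank {d n..<d N} m (\<lambda>i j. X i j - (if i = j then \<mu> else 0))" if "m < k" for m \<mu>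
        using r[OF that] True unfolding scalar_rank_def by blast
    qed
  next
    case False
    have "R = Q" using Q(2,3) False by (simp add: fun_eq_iff)
    then show ?thesis
      using null_matrices_BCD[OF False eD big _ _ _ _ fR, of X] X Q(1) False r by (auto simp: zeros_def std_gl_def std_lie_def scalar_rank_def)
  qed
  then obtain z w where zw: "nil_mat (d n) (d N) z w \<in> std_lie T (d N)"
    "\<And>i j. i < d n \<Longrightarrow> j < d n \<Longrightarrow> (\<Sum>p=d n..<d N. z i p * w p j) = 0"
    "\<And>i j. i < d n \<Longrightarrow> j < d n \<Longrightarrow> (\<Sum>p=d n..<d N. \<Sum>q=d n..<d N. z i p * X p q * w q j) = R i j" by blast
  show ?thesis using path_zeros[OF n X zw(1,2)] by (simp add: zw(3) cong: conj_cong)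
qed

text \<open>The blocks outside the first \<open>d n\<close> coordinates have rank below \<open>k\<close> modulo scalars, for one \<open>n\<close> and
  arbitrarily large \<open>N\<close>.\<close>

definition rank_drops :: "nat \<Rightarrow> bool" where
  "rank_drops k \<longleftrightarrow> (\<exists>n\<ge>3. \<forall>N0. \<exists>N\<ge>N0. n \<le> N \<and> (\<forall>X\<in>zeros N. \<exists>m<k. scalar_rank m {d n..<d N} X))"

text \<open>If the rank does not drop, then at every large level some zero has an outer block of
  rank at least \<open>k\<close> modulo scalars, as \<open>path_exists\<close> requires. The level
  is chosen beyond its room condition as well.\<close>

lemma not_rank_drops_path:
  assumes "\<not> rank_drops k" "3 \<le> n" "R \<in> cone n k"
  shows "\<exists>N\<ge>n. \<exists>A P. \<forall>t. \<exists>Y\<in>zeros N. \<forall>i<d n. \<forall>j<d n. Y i j = A i j + t * P i j + t\<^sup>2 * R i j"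
proof -
  define P where "P N \<longleftrightarrow> n \<le> N \<and> (\<forall>X\<in>zeros N. \<exists>m<k. scalar_rank m {d n..<d N} X)" for N
  have "\<not> (\<forall>N0. \<exists>N\<ge>N0. P N)"
  proof
    assume "\<forall>N0. \<exists>N\<ge>N0. P N"
    then have "rank_drops k" unfolding rank_drops_def P_def using assms(2) by (intro exI[of _ n] conjI)
    with assms(1) show False by (rule notE)
  qed
  then obtain N0 where N0: "\<And>N. N \<ge> N0 \<Longrightarrow> \<not> P N" by auto
  define N where "N = max N0 (12 * k + 30 + d n)"
  have N: "N0 \<le> N" "12 * k + 30 + d n \<le> N" by (auto simp: N_def)
  have nN: "n \<le> N" "12 * k + 30 \<le> d N - d n" using N(2) d_ge[of n] d_ge[of N] by linarith+
  obtain X where X: "X \<in> zeros N" "\<forall>m<k. \<not> scalar_rank m {d n..<d N} X" using N0[OF N(1)] nN(1) unfolding P_def by auto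
  have "\<exists>A P. \<forall>t. \<exists>Y\<in>zeros N. \<forall>i<d n. \<forall>j<d n. Y i j = A i j + t * P i j + t\<^sup>2 * R i j"
    by (rule path_exists[OF assms(2) nN X(1) _ assms(3)]) (use X(2) in simp)
  with nN(1) show ?thesis by (intro exI[of _ N] conjI)
qed

lemma not_rank_drops_0: "\<not> rank_drops 0"
  using zeros_nonempty unfolding rank_drops_def by (metis all_not_in_conv not_less_zero order_trans)

section \<open>The critical rank and the description of J\<close>

lemma eval_at_scalar:
  assumes n: "3 \<le> n" and p: "p \<in> sym_alg (g n)" and \<mu>: "T \<noteq> Type_A \<longrightarrow> \<mu> = 0"
  shows "eval_at (d n) (\<lambda>i j. Q i j - (if i = j then \<mu> else 0)) p = eval_at (d n) Q p"
proof (rule eval_at_eqI[OF n p])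
  fix Y assume "Y \<in> g n"
  then have Y: "\<psi> Y \<in> std_lie T (d n)" by (rule \<psi>_std_lie[OF n])
  have "(\<Sum>i<d n. \<Sum>j<d n. (if i = j then \<mu> else 0) * \<psi> Y j i) = \<mu> * (\<Sum>i<d n. \<psi> Y i i)"
    by (simp add: if_distrib[of "\<lambda>x. x * _"] sum_distrib_left cong: if_cong)
  also have "\<dots> = 0" using Y \<mu> by (auto simp: std_lie_def)
  finally show "trace_prod (d n) (\<lambda>i j. Q i j - (if i = j then \<mu> else 0)) (\<psi> Y) = trace_prod (d n) Q (\<psi> Y)"
    by (simp add: trace_prod_def left_diff_distrib sum_subtractf)
qed

text \<open>Polynomials have no nilpotents, so the Nullstellensatz applies to the zero
  ideal.\<close>

lemma zero_of_vanishing: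
  assumes n: "3 \<le> n" and p: "p \<in> sym_alg (g n)" "\<And>Q. Q \<in> std_lie T (d n) \<Longrightarrow> eval_at (d n) Q p = 0"
  shows "p = 0"
proof (rule ccontr)
  assume "p \<noteq> 0"
  then have np: "p \<notin> {0}" by simp
  have "A.ideal_on (sym_alg (g n)) {0}" by (auto simp: A.ideal_on_def sym_alg_0)
  moreover have "q \<in> {0}" if "q ^ k \<in> {0}" for q :: "'a entry_poly" and k
    using that by (induction k) auto
  ultimately show False using point_exists[OF n _ _ p(1) np] p(2) by blast
qed

text \<open>Otherwise there are paths for every rank. As the whole Lie algebra at level
  \<open>n\<close> lies in the cone of rank \<open>d n\<close>, a nonzero \<open>f\<close> in
  \<open>J\<close> would vanish at all of its points.\<close>

lemma rank_drops_exists: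
  assumes J: "J \<noteq> {0}"
  shows "\<exists>k. rank_drops k"
proof (rule ccontr)
  assume nb: "\<not> (\<exists>k. rank_drops k)"
  obtain f where f: "f \<in> J" "f \<noteq> 0" using J J_props(2) by blast
  then obtain n where n: "3 \<le> n" "f \<in> sym_alg (g n)" using sym_alg_G[of f 3] J_props(1) by blast
  have all: "Q \<in> cone n (d n)" if "Q \<in> std_lie T (d n)" for Q
  proof -
    have e: "Q i j = (\<Sum>l<d n. (if l = i then 1 else 0) * Q l j)" if "i < d n" for i j
      using that by (simp add: if_distrib[of "\<lambda>x. x * _"] cong: if_cong)
    have "factor_rank {..<d n} (d n) Q" unfolding factor_rank_def
      by (rule exI[of _ "\<lambda>i l. if l = i then 1 else 0"], rule exI[of _ Q], intro ballI, rule e) simp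
    moreover have "\<exists>Q'\<in>std_lie T (d n). \<exists>\<mu>. (T \<noteq> Type_A \<longrightarrow> \<mu> = 0) \<and> Q = (\<lambda>i j. Q' i j - (if i = j then \<mu> else 0))"
      by (rule bexI[OF _ that], rule exI[of _ 0]) simp
    ultimately show ?thesis unfolding cone_def by (intro CollectI conjI)
  qed
  have *: "eval_at (d n) R f = 0" if "R \<in> cone n (d n)" for R
  proof (rule vanishing_on_cone[OF n(1) _ _ _ that])
    show "\<exists>N\<ge>n. \<exists>A P. \<forall>t. \<exists>Y\<in>zeros N. \<forall>i<d n. \<forall>j<d n. Y i j = A i j + t * P i j + t\<^sup>2 * R i j" if "R \<in> cone n (d n)" for R
    proof (rule not_rank_drops_path[OF _ n(1) that])
      show "\<not> rank_drops (d n)" using nb by simp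
    qed
    show "h \<in> J" if "h \<in> sym_alg (g n)" "\<forall>R\<in>cone n (d n). eval_at (d n) R h = 0" for h
    proof -
      have "h = 0" by (rule zero_of_vanishing[OF n(1) that(1)]) (use that(2) all in simp)
      then show ?thesis using J_props(2) by simp
    qed
    show "f \<in> J \<inter> sym_alg (g n)" using f n by simp
  qed
  have "f = 0" by (rule zero_of_vanishing[OF n]) (rule *[OF all])
  then show False using f by simp
qed

text \<open>Zeros at level \<open>N\<close> are controlled only outside the first \<open>d n\<close>
  coordinates. The last \<open>d m\<close> coordinates lie in that region because
  \<open>2 * d m + d n \<le> d N\<close>, so exchanging them with the first \<open>d m\<close>
  bounds the rank of the corner block of every zero.\<close>

lemma low_rank_in_J:
  assumes rank_drops: "rank_drops (Suc r)" and m: "3 \<le> m" and p: "p \<in> sym_alg (g m)"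
    and v: "\<And>Q. Q \<in> std_lie T (d m) \<Longrightarrow> scalar_rank r {..<d m} Q \<Longrightarrow> eval_at (d m) Q p = 0"
  shows "p \<in> J"
proof -
  obtain n where n: "3 \<le> n" and *: "\<And>N0. \<exists>N\<ge>N0. n \<le> N \<and> (\<forall>X\<in>zeros N. \<exists>k<Suc r. scalar_rank k {d n..<d N} X)"
    using rank_drops unfolding rank_drops_def by blast
  obtain N where N: "N \<ge> 2 * d m + d n + m" and low: "\<And>X. X \<in> zeros N \<Longrightarrow> \<exists>k<Suc r. scalar_rank k {d n..<d N} X" using * by blast
  have mN: "m \<le> N" and N3: "3 \<le> N" using N m by auto
  have dN: "2 * d m + d n \<le> d N" using N d_ge[of N] by linarith
  have "eval_at (d N) X p = 0" if X: "X \<in> zeros N" for X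
  proof -
    define h where "h = d N - d m"
    have hn: "d n \<le> h" "h + d m = d N" using dN by (auto simp: h_def)
    have "2 * d m \<le> d N" using dN by simp
    from swap_zeros[OF N3 X this] obtain Y where Y: "Y \<in> zeros N" "\<forall>i<d m. \<forall>j<d m. Y (i + h) (j + h) = X i j" by (auto simp: h_def)
    obtain k \<mu> a b where k: "k < Suc r" and \<mu>: "T \<noteq> Type_A \<longrightarrow> \<mu> = 0"
      and ab: "\<forall>i\<in>{d n..<d N}. \<forall>j\<in>{d n..<d N}. Y i j - (if i = j then \<mu> else 0) = (\<Sum>l<k. a i l * b l j)"
      using low[OF Y(1)] by (auto simp: scalar_rank_def factor_rank_def)
    define X' where "X' i j = (if i < d m \<and> j < d m then X i j else 0)" for i j
    have X'ab: "X' i j - (if i = j then \<mu> else 0) = (\<Sum>l<k. a (i + h) l * b l (j + h))" if "i < d m" "j < d m" for i j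
      using ab[rule_format, of "i + h" "j + h"] Y(2) that hn by (simp add: X'_def)
    \<comment> \<open>In type A the corner block may have nonzero trace. The projection changes it
      by a scalar only, which is absorbed into \<mu>.\<close>
    define Q where "Q = proj_T T (d m) X'"
    have Q: "Q \<in> std_lie T (d m)" unfolding Q_def using m d_ge[of m] by (intro proj_T_std_lie d_even) auto
    have "\<exists>\<nu>. (T \<noteq> Type_A \<longrightarrow> \<nu> = 0) \<and> (\<forall>i<d m. \<forall>j<d m. Q i j = X' i j - (if i = j then \<nu> else 0))"
    proof (cases "T = Type_A")
      case True
      then show ?thesis by (intro exI[of _ "(\<Sum>k<d m. X' k k) / of_nat (d m)"]) (simp add: Q_def proj_T_def)
    next
      case False
      have bm: "bar_T T i < d m \<longleftrightarrow> i < d m" for i by (rule bar_less) simp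
      have sX: "star T X i j = - X i j" for i j using X False by (auto simp: zeros_def std_gl_def)
      have "star T X' i j = - X' i j" for i j
        using sX[of i j] by (auto simp: star_def X'_def bm)
      then show ?thesis using False by (intro exI[of _ 0]) (simp add: Q_def proj_T_def)
    qed
    then obtain \<nu> where \<nu>: "T \<noteq> Type_A \<longrightarrow> \<nu> = 0" "\<And>i j. i < d m \<Longrightarrow> j < d m \<Longrightarrow> Q i j = X' i j - (if i = j then \<nu> else 0)" by blast
    have "factor_rank {..<d m} k (\<lambda>i j. Q i j - (if i = j then \<mu> - \<nu> else 0))"
      unfolding factor_rank_def
    proof (rule exI[of _ "\<lambda>i l. a (i + h) l"], rule exI[of _ "\<lambda>l j. b l (j + h)"], intro ballI)
      fix i j assume "i \<in> {..<d m}" "j \<in> {..<d m}"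
      then show "Q i j - (if i = j then \<mu> - \<nu> else 0) = (\<Sum>l<k. a (i + h) l * b l (j + h))"
        using X'ab[of i j] \<nu>(2)[of i j] by auto
    qed
    then have "factor_rank {..<d m} r (\<lambda>i j. Q i j - (if i = j then \<mu> - \<nu> else 0))" by (rule factor_rank_mono) (use k in simp)
    then have "scalar_rank r {..<d m} Q" unfolding scalar_rank_def using \<mu> \<nu>(1) by (intro exI[of _ "\<mu> - \<nu>"]) auto
    then have "eval_at (d m) Q p = 0" using v[OF Q] by blast
    moreover have "eval_at (d N) X p = eval_at (d m) Q p"
    proof (rule eval_at_eqI[OF m p])
      fix V assume "V \<in> g m"
      then have V: "\<psi> V \<in> std_lie T (d m)" by (rule \<psi>_std_lie[OF m])
      then have "sup_in (d m) (\<psi> V)" by (simp add: std_lie_def std_gl_def)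
      then have "trace_prod (d N) X (\<psi> V) = trace_prod (d m) X (\<psi> V)" by (rule trace_prod_restrict[OF _ d_mono[OF mN]])
      also have "\<dots> = trace_prod (d m) X' (\<psi> V)" unfolding trace_prod_def by (intro sum.cong refl) (simp add: X'_def)
      also have "\<dots> = trace_prod (d m) Q (\<psi> V)" unfolding Q_def by (rule trace_prod_proj[OF d_even V, symmetric])
      finally show "trace_prod (d N) X (\<psi> V) = trace_prod (d m) Q (\<psi> V)" .
    qed
    ultimately show ?thesis by simp
  qed
  then show ?thesis using zeros_vanish[OF N3 sym_alg_mono[OF p g_mono[OF m mN]]] by blast
qed

theorem determinantal:
  assumes J: "J \<noteq> {0}"
  shows "\<exists>r. \<forall>n\<ge>3. \<forall>p\<in>sym_alg (g n). p \<in> J \<longleftrightarrow> (\<forall>Q\<in>std_lie T (d n). scalar_rank r {..<d n} Q \<longrightarrow> eval_at (d n) Q p = 0)"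
proof -
  \<comment> \<open>The least value serves both inclusions: dropping at \<open>Suc r\<close> puts
    the functions that vanish in rank \<open>r\<close> into \<open>J\<close>, and failing to drop at
    \<open>r\<close> provides the paths for the converse.\<close>
  define k where "k = (LEAST k. rank_drops k)"
  have bk: "rank_drops k" using rank_drops_exists[OF J] unfolding k_def by (auto intro: LeastI)
  then have "k \<noteq> 0" using not_rank_drops_0 by metis
  then obtain r where kr: "k = Suc r" using not0_implies_Suc by blast
  have nb: "\<not> rank_drops r" using not_less_Least[of r rank_drops] kr unfolding k_def by simp
  have "p \<in> J \<longleftrightarrow> (\<forall>Q\<in>std_lie T (d n). scalar_rank r {..<d n} Q \<longrightarrow> eval_at (d n) Q p = 0)" if n: "3 \<le> n" and p: "p \<in> sym_alg (g n)" for n p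
  proof
    assume "\<forall>Q\<in>std_lie T (d n). scalar_rank r {..<d n} Q \<longrightarrow> eval_at (d n) Q p = 0"
    then show "p \<in> J" using low_rank_in_J[OF _ n p] bk kr by blast
  next
    assume pJ: "p \<in> J"
    have cone_eval_at: "\<exists>R\<in>cone n r. \<forall>h\<in>sym_alg (g n). eval_at (d n) R h = eval_at (d n) Q h" if Q: "Q \<in> std_lie T (d n)" "scalar_rank r {..<d n} Q" for Q
    proof -
      obtain \<mu> where \<mu>: "T \<noteq> Type_A \<longrightarrow> \<mu> = 0" "factor_rank {..<d n} r (\<lambda>i j. Q i j - (if i = j then \<mu> else 0))"
        using Q(2) unfolding scalar_rank_def by blast
      let ?R = "\<lambda>i j. Q i j - (if i = j then \<mu> else 0)"
      have "?R \<in> cone n r" unfolding cone_def using \<mu> Q(1) by blast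
      then show ?thesis using eval_at_scalar[OF n _ \<mu>(1)] by blast
    qed
    have "eval_at (d n) R p = 0" if "R \<in> cone n r" for R
    proof (rule vanishing_on_cone[OF n _ _ _ that])
      show "\<exists>N\<ge>n. \<exists>A P. \<forall>t. \<exists>Y\<in>zeros N. \<forall>i<d n. \<forall>j<d n. Y i j = A i j + t * P i j + t\<^sup>2 * R i j" if "R \<in> cone n r" for R
        using not_rank_drops_path[OF nb n that] .
      show "h \<in> J" if h: "h \<in> sym_alg (g n)" "\<forall>R\<in>cone n r. eval_at (d n) R h = 0" for h
      proof (rule low_rank_in_J[OF _ n h(1)])
        show "rank_drops (Suc r)" using bk kr by simp
        fix Q assume "Q \<in> std_lie T (d n)" "scalar_rank r {..<d n} Q"
        from cone_eval_at[OF this] show "eval_at (d n) Q h = 0" using h by auto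
      qed
      show "p \<in> J \<inter> sym_alg (g n)" using pJ p by simp
    qed
    then show "\<forall>Q\<in>std_lie T (d n). scalar_rank r {..<d n} Q \<longrightarrow> eval_at (d n) Q p = 0" using cone_eval_at p by metis
  qed
  then show ?thesis by blast
qed

end

section \<open>Matrices as functions\<close>

text \<open>A factorisation arises by expanding all columns in a maximal independent set
  \<open>S\<close> of columns. Conversely, more than \<open>r\<close> independent columns are
  impossible: a nontrivial relation among the right factors, from \<open>homogeneous_system\<close>,
  is one among the columns.\<close>

lemma rank_le_iff_factor_rank:
  fixes A :: "'a::field mat"
  assumes A: "A \<in> carrier_mat D D"
  shows "vec_space.rank D A \<le> r \<longleftrightarrow> factor_rank {..<D} r (\<lambda>i j. A $$ (i, j))"
proof -
  interpret V: vec_space "TYPE('a)" D .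
  have fc: "finite (set (cols A))" by simp
  have coord: "set (cols A) \<subseteq> carrier_vec D" using A cols_dim by blast
  obtain S where S: "maximal S (\<lambda>T. T \<subseteq> set (cols A) \<and> V.lin_indpt T)" "finite S"
    using maximal_exists_superset[of "set (cols A)" "\<lambda>T. T \<subseteq> set (cols A) \<and> V.lin_indpt T" "{}"]
    by (auto simp: V.lin_dep_def)
  have Sc: "S \<subseteq> set (cols A)" and Si: "V.lin_indpt S" using S(1) by (auto simp: maximal_def)
  have SC: "S \<subseteq> carrier_vec D" using Sc coord by blast
  have rk: "V.rank A = card S" by (rule V.rank_card_indpt[OF A S(1)])
  show ?thesis
  proof
    assume le: "V.rank A \<le> r"
    have sp: "c \<in> V.span S" if c: "c \<in> set (cols A)" for c
    proof (cases "c \<in> S")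
      case True
      then show ?thesis using V.in_own_span[of S] SC by auto
    next
      case False
      have "V.lin_dep (S \<union> {c})"
      proof (rule ccontr)
        assume "\<not> V.lin_dep (S \<union> {c})"
        then have "S \<union> {c} = S" using S(1) Sc c unfolding maximal_def by blast
        then show False using False by blast
      qed
      then show ?thesis using V.lin_dep_iff_in_span[of S c] SC Si c coord False by auto
    qed
    have "\<exists>a. c = V.lincomb a S" if c: "c \<in> set (cols A)" for c
      using sp[OF c] V.finite_span[OF S(2)] SC by auto
    then obtain \<alpha> where \<alpha>: "\<And>c. c \<in> set (cols A) \<Longrightarrow> c = V.lincomb (\<alpha> c) S" by metis
    obtain e where e: "bij_betw e {..<card S} S" using ex_bij_betw_nat_finite[OF S(2)] by (auto simp: atLeast0LessThan)
    have "A $$ (i, j) = (\<Sum>l<card S. (e l $ i) * \<alpha> (col A j) (e l))" if "i < D" "j < D" for i j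
    proof -
      have "col A j \<in> set (cols A)" using A that by (auto simp: cols_def)
      from \<alpha>[OF this] have "A $$ (i, j) = V.lincomb (\<alpha> (col A j)) S $ i" using A that by (metis carrier_matD index_col)
      also have "\<dots> = (\<Sum>v\<in>S. \<alpha> (col A j) v * v $ i)" by (rule V.lincomb_index[OF that(1) SC])
      also have "\<dots> = (\<Sum>l<card S. \<alpha> (col A j) (e l) * e l $ i)" by (rule sum.reindex_bij_betw[OF e, symmetric])
      finally show ?thesis by (simp add: mult.commute)
    qed
    then have "factor_rank {..<D} (card S) (\<lambda>i j. A $$ (i, j))" unfolding factor_rank_def
      by (intro exI[of _ "\<lambda>i l. e l $ i"] exI[of _ "\<lambda>l j. \<alpha> (col A j) (e l)"]) simp
    then show "factor_rank {..<D} r (\<lambda>i j. A $$ (i, j))" by (rule factor_rank_mono) (use le rk in simp)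
  next
    assume "factor_rank {..<D} r (\<lambda>i j. A $$ (i, j))"
    then obtain a b where ab: "\<And>i j. i < D \<Longrightarrow> j < D \<Longrightarrow> A $$ (i, j) = (\<Sum>l<r. a i l * b l j)" by (auto simp: factor_rank_def)
    show "V.rank A \<le> r"
    proof (rule ccontr)
      assume "\<not> V.rank A \<le> r"
      then have rS: "r < card S" using rk by simp
      have "\<exists>j<D. v = col A j" if "v \<in> S" for v
      proof -
        have "v \<in> col A ` {0..<D}" using that Sc A by (auto simp: cols_def)
        then show ?thesis by auto
      qed
      then obtain j where j: "\<And>v. v \<in> S \<Longrightarrow> j v < D \<and> v = col A (j v)" by metis
      from homogeneous_system[OF S(2) rS, of "\<lambda>l v. b l (j v)"] obtain x
        where x: "\<exists>v\<in>S. x v \<noteq> 0" "\<forall>l<r. (\<Sum>v\<in>S. b l (j v) * x v) = 0" by (elim exE conjE)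
      have "V.lincomb x S = 0\<^sub>v D"
      proof (rule eq_vecI)
        show "dim_vec (V.lincomb x S) = dim_vec (0\<^sub>v D)" using V.lincomb_dim[OF S(2) SC] by simp
        fix i assume "i < dim_vec (0\<^sub>v D)"
        then have i: "i < D" by simp
        have "V.lincomb x S $ i = (\<Sum>v\<in>S. x v * v $ i)" by (rule V.lincomb_index[OF i SC])
        also have "\<dots> = (\<Sum>v\<in>S. \<Sum>l<r. a i l * (b l (j v) * x v))"
        proof (rule sum.cong[OF refl])
          fix v assume v: "v \<in> S"
          have "v $ i = A $$ (i, j v)" using j[OF v] i A by (metis carrier_matD index_col)
          then show "x v * v $ i = (\<Sum>l<r. a i l * (b l (j v) * x v))" using ab[OF i] j[OF v] by (simp add: sum_distrib_left mult_ac)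
        qed
        also have "\<dots> = (\<Sum>l<r. a i l * (\<Sum>v\<in>S. b l (j v) * x v))" by (subst sum.swap) (simp add: sum_distrib_left)
        also have "\<dots> = 0" using x(2) by simp
        finally show "V.lincomb x S $ i = 0\<^sub>v D $ i" using i by simp
      qed
      moreover obtain v where "v \<in> S" "x v \<noteq> 0" using x(1) by auto
      ultimately have "V.lin_dep S" unfolding V.lin_dep_def using S(2)
        by (intro exI[of _ S] exI[of _ x] exI[of _ v]) (simp add: module_vec_simps)
      then show False using Si by simp
    qed
  qed
qed

lemma corner_mult:
  assumes "A \<in> carrier_mat D D" "B \<in> carrier_mat D D"
  shows "corner (A * B) i j = mprod D (corner A) (corner B) i j"
  using assms by (auto simp: corner_def mprod_def scalar_prod_def atLeast0LessThan intro!: sum.cong sum.neutral)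

lemma corner_inj:
  assumes "A \<in> carrier_mat D D" "B \<in> carrier_mat D D" "corner A = corner B"
  shows "A = B"
proof (rule eq_matI)
  show "dim_row A = dim_row B" "dim_col A = dim_col B" using assms by auto
  fix i j assume "i < dim_row B" "j < dim_col B"
  moreover have "corner A i j = corner B i j" by (simp only: assms(3))
  ultimately show "A $$ (i, j) = B $$ (i, j)" using assms(1,2) by (simp add: corner_def)
qed

lemma corner_add: "A \<in> carrier_mat D D \<Longrightarrow> B \<in> carrier_mat D D \<Longrightarrow> corner (A + B) = (\<lambda>i j. corner A i j + corner B i j)"
  and corner_smult: "corner (c \<cdot>\<^sub>m A) = (\<lambda>i j. c * corner A i j)"
  and corner_minus: "A \<in> carrier_mat D D \<Longrightarrow> B \<in> carrier_mat D D \<Longrightarrow> corner (A - B) = (\<lambda>i j. corner A i j - corner B i j)"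
  by (intro ext; auto simp: corner_def)+

definition unit_mat :: "nat \<Rightarrow> nat \<Rightarrow> nat \<Rightarrow> 'a::comm_ring_1" where
  "unit_mat D i j = (if i = j \<and> i < D then 1 else 0)"

lemma corner_one: "corner (1\<^sub>m D) = unit_mat D"
  by (intro ext) (auto simp: corner_def unit_mat_def)

lemma sup_corner: "A \<in> carrier_mat D D \<Longrightarrow> sup_in D (corner A)"
  by (auto simp: sup_in_def corner_def split: if_splits)

lemma sup_inD: "sup_in D M \<Longrightarrow> D \<le> i \<or> D \<le> j \<Longrightarrow> M i j = 0"
  unfolding sup_in_def by (meson not_le)

lemma sup_mprod: "sup_in D A \<Longrightarrow> sup_in D B \<Longrightarrow> sup_in D (mprod D A B)"
  unfolding sup_in_def[of _ "mprod D A B"]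
proof (intro allI impI, rule ccontr)
  fix i j assume s: "sup_in D A" "sup_in D B" and nz: "mprod D A B i j \<noteq> 0" and "\<not> (i < D \<and> j < D)"
  then have "D \<le> i \<or> D \<le> j" by auto
  then show False using nz sup_inD[OF s(1), of i] sup_inD[OF s(2), of _ j] by (auto simp: mprod_def)
qed

lemma mprod_unit: "sup_in D A \<Longrightarrow> mprod D A (unit_mat D) = A" "sup_in D A \<Longrightarrow> mprod D (unit_mat D) A = A"
proof -
  assume s: "sup_in D A"
  show "mprod D A (unit_mat D) = A"
  proof (intro ext)
    fix i j
    have "mprod D A (unit_mat D) i j = (\<Sum>k<D. if k = j then A i k else 0)"
      unfolding mprod_def by (intro sum.cong) (auto simp: unit_mat_def)
    then show "mprod D A (unit_mat D) i j = A i j" using sup_inD[OF s, of i j] by auto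
  qed
  show "mprod D (unit_mat D) A = A"
  proof (intro ext)
    fix i j
    have "mprod D (unit_mat D) A i j = (\<Sum>k<D. if k = i then A k j else 0)"
      unfolding mprod_def by (intro sum.cong) (auto simp: unit_mat_def)
    then show "mprod D (unit_mat D) A i j = A i j" using sup_inD[OF s, of i j] by auto
  qed
qed

lemma mprod_assoc': "mprod D A (mprod D B C) = mprod D (mprod D A B) C"
  by (intro ext mprod_assoc)

lemma inverse_flip:
  fixes A B :: "'a::field infmat"
  assumes s: "sup_in D A" "sup_in D B" and AB: "mprod D A B = unit_mat D"
  shows "mprod D B A = unit_mat D"
proof -
  define f where "f M = mat D D (\<lambda>(i, j). M i j)" for M :: "'a infmat"
  have f: "f M \<in> carrier_mat D D" for M by (simp add: f_def)
  have cf: "corner (f M) = M" if "sup_in D M" for M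
    using sup_inD[OF that] by (intro ext) (auto simp: corner_def f_def not_less)
  have c: "corner (f A * f B) = corner (1\<^sub>m D)"
    by (intro ext) (simp add: corner_mult[OF f f] cf s AB corner_one)
  have "f A * f B = 1\<^sub>m D" by (rule corner_inj[OF _ _ c]) (auto intro: mult_carrier_mat f)
  from mat_mult_left_right_inverse[OF f f this] have "corner (f B * f A) = corner (1\<^sub>m D :: 'a mat)" by simp
  then show ?thesis
    using cf s by (simp add: corner_one fun_eq_iff corner_mult[OF f f])
qed

lemma star_unit:
  assumes D: "T = Type_C \<Longrightarrow> even D"
  shows "star T (unit_mat D) = unit_mat D"
proof (intro ext)
  fix i j
  have b: "bar_T T j = bar_T T i \<longleftrightarrow> i = j" by (metis dual_index_dual_index)
  have l: "bar_T T j < D \<longleftrightarrow> j < D" by (rule bar_less, rule D)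
  show "star T (unit_mat D) i j = unit_mat D i j"
    using l by (auto simp: star_def unit_mat_def b)
qed

lemma star_mm': "(T = Type_C \<Longrightarrow> even D) \<Longrightarrow> star T (mprod D A B) = mprod D (star T B) (star T A)"
  by (intro ext star_mprod)

lemma star_star': "star T (star T M) = M"
  by (intro ext star_star)

lemma sup_star: "(T = Type_C \<Longrightarrow> even D) \<Longrightarrow> sup_in D M \<Longrightarrow> sup_in D (star T M)"
proof -
  assume D: "T = Type_C \<Longrightarrow> even D" and M: "sup_in D M"
  show ?thesis unfolding sup_in_def
  proof (intro allI impI, rule ccontr)
    fix i j assume nz: "star T M i j \<noteq> 0" and "\<not> (i < D \<and> j < D)"
    then have "D \<le> bar_T T j \<or> D \<le> bar_T T i" using bar_less[OF D] not_le by blast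
    then show False using sup_inD[OF M, of "bar_T T j" "bar_T T i"] nz by (auto simp: star_def)
  qed
qed

lemma classical_carrier: "A \<in> classical_mat T n \<Longrightarrow> A \<in> carrier_mat (natural_dim T n) (natural_dim T n)"
  by (cases T) (auto simp: sl_mat_def so_mat_def sp_mat_def)

text \<open>In type C the entry of the symplectic form at (i, \<open>bar_T T i\<close>) is
  \<open>sgn_T T i\<close>; multiplying the defining identity by these signs turns it into skewness
  under \<open>star\<close>. For orthogonal matrices \<open>star\<close> is the transpose.\<close>

lemma classical_corner:
  "corner ` classical_mat T n = (std_lie T (natural_dim T n) :: 'a::field_char_0 infmat set)"
proof -
  define D where "D = natural_dim T n"
  define f where "f M = mat D D (\<lambda>(i, j). M i j)" for M :: "'a infmat"
  have f: "f M \<in> carrier_mat D D" for M by (simp add: f_def)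
  have cf: "corner (f M) = M" if "sup_in D M" for M
    using sup_inD[OF that] by (intro ext) (auto simp: corner_def f_def not_less)
  have so: "A \<in> so_mat D \<longleftrightarrow> corner A \<in> std_lie T D" if A: "A \<in> carrier_mat D D" and T: "T = Type_B \<or> T = Type_D" for A :: "'a mat"
  proof -
    have "transpose_mat A = - A \<longleftrightarrow> (\<forall>i<D. \<forall>j<D. A $$ (j, i) = - A $$ (i, j))"
      using A by (auto simp: mat_eq_iff)
    also have "\<dots> \<longleftrightarrow> (\<forall>i j. star T (corner A) i j = - corner A i j)"
      using A T by (auto simp: star_def corner_def dual_sign_def dual_index_def)
    finally show ?thesis using A T sup_corner[OF A] by (auto simp: so_mat_def std_lie_def std_gl_def)
  qed
  have sl: "A \<in> sl_mat D \<longleftrightarrow> corner A \<in> std_lie T D" if A: "A \<in> carrier_mat D D" and T: "T = Type_A" for A :: "'a mat"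
    using A T sup_corner[OF A] by (simp add: sl_mat_def std_lie_def std_gl_def mat_trace_def corner_def)
  have sp: "A \<in> sp_mat n \<longleftrightarrow> corner A \<in> std_lie T D" if A: "A \<in> carrier_mat D D" and T: "T = Type_C" for A :: "'a mat"
  proof -
    let ?O = "symplectic_form n :: 'a mat"
    have D2: "D = 2 * n" using T by (simp add: D_def)
    have O: "?O \<in> carrier_mat D D" by (simp add: symplectic_form_def D2)
    have b: "bar_T T i < D \<longleftrightarrow> i < D" for i using D2 by (intro bar_less) simp
    have Oe: "?O $$ (i, j) = (if j = bar_T T i then sgn_T T i else 0)" if "i < D" "j < D" for i j
      using that T D2 by (auto simp: symplectic_form_def dual_index_def dual_sign_def elim!: oddE) presburger
    have l: "(transpose_mat A * ?O) $$ (i, j) = - sgn_T T j * A $$ (bar_T T j, i)" if "i < D" "j < D" for i j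
    proof -
      have "(transpose_mat A * ?O) $$ (i, j) = (\<Sum>k<D. A $$ (k, i) * ?O $$ (k, j))"
        using A O that by (simp add: scalar_prod_def atLeast0LessThan)
      also have "\<dots> = (\<Sum>k<D. if k = bar_T T j then A $$ (k, i) * sgn_T T k else 0)"
        using that by (intro sum.cong refl) (auto simp: Oe)
      also have "\<dots> = A $$ (bar_T T j, i) * sgn_T T (bar_T T j)" using that b by simp
      finally show ?thesis using T by (simp add: dual_sign_dual_index form_sign_def)
    qed
    have r: "(?O * A) $$ (i, j) = sgn_T T i * A $$ (bar_T T i, j)" if "i < D" "j < D" for i j
    proof -
      have "(?O * A) $$ (i, j) = (\<Sum>k<D. ?O $$ (i, k) * A $$ (k, j))"
        using A O that by (simp add: scalar_prod_def atLeast0LessThan)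
      also have "\<dots> = (\<Sum>k<D. if k = bar_T T i then sgn_T T i * A $$ (k, j) else 0)"
        using that by (intro sum.cong refl) (auto simp: Oe)
      finally show ?thesis using that b by simp
    qed
    have "transpose_mat A * ?O + ?O * A = 0\<^sub>m (2 * n) (2 * n) \<longleftrightarrow> (\<forall>i<D. \<forall>j<D. - sgn_T T j * A $$ (bar_T T j, i) + sgn_T T i * A $$ (bar_T T i, j) = 0)"
      using A O l r D2 by (simp add: mat_eq_iff)
    also have "\<dots> \<longleftrightarrow> (\<forall>i j. star T (corner A) i j = - corner A i j)"
    proof
      assume *: "\<forall>i<D. \<forall>j<D. - sgn_T T j * A $$ (bar_T T j, i) + sgn_T T i * A $$ (bar_T T i, j) = 0"
      show "\<forall>i j. star T (corner A) i j = - corner A i j"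
      proof (intro allI)
        fix i j
        show "star T (corner A) i j = - corner A i j"
        proof (cases "i < D \<and> j < D")
          case True
          then have "- sgn_T T j * A $$ (bar_T T j, bar_T T i) + sgn_T T (bar_T T i) * A $$ (i, j) = 0"
            using *[rule_format, of "bar_T T i" j] b by simp
          then have "- (sgn_T T j * A $$ (bar_T T j, bar_T T i)) = sgn_T T i * A $$ (i, j)" using T by (simp add: dual_sign_dual_index form_sign_def)
          then have "sgn_T T j * A $$ (bar_T T j, bar_T T i) = - (sgn_T T i * A $$ (i, j))" by (metis minus_minus)
          then have "sgn_T T i * (sgn_T T j * A $$ (bar_T T j, bar_T T i)) = - A $$ (i, j)" by simp
          then show ?thesis using True A b by (simp add: star_def corner_def mult.assoc)
        next
          case False
          then show ?thesis using A b by (auto simp: star_def corner_def)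
        qed
      qed
    next
      assume *: "\<forall>i j. star T (corner A) i j = - corner A i j"
      show "\<forall>i<D. \<forall>j<D. - sgn_T T j * A $$ (bar_T T j, i) + sgn_T T i * A $$ (bar_T T i, j) = 0"
      proof (intro allI impI)
        fix i j assume ij: "i < D" "j < D"
        have "sgn_T T (bar_T T i) * (sgn_T T j * A $$ (bar_T T j, i)) = - A $$ (bar_T T i, j)"
          using *[rule_format, of "bar_T T i" j] ij A b by (simp add: star_def corner_def mult.assoc)
        then have "sgn_T T i * (- (sgn_T T i * (sgn_T T j * A $$ (bar_T T j, i)))) = - (sgn_T T i * A $$ (bar_T T i, j))"
          using T by (simp add: dual_sign_dual_index form_sign_def)
        then show "- sgn_T T j * A $$ (bar_T T j, i) + sgn_T T i * A $$ (bar_T T i, j) = 0" by simp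
      qed
    qed
    finally show ?thesis using A T sup_corner[OF A] D2 by (auto simp: sp_mat_def std_lie_def std_gl_def)
  qed
  have iff: "A \<in> classical_mat T n \<longleftrightarrow> corner A \<in> std_lie T D" if "A \<in> carrier_mat D D" for A :: "'a mat"
    using so[OF that] sl[OF that] sp[OF that] by (cases T) (auto simp: D_def)
  show "corner ` classical_mat T n = (std_lie T (natural_dim T n) :: 'a infmat set)"
  proof
    show "corner ` classical_mat T n \<subseteq> (std_lie T (natural_dim T n) :: 'a infmat set)"
      using iff classical_carrier unfolding D_def by blast
    show "(std_lie T (natural_dim T n) :: 'a infmat set) \<subseteq> corner ` classical_mat T n"
    proof
      fix M :: "'a infmat" assume M: "M \<in> std_lie T (natural_dim T n)"
      then have "corner (f M) = M" by (intro cf) (simp add: std_lie_def std_gl_def D_def)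
      moreover have "f M \<in> classical_mat T n" using iff[OF f, of M] M calculation by (simp add: D_def)
      ultimately show "M \<in> corner ` classical_mat T n" by (metis imageI)
    qed
  qed
qed

section \<open>Gluing natural modules\<close>

text \<open>In the types B, C and D the automorphism \<open>M \<mapsto> C M C'\<close> preserves the Lie algebra
  because \<open>C'\<close> is the adjoint of \<open>C\<close>.\<close>

definition conj_pair :: "cartan_type \<Rightarrow> nat \<Rightarrow> 'a::comm_ring_1 infmat \<Rightarrow> 'a infmat \<Rightarrow> bool" where
  "conj_pair T D C C' \<longleftrightarrow> sup_in D C \<and> sup_in D C' \<and> mprod D C C' = unit_mat D \<and> mprod D C' C = unit_mat D \<and>
     (T \<noteq> Type_A \<longrightarrow> C' = star T C)"

definition conj_by :: "nat \<Rightarrow> 'a::comm_ring_1 infmat \<Rightarrow> 'a infmat \<Rightarrow> 'a infmat \<Rightarrow> 'a infmat" where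
  "conj_by D C C' M = mprod D (mprod D C M) C'"

lemma conj_by_inverse:
  assumes "conj_pair T D C C'" "sup_in D M"
  shows "conj_by D C' C (conj_by D C C' M) = M"
proof -
  have "conj_by D C' C (conj_by D C C' M) = mprod D (mprod D (mprod D C' C) M) (mprod D C' C)"
    by (simp add: conj_by_def mprod_assoc')
  then show ?thesis using assms by (simp add: conj_pair_def mprod_unit)
qed

lemma conj_pair_sym: "conj_pair T D C C' \<Longrightarrow> conj_pair T D C' C"
  by (auto simp: conj_pair_def star_star')

lemma conj_by_std_lie:
  assumes D: "T = Type_C \<Longrightarrow> even D" and c: "conj_pair T D C C'" and M: "M \<in> std_lie T D"
  shows "conj_by D C C' M \<in> std_lie T D"
proof -
  have s: "sup_in D (conj_by D C C' M)" using c M unfolding conj_by_def conj_pair_def std_lie_def std_gl_def by (auto intro!: sup_mprod)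
  have sk: "star T (conj_by D C C' M) i j = - conj_by D C C' M i j" if T: "T \<noteq> Type_A" for i j
  proof -
    have C': "C' = star T C" "star T C' = C" using c T by (auto simp: conj_pair_def star_star')
    have sM: "star T M = (\<lambda>i j. - M i j)" using M T by (intro ext) (auto simp: std_lie_def std_gl_def)
    have sm: "star T (mprod D A B) = mprod D (star T B) (star T A)" for A B :: "'a infmat" by (rule star_mm', rule D)
    have "star T (conj_by D C C' M) = mprod D C (mprod D (star T M) C')"
      unfolding conj_by_def sm C'(2) C'(1)[symmetric] by simp
    moreover have "mprod D C (mprod D (star T M) C') i j = - mprod D C (mprod D M C') i j" unfolding sM by (simp add: mprod_def sum_negf)
    ultimately show ?thesis by (simp add: conj_by_def mprod_assoc')
  qed
  have tr: "(\<Sum>i<D. conj_by D C C' M i i) = 0" if T: "T = Type_A"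
  proof -
    have t: "(\<Sum>i<D. mprod D A B i i) = trace_prod D A B" for A B :: "'a infmat" by (simp add: mprod_def trace_prod_def)
    have "(\<Sum>i<D. conj_by D C C' M i i) = trace_prod D C' (mprod D C M)" unfolding conj_by_def t by (rule trace_prod_commute)
    also have "\<dots> = trace_prod D (mprod D C' C) M" by (rule trace_prod_mprod[symmetric])
    also have "\<dots> = trace_prod D M (unit_mat D)" using c by (simp add: conj_pair_def trace_prod_commute)
    also have "\<dots> = (\<Sum>i<D. mprod D M (unit_mat D) i i)" by (rule t[symmetric])
    also have "\<dots> = 0" using M T mprod_unit(1)[of D M] by (simp add: std_lie_def std_gl_def)
    finally show ?thesis .
  qed
  show ?thesis using s sk tr by (auto simp: std_lie_def std_gl_def)
qed

lemma conj_by_bij: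
  assumes D: "T = Type_C \<Longrightarrow> even D" and c: "conj_pair T D C C'"
  shows "bij_betw (conj_by D C C') (std_lie T D) (std_lie T D)"
  by (rule bij_betw_byWitness[where f' = "conj_by D C' C"])
    (use conj_by_std_lie[OF D c] conj_by_std_lie[OF D conj_pair_sym[OF c]] conj_by_inverse[OF c] conj_by_inverse[OF conj_pair_sym[OF c]]
      in \<open>auto simp: std_lie_def std_gl_def\<close>)

lemma conj_by_mprod:
  assumes "conj_pair T D C C'" "sup_in D M" "sup_in D N"
  shows "conj_by D C C' (mprod D M N) = mprod D (conj_by D C C' M) (conj_by D C C' N)"
proof -
  have "mprod D (conj_by D C C' M) (conj_by D C C' N) = mprod D (mprod D (mprod D C M) (mprod D (mprod D C' C) N)) C'"
    by (simp add: conj_by_def mprod_assoc')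
  also have "mprod D C' C = unit_mat D" using assms by (simp add: conj_pair_def)
  finally show ?thesis using assms by (simp add: conj_by_def mprod_assoc' mprod_unit)
qed

lemma conj_by_trace_prod:
  assumes "conj_pair T D C C'" "sup_in D M" "sup_in D N"
  shows "trace_prod D (conj_by D C C' M) (conj_by D C C' N) = trace_prod D M N"
proof -
  have t: "trace_prod D A B = (\<Sum>i<D. mprod D A B i i)" for A B :: "'a infmat" by (simp add: mprod_def trace_prod_def)
  have "trace_prod D (conj_by D C C' M) (conj_by D C C' N) = (\<Sum>i<D. mprod D (mprod D C (mprod D M N)) C' i i)"
    unfolding t conj_by_mprod[OF assms, symmetric] by (simp add: conj_by_def)
  also have "\<dots> = trace_prod D C' (mprod D C (mprod D M N))" unfolding t[symmetric] by (rule trace_prod_commute)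
  also have "\<dots> = trace_prod D (mprod D C' C) (mprod D M N)" by (rule trace_prod_mprod[symmetric])
  also have "\<dots> = trace_prod D (mprod D M N) (unit_mat D)" using assms by (simp add: conj_pair_def trace_prod_commute)
  also have "\<dots> = trace_prod D M N" unfolding t using mprod_unit(1)[OF sup_mprod[OF assms(2,3)]] by simp
  finally show ?thesis .
qed

lemma conj_by_factor_rank:
  fixes M :: "'a::field infmat"
  assumes c: "conj_pair T D C C'" and M: "factor_rank {..<D} r (\<lambda>i j. M i j - (if i = j then \<mu> else 0))"
  shows "factor_rank {..<D} r (\<lambda>i j. conj_by D C C' M i j - (if i = j then \<mu> else 0))"
proof -
  obtain a b where ab: "\<forall>i\<in>{..<D}. \<forall>j\<in>{..<D}. M i j - (if i = j then \<mu> else 0) = (\<Sum>l<r. a i l * b l j)" using M by (auto simp: factor_rank_def)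
  have "conj_by D C C' M i j - (if i = j then \<mu> else 0) = (\<Sum>l<r. (\<Sum>p<D. C i p * a p l) * (\<Sum>q<D. b l q * C' q j))" if "i < D" "j < D" for i j
  proof -
    have "conj_by D C C' M i j = (\<Sum>q<D. \<Sum>p<D. C i p * M p q * C' q j)"
      by (simp add: conj_by_def mprod_def sum_distrib_right)
    also have "\<dots> = (\<Sum>q<D. \<Sum>p<D. C i p * ((\<Sum>l<r. a p l * b l q) + (if p = q then \<mu> else 0)) * C' q j)"
      using ab by (intro sum.cong refl) (simp add: algebra_simps)
    also have "\<dots> = (\<Sum>q<D. \<Sum>p<D. C i p * (\<Sum>l<r. a p l * b l q) * C' q j) + (\<Sum>q<D. \<Sum>p<D. if p = q then C i p * \<mu> * C' q j else 0)"
      unfolding sum.distrib[symmetric] by (intro sum.cong refl) (simp add: algebra_simps)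
    also have "(\<Sum>q<D. \<Sum>p<D. if p = q then C i p * \<mu> * C' q j else 0) = \<mu> * mprod D C C' i j"
      by (simp add: mprod_def sum_distrib_left mult_ac)
    also have "(\<Sum>q<D. \<Sum>p<D. C i p * (\<Sum>l<r. a p l * b l q) * C' q j) = (\<Sum>q<D. \<Sum>p<D. \<Sum>l<r. (C i p * a p l) * (b l q * C' q j))"
      by (simp add: sum_distrib_left sum_distrib_right mult_ac)
    also have "\<dots> = (\<Sum>q<D. \<Sum>l<r. \<Sum>p<D. (C i p * a p l) * (b l q * C' q j))" by (intro sum.cong refl sum.swap)
    also have "\<dots> = (\<Sum>l<r. \<Sum>q<D. \<Sum>p<D. (C i p * a p l) * (b l q * C' q j))" by (rule sum.swap)
    also have "\<dots> = (\<Sum>l<r. \<Sum>p<D. \<Sum>q<D. (C i p * a p l) * (b l q * C' q j))" by (intro sum.cong refl sum.swap)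
    finally show ?thesis using c that by (simp add: conj_pair_def unit_mat_def sum_product)
  qed
  then show ?thesis unfolding factor_rank_def
    by (intro exI[of _ "\<lambda>i l. \<Sum>p<D. C i p * a p l"] exI[of _ "\<lambda>l j. \<Sum>q<D. b l q * C' q j"]) auto
qed

text \<open>\<open>C\<close> completed by the identity, so that on corner matrices conjugation in
  size \<open>D\<close> agrees with conjugation by \<open>C\<close> in size
  \<open>e\<close>.\<close>

definition pad :: "nat \<Rightarrow> nat \<Rightarrow> 'a::comm_ring_1 infmat \<Rightarrow> 'a infmat" where
  "pad e D C i j = C i j + (if i = j \<and> e \<le> i \<and> i < D then 1 else 0)"

lemma sup_in_mono: "sup_in e M \<Longrightarrow> e \<le> D \<Longrightarrow> sup_in D M"
  by (fastforce simp: sup_in_def)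

lemma std_lie_sup: "M \<in> std_lie T D \<Longrightarrow> sup_in D M"
  by (simp add: std_lie_def std_gl_def)

lemma mprod_pad:
  assumes e: "e \<le> D" and C: "sup_in e C" and M: "sup_in e M"
  shows "mprod D (pad e D C) M = mprod e C M" "mprod D M (pad e D C) = mprod e M C"
proof -
  show "mprod D (pad e D C) M = mprod e C M"
  proof (intro ext)
    fix i j
    have "mprod D (pad e D C) M i j = (\<Sum>k<e. pad e D C i k * M k j)"
      unfolding mprod_def using e sup_inD[OF M] by (intro sum.mono_neutral_right) auto
    also have "\<dots> = mprod e C M i j" unfolding mprod_def pad_def by (intro sum.cong) auto
    finally show "mprod D (pad e D C) M i j = mprod e C M i j" .
  qed
  show "mprod D M (pad e D C) = mprod e M C"
  proof (intro ext)
    fix i j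
    have "mprod D M (pad e D C) i j = (\<Sum>k<e. M i k * pad e D C k j)"
      unfolding mprod_def using e sup_inD[OF M] by (intro sum.mono_neutral_right) auto
    also have "\<dots> = mprod e M C i j" unfolding mprod_def pad_def by (intro sum.cong) auto
    finally show "mprod D M (pad e D C) i j = mprod e M C i j" .
  qed
qed

lemma mprod_restrict:
  assumes "e \<le> D" "sup_in e B"
  shows "mprod D A B = mprod e A B" "mprod D B A = mprod e B A"
  unfolding mprod_def fun_eq_iff using assms(1) sup_inD[OF assms(2)]
  by (intro allI sum.mono_neutral_right; auto)+

lemma pad_inverse:
  assumes e: "e \<le> D" and C: "sup_in e C" "sup_in e C'" and CC: "mprod e C C' = unit_mat e"
  shows "mprod D (pad e D C) (pad e D C') = unit_mat D"
proof (intro ext)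
  fix i j
  define u where "u i j = (if i = j \<and> e \<le> i \<and> i < D then 1 else 0 :: 'a)" for i j :: nat
  have z: "C i k * u k j = 0" "u i k * C' k j = 0" for k
    using sup_inD[OF C(1), of i k] sup_inD[OF C(2), of k j] by (auto simp: u_def)
  have "mprod D (pad e D C) (pad e D C') i j = (\<Sum>k<D. C i k * C' k j + u i k * u k j)"
    unfolding mprod_def pad_def u_def[symmetric] by (intro sum.cong refl) (simp add: distrib_left distrib_right z)
  also have "\<dots> = mprod D C C' i j + (\<Sum>k<D. if k = i then u i j else 0)"
    unfolding mprod_def sum.distrib by (intro arg_cong2[of _ _ _ _ "(+)"] sum.cong refl) (auto simp: u_def)
  also have "mprod D C C' = unit_mat e" using mprod_restrict(1)[OF e C(2)] CC by metis
  finally show "mprod D (pad e D C) (pad e D C') i j = unit_mat D i j" using e by (auto simp: unit_mat_def u_def)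
qed

lemma star_pad:
  assumes "T = Type_C \<Longrightarrow> even e" "T = Type_C \<Longrightarrow> even D"
  shows "star T (pad e D C) = pad e D (star T C)"
proof (intro ext)
  fix i j
  have l: "bar_T T k < e \<longleftrightarrow> k < e" "bar_T T k < D \<longleftrightarrow> k < D" for k
    using bar_less[of T e k] bar_less[of T D k] assms by auto
  have b: "bar_T T j = bar_T T i \<longleftrightarrow> i = j" by (metis dual_index_dual_index)
  show "star T (pad e D C) i j = pad e D (star T C) i j"
    using l by (auto simp: star_def pad_def b distrib_left not_le[symmetric])
qed

lemma conj_pair_pad:
  assumes e: "e \<le> D" and p: "T = Type_C \<Longrightarrow> even e" "T = Type_C \<Longrightarrow> even D" and C: "conj_pair T e C C'"
  shows "conj_pair T D (pad e D C) (pad e D C')"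
proof -
  have s: "sup_in D (pad e D C)" if "sup_in e C" for C :: "'a infmat"
    using sup_in_mono[OF that e] by (auto simp: sup_in_def pad_def)
  show ?thesis using C s pad_inverse[OF e, of C C'] pad_inverse[OF e, of C' C] star_pad[of T e D C, OF p]
    by (auto simp: conj_pair_def)
qed

lemma conj_by_pad:
  assumes "e \<le> D" and C: "conj_pair T e C C'" and M: "sup_in e M"
  shows "conj_by D (pad e D C) (pad e D C') M = conj_by e C C' M"
  using assms by (simp add: conj_by_def mprod_pad conj_pair_def sup_mprod)

lemma conj_pair_comp:
  assumes D: "T = Type_C \<Longrightarrow> even D" and C: "conj_pair T D C1 C1'" "conj_pair T D C2 C2'"
  shows "conj_pair T D (mprod D C1 C2) (mprod D C2' C1')"
proof -
  have 1: "mprod D (mprod D C1 C2) (mprod D C2' C1') = mprod D (mprod D C1 (mprod D C2 C2')) C1'"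
    and 2: "mprod D (mprod D C2' C1') (mprod D C1 C2) = mprod D (mprod D C2' (mprod D C1' C1)) C2"
    by (simp_all add: mprod_assoc')
  have s: "star T (mprod D C1 C2) = mprod D (star T C2) (star T C1)" by (rule star_mm', rule D)
  show ?thesis unfolding conj_pair_def 1 2 using C s by (auto simp: conj_pair_def mprod_unit sup_mprod)
qed

lemma conj_by_comp: "conj_by D (mprod D C1 C2) (mprod D C2' C1') M = conj_by D C1 C1' (conj_by D C2 C2' M)"
  by (simp add: conj_by_def mprod_assoc')

text \<open>In the types B, C and D two embeddings of Lie algebras that are conjugate by \<open>P\<close> in the
  general linear group give \<open>H = P\<^sup>* P\<close> commuting with the smaller Lie algebra; a square root
  of \<open>H\<close> turns \<open>P\<close> into an isometry.\<close>

lemma commutant: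
  fixes H :: "'a::field_char_0 infmat"
  assumes T: "T \<noteq> Type_A" and e: "3 \<le> e" "e \<le> D" "T = Type_C \<Longrightarrow> even e"
    and com: "\<And>M. M \<in> std_lie T e \<Longrightarrow> mprod D H M = mprod D M H"
  shows "\<exists>c. (\<forall>i<e. \<forall>j<D. H i j = (if i = j then c else 0)) \<and> (\<forall>i<D. \<forall>j<e. H i j = (if i = j then c else 0))"
proof -
  \<comment> \<open>Matrix units made skew; comparing the entries of their products with
    \<open>H\<close> on either side yields all relations needed.\<close>
  define E where "E k l i j = (if i = k \<and> j = l then 1 else 0) - (if i = bar_T T l \<and> j = bar_T T k then sgn_T T k * sgn_T T l else 0 :: 'a)"
    for k l i j :: nat
  have b: "bar_T T k < e \<longleftrightarrow> k < e" for k using e(3) by (rule bar_less)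

  have E: "E k l \<in> std_lie T e" if "k < e" "l < e" for k l
  proof -
    have "star T (E k l) i j = - E k l i j" for i j
    proof -
      have b1: "bar_T T j = k \<longleftrightarrow> j = bar_T T k" "bar_T T i = l \<longleftrightarrow> i = bar_T T l"
        "bar_T T j = bar_T T l \<longleftrightarrow> j = l" "bar_T T i = bar_T T k \<longleftrightarrow> i = k" by (metis dual_index_dual_index)+
      have s1: "sgn_T T i * sgn_T T j * (if j = bar_T T k \<and> i = bar_T T l then 1 else 0) = (if i = bar_T T l \<and> j = bar_T T k then sgn_T T k * sgn_T T l else 0 :: 'a)"
        by (auto simp: dual_sign_dual_index form_sign_def mult.commute)
      have s2: "sgn_T T i * sgn_T T j * (if j = l \<and> i = k then sgn_T T k * sgn_T T l else 0) = (if i = k \<and> j = l then 1 else 0 :: 'a)"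
        by (simp add: dual_sign_def)
      show ?thesis unfolding star_def E_def b1 right_diff_distrib s1 s2 by simp
    qed
    moreover have "sup_in e (E k l)" using that b by (auto simp: sup_in_def E_def split: if_splits)
    ultimately show ?thesis using T by (simp add: std_lie_def std_gl_def)
  qed
  have HE: "mprod D H (E k l) i j = (if j = l then H i k else 0) - (if j = bar_T T k then H i (bar_T T l) * (sgn_T T k * sgn_T T l) else 0)"
    if "k < e" "l < e" for k l i j
  proof -
    have "mprod D H (E k l) i j = (\<Sum>p<D. (if p = k then (if j = l then H i k else 0) else 0)
        - (if p = bar_T T l then (if j = bar_T T k then H i (bar_T T l) * (sgn_T T k * sgn_T T l) else 0) else 0))"
      unfolding mprod_def E_def by (intro sum.cong refl) (auto simp: algebra_simps)
    moreover have "k < D" "bar_T T l < D" using that e(2) b[of l] by auto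
    ultimately show ?thesis by (simp add: sum_subtractf)
  qed
  have EH: "mprod D (E k l) H i j = (if i = k then H l j else 0) - (if i = bar_T T l then sgn_T T k * sgn_T T l * H (bar_T T k) j else 0)"
    if "k < e" "l < e" for k l i j
  proof -
    have "mprod D (E k l) H i j = (\<Sum>p<D. (if p = l then (if i = k then H l j else 0) else 0)
        - (if p = bar_T T k then (if i = bar_T T l then sgn_T T k * sgn_T T l * H (bar_T T k) j else 0) else 0))"
      unfolding mprod_def E_def by (intro sum.cong refl) (auto simp: algebra_simps)
    moreover have "l < D" "bar_T T k < D" using that e(2) b[of k] by auto
    ultimately show ?thesis by (simp add: sum_subtractf)
  qed
  have eq: "(if j = l then H i k else 0) - (if j = bar_T T k then H i (bar_T T l) * (sgn_T T k * sgn_T T l) else 0)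
      = (if i = k then H l j else 0) - (if i = bar_T T l then sgn_T T k * sgn_T T l * H (bar_T T k) j else 0)"
    if "k < e" "l < e" for k l i j
    using HE[OF that, of i j] EH[OF that, of i j] com[OF E[OF that]] by simp
  \<comment> \<open>Three indices suffice to avoid two forbidden ones, which is the reason for
    \<open>3 \<le> e\<close>.\<close>
  have ex: "\<exists>m<e. m \<noteq> x \<and> m \<noteq> y" for x y
  proof -
    have "(0 \<noteq> x \<and> 0 \<noteq> y) \<or> (1 \<noteq> x \<and> 1 \<noteq> y) \<or> (2 \<noteq> x \<and> 2 \<noteq> y)" by auto
    moreover have "0 < e" "1 < e" "2 < e" using e(1) by auto
    ultimately show ?thesis by blast
  qed
  have out1: "H l j = 0" if "l < e" "e \<le> j" for l j
  proof -
    obtain k where k: "k < e" "k \<noteq> bar_T T l" using ex by blast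
    have "j \<noteq> l" "j \<noteq> bar_T T k" using b[of k] k that by auto
    then show ?thesis using eq[OF k(1) that(1), of j k] k by simp
  qed
  have out2: "H j k = 0" if "k < e" "e \<le> j" for k j
  proof -
    obtain l where l: "l < e" "l \<noteq> bar_T T k" using ex by blast
    have "j \<noteq> k" "j \<noteq> bar_T T l" using b[of l] l that by auto
    then show ?thesis using eq[OF that(1) l(1), of l j] l by simp
  qed
  have off: "H i k = 0" if "i < e" "k < e" "i \<noteq> k" for i k
  proof -
    obtain l where l: "l < e" "l \<noteq> bar_T T k" "l \<noteq> bar_T T i" using ex by blast
    then have "i \<noteq> bar_T T l" by auto
    then show ?thesis using eq[OF that(2) l(1), of l i] l that by simp
  qed
  have dg: "H k k = H l l" if "k < e" "l < e" "l \<noteq> bar_T T k" for k l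
  proof -
    have "k \<noteq> bar_T T l" using that by auto
    then show ?thesis using eq[OF that(1,2), of l k] that by simp
  qed
  have dg': "H k k = H 0 0" if k: "k < e" for k
  proof (cases "0 = bar_T T k")
    case True
    obtain m where m: "m < e" "m \<noteq> k" "m \<noteq> bar_T T k" using ex by blast
    then have "0 \<noteq> bar_T T m" using True by (metis dual_index_dual_index)
    then show ?thesis using dg[OF k m(1,3)] dg[OF m(1), of 0] e by auto
  next
    case False
    then show ?thesis using dg[OF k, of 0] e by auto
  qed
  have "H i j = (if i = j then H 0 0 else 0)" if "i < e \<or> j < e" for i j
    using that off[of i j] dg'[of i] out1[of i j] out2[of j i] by (cases "i < e"; cases "j < e") auto
  then show ?thesis by (intro exI[of _ "H 0 0"]) blast
qed

text \<open>The symmetric matrix with rows (a, b) and (b, f) is a transpose times a matrix. If a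
  diagonal entry is nonzero, complete the square; if both are 0, the form is a hyperbolic plane and
  a square root of -1 does it.\<close>

lemma symmetric_2x2:
  fixes a b f :: "'a::{alg_closed_field, field_char_0}"
  shows "\<exists>x y z w. x * x + z * z = a \<and> x * y + z * w = b \<and> y * y + w * w = f"
proof -
  have *: "\<exists>x y w. x * x = a \<and> x * y = b \<and> y * y + w * w = f" if a: "a \<noteq> 0" for a b f :: 'a
  proof -
    obtain p where p: "p * p = a" using sqrt_exists by blast
    obtain q where q: "q * q = f - (b / p) * (b / p)" using sqrt_exists by blast
    have "p \<noteq> 0" using p a by auto
    then show ?thesis using p q by (intro exI[of _ p] exI[of _ "b / p"] exI[of _ q]) simp
  qed
  consider "a \<noteq> 0" | "f \<noteq> 0" | "a = 0" "f = 0" by blast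
  then show ?thesis
  proof cases
    case 1
    then obtain x y w where "x * x = a" "x * y = b" "y * y + w * w = f" using * by blast
    then show ?thesis by (intro exI[of _ x] exI[of _ y] exI[of _ 0] exI[of _ w]) simp
  next
    case 2
    then obtain x y w where "x * x = f" "x * y = b" "y * y + w * w = a" using * by blast
    then show ?thesis by (intro exI[of _ y] exI[of _ x] exI[of _ w] exI[of _ 0]) (simp add: mult.commute)
  next
    case 3
    obtain i :: 'a where i: "i * i = - 1" using sqrt_exists by blast
    have "i * (i * b) = - b" using i by (metis mult.assoc mult_minus1)
    then have "1 * (b / 2) + i * (- i * (b / 2)) = b" by (simp add: field_simps)
    moreover have "b / 2 * (b / 2) + (- i * (b / 2)) * (- i * (b / 2)) = 0"
    proof -
      have "(- i * (b / 2)) * (- i * (b / 2)) = (i * i) * (b / 2 * (b / 2))" by (simp add: mult_ac)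
      then show ?thesis by (simp add: i)
    qed
    ultimately show ?thesis using 3 i
      by (intro exI[of _ 1] exI[of _ "b / 2"] exI[of _ i] exI[of _ "- i * (b / 2)"]) simp
  qed
qed

text \<open>The square root of a self-adjoint matrix commuting with the smaller Lie algebra: on the natural
  module it is a scalar, and on the two-dimensional complement a symmetric bilinear form over an
  algebraically closed field is a sum of squares, while in type C it is again a scalar.\<close>

lemma adjoint_root:
  fixes H :: "'a::{alg_closed_field, field_char_0} infmat"
  assumes T: "T \<noteq> Type_A" and e: "T = Type_C \<Longrightarrow> even e"
    and H: "sup_in (e + 2) H" "star T H = H"
    and Hc: "\<forall>i<e. \<forall>j<e + 2. H i j = (if i = j then c else 0)" "\<forall>i<e + 2. \<forall>j<e. H i j = (if i = j then c else 0)"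
  shows "\<exists>s t. sup_in (e + 2) s \<and> mprod (e + 2) (star T s) s = H \<and>
    (\<forall>i j. i < e \<or> j < e \<longrightarrow> s i j = (if i = j then t else 0))"
proof -
  obtain t where t: "t * t = c" using sqrt_exists by blast
  define S where "S x y z w i j = (if i < e \<and> i = j then t else if i = e \<and> j = e then x else if i = e \<and> j = e + 1 then y
    else if i = e + 1 \<and> j = e then z else if i = e + 1 \<and> j = e + 1 then w else 0)" for x y z w and i j :: nat
  have Ssup: "sup_in (e + 2) (S x y z w)" for x y z w by (auto simp: sup_in_def S_def split: if_splits)
  have Sc: "i < e \<or> j < e \<longrightarrow> S x y z w i j = (if i = j then t else 0)" for x y z w i j by (auto simp: S_def)
  have S1: "S x y z w i e = (if i = e then x else if i = Suc e then z else 0)"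
    "S x y z w i (Suc e) = (if i = e then y else if i = Suc e then w else 0)"
    "S x y z w e j = (if j = e then x else if j = Suc e then y else 0)"
    "S x y z w (Suc e) j = (if j = e then z else if j = Suc e then w else 0)" for x y z w i j
    by (auto simp: S_def)
  have prod: "mprod (e + 2) (S x y z w) (S x' y' z' w') i j =
      (if i < e \<and> i = j then c else if i = e \<and> j = e then x * x' + y * z' else if i = e \<and> j = e + 1 then x * y' + y * w'
       else if i = e + 1 \<and> j = e then z * x' + w * z' else if i = e + 1 \<and> j = e + 1 then z * y' + w * w' else 0)"
    for x y z w x' y' z' w' i j
  proof -
    have "mprod (e + 2) (S x y z w) (S x' y' z' w') i j = (\<Sum>k<e. S x y z w i k * S x' y' z' w' k j)
        + S x y z w i e * S x' y' z' w' e j + S x y z w i (Suc e) * S x' y' z' w' (Suc e) j"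
      by (simp add: mprod_def)
    also have "(\<Sum>k<e. S x y z w i k * S x' y' z' w' k j) = (\<Sum>k<e. if k = i then (if i = j then c else 0) else 0)"
      using t by (intro sum.cong refl) (auto simp: S_def)
    finally show ?thesis
      by (cases "i = e"; cases "i = Suc e"; cases "j = e"; cases "j = Suc e"; simp add: S1)
  qed
  have Hz: "H i j = 0" if "\<not> (i < e + 2 \<and> j < e + 2)" for i j using sup_inD[OF H(1)] that by (meson not_le)
  have HS: "H i j = (if i < e \<and> i = j then c else if i = e \<and> j = e then H e e else if i = e \<and> j = e + 1 then H e (e + 1)
       else if i = e + 1 \<and> j = e then H (e + 1) e else if i = e + 1 \<and> j = e + 1 then H (e + 1) (e + 1) else 0)" for i j
  proof (cases "i < e \<or> j < e \<or> e + 2 \<le> i \<or> e + 2 \<le> j")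
    case True
    have "H i j = (if i < e \<and> i = j then c else 0)"
    proof (cases "i < e + 2 \<and> j < e + 2")
      case in2: True
      then have "i < e \<or> j < e" using True by linarith
      then show ?thesis
      proof
        assume "i < e"
        then show ?thesis using Hc(1)[rule_format, of i j] in2 by simp
      next
        assume "j < e"
        then show ?thesis using Hc(2)[rule_format, of i j] in2 by simp
      qed
    qed (use Hz[of i j] in auto)
    moreover have "\<not> (i = e \<and> j = e)" "\<not> (i = e \<and> j = e + 1)" "\<not> (i = e + 1 \<and> j = e)" "\<not> (i = e + 1 \<and> j = e + 1)"
      using True by linarith+
    ultimately show ?thesis by (simp only: if_False)
  next
    case False
    then consider "i = e" "j = e" | "i = e" "j = e + 1" | "i = e + 1" "j = e" | "i = e + 1" "j = e + 1" by linarith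
    then show ?thesis by cases simp_all
  qed
  show ?thesis
  proof (cases "T = Type_C")
    case True
    have ev: "even e" using True e by simp
    have "star T H e e = H e e" "star T H e (e + 1) = H e (e + 1)" "star T H (e + 1) e = H (e + 1) e" by (simp_all only: H(2))
    then have 1: "H (e + 1) (e + 1) = H e e" "- H e (e + 1) = H e (e + 1)" "- H (e + 1) e = H (e + 1) e"
      using True ev by (simp_all add: star_def dual_index_def dual_sign_def)
    then have 2: "H e (e + 1) = 0" "H (e + 1) e = 0" by simp_all
    obtain x where x: "x * x = H e e" using sqrt_exists by blast
    have st: "star T (S x 0 0 x) = S x 0 0 x"
    proof (intro ext)
      fix i j
      have b: "bar_T T k < e \<longleftrightarrow> k < e" for k using e by (rule bar_less)
      have "bar_T T e = e + 1" "bar_T T (e + 1) = e" using True ev by (simp_all add: dual_index_def)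
      then have b2: "bar_T T k = e \<longleftrightarrow> k = e + 1" "bar_T T k = e + 1 \<longleftrightarrow> k = e" for k by (metis dual_index_dual_index)+
      have b3: "bar_T T j = bar_T T i \<longleftrightarrow> i = j" by (metis dual_index_dual_index)
      show "star T (S x 0 0 x) i j = S x 0 0 x i j"
        unfolding star_def S_def b b2 b3 by (cases "i = e"; cases "j = e"; cases "i = e + 1"; cases "j = e + 1"; cases "i = j"; simp)
    qed
    have "mprod (e + 2) (star T (S x 0 0 x)) (S x 0 0 x) = H"
    proof (intro ext)
      fix i j
      show "mprod (e + 2) (star T (S x 0 0 x)) (S x 0 0 x) i j = H i j"
        unfolding st prod HS[of i j] x 1(1) 2 by simp
    qed
    then show ?thesis using Ssup Sc by (intro exI[of _ "S x 0 0 x"] exI[of _ t]) simp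
  next
    case False
    have st: "star T M i j = M j i" for M :: "'a infmat" and i j using False by (simp add: star_def dual_index_def dual_sign_def)
    have sym: "H (e + 1) e = H e (e + 1)" using fun_cong[OF fun_cong[OF H(2), of e], of "e + 1"] by (simp add: st)
    obtain x y z w where xy: "x * x + z * z = H e e" "x * y + z * w = H e (e + 1)" "y * y + w * w = H (e + 1) (e + 1)"
      using symmetric_2x2[of "H e e" "H e (e + 1)" "H (e + 1) (e + 1)"] by blast
    have st': "star T (S x y z w) = S x z y w"
    proof (intro ext)
      fix i j
      show "star T (S x y z w) i j = S x z y w i j"
        unfolding st S_def by (cases "i = e"; cases "j = e"; cases "i = e + 1"; cases "j = e + 1"; cases "i = j"; simp)
    qed
    have "mprod (e + 2) (star T (S x y z w)) (S x y z w) = H"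
    proof (intro ext)
      fix i j
      show "mprod (e + 2) (star T (S x y z w)) (S x y z w) i j = H i j"
        unfolding st' prod HS[of i j] sym xy[symmetric] by (simp add: mult.commute)
    qed
    then show ?thesis using Ssup Sc by (intro exI[of _ "S x y z w"] exI[of _ t]) simp
  qed
qed

lemma conj_pair_exists:
  fixes P Q :: "'a::{alg_closed_field, field_char_0} infmat"
  assumes e: "3 \<le> e" "T = Type_C \<Longrightarrow> even e" and D: "T \<noteq> Type_A \<Longrightarrow> D = e + 2"
    and P: "sup_in D P" "sup_in D Q" "mprod D P Q = unit_mat D" "mprod D Q P = unit_mat D" and eD: "e \<le> D"
    and PQ: "\<And>M. M \<in> std_lie T e \<Longrightarrow> mprod D (mprod D P M) Q \<in> std_lie T D"
  shows "\<exists>P' Q'. conj_pair T D P' Q' \<and> (\<forall>M\<in>std_lie T e. conj_by D P' Q' M = mprod D (mprod D P M) Q)"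
proof (cases "T = Type_A")
  case True
  then show ?thesis using P by (intro exI[of _ P] exI[of _ Q]) (simp add: conj_pair_def conj_by_def)
next
  case T: False
  have D2: "D = e + 2" using D T by simp
  have Dev: "T = Type_C \<Longrightarrow> even D" using e(2) D2 by simp
  have sm: "star T (mprod D A B) = mprod D (star T B) (star T A)" for A B :: "'a infmat" by (rule star_mm', rule Dev)
  have ss: "sup_in D A \<Longrightarrow> sup_in D (star T A)" for A :: "'a infmat" by (rule sup_star, rule Dev)
  have su: "star T (unit_mat D) = (unit_mat D :: 'a infmat)" by (rule star_unit, rule Dev)
  have mn: "mprod D (\<lambda>i j. - A i j) B = (\<lambda>i j. - mprod D A B i j)" "mprod D A (\<lambda>i j. - B i j) = (\<lambda>i j. - mprod D A B i j)"
    for A B :: "'a infmat" by (intro ext; simp add: mprod_def sum_negf)+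
  let ?H = "mprod D (star T P) P"
  have sPQ: "mprod D (star T Q) (star T P) = unit_mat D" "mprod D (star T P) (star T Q) = unit_mat D"
    using sm[of P Q] sm[of Q P] P su by simp_all
  have com: "mprod D ?H M = mprod D M ?H" if M: "M \<in> std_lie T e" for M
  proof -
    have Ms: "sup_in D M" using sup_in_mono[OF std_lie_sup[OF M] eD] .
    have sM: "star T M = (\<lambda>i j. - M i j)" using M T by (intro ext) (auto simp: std_lie_def std_gl_def)
    have "star T (mprod D (mprod D P M) Q) = (\<lambda>i j. - mprod D (mprod D P M) Q i j)" using PQ[OF M] T by (intro ext) (auto simp: std_lie_def std_gl_def)
    moreover have "star T (mprod D (mprod D P M) Q) = (\<lambda>i j. - mprod D (star T Q) (mprod D M (star T P)) i j)"
      unfolding sm sM mn ..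
    ultimately have "mprod D (mprod D P M) Q = mprod D (star T Q) (mprod D M (star T P))" by (simp add: fun_eq_iff)
    then have "mprod D (mprod D (star T P) (mprod D (mprod D P M) Q)) P = mprod D (mprod D (star T P) (mprod D (star T Q) (mprod D M (star T P)))) P" by simp
    moreover have "mprod D (mprod D (star T P) (mprod D (mprod D P M) Q)) P = mprod D (mprod D ?H M) (mprod D Q P)" by (simp add: mprod_assoc')
    moreover have "mprod D (mprod D (star T P) (mprod D (star T Q) (mprod D M (star T P)))) P = mprod D (mprod D (mprod D (star T P) (star T Q)) M) ?H"
      by (simp add: mprod_assoc')
    ultimately show ?thesis using P Ms ss by (simp add: sPQ mprod_unit sup_mprod)
  qed
  obtain c where c: "\<forall>i<e. \<forall>j<D. ?H i j = (if i = j then c else 0)" "\<forall>i<D. \<forall>j<e. ?H i j = (if i = j then c else 0)"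
    using commutant[of T e D ?H, OF T e(1) eD e(2) com] by auto
  have Hs: "sup_in D ?H" "star T ?H = ?H" using P ss by (auto simp: sup_mprod sm star_star')
  have "sup_in (e + 2) ?H" using Hs(1) D2 by simp
  moreover have "\<forall>i<e. \<forall>j<e + 2. ?H i j = (if i = j then c else 0)" "\<forall>i<e + 2. \<forall>j<e. ?H i j = (if i = j then c else 0)"
    using c D2 by simp_all
  ultimately have "\<exists>s t. sup_in (e + 2) s \<and> mprod (e + 2) (star T s) s = ?H \<and> (\<forall>i j. i < e \<or> j < e \<longrightarrow> s i j = (if i = j then t else 0))"
    by (intro adjoint_root[OF T e(2) _ Hs(2)])
  then obtain s t where s: "sup_in D s" "mprod D (star T s) s = ?H" and st: "\<forall>i j. i < e \<or> j < e \<longrightarrow> s i j = (if i = j then t else 0)"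
    unfolding D2[symmetric] by blast
  have scom: "mprod D s M = mprod D M s" if M: "M \<in> std_lie T e" for M
  proof (intro ext)
    fix i j
    note z = sup_inD[OF std_lie_sup[OF M]]
    have "s i k * M k j = (if k = i then t * M i j else 0)" for k using st z[of k j] z[of i j] by (cases "k < e") auto
    moreover have "M i k * s k j = (if k = j then t * M i j else 0)" for k using st z[of i k] z[of i j] by (cases "k < e") auto
    ultimately have "mprod D s M i j = (if i < D then t * M i j else 0)" "mprod D M s i j = (if j < D then t * M i j else 0)"
      by (simp_all add: mprod_def)
    then show "mprod D s M i j = mprod D M s i j" using z[of i j] eD by (cases "i < D"; cases "j < D") auto
  qed
  \<comment> \<open>From \<open>star P P = star s s\<close> it follows that P times the inverse of
    \<open>s\<close> is an isometry. Its inverse is \<open>s Q\<close>, so it equals the adjoint of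
    \<open>s Q\<close>, a description that avoids inverting \<open>s\<close>. As \<open>s\<close>
    commutes with the smaller Lie algebra, the embedding stays the same.\<close>
  let ?Q = "mprod D s Q" and ?P = "star T (mprod D s Q)"
  have PP: "?P = mprod D (star T Q) (star T s)" by (rule sm)
  have "mprod D ?P ?Q = mprod D (mprod D (star T Q) (mprod D (star T s) s)) Q" unfolding PP by (simp add: mprod_assoc')
  also have "\<dots> = mprod D (mprod D (mprod D (star T Q) (star T P)) P) Q" unfolding s(2) by (simp add: mprod_assoc')
  also have "\<dots> = unit_mat D" using P by (simp add: sPQ mprod_unit)
  finally have 1: "mprod D ?P ?Q = unit_mat D" .
  have sup: "sup_in D ?P" "sup_in D ?Q" using s(1) P ss sup_mprod by blast+
  have 2: "mprod D ?Q ?P = unit_mat D" by (rule inverse_flip[OF sup 1])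
  have "conj_pair T D ?P ?Q" using sup 1 2 by (simp add: conj_pair_def star_star')
  moreover have "conj_by D ?P ?Q M = mprod D (mprod D P M) Q" if M: "M \<in> std_lie T e" for M
  proof -
    have "conj_by D ?P ?Q M = mprod D (mprod D (mprod D (star T Q) (star T s)) (mprod D M s)) Q"
      unfolding PP conj_by_def by (simp add: mprod_assoc')
    also have "\<dots> = mprod D (mprod D (mprod D (star T Q) (mprod D (star T s) s)) M) Q"
      unfolding scom[OF M, symmetric] by (simp add: mprod_assoc')
    also have "\<dots> = mprod D (mprod D (mprod D (mprod D (star T Q) (star T P)) P) M) Q" unfolding s(2) by (simp add: mprod_assoc')
    also have "\<dots> = mprod D (mprod D P M) Q" using P by (simp add: sPQ mprod_unit)
    finally show ?thesis .
  qed
  ultimately show ?thesis by blast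
qed

text \<open>The correction at \<open>Suc n\<close> undoes the step from \<open>n\<close> and applies
  the correction at \<open>n\<close>, padded by the identity. The corrections are built by dependent
  choice, starting with the identity at level 3.\<close>

lemma conj_pairs_glue:
  fixes \<phi> :: "nat \<Rightarrow> 'a::{alg_closed_field, field_char_0} infmat \<Rightarrow> 'a infmat"
  assumes \<phi>: "\<And>n X. 3 \<le> n \<Longrightarrow> X \<in> g n \<Longrightarrow> sup_in (natural_dim T n) (\<phi> n X)"
    and step: "\<And>n. 3 \<le> n \<Longrightarrow> \<exists>P Q. conj_pair T (natural_dim T (Suc n)) P Q \<and>
      (\<forall>X\<in>g n. \<phi> (Suc n) X = conj_by (natural_dim T (Suc n)) P Q (\<phi> n X))"
  shows "\<exists>C C'. \<forall>n\<ge>3. conj_pair T (natural_dim T n) (C n) (C' n) \<and>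
    (\<forall>X\<in>g n. conj_by (natural_dim T (Suc n)) (C (Suc n)) (C' (Suc n)) (\<phi> (Suc n) X) = conj_by (natural_dim T n) (C n) (C' n) (\<phi> n X))"
proof -
  let ?d = "natural_dim T"
  have ev: "even (?d n)" if "T = Type_C" for n using that by simp
  have dm: "?d n \<le> ?d (Suc n)" for n by (cases T) auto
  have "\<exists>f. \<forall>m. conj_pair T (?d (m + 3)) (fst (f m)) (snd (f m)) \<and>
    (\<forall>X\<in>g (m + 3). conj_by (?d (Suc m + 3)) (fst (f (Suc m))) (snd (f (Suc m))) (\<phi> (Suc m + 3) X)
      = conj_by (?d (m + 3)) (fst (f m)) (snd (f m)) (\<phi> (m + 3) X))"
  proof (rule dependent_nat_choice)
    have u: "sup_in D (unit_mat D :: 'a infmat)" for D by (auto simp: sup_in_def unit_mat_def split: if_splits)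
    have "star T (unit_mat (?d (0 + 3))) = (unit_mat (?d (0 + 3)) :: 'a infmat)" by (rule star_unit, rule ev)
    then have "conj_pair T (?d (0 + 3)) (unit_mat (?d (0 + 3)) :: 'a infmat) (unit_mat (?d (0 + 3)))"
      using u mprod_unit(1)[OF u] by (simp add: conj_pair_def)
    then show "\<exists>x :: 'a infmat \<times> 'a infmat. conj_pair T (?d (0 + 3)) (fst x) (snd x)"
      by (intro exI[of _ "(unit_mat (?d (0 + 3)), unit_mat (?d (0 + 3)))"]) simp
  next
    fix x :: "'a infmat \<times> 'a infmat" and m
    assume x: "conj_pair T (?d (m + 3)) (fst x) (snd x)"
    define n e D where "n = m + 3" and "e = ?d n" and "D = ?d (Suc n)"
    have eD: "e \<le> D" and ev': "T = Type_C \<Longrightarrow> even e" "T = Type_C \<Longrightarrow> even D" using dm ev by (auto simp: e_def D_def)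
    obtain C C' where xC: "x = (C, C')" by fastforce
    have C: "conj_pair T e C C'" using x by (simp add: xC e_def n_def)
    obtain P Q where PQ: "conj_pair T D P Q" "\<forall>X\<in>g n. \<phi> (Suc n) X = conj_by D P Q (\<phi> n X)"
      using step[of n] unfolding D_def n_def by auto
    let ?C = "mprod D (pad e D C) Q" and ?C' = "mprod D P (pad e D C')"
    have "conj_pair T D (pad e D C) (pad e D C')" by (rule conj_pair_pad[OF eD _ _ C]) (use ev' in auto)
    then have 1: "conj_pair T D ?C ?C'" by (rule conj_pair_comp[rotated 1, OF _ conj_pair_sym[OF PQ(1)]]) (use ev' in auto)
    have 2: "conj_by D ?C ?C' (\<phi> (Suc n) X) = conj_by e C C' (\<phi> n X)" if X: "X \<in> g n" for X
    proof -
      have s: "sup_in e (\<phi> n X)" using \<phi>[of n X] X by (simp add: n_def e_def)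
      have "conj_by D ?C ?C' (\<phi> (Suc n) X) = conj_by D (pad e D C) (pad e D C') (conj_by D Q P (conj_by D P Q (\<phi> n X)))"
        using PQ(2) X by (simp add: conj_by_comp)
      also have "\<dots> = conj_by D (pad e D C) (pad e D C') (\<phi> n X)"
        using conj_by_inverse[OF PQ(1) sup_in_mono[OF s eD]] by simp
      also have "\<dots> = conj_by e C C' (\<phi> n X)" by (rule conj_by_pad[OF eD C s])
      finally show ?thesis .
    qed
    show "\<exists>y. conj_pair T (?d (Suc m + 3)) (fst y) (snd y) \<and>
      (\<forall>X\<in>g (m + 3). conj_by (?d (Suc m + 3)) (fst y) (snd y) (\<phi> (Suc m + 3) X) = conj_by (?d (m + 3)) (fst x) (snd x) (\<phi> (m + 3) X))"
      using 1 2 by (intro exI[of _ "(?C, ?C')"]) (simp add: xC D_def e_def n_def)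
  qed
  then obtain f where f: "\<And>m. conj_pair T (?d (m + 3)) (fst (f m)) (snd (f m))"
    "\<And>m X. X \<in> g (m + 3) \<Longrightarrow> conj_by (?d (Suc m + 3)) (fst (f (Suc m))) (snd (f (Suc m))) (\<phi> (Suc m + 3) X)
      = conj_by (?d (m + 3)) (fst (f m)) (snd (f m)) (\<phi> (m + 3) X)" by blast
  show ?thesis
  proof (rule exI[of _ "\<lambda>n. fst (f (n - 3))"], rule exI[of _ "\<lambda>n. snd (f (n - 3))"], intro allI impI conjI ballI)
    fix n :: nat assume n: "3 \<le> n"
    then obtain m where m: "n = m + 3" by (metis add.commute le_Suc_ex)
    show "conj_pair T (?d n) (fst (f (n - 3))) (snd (f (n - 3)))" using f(1)[of m] by (simp add: m)
    fix X assume "X \<in> g n"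
    then show "conj_by (?d (Suc n)) (fst (f (Suc n - 3))) (snd (f (Suc n - 3))) (\<phi> (Suc n) X) = conj_by (?d n) (fst (f (n - 3))) (snd (f (n - 3))) (\<phi> n X)"
      using f(2)[of X m] by (simp add: m Suc_diff_le)
  qed
qed

section \<open>From the given chain to the standard one\<close>

lemma conj_by_linear:
  shows conj_by_add: "conj_by D C C' (\<lambda>i j. M i j + N i j) = (\<lambda>i j. conj_by D C C' M i j + conj_by D C C' N i j)"
    and conj_by_minus: "conj_by D C C' (\<lambda>i j. M i j - N i j) = (\<lambda>i j. conj_by D C C' M i j - conj_by D C C' N i j)"
    and conj_by_scale: "conj_by D C C' (\<lambda>i j. c * M i j) = (\<lambda>i j. c * conj_by D C C' M i j)"
  by (intro ext; simp add: conj_by_def mprod_def distrib_left distrib_right right_diff_distrib left_diff_distrib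
      sum.distrib sum_subtractf sum_distrib_left sum_distrib_right mult_ac)+

lemma corner_four_block:
  "A \<in> carrier_mat e e \<Longrightarrow> corner (four_block_mat A (0\<^sub>m e k) (0\<^sub>m k e) (0\<^sub>m k k)) = corner A"
  by (intro ext) (auto simp: corner_def)

lemma finite_supp_corner: "finite (supp (corner A))"
  by (rule finite_subset[of _ "{..<dim_row A} \<times> {..<dim_col A}"]) (auto simp: supp_def corner_def split: if_splits)

lemma factor_rank_cong: "(\<And>i j. i \<in> I \<Longrightarrow> j \<in> I \<Longrightarrow> X i j = Y i j) \<Longrightarrow> factor_rank I r X \<longleftrightarrow> factor_rank I r Y"
  by (simp add: factor_rank_def)

lemma natural_module_corner:
  fixes \<rho> :: "'a::field_char_0 infmat \<Rightarrow> 'a mat"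
  assumes "natural_module T n h \<rho>"
  shows "bij_betw (\<lambda>X. corner (\<rho> X)) h (std_lie T (natural_dim T n))"
    and "X \<in> h \<Longrightarrow> Y \<in> h \<Longrightarrow> corner (\<rho> (\<lambda>i j. X i j + Y i j)) = (\<lambda>i j. corner (\<rho> X) i j + corner (\<rho> Y) i j)"
    and "X \<in> h \<Longrightarrow> corner (\<rho> (\<lambda>i j. c * X i j)) = (\<lambda>i j. c * corner (\<rho> X) i j)"
    and "X \<in> h \<Longrightarrow> Y \<in> h \<Longrightarrow> corner (\<rho> (inf_bracket X Y)) =
      (\<lambda>i j. mprod (natural_dim T n) (corner (\<rho> X)) (corner (\<rho> Y)) i j - mprod (natural_dim T n) (corner (\<rho> Y)) (corner (\<rho> X)) i j)"
    and "X \<in> h \<Longrightarrow> \<rho> X \<in> carrier_mat (natural_dim T n) (natural_dim T n)"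
proof -
  let ?D = "natural_dim T n"
  have b: "bij_betw \<rho> h (classical_mat T n)" using assms by (simp add: natural_module_def)
  show car: "\<rho> X \<in> carrier_mat ?D ?D" if "X \<in> h" for X
    using classical_carrier[of "\<rho> X" T n] b that by (auto simp: bij_betw_def)
  have "inj_on corner (classical_mat T n :: 'a mat set)"
    by (rule inj_onI) (rule corner_inj[OF classical_carrier classical_carrier])
  then have "bij_betw corner (classical_mat T n) (std_lie T ?D :: 'a infmat set)"
    using classical_corner by (auto simp: bij_betw_def)
  from bij_betw_trans[OF b this] show "bij_betw (\<lambda>X. corner (\<rho> X)) h (std_lie T ?D)" by (simp add: comp_def)
  show "corner (\<rho> (\<lambda>i j. X i j + Y i j)) = (\<lambda>i j. corner (\<rho> X) i j + corner (\<rho> Y) i j)" if "X \<in> h" "Y \<in> h"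
    using assms that corner_add[OF car car] by (simp add: natural_module_def)
  show "corner (\<rho> (\<lambda>i j. c * X i j)) = (\<lambda>i j. c * corner (\<rho> X) i j)" if "X \<in> h"
    using assms that corner_smult by (simp add: natural_module_def)
  show "corner (\<rho> (inf_bracket X Y)) = (\<lambda>i j. mprod ?D (corner (\<rho> X)) (corner (\<rho> Y)) i j - mprod ?D (corner (\<rho> Y)) (corner (\<rho> X)) i j)"
    if X: "X \<in> h" and Y: "Y \<in> h"
  proof -
    note cX = car[OF X] and cY = car[OF Y]
    have "\<rho> (inf_bracket X Y) = \<rho> X * \<rho> Y - \<rho> Y * \<rho> X"
      using assms X Y by (simp add: natural_module_def mat_bracket_def)
    then show ?thesis
      using corner_minus[OF mult_carrier_mat[OF cX cY] mult_carrier_mat[OF cY cX]]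
      by (simp add: corner_mult[OF cX cY] corner_mult[OF cY cX])
  qed
qed

lemma chain_step:
  fixes \<rho> :: "nat \<Rightarrow> 'a::{alg_closed_field, field_char_0} infmat \<Rightarrow> 'a mat"
  assumes ch: "classical_chain T ginf g \<rho>" and n: "3 \<le> n"
  shows "\<exists>P Q. conj_pair T (natural_dim T (Suc n)) P Q \<and>
    (\<forall>X\<in>g n. corner (\<rho> (Suc n) X) = conj_by (natural_dim T (Suc n)) P Q (corner (\<rho> n X)))"
proof -
  let ?d = "natural_dim T"
  define e D where "e = ?d n" and "D = ?d (Suc n)"
  have eD: "e \<le> D" by (cases T) (auto simp: e_def D_def)
  have nm: "natural_module T n (g n) (\<rho> n)" "natural_module T (Suc n) (g (Suc n)) (\<rho> (Suc n))"
    and gS: "g n \<subseteq> g (Suc n)" and lie: "lie_subalgebra (g n)"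
    using ch n by (auto simp: classical_chain_def)
  have "\<exists>P Q. \<forall>X\<in>g n. similar_mat_wit (\<rho> (Suc n) X)
      (four_block_mat (\<rho> n X) (0\<^sub>m e (D - e)) (0\<^sub>m (D - e) e) (0\<^sub>m (D - e) (D - e))) P Q"
    using ch n unfolding classical_chain_def Let_def e_def D_def Suc_eq_plus1 by blast
  then obtain P Q where PQ: "\<And>X. X \<in> g n \<Longrightarrow> similar_mat_wit (\<rho> (Suc n) X)
      (four_block_mat (\<rho> n X) (0\<^sub>m e (D - e)) (0\<^sub>m (D - e) e) (0\<^sub>m (D - e) (D - e))) P Q" by blast
  note nc = natural_module_corner(5)[OF nm(1), folded e_def]
  have S: "P \<in> carrier_mat D D" "Q \<in> carrier_mat D D" "P * Q = 1\<^sub>m D" "Q * P = 1\<^sub>m D"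
    "corner (\<rho> (Suc n) X) = mprod D (mprod D (corner P) (corner (\<rho> n X))) (corner Q)"
    if X: "X \<in> g n" for X
  proof -
    let ?B = "four_block_mat (\<rho> n X) (0\<^sub>m e (D - e)) (0\<^sub>m (D - e) e) (0\<^sub>m (D - e) (D - e))"
    have c: "\<rho> (Suc n) X \<in> carrier_mat D D" using natural_module_corner(5)[OF nm(2)] X gS by (auto simp: D_def)
    from PQ[OF X] c have w: "?B \<in> carrier_mat D D" "P \<in> carrier_mat D D" "Q \<in> carrier_mat D D" "P * Q = 1\<^sub>m D" "Q * P = 1\<^sub>m D" "\<rho> (Suc n) X = P * ?B * Q"
      unfolding similar_mat_wit_def Let_def by auto
    show "P \<in> carrier_mat D D" "Q \<in> carrier_mat D D" "P * Q = 1\<^sub>m D" "Q * P = 1\<^sub>m D" by fact+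
    have pb: "corner (P * ?B) = mprod D (corner P) (corner ?B)" by (intro ext) (rule corner_mult[OF w(2,1)])
    have "corner (P * ?B * Q) = mprod D (corner (P * ?B)) (corner Q)"
      by (intro ext) (rule corner_mult[OF mult_carrier_mat[OF w(2,1)] w(3)])
    then show "corner (\<rho> (Suc n) X) = mprod D (mprod D (corner P) (corner (\<rho> n X))) (corner Q)"
      unfolding pb w(6) corner_four_block[OF nc[OF X]] .
  qed
  \<comment> \<open>One element of \<open>g n\<close> is enough to extract from the similarity the
    sizes of \<open>P\<close> and \<open>Q\<close> and that they are inverse to each other.\<close>
  have zero: "(\<lambda>i j. 0) \<in> g n" using lie by (simp add: lie_subalgebra_def)
  note S0 = S(1-4)[OF zero]
  have inv: "mprod D (corner P) (corner Q) = unit_mat D" "mprod D (corner Q) (corner P) = unit_mat D"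
    using corner_mult[OF S0(1,2)] corner_mult[OF S0(2,1)] S0(3,4) by (auto simp: fun_eq_iff corner_one[symmetric])
  have im: "\<exists>X\<in>g n. M = corner (\<rho> n X)" if "M \<in> std_lie T e" for M
    using natural_module_corner(1)[OF nm(1)] that by (auto simp: bij_betw_def e_def)
  have cl: "corner (\<rho> (Suc n) X) \<in> std_lie T D" if "X \<in> g n" for X
    using natural_module_corner(1)[OF nm(2)] that gS by (auto simp: bij_betw_def D_def)
  have "\<exists>P' Q'. conj_pair T D P' Q' \<and> (\<forall>M\<in>std_lie T e. conj_by D P' Q' M = mprod D (mprod D (corner P) M) (corner Q))"
  proof (rule conj_pair_exists)
    show "3 \<le> e" using n by (cases T) (auto simp: e_def)
    show "even e" if "T = Type_C" using that by (simp add: e_def)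
    show "D = e + 2" if "T \<noteq> Type_A" using that by (cases T) (auto simp: e_def D_def)
    show "mprod D (mprod D (corner P) M) (corner Q) \<in> std_lie T D" if M: "M \<in> std_lie T e" for M
      using im[OF M] S(5) cl by metis
  qed (use eD inv sup_corner[OF S0(1)] sup_corner[OF S0(2)] in auto)
  then obtain P' Q' where P': "conj_pair T D P' Q'" "\<And>M. M \<in> std_lie T e \<Longrightarrow> conj_by D P' Q' M = mprod D (mprod D (corner P) M) (corner Q)" by blast
  have "corner (\<rho> (Suc n) X) = conj_by D P' Q' (corner (\<rho> n X))" if X: "X \<in> g n" for X
    using S(5)[OF X] P'(2)[OF bij_betwE[OF natural_module_corner(1)[OF nm(1), folded e_def], rule_format, OF X]] by simp
  then show ?thesis using P'(1) unfolding D_def by blast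
qed

lemma chain_model_exists:
  fixes \<rho> :: "nat \<Rightarrow> 'a::{alg_closed_field, field_char_0} infmat \<Rightarrow> 'a mat"
  assumes gi: "ginf = sl_inf \<or> ginf = so_inf \<or> ginf = sp_inf" and ch: "classical_chain T ginf g \<rho>"
  obtains \<psi> C C' where "chain_model T g \<psi>"
    and "\<And>n. 3 \<le> n \<Longrightarrow> conj_pair T (natural_dim T n) (C n) (C' n)"
    and "\<And>n X. 3 \<le> n \<Longrightarrow> X \<in> g n \<Longrightarrow> \<psi> X = conj_by (natural_dim T n) (C n) (C' n) (corner (\<rho> n X))"
proof -
  let ?d = "natural_dim T"
  define \<phi> where "\<phi> n X = corner (\<rho> n X)" for n X
  have nm: "natural_module T n (g n) (\<rho> n)" if "3 \<le> n" for n using ch that by (auto simp: classical_chain_def)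
  have gS: "g n \<subseteq> g (Suc n)" if "3 \<le> n" for n using ch that by (auto simp: classical_chain_def)
  note N = natural_module_corner[OF nm, folded \<phi>_def]
  have cl: "\<phi> n X \<in> std_lie T (?d n)" if "3 \<le> n" "X \<in> g n" for n X using N(1)[OF that(1)] that(2) by (auto simp: bij_betw_def)
  have sp: "sup_in (?d n) (\<phi> n X)" if "3 \<le> n" "X \<in> g n" for n X by (rule std_lie_sup[OF cl[OF that]])
  from conj_pairs_glue[of g T \<phi>, OF sp chain_step[OF ch, folded \<phi>_def]]
  obtain C C' where C: "\<And>n. 3 \<le> n \<Longrightarrow> conj_pair T (?d n) (C n) (C' n)"
    and CS: "\<And>n X. 3 \<le> n \<Longrightarrow> X \<in> g n \<Longrightarrow> conj_by (?d (Suc n)) (C (Suc n)) (C' (Suc n)) (\<phi> (Suc n) X) = conj_by (?d n) (C n) (C' n) (\<phi> n X)"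
    by blast
  define \<sigma> where "\<sigma> n X = conj_by (?d n) (C n) (C' n) (\<phi> n X)" for n X
  have up: "X \<in> g n \<and> \<sigma> n X = \<sigma> m X" if "3 \<le> m" "m \<le> n" "X \<in> g m" for m n X
    using that(2)
  proof (induction n rule: dec_induct)
    case base
    then show ?case using that by simp
  next
    case (step n)
    then have "3 \<le> n" "X \<in> g n" using that(1) by auto
    then show ?case using CS[of n X] gS[of n] step by (auto simp: \<sigma>_def)
  qed
  \<comment> \<open>By \<open>up\<close>, the maps \<open>\<sigma> n\<close> agree wherever they are
    defined; the least level merely selects one of them.\<close>
  define \<psi> where "\<psi> X = \<sigma> (LEAST n. 3 \<le> n \<and> X \<in> g n) X" for X
  have \<psi>: "\<psi> X = \<sigma> n X" if "3 \<le> n" "X \<in> g n" for n X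
  proof -
    let ?P = "\<lambda>n. 3 \<le> n \<and> X \<in> g n"
    have "?P (Least ?P)" "Least ?P \<le> n" using that LeastI[of ?P n] Least_le[of ?P n] by auto
    then show ?thesis using up[of "Least ?P" n X] by (simp add: \<psi>_def)
  qed
  have lie: "lie_subalgebra (g n)" if "3 \<le> n" for n using ch that by (auto simp: classical_chain_def)
  have "chain_model T g \<psi>"
  proof
    fix n :: nat assume n: "3 \<le> n"
    show l: "lie_subalgebra (g n)" by (rule lie[OF n])
    show "g n \<subseteq> g (Suc n)" by (rule gS[OF n])
    have ev: "T = Type_C \<Longrightarrow> even (?d n)" by simp
    have "bij_betw (\<lambda>X. conj_by (?d n) (C n) (C' n) (\<phi> n X)) (g n) (std_lie T (?d n))"
      using bij_betw_trans[OF N(1)[OF n] conj_by_bij[OF ev C[OF n]]] by (simp add: comp_def)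
    then show "bij_betw \<psi> (g n) (std_lie T (?d n))"
      by (rule iffD1[OF bij_betw_cong, rotated]) (simp add: \<psi>[OF n] \<sigma>_def)
    fix X assume X: "X \<in> g n"
    have "X \<in> ginf" using X n ch unfolding classical_chain_def by (metis UN_I atLeast_iff le_trans one_le_numeral)
    then show "finite (supp X)" using gi by (auto simp: sl_inf_def so_inf_def sp_inf_def finite_supp_corner)
    have "(\<lambda>i j. c * X i j) \<in> g n" for c using l X by (simp add: lie_subalgebra_def)
    then show "\<psi> (\<lambda>i j. c * X i j) = (\<lambda>i j. c * \<psi> X i j)" for c
      by (simp add: \<psi>[OF n] X \<sigma>_def N(3)[OF n X] conj_by_scale)
    fix Y assume Y: "Y \<in> g n"
    have "(\<lambda>i j. X i j + Y i j) \<in> g n" "inf_bracket X Y \<in> g n" using l X Y by (auto simp: lie_subalgebra_def)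
    then show "\<psi> (\<lambda>i j. X i j + Y i j) = (\<lambda>i j. \<psi> X i j + \<psi> Y i j)"
      and "\<psi> (inf_bracket X Y) = (\<lambda>i j. mprod (?d n) (\<psi> X) (\<psi> Y) i j - mprod (?d n) (\<psi> Y) (\<psi> X) i j)"
      by (simp_all add: \<psi>[OF n] X Y \<sigma>_def N(2)[OF n X Y] N(4)[OF n X Y] conj_by_add conj_by_minus
          conj_by_mprod[OF C[OF n] sp[OF n X] sp[OF n Y]] conj_by_mprod[OF C[OF n] sp[OF n Y] sp[OF n X]])
  qed
  then show ?thesis using that[of \<psi> C C'] C \<psi> unfolding \<sigma>_def \<phi>_def by blast
qed

text \<open>In the types B, C and D a matrix of small rank plus a scalar has small rank: the sum of
  \<open>M - \<mu>\<close> and its adjoint \<open>- M - \<mu>\<close> is scalar, but has rank at most \<open>2 r\<close>.\<close>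

lemma scalar_eq_0:
  fixes M :: "'a::field_char_0 infmat"
  assumes skew: "\<And>i j. star T M i j = - M i j" and D: "T = Type_C \<Longrightarrow> even D" "2 * r < D"
    and M: "factor_rank {..<D} r (\<lambda>i j. M i j - (if i = j then \<mu> else 0))"
  shows "\<mu> = 0"
proof (rule ccontr)
  assume \<mu>: "\<mu> \<noteq> 0"
  obtain a b where ab: "\<And>i j. i < D \<Longrightarrow> j < D \<Longrightarrow> M i j - (if i = j then \<mu> else 0) = (\<Sum>l<r. a i l * b l j)"
    using M by (auto simp: factor_rank_def)
  have bl: "bar_T T k < D \<longleftrightarrow> k < D" for k using D(1) by (rule bar_less)
  have eq: "(if i = j then - 2 * \<mu> else 0) = (\<Sum>l<r. a i l * b l j) + (\<Sum>l<r. sgn_T T i * b l (bar_T T i) * (sgn_T T j * a (bar_T T j) l))"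
    if "i < D" "j < D" for i j
  proof -
    have e: "bar_T T j = bar_T T i \<longleftrightarrow> i = j" by (metis dual_index_dual_index)
    have "M (bar_T T j) (bar_T T i) = (\<Sum>l<r. a (bar_T T j) l * b l (bar_T T i)) + (if i = j then \<mu> else 0)"
      using ab[of "bar_T T j" "bar_T T i"] that bl e by (simp add: algebra_simps)
    then have "- M i j = sgn_T T i * sgn_T T j * ((\<Sum>l<r. a (bar_T T j) l * b l (bar_T T i)) + (if i = j then \<mu> else 0))"
      using skew[of i j] by (simp add: star_def)
    also have "\<dots> = (\<Sum>l<r. sgn_T T i * b l (bar_T T i) * (sgn_T T j * a (bar_T T j) l)) + (if i = j then \<mu> else 0)"
      by (auto simp: distrib_left sum_distrib_left mult_ac intro!: sum.cong)
    finally have "(\<Sum>l<r. sgn_T T i * b l (bar_T T i) * (sgn_T T j * a (bar_T T j) l)) = - M i j - (if i = j then \<mu> else 0)" by simp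
    then show ?thesis using ab[OF that, symmetric] by simp
  qed
  \<comment> \<open>A vector annihilated by the right factors of both summands, of which there are
    \<open>2 * r < D\<close>. The scalar matrix \<open>- 2 * \<mu>\<close> then kills it as
    well.\<close>
  obtain x where x: "\<exists>i\<in>{..<D}. x i \<noteq> 0"
    "\<forall>k<2 * r. (\<Sum>j<D. (if k < r then b k j else sgn_T T j * a (bar_T T j) (k - r)) * x j) = 0"
    using homogeneous_system[of "{..<D}" "2 * r" "\<lambda>k j. if k < r then b k j else sgn_T T j * a (bar_T T j) (k - r)"] D(2) by auto
  have x1: "(\<Sum>j<D. b l j * x j) = 0" and x2: "(\<Sum>j<D. sgn_T T j * a (bar_T T j) l * x j) = 0" if "l < r" for l
    using x(2)[rule_format, of l] x(2)[rule_format, of "l + r"] that by simp_all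
  obtain i where i: "i < D" "x i \<noteq> 0" using x(1) by auto
  have "- 2 * \<mu> * x i = (\<Sum>j<D. (if j = i then - 2 * \<mu> * x i else 0))" using i by simp
  also have "\<dots> = (\<Sum>j<D. (if i = j then - 2 * \<mu> else 0) * x j)" by (intro sum.cong) auto
  also have "\<dots> = (\<Sum>j<D. (\<Sum>l<r. a i l * (b l j * x j)) + (\<Sum>l<r. sgn_T T i * b l (bar_T T i) * (sgn_T T j * a (bar_T T j) l * x j)))"
    by (intro sum.cong refl) (simp only: eq[OF i(1)] lessThan_iff distrib_right sum_distrib_right mult.assoc)
  also have "\<dots> = (\<Sum>l<r. a i l * (\<Sum>j<D. b l j * x j)) + (\<Sum>l<r. sgn_T T i * b l (bar_T T i) * (\<Sum>j<D. sgn_T T j * a (bar_T T j) l * x j))"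
    unfolding sum.distrib sum_distrib_left by (intro arg_cong2[of _ _ _ _ "(+)"] sum.swap)
  also have "\<dots> = 0" by (simp add: x1 x2)
  finally show False using \<mu> i by simp
qed

theorem theorem3p3:
  fixes ginf :: "'a::{alg_closed_field, field_char_0} infmat set"
    and g :: "nat \<Rightarrow> 'a infmat set"
    and \<rho> :: "nat \<Rightarrow> 'a infmat \<Rightarrow> 'a mat"
    and T :: cartan_type
    and J :: "'a entry_poly set"
  assumes "ginf = sl_inf \<or> ginf = so_inf \<or> ginf = sp_inf"
    and "classical_chain T ginf g \<rho>"
    and "poisson_ideal ginf J"
    and "radical_ideal ginf J"
    and "J \<noteq> {0}"
  shows "\<exists>r::nat. J = J_inf T g \<rho> r"
proof -
  obtain \<psi> C C' where model: "chain_model T g \<psi>"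
    and C: "\<And>n. 3 \<le> n \<Longrightarrow> conj_pair T (natural_dim T n) (C n) (C' n)"
    and \<psi>: "\<And>n X. 3 \<le> n \<Longrightarrow> X \<in> g n \<Longrightarrow> \<psi> X = conj_by (natural_dim T n) (C n) (C' n) (corner (\<rho> n X))"
    by (rule chain_model_exists[OF assms(1,2)]) blast
  interpret chain_model T g \<psi> by (rule model)
  have flow_num: "g n \<subseteq> g (n + 1)" if "1 \<le> n" for n using assms(2) that by (auto simp: classical_chain_def)
  have up: "g n \<subseteq> g (n + k)" if "1 \<le> n" for n k
  proof (induction k)
    case (Suc k)
    then show ?case using flow_num[of "n + k"] that by auto
  qed simp
  have U: "ginf = (\<Union>n\<in>{1..}. g n)" using assms(2) by (simp add: classical_chain_def)
  have G_eq: "G = ginf"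
  proof
    show "G \<subseteq> ginf" unfolding U G_def by (intro UN_mono) auto
    show "ginf \<subseteq> G" unfolding U G_def
    proof
      fix X assume "X \<in> (\<Union>n\<in>{1..}. g n)"
      then obtain n where "1 \<le> n" "X \<in> g n" by auto
      then have "X \<in> g (n + 3)" using up by blast
      then show "X \<in> (\<Union>n\<in>{3..}. g n)" by (intro UN_I[of "n + 3"]) auto
    qed
  qed
  interpret poisson_model T g \<psi> J by unfold_locales (use assms(3,4) G_eq in simp_all)
  obtain r where r: "\<And>n p. 3 \<le> n \<Longrightarrow> p \<in> sym_alg (g n) \<Longrightarrow> p \<in> J \<longleftrightarrow> (\<forall>Q\<in>std_lie T (d n). scalar_rank r {..<d n} Q \<longrightarrow> eval_at (d n) Q p = 0)"
    using determinantal[OF assms(5)] by blast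
  have nm: "natural_module T n (g n) (\<rho> n)" if "3 \<le> n" for n using assms(2) that by (auto simp: classical_chain_def)
  note car = natural_module_corner(5)[OF nm]
  have sup: "sup_in (d n) (corner (\<rho> n X))" if "3 \<le> n" "X \<in> g n" for n X by (rule sup_corner[OF car[OF that]])
  have rank: "vec_space.rank (d n) (\<rho> n X - c \<cdot>\<^sub>m 1\<^sub>m (d n)) \<le> r \<longleftrightarrow> factor_rank {..<d n} r (\<lambda>i j. \<psi> X i j - (if i = j then c else 0))"
    if n: "3 \<le> n" and X: "X \<in> g n" for n X c
  proof -
    have "vec_space.rank (d n) (\<rho> n X - c \<cdot>\<^sub>m 1\<^sub>m (d n)) \<le> r \<longleftrightarrow> factor_rank {..<d n} r (\<lambda>i j. (\<rho> n X - c \<cdot>\<^sub>m 1\<^sub>m (d n)) $$ (i, j))"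
      using car[OF n X] by (intro rank_le_iff_factor_rank) auto
    also have "\<dots> \<longleftrightarrow> factor_rank {..<d n} r (\<lambda>i j. corner (\<rho> n X) i j - (if i = j then c else 0))"
      using car[OF n X] by (intro factor_rank_cong) (auto simp: corner_def)
    also have "\<dots> \<longleftrightarrow> factor_rank {..<d n} r (\<lambda>i j. \<psi> X i j - (if i = j then c else 0))"
      using conj_by_factor_rank[OF C[OF n], of r "corner (\<rho> n X)" c] conj_by_factor_rank[OF conj_pair_sym[OF C[OF n]], of r "\<psi> X" c]
        conj_by_inverse[OF C[OF n] sup[OF n X]] by (auto simp: \<psi>[OF n X])
    finally show ?thesis .
  qed
  have tr: "trace_form (\<rho> n) X Y = trace_prod (d n) (\<psi> X) (\<psi> Y)" if n: "3 \<le> n" and X: "X \<in> g n" and Y: "Y \<in> g n" for n X Y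
  proof -
    have "trace_form (\<rho> n) X Y = (\<Sum>i<d n. corner (\<rho> n X * \<rho> n Y) i i)"
      using car[OF n X] car[OF n Y] by (simp add: trace_form_def mat_trace_def corner_def)
    also have "\<dots> = trace_prod (d n) (corner (\<rho> n X)) (corner (\<rho> n Y))"
      by (simp add: corner_mult[OF car[OF n X] car[OF n Y]] mprod_def trace_prod_def)
    finally show ?thesis using conj_by_trace_prod[OF C[OF n] sup[OF n X] sup[OF n Y]] \<psi>[OF n X] \<psi>[OF n Y] by simp
  qed
  show ?thesis
  proof (intro exI[of _ r] equalityI subsetI)
    fix f assume f: "f \<in> J"
    then have "f \<in> sym_alg G" using J_props(1) by blast
    \<comment> \<open>\<open>rank_le\<close> admits every scalar. From level
      \<open>2 * r + 1\<close> on, \<open>scalar_eq_0\<close> shows that outside type A only the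
      scalar 0 occurs; the level may be raised because \<open>J_inf\<close> is a union over all
      levels.\<close>
    then obtain n where n: "2 * r + 1 \<le> n" "3 \<le> n" "f \<in> sym_alg (g n)" using sym_alg_G by blast
    have "vanishes_at (g n) (trace_form (\<rho> n) X) f" if X: "X \<in> rank_le (g n) (\<rho> n) (d n) r" for X
    proof -
      obtain c where Xg: "X \<in> g n" and c: "factor_rank {..<d n} r (\<lambda>i j. \<psi> X i j - (if i = j then c else 0))"
        using X rank[OF n(2)] by (auto simp: rank_le_def)
      have cl: "\<psi> X \<in> std_lie T (d n)" by (rule \<psi>_std_lie[OF n(2) Xg])
      have "c = 0" if "T \<noteq> Type_A"
        by (rule scalar_eq_0[OF _ _ _ c, of T]) (use cl that n(1) d_ge[of n] in \<open>auto simp: std_lie_def std_gl_def\<close>)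
      then have "scalar_rank r {..<d n} (\<psi> X)" using c unfolding scalar_rank_def by blast
      then have "eval_at (d n) (\<psi> X) f = 0" using r[OF n(2,3)] f cl by blast
      moreover have "evaluation_at (g n) (trace_form (\<rho> n) X) (eval_at (d n) (\<psi> X))"
        using g_G[OF n(2)] by (auto simp: evaluation_at_def eval_at_simps eval_at_lin tr[OF n(2) Xg])
      ultimately show ?thesis unfolding vanishes_at_def by blast
    qed
    then have "f \<in> J_fin (g n) (\<rho> n) (d n) r" using n(3) by (simp add: J_fin_def)
    then show "f \<in> J_inf T g \<rho> r" using n(2) by (auto simp: J_inf_def)
  next
    fix f assume "f \<in> J_inf T g \<rho> r"
    then obtain n where n: "3 \<le> n" and f: "f \<in> sym_alg (g n)"
      and v: "\<And>X. X \<in> rank_le (g n) (\<rho> n) (d n) r \<Longrightarrow> vanishes_at (g n) (trace_form (\<rho> n) X) f"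
      by (auto simp: J_inf_def J_fin_def)
    have "eval_at (d n) Q f = 0" if Q: "Q \<in> std_lie T (d n)" "scalar_rank r {..<d n} Q" for Q
    proof -
      have X: "lift_mat n Q \<in> g n" "\<psi> (lift_mat n Q) = Q" using lift_mat[OF n Q(1)] by auto
      have "lift_mat n Q \<in> rank_le (g n) (\<rho> n) (d n) r" using Q(2) X rank[OF n X(1)] by (auto simp: rank_le_def scalar_rank_def)
      from v[OF this] obtain e where e: "evaluation_at (g n) (trace_form (\<rho> n) (lift_mat n Q)) e" "e f = 0"
        by (auto simp: vanishes_at_def)
      \<comment> \<open>\<open>vanishes_at\<close> supplies some evaluation, and evaluations at a
        given linear form agree on \<open>sym_alg (g n)\<close>.\<close>
      have "e f = eval_at (d n) Q f"
        by (rule hom_unique[OF _ _ _ _ f]) (use e(1) g_G[OF n] in \<open>auto simp: evaluation_at_def eval_at_simps eval_at_lin tr[OF n X(1)] X(2)\<close>)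
      then show ?thesis using e(2) by simp
    qed
    then show "f \<in> J" using r[OF n f] by blast
  qed
qed

end
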